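(* Let $n\ge 2$, let $\mathcal X$ be $\mathcal{TO}$ or $\mathcal O$, and suppose that the reduced signature map $\overline{\mathrm{sig}}:\mathcal X_n\to\mathbb Z_{n-1}$ is onto the group of units of $\mathbb Z_{n-1}$. Then for all $[i],[j]\in[\mathbb Z_n^0]$ we have $\langle\mathcal X_{n,[i]},\mathcal X_{n,[j]}\rangle=\mathcal X_{n,[r]}$, where $[r]$ is the lowest common multiple of $[i]$ and $[j]$.
   Context: Notation. Maps act on the right. $X_n=\{0,\ldots,n-1\}$; $X_n^*$ (resp. $X_n^k$) is the set of finite words (words of length $k$) over $X_n$; $\epsilon$ is the empty word; for $1\le r\le n-1$, $\dot{\mathbf r}=\{\dot 0,\ldots,\dot{(r-1)}\}$ is a further ordered alphabet; $X_{n,r}^+=\{\dot a w:\dot a\in\dot{\mathbf r},\,w\in X_n^*\}$, $X_{n,r}^*=X_{n,r}^+\cup\{\epsilon\}$. $\mathfrak C_n=X_n^\omega$ and $\mathfrak C_{n,r}=\{\dot a x:\dot a\in\dot{\mathbf r},\,x\in\mathfrak C_n\}$ are Cantor spaces; $U_\nu$ is the set of infinite words with prefix $\nu$; $\mathbb Z_{n-1}=\mathbb Z/(n-1)\mathbb Z$. The relation $\simeq$ on $\mathfrak C_{n,r}$: $x\simeq y$ iff $x=y$, or $\{x,y\}=\{w\,i\,000\ldots,\;w\,(i-1)(n-1)(n-1)\ldots\}$ with $w\in X_{n,r}^+$ and $0<i\le n-1$, or $\{x,y\}=\{\dot a\,00\ldots,\;\dot{(a-1)}(n-1)(n-1)\ldots\}$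 with $0<a\le r-1$, or $\{x,y\}=\{\dot 0\,00\ldots,\;\dot{(r-1)}(n-1)(n-1)\ldots\}$. Transducers over $X_n$. A transducer $\langle X_n,Q,\pi,\lambda\rangle$ has transition function $\pi:X_n\times Q\to Q$ and output function $\lambda:X_n\times Q\to X_n^*$, extended to words by $\pi(wi,q)=\pi(i,\pi(w,q))$, $\lambda(wi,q)=\lambda(w,q)\lambda(i,\pi(w,q))$, such that infinite inputs give infinite outputs; $h_q:\mathfrak C_n\to\mathfrak C_n$ is the continuous map $\delta\mapsto\lambda(\delta,q)$ and $\mathrm{im}(q)$ is its image. Fixing an initial state $q_0$ gives an initial transducer, representing $h_{q_0}$; it is minimal if all states are reachable from $q_0$, $h_q\neq h_p$ for distinct states $q,p$, and for every state $q$ and letter $i$, $\lambda(i,q)$ is the greatest common prefix of $\{(i\delta)h_q:\delta\in\mathfrak C_n\}$. A transducer is synchronizing at level $k$ if for each $\Gamma\in X_n^k$ the state $\pi(\Gamma,q)$ does not depend on $q$ (the state forced by $\Gamma$); its core is the sub-transducer on the states forced by words of $X_n^k$. Transducers over $\mathfrak C_{n,r}$. An initial transducer $A_{q_0}$ over $\mathfrak C_{n,r}$ has state set $Q=R\sqcup S$ with $R$ finite, $q_0\in R$, and functions $\pi,\lambda$ defined on $(\dot{\mathbf r}\times\{q_0\})\sqcup(X_n\times(Q\setminus\{q_0\}))$, $\pi$ with values in $Q\setminus\{q_0\}$ and $\lambda$ with values in $X_{n,r}^*\sqcup X_n^*$, such that: a transition from a state of $R$ outputs $\epsilon$ if it ends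 in $R$ and a word of $X_{n,r}^+$ if it ends in $S$; transitions from $S$ end in $S$ with output in $X_n^*$; infinite words read from states of $S$ give infinite output; no state of $R$ lies on a cycle. It represents the map $h_{q_0}:\mathfrak C_{n,r}\to\mathfrak C_{n,r}$. It is minimal if all its states are reachable from $q_0$, distinct states $q,p$ induce distinct maps $\delta\mapsto\lambda(\delta,q)$, $\delta\mapsto\lambda(\delta,p)$ on infinite words, and for every state $q$ and every letter $i$ readable from $q$, $\lambda(i,q)$ is the greatest common prefix of $\{\lambda(i\delta,q):\delta\in\mathfrak C_n\}$; every homeomorphism of $\mathfrak C_{n,r}$ is represented by a unique minimal transducer. It is synchronizing if for some $k$ the state reached by reading a word of length $k$ from any state from which it can be read depends only on the word; its core is then the transducer over $X_n$ formed by the states forced by words of $X_n^k$. Groups. $\mathcal B_{n,r}$ is the group of homeomorphisms $h$ of $\mathfrak C_{n,r}$ such that the minimal transducers of $h$ and $h^{-1}$ are finite and synchronizing; $\mathcal{TB}_{n,r}$ is the subgroup of those $h\in\mathcal B_{n,r}$ preserving $\simeq$. For $h\in\mathcal B_{n,r}$ let $\mathrm{Core}(h)$ be the core of its minimal transducer (a transducer over $X_n$, up to renaming states). $\mathcal O_{n,r}=\{\mathrm{Core}(h):h\in\mathcal B_{n,r}\}$, $\mathcal{TO}_{n,r}=\{\mathrm{Core}(h):h\in\mathcal{TB}_{n,r}\}$, $\mathcal O_n=\bigcup_{1\le r\le n-1}\mathcal O_{n,r}$, $\mathcal{TO}_n=\bigcup_{1\le r\le n-1}\mathcal{TO}_{n,r}$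 (which equals $\mathcal{TO}_{n,n-1}$). The product of $g,h\in\mathcal O_n$ is the core of the minimal transducer representing $h_{q_1}$ followed by $h_{q_2}$, for any states $q_1$ of $g$ and $q_2$ of $h$ (independent of the choice). With this product $\mathcal O_n$ is a group and $\mathcal{TO}_n$, $\mathcal O_{n,r}$, $\mathcal{TO}_{n,r}$ are subgroups. Every state of an element of $\mathcal O_n$ induces an injective map with clopen image. Signature. For $T\in\mathcal O_n$ and a state $q$ of $T$, $m_q$ is the size of the smallest set $V\subset X_n^*$ with $\bigcup_{v\in V}U_v=\mathrm{im}(q)$. Let $k$ be the minimal synchronizing level of $T$ and for $x\in X_n^k$ let $q_x$ be the state forced by $x$. Then $(T)\mathrm{sig}=\sum_{x\in X_n^k}m_{q_x}$ and $(T)\overline{\mathrm{sig}}=(T)\mathrm{sig}\bmod (n-1)$; $\overline{\mathrm{sig}}$ takes values in the units of $\mathbb Z_{n-1}$. Classes, atoms, divisibility (for fixed $\mathcal X\in\{\mathcal{TO},\mathcal O\}$). For $i\in\{1,\ldots,n-1\}$ let $[i]=\{j\in\{1,\ldots,n-1\}:\mathcal X_{n,j}=\mathcal X_{n,i}\}$, let $[\mathbb Z_n^0]$ be the set of all these classes, and put $\mathcal X_{n,[i]}=\mathcal X_{n,i}$. Classes are ordered by $[i]<[j]$ if the smallest element of $[i]$ is less than the smallest element of $[j]$. A class $[r]$ is an atom if there is $T\in\mathcal X_{n,[r]}$ which is not in $\mathcal X_{n,[s]}$ for any $[s]<[r]$. An atom of $[i]$ is an atom $[r]$ with $\mathcal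 X_{n,[r]}\le\mathcal X_{n,[i]}$. If $i,j$ are the smallest elements of $[i],[j]$, then $[i]$ divides $[j]$ if $r\mid j$ for every atom $[r]$ of $[i]$ (with $r$ the smallest element of $[r]$). The lowest common multiple of $[i]$ and $[j]$ is the smallest class $[l]$ such that $[i]$ and $[j]$ both divide $[l]$ (it always exists). *)

theory Defs
  imports
    "HOL-Analysis.Function_Topology"
    "HOL-Algebra.Generated_Groups"
    "HOL-Number_Theory.Cong"
begin

section \<open>Words and Cantor spaces\<close>

text \<open>A single type of letters serves both alphabets: \<open>Sym i\<close> is the letter \<open>i\<close> of \<open>X\<^sub>n\<close> and
  \<open>Dot a\<close> is the dotted letter \<open>a\<close>.\<close>

datatype letter = Sym nat | Dot nat

type_synonym word = "letter list"
type_synonym iword = "nat \<Rightarrow> letter"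

definition alphabet :: "nat \<Rightarrow> letter set" where
  "alphabet n = Sym ` {..<n}"

definition dots :: "nat \<Rightarrow> letter set" where
  "dots r = Dot ` {..<r}"

definition words :: "nat \<Rightarrow> nat \<Rightarrow> word set" where
  "words n k = {w \<in> lists (alphabet n). length w = k}"

definition dotted_words :: "nat \<Rightarrow> nat \<Rightarrow> word set" where
  "dotted_words n r = {d # w | d w. d \<in> dots r \<and> w \<in> lists (alphabet n)}"

definition cantor_n :: "nat \<Rightarrow> iword set" where
  "cantor_n n = {x. \<forall>k. x k \<in> alphabet n}"

definition cantor_nr_topology :: "nat \<Rightarrow> nat \<Rightarrow> iword topology" where
  "cantor_nr_topology n r =
     product_topology (\<lambda>k. discrete_topology (if k = 0 then dots r else alphabet n)) UNIV"

definition cantor_nr :: "nat \<Rightarrow> nat \<Rightarrow> iword set" where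
  "cantor_nr n r = {x. x 0 \<in> dots r \<and> (\<forall>k>0. x k \<in> alphabet n)}"

lemma topspace_cantor_nr_topology: "topspace (cantor_nr_topology n r) = cantor_nr n r"
  by (auto simp: cantor_nr_topology_def cantor_nr_def PiE_iff Pi_iff split: if_splits)

definition iprefix :: "nat \<Rightarrow> iword \<Rightarrow> word" where
  "iprefix k x = map x [0..<k]"

definition iappend :: "word \<Rightarrow> iword \<Rightarrow> iword" where
  "iappend w x = (\<lambda>k. if k < length w then w ! k else x (k - length w))"

text \<open>The cone \<open>U\<^sub>v\<close>, for \<open>v\<close> a word over \<open>X\<^sub>n\<close>.\<close>
definition cone :: "nat \<Rightarrow> word \<Rightarrow> iword set" where
  "cone n v = {x \<in> cantor_n n. iprefix (length v) x = v}"

text \<open>No word satisfies this when \<open>A\<close> has a single element.\<close>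
definition is_greatest_common_prefix :: "word \<Rightarrow> iword set \<Rightarrow> bool" where
  "is_greatest_common_prefix w A \<longleftrightarrow>
     (\<forall>x\<in>A. iprefix (length w) x = w) \<and>
     (\<forall>v. (\<forall>x\<in>A. iprefix (length v) x = v) \<longrightarrow> length v \<le> length w)"

inductive glued_pair :: "nat \<Rightarrow> nat \<Rightarrow> iword \<Rightarrow> iword \<Rightarrow> bool" for n r where
  "w \<in> dotted_words n r \<Longrightarrow> 0 < i \<Longrightarrow> i \<le> n - 1 \<Longrightarrow>
     glued_pair n r (iappend (w @ [Sym i]) (\<lambda>_. Sym 0))
                    (iappend (w @ [Sym (i - 1)]) (\<lambda>_. Sym (n - 1)))"
| "0 < a \<Longrightarrow> a \<le> r - 1 \<Longrightarrow>
     glued_pair n r (iappend [Dot a] (\<lambda>_. Sym 0)) (iappend [Dot (a - 1)] (\<lambda>_. Sym (n - 1)))"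
| "glued_pair n r (iappend [Dot 0] (\<lambda>_. Sym 0)) (iappend [Dot (r - 1)] (\<lambda>_. Sym (n - 1)))"

definition glue :: "nat \<Rightarrow> nat \<Rightarrow> iword \<Rightarrow> iword \<Rightarrow> bool" where
  "glue n r x y \<longleftrightarrow> x = y \<or> glued_pair n r x y \<or> glued_pair n r y x"


section \<open>Transducers over \<open>X\<^sub>n\<close>\<close>

record 'q transducer =
  states :: "'q set"
  step :: "letter \<Rightarrow> 'q \<Rightarrow> 'q"
  emit :: "letter \<Rightarrow> 'q \<Rightarrow> word"

primrec run :: "('q, 'm) transducer_scheme \<Rightarrow> word \<Rightarrow> 'q \<Rightarrow> 'q" where
  "run T [] q = q"
| "run T (i # w) q = run T w (step T i q)"

primrec outword :: "('q, 'm) transducer_scheme \<Rightarrow> word \<Rightarrow> 'q \<Rightarrow> word" where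
  "outword T [] q = []"
| "outword T (i # w) q = emit T i q @ outword T w (step T i q)"

definition infinite_output :: "('q, 'm) transducer_scheme \<Rightarrow> 'q \<Rightarrow> iword \<Rightarrow> bool" where
  "infinite_output T q x \<longleftrightarrow> (\<forall>m. \<exists>k. m < length (outword T (iprefix k x) q))"

text \<open>The map \<open>h\<^sub>q\<close>: letter \<open>m\<close> of the output is read off from any input prefix that already
  produces more than \<open>m\<close> letters.\<close>
definition state_map :: "('q, 'm) transducer_scheme \<Rightarrow> 'q \<Rightarrow> iword \<Rightarrow> iword" where
  "state_map T q x =
     (\<lambda>m. outword T (iprefix (LEAST k. m < length (outword T (iprefix k x) q)) x) q ! m)"

definition state_image :: "nat \<Rightarrow> ('q, 'm) transducer_scheme \<Rightarrow> 'q \<Rightarrow> iword set" where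
  "state_image n T q = state_map T q ` cantor_n n"

definition is_transducer :: "nat \<Rightarrow> 'q transducer \<Rightarrow> bool" where
  "is_transducer n T \<longleftrightarrow>
     (\<forall>q\<in>states T. \<forall>i\<in>alphabet n. step T i q \<in> states T \<and> emit T i q \<in> lists (alphabet n)) \<and>
     (\<forall>q\<in>states T. \<forall>x\<in>cantor_n n. infinite_output T q x)"

definition minimal_transducer :: "nat \<Rightarrow> 'q transducer \<Rightarrow> 'q \<Rightarrow> bool" where
  "minimal_transducer n T q0 \<longleftrightarrow>
     is_transducer n T \<and> q0 \<in> states T \<and>
     (\<forall>q\<in>states T. \<exists>w\<in>lists (alphabet n). run T w q0 = q) \<and>
     (\<forall>q\<in>states T. \<forall>p\<in>states T. (\<forall>x\<in>cantor_n n. state_map T q x = state_map T p x) \<longrightarrow> q = p) \<and>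
     (\<forall>q\<in>states T. \<forall>i\<in>alphabet n.
        is_greatest_common_prefix (emit T i q)
          {state_map T q (iappend [i] x) | x. x \<in> cantor_n n})"

definition sync_at :: "nat \<Rightarrow> 'q transducer \<Rightarrow> nat \<Rightarrow> bool" where
  "sync_at n T k \<longleftrightarrow> (\<forall>w\<in>words n k. \<forall>p\<in>states T. \<forall>q\<in>states T. run T w p = run T w q)"

definition min_sync_level :: "nat \<Rightarrow> 'q transducer \<Rightarrow> nat" where
  "min_sync_level n T = (LEAST k. sync_at n T k)"

text \<open>The set of states forced by the words of length \<open>k\<close> is the same for every synchronizing
  level \<open>k\<close>; the least one is used.\<close>
definition core :: "nat \<Rightarrow> 'q transducer \<Rightarrow> 'q transducer" where
  "core n T =
     T\<lparr>states := {run T w q | w q. w \<in> words n (min_sync_level n T) \<and> q \<in> states T}\<rparr>"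

definition isomorphic :: "nat \<Rightarrow> 'q transducer \<Rightarrow> 'p transducer \<Rightarrow> bool" where
  "isomorphic n T T' \<longleftrightarrow>
     (\<exists>f. bij_betw f (states T) (states T') \<and>
        (\<forall>q\<in>states T. \<forall>i\<in>alphabet n.
           f (step T i q) = step T' i (f q) \<and> emit T i q = emit T' i (f q)))"

text \<open>A finite transducer up to renaming of states is represented by the set of all its copies
  with states in \<^typ>\<open>nat\<close>.\<close>

type_synonym transducer_class = "nat transducer set"

definition iso_class :: "nat \<Rightarrow> 'q transducer \<Rightarrow> transducer_class" where
  "iso_class n T = {T'. isomorphic n T T'}"


section \<open>Transducers over the Cantor space with dotted letters\<close>

text \<open>The set \<open>S\<close> is \<^term>\<open>states A - rstates A\<close>.\<close>

record 'q rtransducer = "'q transducer" +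
  init :: 'q
  rstates :: "'q set"

definition letters_from :: "nat \<Rightarrow> nat \<Rightarrow> 'q rtransducer \<Rightarrow> 'q \<Rightarrow> letter set" where
  "letters_from n r A q = (if q = init A then dots r else alphabet n)"

definition inputs_from :: "nat \<Rightarrow> nat \<Rightarrow> 'q rtransducer \<Rightarrow> 'q \<Rightarrow> iword set" where
  "inputs_from n r A q = (if q = init A then cantor_nr n r else cantor_n n)"

definition readable :: "nat \<Rightarrow> nat \<Rightarrow> 'q rtransducer \<Rightarrow> 'q \<Rightarrow> word \<Rightarrow> bool" where
  "readable n r A q w \<longleftrightarrow>
     w = [] \<or> (hd w \<in> letters_from n r A q \<and> tl w \<in> lists (alphabet n))"

definition is_rtransducer :: "nat \<Rightarrow> nat \<Rightarrow> 'q rtransducer \<Rightarrow> bool" where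
  "is_rtransducer n r A \<longleftrightarrow>
     rstates A \<subseteq> states A \<and> finite (rstates A) \<and> init A \<in> rstates A \<and>
     (\<forall>q\<in>states A. \<forall>i\<in>letters_from n r A q. step A i q \<in> states A - {init A}) \<and>
     (\<forall>q\<in>rstates A. \<forall>i\<in>letters_from n r A q.
        (step A i q \<in> rstates A \<longrightarrow> emit A i q = []) \<and>
        (step A i q \<notin> rstates A \<longrightarrow> emit A i q \<in> dotted_words n r)) \<and>
     (\<forall>q\<in>states A - rstates A. \<forall>i\<in>alphabet n.
        step A i q \<in> states A - rstates A \<and> emit A i q \<in> lists (alphabet n)) \<and>
     (\<forall>q\<in>states A - rstates A. \<forall>x\<in>cantor_n n. infinite_output A q x) \<and>
     (\<forall>q\<in>rstates A. \<forall>w. w \<noteq> [] \<and> readable n r A q w \<longrightarrow> run A w q \<noteq> q)"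

definition minimal_rtransducer :: "nat \<Rightarrow> nat \<Rightarrow> 'q rtransducer \<Rightarrow> bool" where
  "minimal_rtransducer n r A \<longleftrightarrow>
     is_rtransducer n r A \<and>
     (\<forall>q\<in>states A. \<exists>w. readable n r A (init A) w \<and> run A w (init A) = q) \<and>
     (\<forall>q\<in>states A. \<forall>p\<in>states A.
        inputs_from n r A q = inputs_from n r A p \<and>
        (\<forall>x\<in>inputs_from n r A q. state_map A q x = state_map A p x) \<longrightarrow> q = p) \<and>
     (\<forall>q\<in>states A. \<forall>i\<in>letters_from n r A q.
        is_greatest_common_prefix (emit A i q)
          {state_map A q (iappend [i] x) | x. x \<in> cantor_n n})"

definition is_minimal_for :: "nat \<Rightarrow> nat \<Rightarrow> 'q rtransducer \<Rightarrow> (iword \<Rightarrow> iword) \<Rightarrow> bool" where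
  "is_minimal_for n r A h \<longleftrightarrow>
     minimal_rtransducer n r A \<and> (\<forall>x\<in>cantor_nr n r. state_map A (init A) x = h x)"

definition rsync_at :: "nat \<Rightarrow> nat \<Rightarrow> 'q rtransducer \<Rightarrow> nat \<Rightarrow> bool" where
  "rsync_at n r A k \<longleftrightarrow>
     (\<forall>w. length w = k \<longrightarrow>
        (\<forall>p\<in>states A. \<forall>q\<in>states A.
           readable n r A p w \<and> readable n r A q w \<longrightarrow> run A w p = run A w q))"

text \<open>A synchronizing level is never 0 here, so the words over \<open>X\<^sub>n\<close> of that length can be read
  exactly from the states other than the initial one.\<close>
definition rcore :: "nat \<Rightarrow> nat \<Rightarrow> 'q rtransducer \<Rightarrow> 'q transducer" where
  "rcore n r A =
     \<lparr>states = {run A w q | w q. w \<in> words n (LEAST k. rsync_at n r A k) \<and>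
                                 q \<in> states A - {init A}},
      step = step A, emit = emit A\<rparr>"


section \<open>The groups\<close>

text \<open>Minimal transducers are unique up to renaming of states, so quantifying existentially over
  those with states in \<^typ>\<open>nat\<close> loses nothing when finiteness is required.\<close>

definition bisync :: "nat \<Rightarrow> nat \<Rightarrow> (iword \<Rightarrow> iword) \<Rightarrow> bool" where
  "bisync n r h \<longleftrightarrow>
     (\<exists>A :: nat rtransducer. is_minimal_for n r A h \<and> finite (states A) \<and> (\<exists>k. rsync_at n r A k))"

definition B_nr :: "nat \<Rightarrow> nat \<Rightarrow> (iword \<Rightarrow> iword) set" where
  "B_nr n r =
     {h. homeomorphic_map (cantor_nr_topology n r) (cantor_nr_topology n r) h \<and>
         bisync n r h \<and> bisync n r (inv_into (cantor_nr n r) h)}"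

definition TB_nr :: "nat \<Rightarrow> nat \<Rightarrow> (iword \<Rightarrow> iword) set" where
  "TB_nr n r =
     {h \<in> B_nr n r. \<forall>x\<in>cantor_nr n r. \<forall>y\<in>cantor_nr n r. glue n r x y \<longleftrightarrow> glue n r (h x) (h y)}"

definition Core :: "nat \<Rightarrow> nat \<Rightarrow> (iword \<Rightarrow> iword) \<Rightarrow> transducer_class" where
  "Core n r h = (\<Union>A \<in> {A :: nat rtransducer. is_minimal_for n r A h}. iso_class n (rcore n r A))"

definition O_nr :: "nat \<Rightarrow> nat \<Rightarrow> transducer_class set" where
  "O_nr n r = Core n r ` B_nr n r"

definition TO_nr :: "nat \<Rightarrow> nat \<Rightarrow> transducer_class set" where
  "TO_nr n r = Core n r ` TB_nr n r"

text \<open>The unions here and in \<^const>\<open>Core\<close> are over equal sets: the result does not depend on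
  the representatives \<open>T\<close>, \<open>T'\<close>, on the states \<open>q\<close>, \<open>q'\<close>, or on the copy \<open>M\<close> of the minimal
  transducer. Maps act on the right, so the first factor acts first.\<close>
definition core_product :: "nat \<Rightarrow> transducer_class \<Rightarrow> transducer_class \<Rightarrow> transducer_class" where
  "core_product n g h =
     (\<Union>{iso_class n (core n M) | M. \<exists>T\<in>g. \<exists>T'\<in>h. \<exists>q\<in>states T. \<exists>q'\<in>states T'. \<exists>q0.
           minimal_transducer n (M :: nat transducer) q0 \<and>
           (\<forall>x\<in>cantor_n n. state_map M q0 x = state_map T' q' (state_map T q x))})"

definition identity_transducer :: "nat transducer" where
  "identity_transducer = \<lparr>states = {0}, step = (\<lambda>i q. 0), emit = (\<lambda>i q. [i])\<rparr>"

definition O_group :: "nat \<Rightarrow> transducer_class monoid" where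
  "O_group n = \<lparr>carrier = (\<Union>r\<in>{1..n - 1}. O_nr n r), monoid.mult = core_product n,
                monoid.one = iso_class n identity_transducer\<rparr>"


section \<open>Signature\<close>

definition cone_number :: "nat \<Rightarrow> 'q transducer \<Rightarrow> 'q \<Rightarrow> nat" where
  "cone_number n T q =
     (LEAST m. \<exists>V. V \<subseteq> lists (alphabet n) \<and> finite V \<and> card V = m \<and>
                  (\<Union>v\<in>V. cone n v) = state_image n T q)"

definition forced_state :: "'q transducer \<Rightarrow> word \<Rightarrow> 'q" where
  "forced_state T w = (THE q. \<forall>p\<in>states T. run T w p = q)"

definition transducer_sig :: "nat \<Rightarrow> 'q transducer \<Rightarrow> nat" where
  "transducer_sig n T =
     (\<Sum>w \<in> words n (min_sync_level n T). cone_number n T (forced_state T w))"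

definition sig :: "nat \<Rightarrow> transducer_class \<Rightarrow> nat" where
  "sig n g = transducer_sig n (SOME T. T \<in> g)"

definition reduced_sig :: "nat \<Rightarrow> transducer_class \<Rightarrow> nat" where
  "reduced_sig n g = sig n g mod (n - 1)"

text \<open>The units of \<open>\<int>/m\<int>\<close>, as residues in \<open>{0..<m}\<close>; for \<open>m = 1\<close> this is \<open>{0}\<close>. (The library's
  \<open>residue_ring 1\<close> has no units, since its unit element 1 is outside its carrier.)\<close>
definition unit_residues :: "nat \<Rightarrow> nat set" where
  "unit_residues m = {u. u < m \<and> (\<exists>v. [u * v = 1] (mod m))}"


section \<open>Classes, atoms, divisibility\<close>

text \<open>Here \<open>G\<close> is the family \<open>r \<mapsto> X\<^bsub>n,r\<^esub>\<close> of subgroups for a fixed \<open>n\<close>.\<close>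

definition index_class :: "nat \<Rightarrow> (nat \<Rightarrow> 'g set) \<Rightarrow> nat \<Rightarrow> nat set" where
  "index_class n G i = {j \<in> {1..n - 1}. G j = G i}"

definition index_classes :: "nat \<Rightarrow> (nat \<Rightarrow> 'g set) \<Rightarrow> nat set set" where
  "index_classes n G = index_class n G ` {1..n - 1}"

definition class_group :: "(nat \<Rightarrow> 'g set) \<Rightarrow> nat set \<Rightarrow> 'g set" where
  "class_group G c = G (Min c)"

definition class_less :: "nat set \<Rightarrow> nat set \<Rightarrow> bool" where
  "class_less c d \<longleftrightarrow> Min c < Min d"

definition is_atom :: "nat \<Rightarrow> (nat \<Rightarrow> 'g set) \<Rightarrow> nat set \<Rightarrow> bool" where
  "is_atom n G a \<longleftrightarrow> a \<in> index_classes n G \<and>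
     (\<exists>t\<in>class_group G a. \<forall>s\<in>index_classes n G. class_less s a \<longrightarrow> t \<notin> class_group G s)"

definition is_atom_of :: "nat \<Rightarrow> (nat \<Rightarrow> 'g set) \<Rightarrow> nat set \<Rightarrow> nat set \<Rightarrow> bool" where
  "is_atom_of n G a c \<longleftrightarrow> is_atom n G a \<and> class_group G a \<subseteq> class_group G c"

definition class_dvd :: "nat \<Rightarrow> (nat \<Rightarrow> 'g set) \<Rightarrow> nat set \<Rightarrow> nat set \<Rightarrow> bool" where
  "class_dvd n G c d \<longleftrightarrow> (\<forall>a. is_atom_of n G a c \<longrightarrow> Min a dvd Min d)"

definition is_class_lcm ::
    "nat \<Rightarrow> (nat \<Rightarrow> 'g set) \<Rightarrow> nat set \<Rightarrow> nat set \<Rightarrow> nat set \<Rightarrow> bool" where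
  "is_class_lcm n G c d l \<longleftrightarrow>
     l \<in> index_classes n G \<and> class_dvd n G c l \<and> class_dvd n G d l \<and>
     (\<forall>l'\<in>index_classes n G. class_dvd n G c l' \<and> class_dvd n G d l' \<longrightarrow>
        l = l' \<or> class_less l l')"

definition class_lcm :: "nat \<Rightarrow> (nat \<Rightarrow> 'g set) \<Rightarrow> nat set \<Rightarrow> nat set \<Rightarrow> nat set" where
  "class_lcm n G c d = (THE l. is_class_lcm n G c d l)"

end

(*
  Idea. Everything is read off maps instead of transducers. For a map f and a word w write
  f(w x) = lout(w) loc_w(x), where lout(w) is the greatest common prefix of the values of f on the
  cone of w. The states of the minimal transducer of f are the maps loc_w, f is synchronizing iff
  loc_w depends only on a long enough suffix of w, and the core is the set of the maps loc_w for
  long w. Two homeomorphisms with the same long-range local actions therefore have the same core,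
  and this relation is compatible with composition.

  Counting cones modulo n - 1, all images of core states of h have the same size s, which is the
  reduced signature; a core state multiplies the size of clopen sets by s. Hence the reduced
  signature is multiplicative, and r s = r modulo n - 1 for h in B_{n,r}. Conversely, if r s = r
  then the images of the core states attached to all words of a fixed length over r dotted letters
  can be cut into cones that are moved onto a partition of the dotted Cantor space, so the core
  is realized in B_{n,r}. For TB the core states are all increasing or all decreasing in the
  lexicographic order, by an intermediate value argument, and the cones can be moved so that the
  resulting homeomorphism is monotone, which preserves the gluing relation.

  So X_{n,r} is the preimage under the reduced signature of the units u with r u = r. By the
  Chinese remainder theorem the subgroups of units for i and j generate the one for lcm i j, and
  divisibility of classes is inclusion of the corresponding groups.
*)
theory Submission
  imports Defs "HOL-Analysis.T1_Spaces"
begin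



section \<open>Words\<close>

text \<open>Splitting a cone replaces one word by \<open>n\<close> words, so only the residue modulo
  \<open>n - 1\<close> of the number of cones is an invariant of a clopen set; this is the origin of
  the modulus. For \<open>r = n - 1\<close> the condition \<open>r s = r\<close> holds for every
  \<open>s\<close>, so the group with \<open>n - 1\<close> dotted letters contains all the others,
  and the product and the signature need to be studied there only. Maps are compared by
  \<open>sim\<close>, which allows different domains: homeomorphisms over \<open>r\<close> and over
  \<open>s\<close> dotted letters and a core state acting on \<open>cantor_n n\<close> may all have
  the same core. The obstacle in realizing a core is the inverse. That the assembled homeomorphism
  is synchronizing is visible from its construction; its inverse is controlled by comparing it with
  the inverse of the given homeomorphism. Surjectivity of the signature supplies an element of
  prescribed signature when a unit belonging to \<open>lcm i j\<close> is factored into units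
  belonging to \<open>i\<close> and \<open>j\<close>. Atoms are handled by the number
  \<open>\<rho> x\<close>, a divisor of \<open>n - 1\<close> such that \<open>x\<close> lies in the
  group of \<open>r\<close> exactly when \<open>\<rho> x\<close> divides \<open>r\<close>.\<close>

definition idrop :: "nat \<Rightarrow> iword \<Rightarrow> iword" where
  "idrop k x = (\<lambda>i. x (i + k))"

lemma iappend_Nil [simp]: "iappend [] x = x"
  by (simp add: iappend_def)

lemma iappend_iappend [simp]: "iappend u (iappend v x) = iappend (u @ v) x"
  by (auto simp: iappend_def fun_eq_iff nth_append)

lemma length_iprefix [simp]: "length (iprefix k x) = k"
  by (simp add: iprefix_def)

lemma nth_iprefix [simp]: "i < k \<Longrightarrow> iprefix k x ! i = x i"
  by (simp add: iprefix_def)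

lemma iprefix_0 [simp]: "iprefix 0 x = []"
  by (simp add: iprefix_def)

lemma iprefix_Suc: "iprefix (Suc k) x = iprefix k x @ [x k]"
  by (simp add: iprefix_def)

lemma iprefix_iappend_ge: "length w \<le> k \<Longrightarrow> iprefix k (iappend w x) = w @ iprefix (k - length w) x"
  by (rule nth_equalityI) (auto simp: nth_append iappend_def)

lemma iprefix_iappend_add [simp]: "iprefix (length w + k) (iappend w x) = w @ iprefix k x"
  by (simp add: iprefix_iappend_ge)

lemma iprefix_iappend_le: "k \<le> length w \<Longrightarrow> iprefix k (iappend w x) = take k w"
  by (rule nth_equalityI) (auto simp: iappend_def)

lemma iprefix_length_iappend [simp]: "iprefix (length w) (iappend w x) = w"
  by (simp add: iprefix_iappend_le)

lemma idrop_iappend_le: "k \<le> length w \<Longrightarrow> idrop k (iappend w x) = iappend (drop k w) x"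
  by (rule ext) (auto simp: idrop_def iappend_def add.commute)

lemma idrop_length_iappend [simp]: "idrop (length w) (iappend w x) = x"
  by (simp add: idrop_iappend_le)

lemma iappend_iprefix_idrop [simp]: "iappend (iprefix k x) (idrop k x) = x"
  by (rule ext) (auto simp: idrop_def iappend_def)

lemma iappend_cong_iff [simp]: "iappend w x = iappend w y \<longleftrightarrow> x = y"
  by (metis idrop_length_iappend)

lemma iappend_eq_iff: "length w = length v \<Longrightarrow> iappend w x = iappend v y \<longleftrightarrow> w = v \<and> x = y"
  by (metis idrop_length_iappend iprefix_length_iappend)

lemma iprefix_eq_iff: "iprefix k x = iprefix k y \<longleftrightarrow> (\<forall>i<k. x i = y i)"
  by (auto simp: iprefix_def)

lemma iprefix_mono: "iprefix k x = iprefix k y \<Longrightarrow> j \<le> k \<Longrightarrow> iprefix j x = iprefix j y"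
  by (auto simp: iprefix_eq_iff)

lemma take_iprefix: "j \<le> k \<Longrightarrow> take j (iprefix k x) = iprefix j x"
  by (simp add: iprefix_def take_map)

lemma iprefix_word_iff: "iprefix (length w) x = w \<longleftrightarrow> (\<exists>y. x = iappend w y)"
  by (metis iappend_iprefix_idrop iprefix_length_iappend)

lemma iprefix_append_word:
  assumes "iprefix (length v) x = v" "length u \<le> length v" "iprefix (length u) x = u"
  shows "\<exists>t. v = u @ t"
  by (metis append_take_drop_id assms take_iprefix)

lemma iappend_in_cantor_n [simp]:
  "iappend w x \<in> cantor_n n \<longleftrightarrow> w \<in> lists (alphabet n) \<and> x \<in> cantor_n n"
proof
  assume a: "iappend w x \<in> cantor_n n"
  have "w ! i \<in> alphabet n" if "i < length w" for i
    using a that by (auto simp: cantor_n_def iappend_def dest!: spec[of _ i])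
  moreover have "x i \<in> alphabet n" for i
    using a by (auto simp: cantor_n_def iappend_def dest!: spec[of _ "i + length w"])
  ultimately show "w \<in> lists (alphabet n) \<and> x \<in> cantor_n n"
    by (auto simp: cantor_n_def in_set_conv_nth)
next
  assume "w \<in> lists (alphabet n) \<and> x \<in> cantor_n n"
  then show "iappend w x \<in> cantor_n n"
    by (auto simp: cantor_n_def iappend_def)
qed

lemma iprefix_in_lists: "x \<in> cantor_n n \<Longrightarrow> iprefix k x \<in> lists (alphabet n)"
  by (auto simp: cantor_n_def iprefix_def)

lemma idrop_in_cantor_n: "x \<in> cantor_n n \<Longrightarrow> idrop k x \<in> cantor_n n"
  by (auto simp: cantor_n_def idrop_def)

lemma words_eq: "words n k = {w. set w \<subseteq> alphabet n \<and> length w = k}"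
  by (auto simp: words_def)

lemma finite_words [simp]: "finite (words n k)"
  unfolding words_eq by (rule finite_lists_length_eq) (simp add: alphabet_def)

lemma card_words: "card (words n k) = n ^ k"
proof -
  have "card (alphabet n) = n"
    by (simp add: alphabet_def card_image inj_on_def)
  then show ?thesis
    unfolding words_eq by (subst card_lists_length_eq) (simp_all add: alphabet_def)
qed

section \<open>Greatest common prefixes of sets of infinite words\<close>

lemma gcp_unique:
  assumes "is_greatest_common_prefix u A" "is_greatest_common_prefix v A" "x \<in> A"
  shows "u = v"
  using assms unfolding is_greatest_common_prefix_def by (metis le_antisym)

text \<open>Two different members disagree at some position \<open>k\<close>, which bounds the
  length of every common prefix, so a longest one exists.\<close>

lemma gcp_exists:
  assumes "x \<in> A" "y \<in> A" "x \<noteq> y"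
  shows "\<exists>w. is_greatest_common_prefix w A"
proof -
  obtain k where k: "x k \<noteq> y k"
    using assms(3) by auto
  define P where "P j \<longleftrightarrow> (\<forall>z\<in>A. iprefix j z = iprefix j x)" for j
  have bnd: "j \<le> k" if "P j" for j
    using that k assms(2) unfolding P_def by (metis iprefix_eq_iff not_le_imp_less)
  have "P 0"
    by (simp add: P_def)
  then have G: "P (GREATEST j. P j)" "\<And>j. P j \<Longrightarrow> j \<le> (GREATEST j. P j)"
    using bnd by (blast intro: GreatestI_nat Greatest_le_nat)+
  show ?thesis
  proof (intro exI[of _ "iprefix (GREATEST j. P j) x"], unfold is_greatest_common_prefix_def, intro conjI allI impI)
    show "\<forall>z\<in>A. iprefix (length (iprefix (GREATEST j. P j) x)) z = iprefix (GREATEST j. P j) x"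
      using G(1) by (simp add: P_def)
    fix v assume "\<forall>z\<in>A. iprefix (length v) z = v"
    then have "P (length v)"
      using assms(1) by (simp add: P_def)
    then show "length v \<le> length (iprefix (GREATEST j. P j) x)"
      using G(2) by simp
  qed
qed

lemma gcp_iappend:
  assumes "is_greatest_common_prefix u A" "A \<noteq> {}"
  shows "is_greatest_common_prefix (l @ u) (iappend l ` A)"
  unfolding is_greatest_common_prefix_def
proof (intro conjI allI impI ballI)
  fix x assume "x \<in> iappend l ` A"
  then show "iprefix (length (l @ u)) x = l @ u"
    using assms(1) by (auto simp: is_greatest_common_prefix_def)
next
  fix v assume v: "\<forall>x\<in>iappend l ` A. iprefix (length v) x = v"
  show "length v \<le> length (l @ u)"
  proof (cases "length v \<le> length l")
    case False
    define t where "t = drop (length l) v"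
    have "iprefix (length t) x = t" if "x \<in> A" for x
    proof -
      have "l @ iprefix (length t) x = v"
        using v that False iprefix_iappend_ge[of l "length v" x] by (simp add: t_def)
      then show ?thesis
        by (metis append_eq_conv_conj t_def)
    qed
    then have "length t \<le> length u"
      using assms(1) by (auto simp: is_greatest_common_prefix_def)
    then show ?thesis
      using False by (simp add: t_def)
  qed simp
qed

section \<open>Local actions\<close>

text \<open>A definite description, meaningful when \<open>f\<close> is not constant on the cone of
  \<open>w\<close>; this is why \<open>inj_cone\<close> accompanies it everywhere.\<close>

definition lout :: "nat \<Rightarrow> (iword \<Rightarrow> iword) \<Rightarrow> word \<Rightarrow> word" where
  "lout n f w = (THE l. is_greatest_common_prefix l {f (iappend w x) | x. x \<in> cantor_n n})"

text \<open>The restriction makes local actions that agree on \<open>cantor_n n\<close> equal as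
  functions, so that they can themselves serve as the states of a transducer.\<close>

definition loc :: "nat \<Rightarrow> (iword \<Rightarrow> iword) \<Rightarrow> word \<Rightarrow> iword \<Rightarrow> iword" where
  "loc n f w = (\<lambda>x \<in> cantor_n n. idrop (length (lout n f w)) (f (iappend w x)))"

definition inj_cone :: "nat \<Rightarrow> (iword \<Rightarrow> iword) \<Rightarrow> word \<Rightarrow> bool" where
  "inj_cone n f w \<longleftrightarrow> inj_on (\<lambda>x. f (iappend w x)) (cantor_n n)"

text \<open>Uniform continuity for the usual ultrametric.\<close>

definition uc :: "iword set \<Rightarrow> (iword \<Rightarrow> iword) \<Rightarrow> bool" where
  "uc D f \<longleftrightarrow> (\<forall>m. \<exists>L. \<forall>x\<in>D. \<forall>y\<in>D. iprefix L x = iprefix L y \<longrightarrow> iprefix m (f x) = iprefix m (f y))"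

lemma uc_cong: "uc D f \<Longrightarrow> (\<And>x. x \<in> D \<Longrightarrow> g x = f x) \<Longrightarrow> uc D g"
  by (simp add: uc_def)

lemma uc_comp:
  assumes "uc D f" "f ` D \<subseteq> E" "uc E g"
  shows "uc D (\<lambda>x. g (f x))"
  unfolding uc_def
proof
  fix m
  obtain L where L: "\<forall>x\<in>E. \<forall>y\<in>E. iprefix L x = iprefix L y \<longrightarrow> iprefix m (g x) = iprefix m (g y)"
    using assms(3) unfolding uc_def by blast
  obtain L' where "\<forall>x\<in>D. \<forall>y\<in>D. iprefix L' x = iprefix L' y \<longrightarrow> iprefix L (f x) = iprefix L (f y)"
    using assms(1) unfolding uc_def by blast
  then show "\<exists>L. \<forall>x\<in>D. \<forall>y\<in>D. iprefix L x = iprefix L y \<longrightarrow> iprefix m (g (f x)) = iprefix m (g (f y))"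
    using L assms(2) by (intro exI[of _ L']) blast
qed

locale alph =
  fixes n :: nat
  assumes n2: "2 \<le> n"
begin

abbreviation C :: "iword set" where "C \<equiv> cantor_n n"
abbreviation W :: "word set" where "W \<equiv> lists (alphabet n)"

lemma Sym_in: "i < n \<Longrightarrow> Sym i \<in> alphabet n"
  by (simp add: alphabet_def)

lemma const_in_C: "i < n \<Longrightarrow> (\<lambda>_. Sym i) \<in> C"
  by (simp add: cantor_n_def Sym_in)

lemma C_two: "(\<lambda>_. Sym 0) \<in> C" "(\<lambda>_. Sym (Suc 0)) \<in> C" "(\<lambda>_. Sym 0) \<noteq> (\<lambda>_. Sym (Suc 0))"
  using n2 by (auto intro: const_in_C simp: fun_eq_iff)

lemma C_nonempty: "C \<noteq> {}"
  using C_two by auto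

lemma words_exist: "\<exists>w\<in>W. length w = k"
  using C_two(1) by (meson iprefix_in_lists length_iprefix)

lemma inj_coneD:
  "inj_cone n f w \<Longrightarrow> x \<in> C \<Longrightarrow> y \<in> C \<Longrightarrow> f (iappend w x) = f (iappend w y) \<Longrightarrow> x = y"
  unfolding inj_cone_def inj_on_def by blast

lemma inj_coneI:
  "(\<And>x y. x \<in> C \<Longrightarrow> y \<in> C \<Longrightarrow> f (iappend w x) = f (iappend w y) \<Longrightarrow> x = y) \<Longrightarrow> inj_cone n f w"
  unfolding inj_cone_def by (rule inj_onI)

lemma inj_on_cone:
  assumes "inj_on f D" "\<And>y. y \<in> C \<Longrightarrow> iappend w y \<in> D"
  shows "inj_cone n f w"
proof (rule inj_coneI)
  fix x y assume "x \<in> C" "y \<in> C" "f (iappend w x) = f (iappend w y)"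
  then have "iappend w x = iappend w y"
    using inj_onD[OF assms(1)] assms(2) by blast
  then show "x = y" by simp
qed

lemma lout_gcp:
  assumes "inj_cone n f w"
  shows "is_greatest_common_prefix (lout n f w) {f (iappend w x) | x. x \<in> C}"
proof -
  let ?A = "{f (iappend w x) | x. x \<in> C}"
  have "f (iappend w (\<lambda>_. Sym 0)) \<noteq> f (iappend w (\<lambda>_. Sym (Suc 0)))"
    using inj_coneD[OF assms] C_two by blast
  then obtain l where l: "is_greatest_common_prefix l ?A"
    using gcp_exists[of "f (iappend w (\<lambda>_. Sym 0))" ?A "f (iappend w (\<lambda>_. Sym (Suc 0)))"] C_two by blast
  show ?thesis
    unfolding lout_def
    by (rule theI[of _ l]) (use l gcp_unique C_two in blast)+
qed

lemma lout_eqI: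
  assumes "is_greatest_common_prefix l {f (iappend w x) | x. x \<in> C}"
  shows "lout n f w = l"
  unfolding lout_def
  by (rule the_equality) (use assms gcp_unique C_two in blast)+

lemma lout_loc:
  assumes "inj_cone n f w" "x \<in> C"
  shows "f (iappend w x) = iappend (lout n f w) (loc n f w x)"
proof -
  have "iprefix (length (lout n f w)) (f (iappend w x)) = lout n f w"
    using lout_gcp[OF assms(1)] assms(2) unfolding is_greatest_common_prefix_def by blast
  then show ?thesis
    using assms(2) iappend_iprefix_idrop[of "length (lout n f w)" "f (iappend w x)"]
    by (simp add: loc_def)
qed

lemma loc_ext [simp]: "loc n f w \<in> extensional C"
  by (simp add: loc_def)

lemma inj_loc:
  assumes "inj_cone n f w"
  shows "inj_on (loc n f w) C"
  using assms lout_loc unfolding inj_on_def by (metis inj_coneD)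

text \<open>The main tool for identifying local actions: they do not see a word prepended to the
  values. Compositions, inverses and assembled homeomorphisms are all treated by exhibiting such an
  equation.\<close>

lemma
  assumes eq: "\<And>x. x \<in> C \<Longrightarrow> f (iappend w x) = iappend l (g (iappend u x))"
    and inj: "inj_cone n g u"
  shows lout_shift: "lout n f w = l @ lout n g u" and loc_shift: "loc n f w = loc n g u"
proof -
  have A: "{f (iappend w x) | x. x \<in> C} = iappend l ` {g (iappend u x) | x. x \<in> C}"
    using eq by (auto simp: image_iff) metis+
  show L: "lout n f w = l @ lout n g u"
    by (rule lout_eqI, subst A, rule gcp_iappend) (use lout_gcp[OF inj] C_nonempty in auto)
  have "idrop (length l + k) (iappend l z) = idrop k z" for k z
    by (rule ext) (simp add: idrop_def iappend_def)
  then show "loc n f w = loc n g u"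
    unfolding loc_def L using eq by (intro restrict_ext) simp
qed

lemma loc_cong:
  assumes "\<And>x. x \<in> C \<Longrightarrow> f (iappend w x) = g (iappend w x)"
  shows "loc n f w = loc n g w" "lout n f w = lout n g w"
proof -
  have A: "{f (iappend w x) | x. x \<in> C} = {g (iappend w x) | x. x \<in> C}"
    using assms by metis
  show L: "lout n f w = lout n g w"
    by (simp add: lout_def A)
  show "loc n f w = loc n g w"
    unfolding loc_def L using assms by (intro restrict_ext) simp
qed

lemma inj_cone_loc: "inj_cone n f w \<Longrightarrow> u \<in> W \<Longrightarrow> inj_cone n (loc n f w) u"
  by (rule inj_on_cone[OF inj_loc]) auto

text \<open>The cocycle rule. It turns the set of local actions into a transducer with transitions
  \<open>loc n q [i]\<close> and outputs \<open>lout n q [i]\<close>.\<close>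

lemma
  assumes "inj_cone n f w" "u \<in> W"
  shows loc_loc: "loc n (loc n f w) u = loc n f (w @ u)"
    and lout_append: "lout n f (w @ u) = lout n f w @ lout n (loc n f w) u"
proof -
  have "f (iappend (w @ u) x) = iappend (lout n f w) (loc n f w (iappend u x))" if "x \<in> C" for x
    using lout_loc[OF assms(1), of "iappend u x"] that assms(2) by simp
  from loc_shift[OF this inj_cone_loc[OF assms]] lout_shift[OF this inj_cone_loc[OF assms]]
  show "loc n (loc n f w) u = loc n f (w @ u)"
    "lout n f (w @ u) = lout n f w @ lout n (loc n f w) u" by auto
qed

lemma lout_loc_Nil: "inj_cone n f w \<Longrightarrow> lout n (loc n f w) [] = []"
  using lout_append[of f w "[]"] by simp

lemma loc_loc_Nil: "inj_cone n f w \<Longrightarrow> loc n (loc n f w) [] = loc n f w"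
  using loc_loc[of f w "[]"] by simp

definition pre :: "iword set \<Rightarrow> word set" where
  "pre D = {v. v \<noteq> [] \<and> (\<forall>y\<in>C. iappend v y \<in> D)}"

text \<open>The common abstraction of \<open>cantor_n n\<close> and the dotted spaces: after the
  first letter any word over the undotted alphabet may follow. As the first letter is special in a
  dotted space, \<open>pre\<close> leaves out the empty word for both kinds of spaces.\<close>

definition tail_space :: "iword set \<Rightarrow> bool" where
  "tail_space D \<longleftrightarrow> D \<noteq> {} \<and> (\<forall>x\<in>D. \<forall>k\<ge>1. iprefix k x \<in> pre D \<and> idrop k x \<in> C) \<and>
     finite ((\<lambda>x. x 0) ` D)"

lemma tail_spaceD:
  "tail_space D \<Longrightarrow> x \<in> D \<Longrightarrow> 1 \<le> k \<Longrightarrow> iprefix k x \<in> pre D"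
  "tail_space D \<Longrightarrow> x \<in> D \<Longrightarrow> 1 \<le> k \<Longrightarrow> idrop k x \<in> C"
  by (auto simp: tail_space_def)

lemma preD: "v \<in> pre D \<Longrightarrow> y \<in> C \<Longrightarrow> iappend v y \<in> D" "v \<in> pre D \<Longrightarrow> v \<noteq> []"
  by (auto simp: pre_def)

lemma pre_append: "v \<in> pre D \<Longrightarrow> w \<in> W \<Longrightarrow> v @ w \<in> pre D"
  unfolding pre_def by (auto simp flip: iappend_iappend)

lemma pre_exists:
  assumes "tail_space D"
  shows "\<exists>v\<in>pre D. length v = Suc k"
proof -
  obtain x where "x \<in> D"
    using assms by (auto simp: tail_space_def)
  then have "iprefix (Suc k) x \<in> pre D"
    using tail_spaceD(1)[OF assms] by simp
  then show ?thesis
    by (metis length_iprefix)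
qed

lemma tail_space_iappendD:
  assumes "tail_space D" "iappend v y \<in> D" "v \<noteq> []"
  shows "v \<in> pre D" "y \<in> C"
proof -
  have "1 \<le> length v"
    using assms(3) by (simp add: Suc_le_eq)
  then show "v \<in> pre D" "y \<in> C"
    using tail_spaceD[OF assms(1,2), of "length v"] by auto
qed

lemma pre_appendD:
  assumes "tail_space D" "u @ w \<in> pre D" "u \<noteq> []"
  shows "u \<in> pre D" "w \<in> W"
proof -
  have "iappend u (iappend w (\<lambda>_. Sym 0)) \<in> D"
    using assms(2) C_two by (auto simp: pre_def)
  from tail_space_iappendD[OF assms(1) this assms(3)]
  show "u \<in> pre D" "w \<in> W" by auto
qed

lemma tail_space_C: "tail_space C" and pre_C: "pre C = W - {[]}"
proof -
  show P: "pre C = W - {[]}"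
    using C_two by (auto simp: pre_def)
  have "finite ((\<lambda>x. x 0) ` C)"
    by (rule finite_subset[of _ "alphabet n"]) (auto simp: cantor_n_def alphabet_def)
  then show "tail_space C"
    unfolding tail_space_def P
    using C_nonempty idrop_in_cantor_n iprefix_in_lists
    by (auto simp flip: length_0_conv)
qed

lemma
  assumes "1 \<le> r"
  shows tail_space_cantor_nr: "tail_space (cantor_nr n r)"
    and pre_cantor_nr: "pre (cantor_nr n r) = dotted_words n r"
proof -
  have a: "iappend (d # w) x \<in> cantor_nr n r \<longleftrightarrow> d \<in> dots r \<and> iappend w x \<in> C" for d w x
  proof -
    have "iappend (d # w) x 0 = d" "iappend (d # w) x (Suc k) = iappend w x k" for k
      by (auto simp: iappend_def)
    then show ?thesis
      by (auto simp: cantor_nr_def cantor_n_def dest: gr0_implies_Suc)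
  qed
  show P: "pre (cantor_nr n r) = dotted_words n r"
  proof (rule Set.set_eqI)
    fix v show "v \<in> pre (cantor_nr n r) \<longleftrightarrow> v \<in> dotted_words n r"
      using C_nonempty by (cases v) (auto simp: pre_def dotted_words_def a)
  qed
  have "iprefix k x \<in> dotted_words n r \<and> idrop k x \<in> C" if xk: "x \<in> cantor_nr n r" "k \<ge> 1" for k x
  proof -
    obtain d w where dw: "iprefix k x = d # w"
      using xk(2) by (metis One_nat_def Suc_le_length_iff length_iprefix)
    then have "iappend (d # w) (idrop k x) \<in> cantor_nr n r"
      using xk(1) by (metis iappend_iprefix_idrop)
    then show ?thesis
      unfolding a dw by (simp add: dotted_words_def)
  qed
  moreover have "iappend [Dot 0] (\<lambda>_. Sym 0) \<in> cantor_nr n r"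
    unfolding a using assms C_two by (simp add: dots_def)
  moreover have "finite ((\<lambda>x. x 0) ` cantor_nr n r)"
    by (rule finite_subset[of _ "dots r"]) (auto simp: cantor_nr_def dots_def)
  ultimately show "tail_space (cantor_nr n r)"
    unfolding tail_space_def P by blast
qed

lemma finite_pre:
  assumes "tail_space D"
  shows "finite {v \<in> pre D. length v = k}"
proof (cases k)
  case 0
  then show ?thesis
    by (auto intro: finite_subset[of _ "{[]}"])
next
  case (Suc l)
  have "{v \<in> pre D. length v = k} \<subseteq> (\<lambda>(c, w). c # w) ` ((\<lambda>x. x 0) ` D \<times> words n l)"
  proof clarify
    fix v assume v: "v \<in> pre D" "k = length v"
    then obtain c w where cw: "v = c # w"
      by (metis Suc length_Suc_conv)
    have "w \<in> W"
      using pre_appendD[of D "[c]" w] assms v cw by simp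
    moreover have "iappend v (\<lambda>_. Sym 0) \<in> D"
      using v C_two by (auto simp: pre_def)
    then have "c \<in> (\<lambda>x. x 0) ` D"
      unfolding cw by (rule rev_image_eqI) (simp add: iappend_def)
    ultimately show "v \<in> (\<lambda>(c, w). c # w) ` ((\<lambda>x. x 0) ` D \<times> words n l)"
      using v cw Suc by (auto simp: words_def)
  qed
  moreover have "finite ((\<lambda>(c, w). c # w) ` ((\<lambda>x. x 0) ` D \<times> words n l))"
    using assms by (simp add: tail_space_def)
  ultimately show ?thesis
    by (rule finite_subset)
qed

lemma inj_cone_pre: "inj_on f D \<Longrightarrow> v \<in> pre D \<Longrightarrow> inj_cone n f v"
  by (rule inj_on_cone) (auto simp: preD)

lemma inj_cone_W: "inj_on f C \<Longrightarrow> w \<in> W \<Longrightarrow> inj_cone n f w"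
  by (rule inj_on_cone) auto

text \<open>Uniform continuity fixes the first \<open>m\<close> letters of the values on every
  sufficiently small cone, so they belong to the common prefix.\<close>

lemma lout_long:
  assumes D: "tail_space D" and f: "inj_on f D" "uc D f"
  shows "\<exists>L. \<forall>v\<in>pre D. L \<le> length v \<longrightarrow> m \<le> length (lout n f v)"
proof -
  obtain L where L: "\<forall>x\<in>D. \<forall>y\<in>D. iprefix L x = iprefix L y \<longrightarrow> iprefix m (f x) = iprefix m (f y)"
    using f(2) unfolding uc_def by blast
  have "m \<le> length (lout n f v)" if v: "v \<in> pre D" "L \<le> length v" for v
  proof -
    let ?u = "iprefix m (f (iappend v (\<lambda>_. Sym 0)))"
    have "iprefix m (f (iappend v x)) = ?u" if "x \<in> C" for x
      using L that v C_two(1) by (auto simp: preD iprefix_iappend_le)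
    then have "\<forall>z\<in>{f (iappend v x) | x. x \<in> C}. iprefix (length ?u) z = ?u"
      by auto
    then have "length ?u \<le> length (lout n f v)"
      using lout_gcp[OF inj_cone_pre[OF f(1) v(1)]] unfolding is_greatest_common_prefix_def by blast
    then show ?thesis by simp
  qed
  then show ?thesis by blast
qed

lemma uc_loc:
  assumes "uc D f" "v \<in> pre D"
  shows "uc C (loc n f v)"
  unfolding uc_def
proof
  fix m
  let ?l = "length (lout n f v)"
  obtain L where L: "\<forall>x\<in>D. \<forall>y\<in>D. iprefix L x = iprefix L y \<longrightarrow>
      iprefix (m + ?l) (f x) = iprefix (m + ?l) (f y)"
    using assms(1) unfolding uc_def by blast
  have "iprefix m (loc n f v x) = iprefix m (loc n f v y)"
    if "x \<in> C" "y \<in> C" "iprefix L x = iprefix L y" for x y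
  proof -
    have "iprefix (length v + L) (iappend v x) = iprefix (length v + L) (iappend v y)"
      using that by simp
    then have "iprefix L (iappend v x) = iprefix L (iappend v y)"
      by (rule iprefix_mono) simp
    then have "iprefix (m + ?l) (f (iappend v x)) = iprefix (m + ?l) (f (iappend v y))"
      using L that assms(2) by (auto simp: preD)
    then show ?thesis
      using that(1,2) by (auto simp: loc_def idrop_def iprefix_eq_iff)
  qed
  then show "\<exists>L. \<forall>x\<in>C. \<forall>y\<in>C. iprefix L x = iprefix L y \<longrightarrow>
      iprefix m (loc n f v x) = iprefix m (loc n f v y)" by blast
qed

text \<open>Once a nonempty part of the value is written, the dotted letter, if there is one, is
  among it, and what remains lies in \<open>C\<close>.\<close>

lemma lout_in_pre:
  assumes "tail_space E" "inj_on f D" "f ` D \<subseteq> E" "v \<in> pre D" "lout n f v \<noteq> []"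
  shows "lout n f v \<in> pre E" "x \<in> C \<Longrightarrow> loc n f v x \<in> C"
proof -
  have *: "iappend (lout n f v) (loc n f v x) \<in> E" if "x \<in> C" for x
    using lout_loc[OF inj_cone_pre[OF assms(2,4)] that] assms(3,4) that by (metis image_subset_iff preD(1))
  then show "lout n f v \<in> pre E"
    using tail_space_iappendD[OF assms(1) _ assms(5)] C_two by blast
  show "x \<in> C \<Longrightarrow> loc n f v x \<in> C"
    using tail_space_iappendD[OF assms(1) * assms(5)] by blast
qed

end



section \<open>Synchronization and cores\<close>

context alph
begin

text \<open>A topological embedding in combinatorial form; topologies return only in the section on
  homeomorphisms, where compactness makes uniform continuity and continuity the same.\<close>

definition emb :: "iword set \<Rightarrow> iword set \<Rightarrow> (iword \<Rightarrow> iword) \<Rightarrow> bool" where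
  "emb D E f \<longleftrightarrow> tail_space D \<and> tail_space E \<and> inj_on f D \<and> uc D f \<and> f ` D \<subseteq> E"

lemma embD:
  assumes "emb D E f"
  shows "tail_space D" "tail_space E" "inj_on f D" "uc D f" "f ` D \<subseteq> E"
  using assms by (auto simp: emb_def)

lemma emb_in: "emb D E f \<Longrightarrow> x \<in> D \<Longrightarrow> f x \<in> E"
  by (auto simp: emb_def)

lemma emb_inj_cone: "emb D E f \<Longrightarrow> v \<in> pre D \<Longrightarrow> inj_cone n f v"
  by (rule inj_cone_pre) (auto simp: emb_def)

lemma emb_inj_cone_C: "emb C E f \<Longrightarrow> v \<in> W \<Longrightarrow> inj_cone n f v"
  by (rule inj_cone_W) (auto simp: emb_def)

lemma emb_inj: "emb D E f \<Longrightarrow> x \<in> D \<Longrightarrow> y \<in> D \<Longrightarrow> f x = f y \<Longrightarrow> x = y"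
  unfolding emb_def by (meson inj_onD)

lemma emb_comp:
  assumes f: "emb D E f" and g: "emb E F g"
  shows "emb D F (\<lambda>x. g (f x))"
  unfolding emb_def
proof (intro conjI)
  show "inj_on (\<lambda>x. g (f x)) D"
    by (rule inj_onI) (meson emb_inj[OF f] emb_inj[OF g] emb_in[OF f])
  show "uc D (\<lambda>x. g (f x))"
    by (rule uc_comp[OF embD(4,5)[OF f] embD(4)[OF g]])
  show "tail_space D" "tail_space F"
    by (rule embD(1)[OF f], rule embD(2)[OF g])
  show "(\<lambda>x. g (f x)) ` D \<subseteq> F"
    using emb_in[OF f] emb_in[OF g] by auto
qed

lemma emb_cong:
  assumes f: "emb D E f" and g: "\<And>x. x \<in> D \<Longrightarrow> g x = f x"
  shows "emb D E g"
  unfolding emb_def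
proof (intro conjI)
  show "inj_on g D"
    using embD(3)[OF f] g by (simp cong: inj_on_cong)
  show "uc D g"
    by (rule uc_cong[OF embD(4)[OF f] g])
  show "g ` D \<subseteq> E"
    using g emb_in[OF f] by auto
  show "tail_space D" "tail_space E"
    by (fact embD(1,2)[OF f])+
qed

lemma emb_loc:
  assumes "emb D E f" "v \<in> pre D" "lout n f v \<noteq> []"
  shows "emb C C (loc n f v)"
  using assms lout_in_pre[of E f D v] inj_loc[OF emb_inj_cone[OF assms(1,2)]] uc_loc[of D f v]
  by (auto simp: emb_def tail_space_C)

text \<open>Two maps, possibly on different spaces, are related by \<open>sim\<close> when both are synchronizing, with
  the same core; \<open>sim D f D f\<close> says that \<open>f\<close> is synchronizing.\<close>

definition sim_at :: "iword set \<Rightarrow> (iword \<Rightarrow> iword) \<Rightarrow> iword set \<Rightarrow> (iword \<Rightarrow> iword) \<Rightarrow> nat \<Rightarrow> bool" where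
  "sim_at D f E g k \<longleftrightarrow>
     (\<forall>w\<in>W. k \<le> length w \<longrightarrow> (\<forall>v\<in>pre D. \<forall>v'\<in>pre E. loc n f (v @ w) = loc n g (v' @ w)))"

definition sim :: "iword set \<Rightarrow> (iword \<Rightarrow> iword) \<Rightarrow> iword set \<Rightarrow> (iword \<Rightarrow> iword) \<Rightarrow> bool" where
  "sim D f E g \<longleftrightarrow> (\<exists>k. sim_at D f E g k)"

lemma sim_atD:
  "sim_at D f E g k \<Longrightarrow> w \<in> W \<Longrightarrow> k \<le> length w \<Longrightarrow> v \<in> pre D \<Longrightarrow> v' \<in> pre E \<Longrightarrow>
     loc n f (v @ w) = loc n g (v' @ w)"
  by (simp add: sim_at_def)

text \<open>The local action at \<open>v @ w\<close> arises from the one at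
  \<open>v @ take k w\<close> by reading the rest of \<open>w\<close>, so agreement at length
  \<open>k\<close> propagates to longer words.\<close>

lemma sim_atI:
  assumes "inj_on f D" "inj_on g E"
    and "\<And>w v v'. w \<in> words n k \<Longrightarrow> v \<in> pre D \<Longrightarrow> v' \<in> pre E \<Longrightarrow> loc n f (v @ w) = loc n g (v' @ w)"
  shows "sim_at D f E g k"
  unfolding sim_at_def
proof (intro ballI impI)
  fix w v v' assume w: "w \<in> W" "k \<le> length w" and v: "v \<in> pre D" "v' \<in> pre E"
  let ?a = "take k w" and ?b = "drop k w"
  have "set ?a \<subseteq> set w" "set ?b \<subseteq> set w"
    by (simp_all add: set_take_subset set_drop_subset)
  then have ab: "?a \<in> W" "?b \<in> W" "?a \<in> words n k"
    using w by (auto simp: words_def)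
  have "loc n f ((v @ ?a) @ ?b) = loc n (loc n f (v @ ?a)) ?b"
    using loc_loc inj_cone_pre[OF assms(1) pre_append[OF v(1) ab(1)]] ab(2) by simp
  moreover have "loc n g ((v' @ ?a) @ ?b) = loc n (loc n g (v' @ ?a)) ?b"
    using loc_loc inj_cone_pre[OF assms(2) pre_append[OF v(2) ab(1)]] ab(2) by simp
  ultimately show "loc n f (v @ w) = loc n g (v' @ w)"
    using assms(3)[OF ab(3) v] by simp
qed

lemma sim_sym: "sim D f E g \<Longrightarrow> sim E g D f"
  unfolding sim_def sim_at_def by metis

text \<open>The two equations are linked through a word of \<open>pre E\<close>; the assumption on
  \<open>E\<close> provides one.\<close>

lemma sim_trans:
  assumes "sim D f E g" "sim E g F h" "tail_space E"
  shows "sim D f F h"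
proof -
  obtain k where k: "sim_at D f E g k"
    using assms(1) by (auto simp: sim_def)
  obtain l where l: "sim_at E g F h l"
    using assms(2) by (auto simp: sim_def)
  obtain u where u: "u \<in> pre E"
    using pre_exists[OF assms(3)] by blast
  have "sim_at D f F h (max k l)"
    unfolding sim_at_def using sim_atD[OF k _ _ _ u] sim_atD[OF l _ _ u] by simp
  then show ?thesis
    by (auto simp: sim_def)
qed

lemma sim_cong:
  assumes "sim D f E g" "\<And>x. x \<in> D \<Longrightarrow> f' x = f x" "\<And>x. x \<in> E \<Longrightarrow> g' x = g x"
  shows "sim D f' E g'"
proof -
  have "loc n f' (v @ w) = loc n f (v @ w)" if "v \<in> pre D" "w \<in> W" for v w
    by (rule loc_cong) (use assms(2) preD(1)[OF pre_append[OF that]] in auto)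
  moreover have "loc n g' (v @ w) = loc n g (v @ w)" if "v \<in> pre E" "w \<in> W" for v w
    by (rule loc_cong) (use assms(3) preD(1)[OF pre_append[OF that]] in auto)
  ultimately show ?thesis
    using assms(1) unfolding sim_def sim_at_def by metis
qed

text \<open>Local actions occurring after arbitrarily long words. For a synchronizing map these are
  the states forced at any synchronizing level, but no level has to be chosen to state it.\<close>

definition core_maps :: "iword set \<Rightarrow> (iword \<Rightarrow> iword) \<Rightarrow> (iword \<Rightarrow> iword) set" where
  "core_maps D f = {g. \<forall>N. \<exists>v\<in>pre D. \<exists>w\<in>W. N \<le> length w \<and> g = loc n f (v @ w)}"

lemma core_mapsE:
  assumes "g \<in> core_maps D f"
  obtains v w where "v \<in> pre D" "w \<in> W" "N \<le> length w" "g = loc n f (v @ w)"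
  using assms unfolding core_maps_def by blast

lemma core_maps_subset:
  assumes "sim D f E g" "tail_space E"
  shows "core_maps D f \<subseteq> core_maps E g"
proof
  fix p assume p: "p \<in> core_maps D f"
  obtain k where k: "sim_at D f E g k"
    using assms(1) by (auto simp: sim_def)
  obtain u where u: "u \<in> pre E"
    using pre_exists[OF assms(2)] by blast
  have "\<exists>v\<in>pre E. \<exists>w\<in>W. N \<le> length w \<and> p = loc n g (v @ w)" for N
  proof -
    obtain v w where "v \<in> pre D" "w \<in> W" "max N k \<le> length w" "p = loc n f (v @ w)"
      using p by (rule core_mapsE)
    then show ?thesis
      using sim_atD[OF k _ _ _ u] u by (intro bexI[of _ u] bexI[of _ w]) auto
  qed
  then show "p \<in> core_maps E g"
    by (simp add: core_maps_def)
qed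

lemma core_maps_eq:
  "sim D f E g \<Longrightarrow> tail_space D \<Longrightarrow> tail_space E \<Longrightarrow> core_maps D f = core_maps E g"
  by (meson core_maps_subset sim_sym subset_antisym)

text \<open>By synchronization a word \<open>t\<close> of any length can be inserted before
  \<open>w\<close> without changing the local action.\<close>

lemma loc_in_core_maps:
  assumes "sim_at D f D f k" "v \<in> pre D" "w \<in> W" "k \<le> length w"
  shows "loc n f (v @ w) \<in> core_maps D f"
proof -
  have "\<exists>v'\<in>pre D. \<exists>u\<in>W. N \<le> length u \<and> loc n f (v @ w) = loc n f (v' @ u)" for N
  proof -
    obtain t where t: "t \<in> W" "length t = N"
      using words_exist by blast
    have "loc n f ((v @ t) @ w) = loc n f (v @ w)"
      using sim_atD[OF assms(1,3,4) pre_append[OF assms(2) t(1)] assms(2)] .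
    then show ?thesis
      using assms t by (intro bexI[of _ v] bexI[of _ "t @ w"]) auto
  qed
  then show ?thesis
    by (simp add: core_maps_def)
qed

lemma core_maps_level:
  assumes "sim_at D f D f k" "u \<in> pre D"
  shows "core_maps D f = (\<lambda>w. loc n f (u @ w)) ` words n k"
proof
  show "(\<lambda>w. loc n f (u @ w)) ` words n k \<subseteq> core_maps D f"
    using loc_in_core_maps[OF assms] by (auto simp: words_def)
  show "core_maps D f \<subseteq> (\<lambda>w. loc n f (u @ w)) ` words n k"
  proof
    fix g assume "g \<in> core_maps D f"
    then obtain v w where vw: "v \<in> pre D" "w \<in> W" "k \<le> length w" "g = loc n f (v @ w)"
      by (rule core_mapsE)
    define a b where "a = take (length w - k) w" and "b = drop (length w - k) w"
    have ab: "w = a @ b" "length b = k" "a \<in> W" "b \<in> W"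
      using vw by (auto simp: a_def b_def dest: in_set_takeD in_set_dropD)
    have "g = loc n f ((v @ a) @ b)"
      using vw ab by simp
    also have "\<dots> = loc n f (u @ b)"
      using sim_atD[OF assms(1) ab(4) _ pre_append[OF vw(1) ab(3)] assms(2)] ab by simp
    finally show "g \<in> (\<lambda>w. loc n f (u @ w)) ` words n k"
      using ab by (auto simp: words_def)
  qed
qed

lemma core_maps_finite: "sim D f D f \<Longrightarrow> tail_space D \<Longrightarrow> finite (core_maps D f)"
  unfolding sim_def using core_maps_level pre_exists by (metis finite_imageI finite_words)

lemma core_maps_nonempty: "sim D f D f \<Longrightarrow> tail_space D \<Longrightarrow> core_maps D f \<noteq> {}"
proof -
  assume a: "sim D f D f" "tail_space D"
  then obtain k u where "sim_at D f D f k" "u \<in> pre D"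
    unfolding sim_def using pre_exists by blast
  then show ?thesis
    using loc_in_core_maps[of D f k u] words_exist[of k] by blast
qed

text \<open>A core map occurs after words that have already produced output; hence it maps
  \<open>C\<close> into \<open>C\<close>, even if \<open>f\<close> has dotted values.\<close>

lemma core_maps_emb:
  assumes f: "emb D E f" and g: "g \<in> core_maps D f"
  shows "emb C C g" "g \<in> extensional C" "lout n g [] = []" "u \<in> W \<Longrightarrow> loc n g u \<in> core_maps D f"
proof -
  obtain L where L: "\<forall>v\<in>pre D. L \<le> length v \<longrightarrow> 1 \<le> length (lout n f v)"
    using lout_long embD[OF f] by blast
  obtain v w where vw: "v \<in> pre D" "w \<in> W" "L \<le> length w" "g = loc n f (v @ w)"
    using g by (rule core_mapsE)
  have p: "v @ w \<in> pre D" "lout n f (v @ w) \<noteq> []"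
    using L vw pre_append[OF vw(1,2)] by force+
  show "emb C C g" "g \<in> extensional C" "lout n g [] = []"
    using emb_loc[OF f p] vw(4) lout_loc_Nil[OF emb_inj_cone[OF f p(1)]] by simp_all
  show "loc n g u \<in> core_maps D f" if u: "u \<in> W"
  proof -
    have "\<exists>v\<in>pre D. \<exists>w\<in>W. N \<le> length w \<and> loc n g u = loc n f (v @ w)" for N
    proof -
      obtain v w where vw: "v \<in> pre D" "w \<in> W" "N \<le> length w" "g = loc n f (v @ w)"
        using g by (rule core_mapsE)
      have "loc n g u = loc n f (v @ w @ u)"
        using loc_loc[OF emb_inj_cone[OF f pre_append[OF vw(1,2)]] u] vw(4) by simp
      then show ?thesis
        using vw u by (intro bexI[of _ v] bexI[of _ "w @ u"]) auto
    qed
    then show ?thesis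
      by (simp add: core_maps_def)
  qed
qed

text \<open>A single core state already has the whole core as its core. This is why products of
  cores may be computed from any pair of states.\<close>

lemma core_maps_sim:
  assumes f: "emb D E f" and s: "sim D f D f" and g: "g \<in> core_maps D f"
  shows "sim C g D f"
proof -
  obtain k where k: "sim_at D f D f k"
    using s by (auto simp: sim_def)
  obtain v w where vw: "v \<in> pre D" "w \<in> W" "0 \<le> length w" "g = loc n f (v @ w)"
    using g by (rule core_mapsE)
  have "sim_at C g D f k"
    unfolding sim_at_def
  proof (intro ballI impI)
    fix t a b assume t: "t \<in> W" "k \<le> length t" and a: "a \<in> pre C" and b: "b \<in> pre D"
    have aW: "a \<in> W"
      using a pre_C by blast
    have "loc n g (a @ t) = loc n f ((v @ w @ a) @ t)"
      using loc_loc[OF emb_inj_cone[OF f pre_append[OF vw(1,2)]], of "a @ t"] vw(4) aW t by simp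
    also have "\<dots> = loc n f (b @ t)"
      by (rule sim_atD[OF k t _ b]) (use vw aW pre_append[OF vw(1), of "w @ a"] in simp)
    finally show "loc n g (a @ t) = loc n f (b @ t)" .
  qed
  then show ?thesis
    by (auto simp: sim_def)
qed

text \<open>The second factor acts on the cone of the output of the first. The outer
  \<open>loc\<close> at the empty word strips the common prefix that composing two local actions can
  create.\<close>

lemma loc_comp:
  assumes f: "emb D E f" and g: "emb E F g" and v: "v \<in> pre D" and l: "lout n f v \<noteq> []"
  shows "loc n (\<lambda>x. g (f x)) v = loc n (\<lambda>x. loc n g (lout n f v) (loc n f v x)) []"
proof (rule loc_shift)
  have le: "lout n f v \<in> pre E" "\<And>x. x \<in> C \<Longrightarrow> loc n f v x \<in> C"
    using lout_in_pre[of E f D v] embD[OF f] v l by blast+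
  show "g (f (iappend v x)) = iappend (lout n g (lout n f v))
         (loc n g (lout n f v) (loc n f v (iappend [] x)))" if "x \<in> C" for x
    using lout_loc[OF emb_inj_cone[OF f v] that] lout_loc[OF emb_inj_cone[OF g le(1)] le(2)[OF that]]
    by simp
  have "inj_on (loc n g (lout n f v)) C" "inj_on (loc n f v) C"
    using inj_loc emb_inj_cone[OF g le(1)] emb_inj_cone[OF f v] by blast+
  then have "inj_on (\<lambda>x. loc n g (lout n f v) (loc n f v x)) C"
    using le(2) by (intro inj_onI) (meson inj_onD)
  then show "inj_cone n (\<lambda>x. loc n g (lout n f v) (loc n f v x)) []"
    by (rule inj_cone_W) simp
qed

text \<open>The output along \<open>v @ w1\<close> may be empty, hence not in \<open>pre E\<close>.
  Moving the first letter \<open>c\<close> of the further output into \<open>a\<close> makes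
  \<open>a\<close> a legitimate prefix.\<close>

lemma lout_split:
  assumes f: "emb D E f" and v: "v \<in> pre D" and w: "w1 \<in> W" "w2 \<in> W"
    and q: "lout n (loc n f (v @ w1)) w2 = c # t"
  shows "\<exists>a \<in> pre E. lout n f (v @ w1 @ w2) = a @ t"
proof -
  have "lout n f (v @ w1 @ w2) = lout n f (v @ w1) @ c # t"
    using lout_append[OF emb_inj_cone[OF f pre_append[OF v w(1)]] w(2)] q by simp
  moreover from this have "lout n f (v @ w1 @ w2) \<in> pre E"
    using lout_in_pre(1)[of E f D "v @ w1 @ w2"] embD[OF f] pre_append[OF v, of "w1 @ w2"] w by simp
  ultimately show ?thesis
    using pre_appendD(1)[of E "lout n f (v @ w1) @ [c]" t] embD(2)[OF f]
    by (intro bexI[of _ "lout n f (v @ w1) @ [c]"]) auto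
qed

text \<open>A long word is cut as \<open>w1 @ w2\<close>. Reading \<open>w1\<close> forces one
  common state \<open>q\<close> of both first factors, and \<open>w2\<close> is so long that the
  output of \<open>q\<close> on it ends in a word that synchronizes the second factors.\<close>

lemma sim_comp:
  assumes f1: "emb D1 D2 f1" and g1: "emb E1 E2 g1" and f2: "emb D2 D3 f2" and g2: "emb E2 E3 g2"
    and s1: "sim D1 f1 E1 g1" and s2: "sim D2 f2 E2 g2"
  shows "sim D1 (\<lambda>x. f2 (f1 x)) E1 (\<lambda>x. g2 (g1 x))"
proof -
  obtain k1 where k1: "sim_at D1 f1 E1 g1 k1"
    using s1 by (auto simp: sim_def)
  obtain k2 where k2: "sim_at D2 f2 E2 g2 k2"
    using s2 by (auto simp: sim_def)
  obtain v0 where v0: "v0 \<in> pre D1"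
    using pre_exists embD(1)[OF f1] by blast
  \<comment> \<open>Bounds the output along \<open>w1\<close>, so that a long output along
    \<open>w1 @ w2\<close> must come mostly from \<open>w2\<close>.\<close>
  define B where "B = Max ((\<lambda>w. length (lout n f1 (v0 @ w))) ` words n k1)"
  have B: "length (lout n f1 (v0 @ w)) \<le> B" if "w \<in> words n k1" for w
    unfolding B_def using that by (intro Max_ge) auto
  \<comment> \<open>Besides \<open>k2\<close> letters for synchronizing the second factor, one
    letter is reserved for the \<open>c\<close> of \<open>lout_split\<close>.\<close>
  obtain L where L: "\<forall>v\<in>pre D1. L \<le> length v \<longrightarrow> B + Suc k2 \<le> length (lout n f1 v)"
    using lout_long[of D1 f1 "B + Suc k2"] embD[OF f1] by blast
  have "loc n (\<lambda>x. f2 (f1 x)) (v @ w) = loc n (\<lambda>x. g2 (g1 x)) (v' @ w)"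
    if w: "w \<in> W" "k1 + L \<le> length w" and v: "v \<in> pre D1" "v' \<in> pre E1" for w v v'
  proof -
    define w1 w2 where "w1 = take k1 w" and "w2 = drop k1 w"
    have w12: "w = w1 @ w2" "w1 \<in> W" "w2 \<in> W" "w1 \<in> words n k1" "L \<le> length w2" "k1 \<le> length w1"
      using w by (auto simp: w1_def w2_def words_def dest: in_set_takeD in_set_dropD)
    define q where "q = loc n f1 (v0 @ w1)"
    have q: "loc n f1 (v @ w1) = q" "loc n g1 (v' @ w1) = q"
      using sim_atD[OF k1 w12(2,6) v] sim_atD[OF k1 w12(2,6) v0 v(2)] by (simp_all add: q_def)
    have "lout n f1 (v0 @ w1 @ w2) = lout n f1 (v0 @ w1) @ lout n q w2"
      using lout_append[OF emb_inj_cone[OF f1 pre_append[OF v0 w12(2)]] w12(3)] by (simp add: q_def)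
    moreover have "B + Suc k2 \<le> length (lout n f1 (v0 @ w1 @ w2))"
      using L pre_append[OF v0, of "w1 @ w2"] w12 by simp
    ultimately have "Suc k2 \<le> length (lout n q w2)"
      using B[OF w12(4)] by simp
    then obtain c t where ct: "lout n q w2 = c # t" "k2 \<le> length t"
      by (metis Suc_le_length_iff)
    obtain a where a: "a \<in> pre D2" "lout n f1 (v @ w) = a @ t"
      using lout_split[OF f1 v(1) w12(2,3)] ct(1) q(1) w12(1) by metis
    obtain b where b: "b \<in> pre E2" "lout n g1 (v' @ w) = b @ t"
      using lout_split[OF g1 v(2) w12(2,3)] ct(1) q(2) w12(1) by metis
    have "a @ t \<in> pre D2"
      using lout_in_pre(1)[of D2 f1 D1 "v @ w"] embD[OF f1] pre_append[OF v(1) w(1)] a preD(2)[OF a(1)]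
      by simp
    then have t: "t \<in> W"
      using pre_appendD(2) embD(2)[OF f1] preD(2)[OF a(1)] by blast
    have "loc n (\<lambda>x. f2 (f1 x)) (v @ w) = loc n (\<lambda>x. loc n f2 (a @ t) (loc n f1 (v @ w) x)) []"
      using loc_comp[OF f1 f2 pre_append[OF v(1) w(1)]] a preD(2)[OF a(1)] by simp
    also have "loc n f2 (a @ t) = loc n g2 (b @ t)"
      by (rule sim_atD[OF k2 t ct(2) a(1) b(1)])
    also have "loc n f1 (v @ w) = loc n g1 (v' @ w)"
      by (rule sim_atD[OF k1 w(1) _ v]) (use w(2) in simp)
    also have "loc n (\<lambda>x. loc n g2 (b @ t) (loc n g1 (v' @ w) x)) [] = loc n (\<lambda>x. g2 (g1 x)) (v' @ w)"
      using loc_comp[OF g1 g2 pre_append[OF v(2) w(1)]] b preD(2)[OF b(1)] by simp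
    finally show ?thesis .
  qed
  then have "sim_at D1 (\<lambda>x. f2 (f1 x)) E1 (\<lambda>x. g2 (g1 x)) (k1 + L)"
    by (simp add: sim_at_def)
  then show ?thesis
    by (auto simp: sim_def)
qed

text \<open>On a long enough cone \<open>\<eta>\<close> the inverse of \<open>h\<close> acts as the inverse of a core state of \<open>h\<close> on a
  long cone \<open>\<zeta>\<close>, and so does the inverse of \<open>h0\<close>.\<close>

lemma sim_inverse:
  assumes h: "emb D D h" and h0: "emb E E h0" and s: "sim D h E h0"
    and hi: "emb D D hi" "\<And>x. x \<in> D \<Longrightarrow> h (hi x) = x"
    and h0i: "emb E E h0i" "\<And>x. x \<in> E \<Longrightarrow> h0i (h0 x) = x" and s0: "sim E h0i E h0i"
  shows "sim D hi D hi"
proof -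
  have D: "tail_space D" and E: "tail_space E"
    using embD h h0 by auto
  obtain k where k: "sim_at D h E h0 k"
    using s by (auto simp: sim_def)
  obtain k0 where k0: "sim_at E h0i E h0i k0"
    using s0 by (auto simp: sim_def)
  obtain u0 where u0: "u0 \<in> pre E"
    using pre_exists E by blast
  let ?P = "{v \<in> pre D. length v = Suc k}"
  \<comment> \<open>Bounds how much of \<open>\<eta> @ w\<close> is used up by the output of
    \<open>h\<close> on a word of length \<open>Suc k\<close>.\<close>
  define B where "B = Max ((\<lambda>v. length (lout n h v)) ` ?P)"
  have B: "length (lout n h v) \<le> B" if "v \<in> ?P" for v
    unfolding B_def using that finite_pre[OF D, of "Suc k"] by (intro Max_ge) auto
  \<comment> \<open>On cones of this level the inverse has already decided its first
    \<open>Suc k\<close> letters: one initial letter and \<open>k\<close> letters that synchronize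
    \<open>h\<close>.\<close>
  obtain N where N: "\<forall>x\<in>D. \<forall>y\<in>D. iprefix N x = iprefix N y \<longrightarrow>
      iprefix (Suc k) (hi x) = iprefix (Suc k) (hi y)"
    using embD(4)[OF hi(1)] unfolding uc_def by blast
  have key: "\<exists>a \<in> pre E. loc n hi (\<eta> @ w) = loc n h0i (a @ drop (length w - k0) w)"
    if w: "w \<in> W" "N + B + Suc k0 \<le> length w" and \<eta>: "\<eta> \<in> pre D" for w \<eta>
  proof -
    let ?\<eta> = "\<eta> @ w"
    have p\<eta>: "?\<eta> \<in> pre D"
      using pre_append[OF \<eta> w(1)] .
    \<comment> \<open>The first \<open>Suc k\<close> letters of \<open>hi\<close> on the cone;
      \<open>z\<close> is the remaining value, and \<open>q\<close> applied to it must give back the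
      input.\<close>
    define v where "v = iprefix (Suc k) (hi (iappend ?\<eta> (\<lambda>_. Sym 0)))"
    have hiD: "hi (iappend ?\<eta> x) \<in> D" if "x \<in> C" for x
      using emb_in[OF hi(1)] preD(1)[OF p\<eta> that] .
    have v: "v \<in> pre D" "length v = Suc k"
      using tail_spaceD(1)[OF D hiD[OF C_two(1)], of "Suc k"] by (simp_all add: v_def)
    define z where "z x = idrop (Suc k) (hi (iappend ?\<eta> x))" for x
    have z: "hi (iappend ?\<eta> x) = iappend v (z x)" "z x \<in> C" if x: "x \<in> C" for x
    proof -
      have "iprefix N (iappend ?\<eta> x) = iprefix N (iappend ?\<eta> (\<lambda>_. Sym 0))"
        using w(2) by (simp add: iprefix_iappend_le)
      then have "iprefix (Suc k) (hi (iappend ?\<eta> x)) = v"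
        using N preD(1)[OF p\<eta>] x C_two(1) unfolding v_def by blast
      then show "hi (iappend ?\<eta> x) = iappend v (z x)"
        unfolding z_def by (metis iappend_iprefix_idrop)
      show "z x \<in> C"
        unfolding z_def using tail_spaceD(2)[OF D hiD[OF x]] by simp
    qed
    define q where "q = loc n h v"
    have hz: "iappend ?\<eta> x = iappend (lout n h v) (q (z x))" if x: "x \<in> C" for x
      using lout_loc[OF emb_inj_cone[OF h v(1)] z(2)[OF x]] hi(2)[OF preD(1)[OF p\<eta> x]] z(1)[OF x]
      by (simp add: q_def)
    have len: "length (lout n h v) + Suc k0 \<le> length w"
      using B[of v] v w(2) by simp
    \<comment> \<open>The part of the input lying beyond the output of \<open>h\<close> on
      \<open>v\<close>. On this cone \<open>z\<close> inverts the core state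
      \<open>q\<close>.\<close>
    define \<zeta> where "\<zeta> = drop (length (lout n h v)) ?\<eta>"
    have \<eta>': "?\<eta> = lout n h v @ \<zeta>"
    proof -
      have "iprefix (length (lout n h v)) (iappend ?\<eta> (\<lambda>_. Sym 0)) = lout n h v"
        by (subst hz[OF C_two(1)]) simp
      then have "take (length (lout n h v)) ?\<eta> = lout n h v"
        using len by (simp add: iprefix_iappend_le del: append_take_drop_id take_append)
      then show ?thesis
        unfolding \<zeta>_def by (metis append_take_drop_id)
    qed
    have qz: "q (z x) = iappend \<zeta> x" if "x \<in> C" for x
    proof -
      have "iappend (lout n h v) (iappend \<zeta> x) = iappend (lout n h v) (q (z x))"
        using hz[OF that] \<eta>' by simp
      then show ?thesis
        unfolding iappend_cong_iff by (rule sym)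
    qed
    \<comment> \<open>The first letter of \<open>v\<close> is split off, since synchronization
      concerns what follows a word of \<open>pre D\<close>; thus \<open>q\<close> is also the state
      of \<open>h0\<close> forced by \<open>w'\<close>.\<close>
    obtain c w' where cw: "v = c # w'" "length w' = k"
      using v(2) by (metis length_Suc_conv)
    have w': "w' \<in> W" "[c] \<in> pre D"
      using pre_appendD[of D "[c]" w'] v(1) cw D by simp_all
    have q0: "q = loc n h0 (u0 @ w')"
      using sim_atD[OF k w'(1) _ w'(2) u0] cw by (simp add: q_def)
    have p0: "u0 @ w' \<in> pre E"
      using pre_append[OF u0 w'(1)] .
    \<comment> \<open>The cone on which \<open>h0i\<close> must invert the same \<open>q\<close> in
      the same way as \<open>hi\<close> does on \<open>?\<eta>\<close>.\<close>
    define \<theta> where "\<theta> = lout n h0 (u0 @ w') @ \<zeta>"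
    have inv: "h0i (iappend \<theta> x) = iappend (u0 @ w') (z x)" and \<theta>x: "iappend \<theta> x \<in> E" if x: "x \<in> C" for x
    proof -
      have e: "h0 (iappend (u0 @ w') (z x)) = iappend \<theta> x"
        using lout_loc[OF emb_inj_cone[OF h0 p0] z(2)[OF x]] qz[OF x] q0 by (simp add: \<theta>_def)
      have m: "iappend (u0 @ w') (z x) \<in> E"
        using preD(1)[OF p0 z(2)[OF x]] .
      show "h0i (iappend \<theta> x) = iappend (u0 @ w') (z x)" "iappend \<theta> x \<in> E"
        using h0i(2)[OF m] emb_in[OF h0 m] e by auto
    qed
    have zinj: "inj_cone n z []"
    proof (rule inj_coneI)
      fix x y assume xy: "x \<in> C" "y \<in> C" and "z (iappend [] x) = z (iappend [] y)"
      then have e: "z x = z y" by simp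
      have "iappend \<zeta> x = iappend \<zeta> y"
        unfolding qz[OF xy(1), symmetric] qz[OF xy(2), symmetric] e ..
      then show "x = y"
        unfolding iappend_cong_iff .
    qed
    \<comment> \<open>The last \<open>k0\<close> letters of \<open>w\<close> survive in
      \<open>\<zeta>\<close> because of the bound \<open>B\<close>; they end both words and
      synchronize \<open>h0i\<close>.\<close>
    define t where "t = drop (length w - k0) w"
    have lt: "length t = k0" "t \<in> W"
      using w set_drop_subset[of "length w - k0" w] by (auto simp: t_def)
    define \<zeta>' where "\<zeta>' = drop (length (lout n h v)) (\<eta> @ take (length w - k0) w)"
    have "\<eta> @ w = (\<eta> @ take (length w - k0) w) @ t"
      by (simp add: t_def)
    then have \<zeta>'t: "\<zeta> = \<zeta>' @ t"
      unfolding \<zeta>_def \<zeta>'_def using len by (simp only: drop_append) simp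
    \<comment> \<open>The extra letter in \<open>Suc k0\<close> is spent here: it makes the word in
      front of \<open>t\<close> nonempty, hence a member of \<open>pre E\<close>.\<close>
    have "\<zeta>' \<noteq> []"
    proof -
      have "length (lout n h v) < length (\<eta> @ take (length w - k0) w)"
        using len by (simp; linarith)
      then show ?thesis
        unfolding \<zeta>'_def by (metis drop_eq_Nil not_le)
    qed
    moreover have "\<theta> \<in> pre E"
      using tail_space_iappendD(1)[OF E \<theta>x[OF C_two(1)]] calculation by (simp add: \<theta>_def \<zeta>'t)
    ultimately have a: "lout n h0 (u0 @ w') @ \<zeta>' \<in> pre E"
      using pre_appendD(1)[OF E, of "lout n h0 (u0 @ w') @ \<zeta>'" t] by (simp add: \<theta>_def \<zeta>'t)
    have "loc n hi ?\<eta> = loc n z []"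
      by (rule loc_shift[where l = v]) (use z zinj in auto)
    also have "\<dots> = loc n h0i \<theta>"
      by (rule loc_shift[symmetric, where l = "u0 @ w'"]) (use inv zinj in auto)
    also have "\<theta> = (lout n h0 (u0 @ w') @ \<zeta>') @ t"
      by (simp add: \<theta>_def \<zeta>'t)
    finally show ?thesis
      using a unfolding t_def by blast
  qed
  have "sim_at D hi D hi (N + B + Suc k0)"
    unfolding sim_at_def
  proof (intro ballI impI)
    fix w v v' assume w: "w \<in> W" "N + B + Suc k0 \<le> length w" and v: "v \<in> pre D" "v' \<in> pre D"
    let ?t = "drop (length w - k0) w"
    obtain a where a: "a \<in> pre E" "loc n hi (v @ w) = loc n h0i (a @ ?t)"
      using key[OF w v(1)] by blast
    obtain b where b: "b \<in> pre E" "loc n hi (v' @ w) = loc n h0i (b @ ?t)"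
      using key[OF w v(2)] by blast
    have "?t \<in> W" "k0 \<le> length ?t"
      using w by (auto dest: in_set_dropD)
    then show "loc n hi (v @ w) = loc n hi (v' @ w)"
      using sim_atD[OF k0 _ _ a(1) b(1)] a b by simp
  qed
  then show ?thesis
    by (auto simp: sim_def)
qed

end



section \<open>Transducers and local actions\<close>

lemma run_append: "run T (u @ v) q = run T v (run T u q)"
  by (induction u arbitrary: q) auto

lemma outword_append: "outword T (u @ v) q = outword T u q @ outword T v (run T u q)"
  by (induction u arbitrary: q) auto

lemma iprefix_split: "j \<le> k \<Longrightarrow> \<exists>t. iprefix k x = iprefix j x @ t"
  by (metis append_take_drop_id take_iprefix)

lemma state_map_eqI:
  assumes inf: "infinite_output T q x"
    and out: "\<And>k. iprefix (length (outword T (iprefix k x) q)) y = outword T (iprefix k x) q"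
  shows "state_map T q x = y"
proof
  fix m
  define k where "k = (LEAST k. m < length (outword T (iprefix k x) q))"
  have "\<exists>k. m < length (outword T (iprefix k x) q)"
    using inf by (simp add: infinite_output_def)
  from LeastI_ex[OF this] have "m < length (outword T (iprefix k x) q)"
    unfolding k_def .
  from nth_iprefix[OF this, of y] show "state_map T q x m = y m"
    unfolding state_map_def k_def[symmetric] out by simp
qed

lemma state_map_iprefix:
  assumes "infinite_output T q x"
  shows "iprefix (length (outword T (iprefix k x) q)) (state_map T q x) = outword T (iprefix k x) q"
proof (rule nth_equalityI)
  fix m assume "m < length (iprefix (length (outword T (iprefix k x) q)) (state_map T q x))"
  then have m: "m < length (outword T (iprefix k x) q)"
    by simp
  define l where "l = (LEAST k. m < length (outword T (iprefix k x) q))"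
  have l: "m < length (outword T (iprefix l x) q)" "l \<le> k"
    unfolding l_def by (rule LeastI[of _ k], rule m, rule Least_le, rule m)
  obtain t where "iprefix k x = iprefix l x @ t"
    using iprefix_split[OF l(2)] by blast
  then have "outword T (iprefix k x) q ! m = outword T (iprefix l x) q ! m"
    using l(1) by (simp add: outword_append nth_append)
  then show "iprefix (length (outword T (iprefix k x) q)) (state_map T q x) ! m =
      outword T (iprefix k x) q ! m"
    using m by (simp add: state_map_def l_def)
qed simp

lemma outword_iappend_ge:
  "outword T (iprefix (length w + k) (iappend w x)) q =
     outword T w q @ outword T (iprefix k x) (run T w q)"
  by (simp add: outword_append)

lemma infinite_output_iappend:
  "infinite_output T q (iappend w x) \<longleftrightarrow> infinite_output T (run T w q) x"
proof
  assume a: "infinite_output T q (iappend w x)"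
  show "infinite_output T (run T w q) x"
    unfolding infinite_output_def
  proof
    fix m
    obtain k where k: "m + length (outword T w q) < length (outword T (iprefix k (iappend w x)) q)"
      using a unfolding infinite_output_def by blast
    have "length w \<le> k"
    proof (rule ccontr)
      assume "\<not> length w \<le> k"
      then obtain t where "iprefix (length w) (iappend w x) = iprefix k (iappend w x) @ t"
        using iprefix_split[of k "length w"] by fastforce
      then have "w = iprefix k (iappend w x) @ t"
        by simp
      then have "length (outword T (iprefix k (iappend w x)) q) \<le> length (outword T w q)"
        by (metis outword_append length_append le_add1)
      then show False
        using k by simp
    qed
    then obtain j where "k = length w + j"
      using le_Suc_ex by blast
    then show "\<exists>k. m < length (outword T (iprefix k x) (run T w q))"
      using k by (intro exI[of _ j]) (simp add: outword_iappend_ge del: iprefix_iappend_add)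
  qed
next
  assume a: "infinite_output T (run T w q) x"
  show "infinite_output T q (iappend w x)"
    unfolding infinite_output_def
  proof
    fix m
    obtain k where "m < length (outword T (iprefix k x) (run T w q))"
      using a unfolding infinite_output_def by blast
    then show "\<exists>k. m < length (outword T (iprefix k (iappend w x)) q)"
      by (intro exI[of _ "length w + k"]) (simp add: outword_iappend_ge del: iprefix_iappend_add)
  qed
qed

lemma state_map_iappend:
  assumes "infinite_output T (run T w q) x"
  shows "state_map T q (iappend w x) = iappend (outword T w q) (state_map T (run T w q) x)"
proof (rule state_map_eqI)
  show inf: "infinite_output T q (iappend w x)"
    using assms by (simp add: infinite_output_iappend)
  fix k
  let ?y = "iappend (outword T w q) (state_map T (run T w q) x)"
  have ge: "iprefix (length (outword T (iprefix (length w + j) (iappend w x)) q)) ?y =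
      outword T (iprefix (length w + j) (iappend w x)) q" for j
    unfolding outword_iappend_ge using state_map_iprefix[OF assms, of j] by simp
  obtain t where t: "iprefix (length w + k) (iappend w x) = iprefix k (iappend w x) @ t"
    using iprefix_split[of k "length w + k"] by fastforce
  let ?u = "outword T (iprefix k (iappend w x)) q"
  obtain s where "outword T (iprefix (length w + k) (iappend w x)) q = ?u @ s"
    unfolding t outword_append by blast
  then have "iprefix (length ?u + length s) ?y = ?u @ s"
    using ge[of k] by simp
  then show "iprefix (length ?u) ?y = ?u"
    by (metis append_eq_conv_conj take_iprefix le_add1)
qed

context alph
begin

text \<open>A labelling of states by maps under which reading a letter is passing to the local
  action. It transfers statements about runs to \<open>loc\<close> and \<open>lout\<close>, for
  concrete transducers as well as for arbitrary representatives of a core.\<close>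

definition coherent :: "('q, 'm) transducer_scheme \<Rightarrow> ('q \<Rightarrow> iword \<Rightarrow> iword) \<Rightarrow> 'q set \<Rightarrow> bool" where
  "coherent T F S \<longleftrightarrow> (\<forall>q\<in>S. inj_on (F q) C \<and> uc C (F q) \<and>
     (\<forall>i\<in>alphabet n. step T i q \<in> S \<and> F (step T i q) = loc n (F q) [i] \<and>
        emit T i q = lout n (F q) [i]))"

lemma coherentD:
  assumes "coherent T F S" "q \<in> S"
  shows "inj_on (F q) C" "uc C (F q)" "i \<in> alphabet n \<Longrightarrow> step T i q \<in> S"
    "i \<in> alphabet n \<Longrightarrow> F (step T i q) = loc n (F q) [i]"
    "i \<in> alphabet n \<Longrightarrow> emit T i q = lout n (F q) [i]"
  using assms by (auto simp: coherent_def)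

text \<open>The empty word is excepted because the values of \<open>F q\<close> may have a nonempty
  common prefix, as for the initial state of a minimal transducer.\<close>

lemma coherent_run:
  assumes co: "coherent T F S" and "q \<in> S" "w \<in> W"
  shows "run T w q \<in> S \<and> (w \<noteq> [] \<longrightarrow> F (run T w q) = loc n (F q) w \<and> outword T w q = lout n (F q) w)"
  using assms(2,3)
proof (induction w arbitrary: q)
  case (Cons i w)
  then have i: "i \<in> alphabet n" "w \<in> W"
    by auto
  note st = coherentD[OF co Cons.prems(1)]
  have inj: "inj_cone n (F q) [i]"
    by (rule inj_cone_W[OF st(1)]) (use i in simp)
  show ?case
  proof (cases "w = []")
    case True
    then show ?thesis
      using st(3-5)[OF i(1)] by simp
  next
    case False
    have "run T w (step T i q) \<in> S \<and> (F (run T w (step T i q)) = loc n (F (step T i q)) w \<and>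
        outword T w (step T i q) = lout n (F (step T i q)) w)"
      using Cons.IH[OF st(3)[OF i(1)] i(2)] False by simp
    then show ?thesis
      using loc_loc[OF inj i(2)] lout_append[OF inj i(2)] st(4,5)[OF i(1)] by simp
  qed
qed simp

text \<open>The outputs are common prefixes of values of \<open>F q\<close>, and uniform continuity
  makes them grow without bound, so the transducer writes exactly \<open>F q x\<close>.\<close>

lemma coherent_state_map:
  assumes co: "coherent T F S" and q: "q \<in> S" and x: "x \<in> C"
  shows "infinite_output T q x" "state_map T q x = F q x"
proof -
  have out: "outword T (iprefix k x) q = lout n (F q) (iprefix k x)" if "k \<noteq> 0" for k
    using coherent_run[OF co q iprefix_in_lists[OF x, of k]] that by (metis length_0_conv length_iprefix)
  show inf: "infinite_output T q x"
    unfolding infinite_output_def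
  proof
    fix m
    obtain L where L: "\<forall>v\<in>pre C. L \<le> length v \<longrightarrow> Suc m \<le> length (lout n (F q) v)"
      using lout_long[OF tail_space_C coherentD(1,2)[OF co q]] by blast
    have "iprefix (Suc L) x \<in> pre C"
      using tail_spaceD(1)[OF tail_space_C x, of "Suc L"] by simp
    then have "Suc m \<le> length (lout n (F q) (iprefix (Suc L) x))"
      using L by simp
    then show "\<exists>k. m < length (outword T (iprefix k x) q)"
      using out[of "Suc L"] by (intro exI[of _ "Suc L"]) simp
  qed
  show "state_map T q x = F q x"
  proof (rule state_map_eqI[OF inf])
    fix k
    show "iprefix (length (outword T (iprefix k x) q)) (F q x) = outword T (iprefix k x) q"
    proof (cases "k = 0")
      case False
      have "F q (iappend (iprefix k x) (idrop k x)) =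
          iappend (lout n (F q) (iprefix k x)) (loc n (F q) (iprefix k x) (idrop k x))"
        by (rule lout_loc[OF inj_cone_W[OF coherentD(1)[OF co q] iprefix_in_lists[OF x]]
              idrop_in_cantor_n[OF x]])
      then show ?thesis
        unfolding out[OF False] by simp
    qed simp
  qed
qed

text \<open>The output along \<open>w\<close> is a fixed prefix of all values on the cone; the
  reduction condition at the last transition makes the total output the longest one.\<close>

lemma run_local_action:
  assumes inf: "\<And>x. x \<in> C \<Longrightarrow> infinite_output T q (iappend (w @ [i]) x)"
    and gcp: "is_greatest_common_prefix (emit T i (run T w q))
               {state_map T (run T w q) (iappend [i] x) | x. x \<in> C}"
    and f: "\<And>x. x \<in> C \<Longrightarrow> f (iappend (w @ [i]) x) = state_map T q (iappend (w @ [i]) x)"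
  shows "lout n f (w @ [i]) = outword T (w @ [i]) q"
    "loc n f (w @ [i]) = restrict (state_map T (run T (w @ [i]) q)) C"
proof -
  let ?p = "run T w q"
  have "infinite_output T ?p (iappend [i] x)" if "x \<in> C" for x
    using inf[OF that] infinite_output_iappend[of T q w "iappend [i] x"] by simp
  then have e: "f (iappend (w @ [i]) x) = iappend (outword T w q) (state_map T ?p (iappend [i] x))"
    if "x \<in> C" for x
    using state_map_iappend[of T w q "iappend [i] x"] f that by simp
  have "{f (iappend (w @ [i]) x) | x. x \<in> C} =
      iappend (outword T w q) ` {state_map T ?p (iappend [i] x) | x. x \<in> C}"
    unfolding Setcompr_eq_image image_image using e by (intro image_cong) simp_all
  then have "is_greatest_common_prefix (outword T (w @ [i]) q) {f (iappend (w @ [i]) x) | x. x \<in> C}"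
    using gcp_iappend[OF gcp, of "outword T w q"] C_nonempty by (auto simp: outword_append)
  then show l: "lout n f (w @ [i]) = outword T (w @ [i]) q"
    by (rule lout_eqI)
  have "f (iappend (w @ [i]) x) =
      iappend (outword T (w @ [i]) q) (state_map T (run T (w @ [i]) q) x)" if "x \<in> C" for x
    using state_map_iappend inf[OF that] f[OF that] infinite_output_iappend by metis
  then show "loc n f (w @ [i]) = restrict (state_map T (run T (w @ [i]) q)) C"
    unfolding loc_def l by (intro restrict_ext) simp
qed

subsection \<open>Isomorphism\<close>

text \<open>Closure under \<open>step\<close> is what allows the inverse bijection to be applied to
  the image of \<open>step T i q\<close>.\<close>

lemma isomorphic_sym:
  assumes iso: "isomorphic n T T'"
    and closed: "\<And>q i. q \<in> states T \<Longrightarrow> i \<in> alphabet n \<Longrightarrow> step T i q \<in> states T"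
  shows "isomorphic n T' T"
proof -
  obtain f where f: "bij_betw f (states T) (states T')"
    "\<forall>q\<in>states T. \<forall>i\<in>alphabet n. f (step T i q) = step T' i (f q) \<and> emit T i q = emit T' i (f q)"
    using iso unfolding isomorphic_def by blast
  define g where "g = inv_into (states T) f"
  have g: "bij_betw g (states T') (states T)"
    unfolding g_def by (rule bij_betw_inv_into[OF f(1)])
  have "g (step T' i q') = step T i (g q') \<and> emit T' i q' = emit T i (g q')"
    if q': "q' \<in> states T'" "i \<in> alphabet n" for q' i
  proof -
    obtain q where q: "q \<in> states T" "q' = f q"
      using q'(1) f(1) by (auto simp: bij_betw_def)
    have "g (f p) = p" if "p \<in> states T" for p
      unfolding g_def using bij_betw_inv_into_left[OF f(1) that] .
    moreover have "f (step T i q) = step T' i q'" "emit T i q = emit T' i q'"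
      using f(2) q q'(2) by auto
    ultimately show ?thesis
      using q closed[OF q(1) q'(2)] by metis
  qed
  then show ?thesis
    unfolding isomorphic_def using g by blast
qed

lemma isomorphic_trans:
  assumes "isomorphic n T T'" "isomorphic n T' T''"
  shows "isomorphic n T T''"
proof -
  obtain f where f: "bij_betw f (states T) (states T')"
    "\<forall>q\<in>states T. \<forall>i\<in>alphabet n. f (step T i q) = step T' i (f q) \<and> emit T i q = emit T' i (f q)"
    using assms(1) unfolding isomorphic_def by blast
  obtain g where g: "bij_betw g (states T') (states T'')"
    "\<forall>q\<in>states T'. \<forall>i\<in>alphabet n. g (step T' i q) = step T'' i (g q) \<and> emit T' i q = emit T'' i (g q)"
    using assms(2) unfolding isomorphic_def by blast
  have "f q \<in> states T'" if "q \<in> states T" for q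
    using f(1) that by (auto simp: bij_betw_def)
  then show ?thesis
    unfolding isomorphic_def using bij_betw_trans[OF f(1) g(1)] f(2) g(2)
    by (intro exI[of _ "g \<circ> f"]) auto
qed

lemma iso_class_eq:
  assumes "isomorphic n T T'"
    and "\<And>q i. q \<in> states T \<Longrightarrow> i \<in> alphabet n \<Longrightarrow> step T i q \<in> states T"
  shows "iso_class n T = iso_class n T'"
  unfolding iso_class_def
  using isomorphic_trans[OF assms(1)] isomorphic_trans[OF isomorphic_sym[OF assms]] by blast

definition core_transducer :: "(iword \<Rightarrow> iword) set \<Rightarrow> (iword \<Rightarrow> iword) transducer" where
  "core_transducer S = \<lparr>states = S, step = (\<lambda>i q. loc n q [i]), emit = (\<lambda>i q. lout n q [i])\<rparr>"

lemma core_transducer_simps [simp]: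
  "states (core_transducer S) = S"
  "step (core_transducer S) i q = loc n q [i]"
  "emit (core_transducer S) i q = lout n q [i]"
  by (simp_all add: core_transducer_def)

definition core_class :: "iword set \<Rightarrow> (iword \<Rightarrow> iword) \<Rightarrow> transducer_class" where
  "core_class D f = iso_class n (core_transducer (core_maps D f))"

text \<open>Every representative of the class is a copy of the core maps, and the isomorphism back
  to them is the coherent labelling.\<close>

lemma core_class_coherent:
  assumes f: "emb D E f" and T: "T \<in> core_class D f"
  shows "\<exists>F. coherent T F (states T) \<and> bij_betw F (states T) (core_maps D f)"
proof -
  let ?K = "core_maps D f"
  have "isomorphic n T (core_transducer ?K)"
    by (rule isomorphic_sym) (use T core_maps_emb(4)[OF f] in \<open>auto simp: core_class_def iso_class_def\<close>)
  then obtain F where F: "bij_betw F (states T) ?K"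
    "\<forall>q\<in>states T. \<forall>i\<in>alphabet n. F (step T i q) = loc n (F q) [i] \<and> emit T i q = lout n (F q) [i]"
    unfolding isomorphic_def by auto
  \<comment> \<open>The relation \<open>isomorphic\<close> does not include closure of
    \<open>states T\<close> under \<open>step T\<close>; it is transported from the core maps along
    \<open>G\<close>.\<close>
  obtain G where G: "bij_betw G ?K (states T)"
    "\<forall>q\<in>?K. \<forall>i\<in>alphabet n. G (loc n q [i]) = step T i (G q)"
    using T unfolding core_class_def iso_class_def isomorphic_def by auto
  have FK: "F q \<in> ?K" if "q \<in> states T" for q
    using F(1) that by (auto simp: bij_betw_def)
  have "step T i q \<in> states T" if qi: "q \<in> states T" "i \<in> alphabet n" for q i
  proof -
    obtain p where p: "p \<in> ?K" "q = G p"
      using G(1) qi(1) by (auto simp: bij_betw_def)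
    then have "step T i q = G (loc n p [i])" "loc n p [i] \<in> ?K"
      using G(2) qi(2) core_maps_emb(4)[OF f p(1), of "[i]"] by simp_all
    then show ?thesis
      using G(1) by (auto simp: bij_betw_def)
  qed
  moreover have "inj_on (F q) C \<and> uc C (F q)" if "q \<in> states T" for q
    using embD(3,4)[OF core_maps_emb(1)[OF f FK[OF that]]] by blast
  ultimately have "coherent T F (states T)"
    unfolding coherent_def using F(2) by blast
  then show ?thesis
    using F(1) by blast
qed


subsection \<open>Minimal transducers over \<open>X\<^sub>n\<close>\<close>

lemma minimal_transducerD:
  assumes "minimal_transducer n M q0"
  shows "is_transducer n M" "q0 \<in> states M" "q \<in> states M \<Longrightarrow> \<exists>w\<in>W. run M w q0 = q"
    "p \<in> states M \<Longrightarrow> q \<in> states M \<Longrightarrow> (\<And>x. x \<in> C \<Longrightarrow> state_map M p x = state_map M q x) \<Longrightarrow> p = q"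
    "q \<in> states M \<Longrightarrow> i \<in> alphabet n \<Longrightarrow>
       is_greatest_common_prefix (emit M i q) {state_map M q (iappend [i] x) | x. x \<in> C}"
proof -
  note a = assms[unfolded minimal_transducer_def]
  note a2 = a[THEN conjunct2] note a3 = a2[THEN conjunct2] note a4 = a3[THEN conjunct2]
  show "is_transducer n M" "q0 \<in> states M"
    by (rule a[THEN conjunct1], rule a2[THEN conjunct1])
  show "\<exists>w\<in>W. run M w q0 = q" if "q \<in> states M"
    by (rule bspec[OF a3[THEN conjunct1] that])
  show "p = q" if "p \<in> states M" "q \<in> states M" "\<And>x. x \<in> C \<Longrightarrow> state_map M p x = state_map M q x"
    by (rule bspec[OF bspec[OF a4[THEN conjunct1] that(1)] that(2), THEN mp]) (use that(3) in blast)
  show "is_greatest_common_prefix (emit M i q) {state_map M q (iappend [i] x) | x. x \<in> C}"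
    if "q \<in> states M" "i \<in> alphabet n"
    by (rule bspec[OF bspec[OF a4[THEN conjunct2] that(1)] that(2)])
qed

lemma is_transducerD:
  assumes "is_transducer n M" "q \<in> states M"
  shows "i \<in> alphabet n \<Longrightarrow> step M i q \<in> states M" "x \<in> C \<Longrightarrow> infinite_output M q x"
  using assms by (simp_all add: is_transducer_def)

lemma minimal_transducer_local_action:
  assumes M: "minimal_transducer n M q0" and f: "\<forall>x\<in>C. state_map M q0 x = f x"
    and w: "w \<in> W" "w \<noteq> []"
  shows "lout n f w = outword M w q0" "loc n f w = restrict (state_map M (run M w q0)) C"
    "run M w q0 \<in> states M"
proof -
  have cl: "step M i q \<in> states M" if "q \<in> states M" "i \<in> alphabet n" for i q
    by (rule is_transducerD(1)[OF minimal_transducerD(1)[OF M] that])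
  have run: "run M v q \<in> states M" if "v \<in> W" "q \<in> states M" for v q
    using that cl by (induction v arbitrary: q) auto
  have q0: "q0 \<in> states M"
    by (rule minimal_transducerD(2)[OF M])
  obtain v i where v: "w = v @ [i]"
    using w(2) by (metis append_butlast_last_id)
  then have vi: "v \<in> W" "i \<in> alphabet n"
    using w(1) by auto
  have inf: "infinite_output M q0 (iappend (v @ [i]) x)" if "x \<in> C" for x
    by (rule is_transducerD(2)[OF minimal_transducerD(1)[OF M] q0]) (use vi that in simp)
  have gcp: "is_greatest_common_prefix (emit M i (run M v q0))
      {state_map M (run M v q0) (iappend [i] x) | x. x \<in> C}"
    by (rule minimal_transducerD(5)[OF M run[OF vi(1) q0] vi(2)])
  have "f (iappend (v @ [i]) x) = state_map M q0 (iappend (v @ [i]) x)" if "x \<in> C" for x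
    using bspec[OF f, of "iappend (v @ [i]) x"] vi that by simp
  from run_local_action[OF inf gcp this]
  show "lout n f w = outword M w q0" "loc n f w = restrict (state_map M (run M w q0)) C"
    unfolding v by auto
  show "run M w q0 \<in> states M"
    using run[OF w(1) q0] .
qed

lemma state_eqI:
  assumes M: "minimal_transducer n M q0" and "p \<in> states M" "q \<in> states M"
    and "restrict (state_map M p) C = restrict (state_map M q) C"
  shows "p = q"
proof -
  have "state_map M p x = state_map M q x" if "x \<in> C" for x
    using fun_cong[OF assms(4), of x] that by simp
  then show ?thesis
    by (rule minimal_transducerD(4)[OF M assms(2,3)])
qed

text \<open>Labelling a state by its restricted map is injective by minimality and identifies the
  forced states with the core maps of \<open>f\<close>.\<close>

lemma minimal_transducer_core:
  assumes M: "minimal_transducer n M q0" and f: "\<forall>x\<in>C. state_map M q0 x = f x"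
    and emb: "emb C C f" and s: "sim C f C f"
  shows "isomorphic n (core n M) (core_transducer (core_maps C f))"
proof -
  note la = minimal_transducer_local_action[OF M f]
  have q0: "q0 \<in> states M"
    by (rule minimal_transducerD(2)[OF M])
  obtain k where k: "sim_at C f C f k"
    using s by (auto simp: sim_def)
  have reach: "\<exists>v\<in>W. q = run M v q0" if "q \<in> states M" for q
    using minimal_transducerD(3)[OF M that] by blast
  \<comment> \<open>One letter more than \<open>k\<close>: a run may start in the initial state, and
    the extra letter makes the word before the synchronizing part nonempty.\<close>
  have "sync_at n M (Suc k)"
    unfolding sync_at_def
  proof (intro ballI)
    fix w p q assume w: "w \<in> words n (Suc k)" and p: "p \<in> states M" and q: "q \<in> states M"
    obtain c w' where cw: "w = c # w'" "c \<in> alphabet n" "w' \<in> W" "k \<le> length w'"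
      using w by (cases w) (auto simp: words_def)
    obtain u v where u: "u \<in> W" "p = run M u q0" and v: "v \<in> W" "q = run M v q0"
      using reach[OF p] reach[OF q] by blast
    have ne: "u @ w \<in> W" "u @ w \<noteq> []" "v @ w \<in> W" "v @ w \<noteq> []"
      using u v cw by auto
    have "loc n f ((u @ [c]) @ w') = loc n f ((v @ [c]) @ w')"
      by (rule sim_atD[OF k cw(3,4)]) (use u v cw(2) pre_C in auto)
    then have "restrict (state_map M (run M (u @ w) q0)) C = restrict (state_map M (run M (v @ w) q0)) C"
      using la(2)[OF ne(1,2)] la(2)[OF ne(3,4)] cw(1) by simp
    from state_eqI[OF M la(3)[OF ne(1,2)] la(3)[OF ne(3,4)] this]
    show "run M w p = run M w q"
      unfolding u v run_append by simp
  qed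
  then have sy: "sync_at n M (min_sync_level n M)"
    unfolding min_sync_level_def by (rule LeastI)
  define l where "l = min_sync_level n M"
  have sy: "run M w p = run M w q" if "w \<in> words n l" "p \<in> states M" "q \<in> states M" for w p q
    using sy that unfolding sync_at_def l_def by blast
  \<comment> \<open>Conversely, a synchronizing level of \<open>M\<close> is one for the local
    actions, so the core maps can be listed at the level that \<open>core\<close> uses.\<close>
  have at: "sim_at C f C f l"
  proof (rule sim_atI[OF embD(3)[OF emb] embD(3)[OF emb]])
    fix w v v' assume w: "w \<in> words n l" and v: "v \<in> pre C" "v' \<in> pre C"
    have ne: "v \<in> W" "v' \<in> W" "v @ w \<in> W" "v @ w \<noteq> []" "v' @ w \<in> W" "v' @ w \<noteq> []"
      using v w by (auto simp: pre_C words_def)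
    have "run M (v @ w) q0 = run M (v' @ w) q0"
      unfolding run_append by (rule sy[OF w]) (use v la(3) in \<open>auto simp: pre_C\<close>)
    then show "loc n f (v @ w) = loc n f (v' @ w)"
      using la(2)[OF ne(3,4)] la(2)[OF ne(5,6)] by simp
  qed
  obtain u where u: "u \<in> pre C"
    using pre_exists[OF tail_space_C] by blast
  have uW: "u \<in> W" "u \<noteq> []"
    using u pre_C by auto
  define \<Phi> where "\<Phi> p = restrict (state_map M p) C" for p
  have core: "states (core n M) = (\<lambda>w. run M (u @ w) q0) ` words n l"
  proof -
    have eq: "run M w q = run M (u @ w) q0" if "w \<in> words n l" "q \<in> states M" for w q
      unfolding run_append by (rule sy[OF that la(3)[OF uW]])
    have "{run M w q | w q. w \<in> words n l \<and> q \<in> states M} = (\<lambda>w. run M (u @ w) q0) ` words n l"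
    proof (intro equalityI subsetI)
      fix p assume "p \<in> (\<lambda>w. run M (u @ w) q0) ` words n l"
      then show "p \<in> {run M w q | w q. w \<in> words n l \<and> q \<in> states M}"
        using eq[OF _ q0, symmetric] q0 by blast
    qed (use eq in auto)
    then show ?thesis
      by (simp add: core_def l_def)
  qed
  have sub: "p \<in> states M" "\<exists>w\<in>words n l. p = run M (u @ w) q0" if p: "p \<in> states (core n M)" for p
  proof -
    obtain w where w: "w \<in> words n l" "p = run M (u @ w) q0"
      using p unfolding core by blast
    then show "\<exists>w\<in>words n l. p = run M (u @ w) q0"
      by blast
    show "p \<in> states M"
      unfolding w(2) by (rule la(3)) (use w(1) uW in \<open>auto simp: words_def\<close>)
  qed
  have \<Phi>u: "\<Phi> (run M (u @ w) q0) = loc n f (u @ w)" if "w \<in> W" for w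
    unfolding \<Phi>_def by (subst la(2)) (use uW that in auto)
  have "inj_on \<Phi> (states (core n M))"
    unfolding \<Phi>_def by (rule inj_onI, rule state_eqI[OF M sub(1) sub(1)])
  moreover have "\<Phi> ` states (core n M) = core_maps C f"
    unfolding core core_maps_level[OF at u] image_image
    by (intro image_cong refl \<Phi>u) (simp add: words_def)
  ultimately have bij: "bij_betw \<Phi> (states (core n M)) (core_maps C f)"
    by (simp add: bij_betw_def)
  have st: "\<Phi> (step M i p) = loc n (\<Phi> p) [i] \<and> emit M i p = lout n (\<Phi> p) [i]"
    if p: "p \<in> states (core n M)" and i: "i \<in> alphabet n" for p i
  proof -
    obtain w where w: "w \<in> W" "p = run M (u @ w) q0"
      using sub(2)[OF p] by (auto simp: words_def)
    have ne: "u @ w \<in> W" "u @ w \<noteq> []" "u @ w @ [i] \<in> W" "u @ w @ [i] \<noteq> []"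
      using uW w i by auto
    have st: "run M (u @ w @ [i]) q0 = step M i p"
      by (simp add: w run_append)
    have inj: "inj_cone n f (u @ w)"
      using emb_inj_cone_C[OF emb ne(1)] .
    have "lout n f (u @ w) @ emit M i p = lout n f (u @ w) @ lout n (loc n f (u @ w)) [i]"
      using la(1)[OF ne(1,2)] la(1)[OF ne(3,4)] lout_append[OF inj, of "[i]"] i
        outword_append[of M "u @ w" "[i]" q0] by (simp add: w)
    moreover have "\<Phi> (step M i p) = loc n (loc n f (u @ w)) [i]"
      using la(2)[OF ne(3,4)] loc_loc[OF inj, of "[i]"] i st by (simp add: \<Phi>_def)
    ultimately show ?thesis
      using \<Phi>u[OF w(1)] w(2) by simp
  qed
  have "step (core n M) = step M" "emit (core n M) = emit M"
    by (simp_all add: core_def)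
  then show ?thesis
    unfolding isomorphic_def using bij st by (intro exI[of _ \<Phi>]) simp
qed

text \<open>Short words are finite in number, and long words give core maps.\<close>

lemma finite_local_actions:
  assumes "sim D f D f" "tail_space D" "inj_on f D"
  shows "finite (loc n f ` pre D)"
proof -
  obtain k where k: "sim_at D f D f k"
    using assms(1) by (auto simp: sim_def)
  let ?S = "\<Union>l\<le>Suc k. {v \<in> pre D. length v = l}"
  obtain u where u: "u \<in> pre D"
    using pre_exists[OF assms(2)] by blast
  have "loc n f v \<in> loc n f ` ?S \<union> core_maps D f" if v: "v \<in> pre D" for v
  proof (cases "length v \<le> Suc k")
    case False
    define a b where "a = take 1 v" and "b = drop 1 v"
    have ab: "v = a @ b" "k \<le> length b" "a \<noteq> []"
      using False preD(2)[OF v] by (auto simp: a_def b_def)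
    then have "a \<in> pre D" "b \<in> W"
      using pre_appendD[OF assms(2), of a b] v by auto
    then show ?thesis
      using loc_in_core_maps[OF k _ _ ab(2)] ab(1) by blast
  qed (use v in blast)
  then have "loc n f ` pre D \<subseteq> loc n f ` ?S \<union> core_maps D f"
    by blast
  moreover have "finite (loc n f ` ?S \<union> core_maps D f)"
    using finite_pre[OF assms(2)] core_maps_finite[OF assms(1,2)] by simp
  ultimately show ?thesis
    by (rule finite_subset)
qed

text \<open>The states are the local actions together with \<open>g\<close> itself. The initial
  state is \<open>g\<close> and not \<open>loc n g []\<close>, because the common prefix of the
  values of \<open>f\<close> has to be written too.\<close>

lemma minimal_transducer_exists:
  assumes emb: "emb C C f" and s: "sim C f C f"
  shows "\<exists>(M :: nat transducer) q0. minimal_transducer n M q0 \<and> (\<forall>x\<in>C. state_map M q0 x = f x)"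
proof -
  define g where "g = restrict f C"
  have g: "emb C C g"
    by (rule emb_cong[OF emb]) (simp add: g_def)
  define S where "S = insert g (loc n g ` pre C)"
  have "sim C g C g"
    by (rule sim_cong[OF s]) (simp_all add: g_def)
  then have fin: "finite S"
    unfolding S_def using finite_local_actions[OF _ tail_space_C] embD[OF g] by blast
  define c d where "c = to_nat_on S" and "d = from_nat_into S"
  have dc: "d (c p) = p" if "p \<in> S" for p
    unfolding c_def d_def using from_nat_into_to_nat_on[OF countable_finite[OF fin] that] .
  have Sloc: "loc n p w \<in> S" if pS: "p \<in> S" and "w \<in> W" "w \<noteq> []" for p w
  proof (cases "p = g")
    case True
    then show ?thesis
      using that by (auto simp: S_def pre_C)
  next
    case False
    then obtain v where "v \<in> pre C" "p = loc n g v"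
      using pS by (auto simp: S_def)
    then show ?thesis
      using loc_loc[OF emb_inj_cone[OF g] that(2)] pre_append[OF _ that(2)] by (auto simp: S_def)
  qed
  have lW: "lout n g w \<in> W" if "w \<in> W" for w
  proof -
    have "iappend w (\<lambda>_. Sym 0) \<in> C"
      using that C_two(1) by simp
    from emb_in[OF g this] show ?thesis
      unfolding lout_loc[OF emb_inj_cone_C[OF g that] C_two(1)] by simp
  qed
  have Semb: "inj_on p C \<and> uc C p \<and> p \<in> extensional C \<and> (\<forall>w\<in>W. lout n p w \<in> W)" if p: "p \<in> S" for p
  proof (cases "p = g")
    case True
    then show ?thesis
      using True embD[OF g] lW by (auto simp: g_def)
  next
    case False
    then obtain v where v: "v \<in> pre C" "p = loc n g v"
      using p by (auto simp: S_def)
    have "lout n p w \<in> W" if "w \<in> W" for w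
      using lout_append[OF emb_inj_cone[OF g v(1)] that] lW[of "v @ w"] v that by (auto simp: pre_C)
    then show ?thesis
      using inj_loc[OF emb_inj_cone[OF g v(1)]] uc_loc[OF embD(4)[OF g] v(1)] v(2) by auto
  qed
  define M :: "nat transducer" where
    "M = \<lparr>states = c ` S, step = (\<lambda>i q. c (loc n (d q) [i])), emit = (\<lambda>i q. lout n (d q) [i])\<rparr>"
  have M: "states M = c ` S" "\<And>i q. step M i q = c (loc n (d q) [i])"
    "\<And>i q. emit M i q = lout n (d q) [i]"
    by (simp_all add: M_def)
  have co: "coherent M d (c ` S)"
    unfolding coherent_def M using dc Sloc Semb by auto
  have sm: "state_map M (c p) x = p x" "infinite_output M (c p) x" if "p \<in> S" "x \<in> C" for p x
    using coherent_state_map[OF co _ that(2), of "c p"] dc that(1) by auto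
  have gS: "g \<in> S"
    by (simp add: S_def)
  have "minimal_transducer n M (c g)"
    unfolding minimal_transducer_def
  proof (intro conjI ballI impI)
    show "is_transducer n M"
      unfolding is_transducer_def M using dc Sloc Semb sm(2) by auto
    show "c g \<in> states M"
      using gS by (simp add: M)
    show "\<exists>w\<in>W. run M w (c g) = q" if q: "q \<in> states M" for q
    proof -
      obtain p where p: "p \<in> S" "q = c p"
        using q by (auto simp: M)
      show ?thesis
      proof (cases "p = g")
        case True
        then show ?thesis
          using p by (intro bexI[of _ "[]"]) auto
      next
        case False
        then obtain v where v: "v \<in> pre C" "p = loc n g v"
          using p by (auto simp: S_def)
        have vW: "v \<in> W" "v \<noteq> []"
          using v(1) by (auto simp: pre_C)
        have r: "run M v (c g) \<in> c ` S" "d (run M v (c g)) = p"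
          using coherent_run[OF co _ vW(1), of "c g"] gS vW(2) dc[OF gS] v(2) by auto
        then obtain p' where "p' \<in> S" "run M v (c g) = c p'"
          by auto
        then have "run M v (c g) = c p"
          using r(2) dc by metis
        then show ?thesis
          using vW(1) p(2) by blast
      qed
    qed
    show "q = p" if q: "q \<in> states M" "p \<in> states M" and eq: "\<forall>x\<in>C. state_map M q x = state_map M p x" for q p
    proof -
      obtain a b where ab: "a \<in> S" "q = c a" "b \<in> S" "p = c b"
        using q by (auto simp: M)
      have "a x = b x" if "x \<in> C" for x
        using eq that sm(1)[OF ab(1) that] sm(1)[OF ab(3) that] ab by simp
      then have "a = b"
        using Semb[OF ab(1)] Semb[OF ab(3)] by (intro extensionalityI[of a C b]) auto
      then show ?thesis
        using ab by simp
    qed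
    fix q i assume q: "q \<in> states M" and i: "i \<in> alphabet n"
    then obtain p where p: "p \<in> S" "q = c p"
      by (auto simp: M)
    have "{state_map M q (iappend [i] x) | x. x \<in> C} = {p (iappend [i] x) | x. x \<in> C}"
      unfolding Setcompr_eq_image using sm(1)[OF p(1)] i p(2) by (intro image_cong) simp_all
    moreover have "is_greatest_common_prefix (lout n p [i]) {p (iappend [i] x) | x. x \<in> C}"
      by (rule lout_gcp[OF inj_cone_W]) (use Semb[OF p(1)] i in auto)
    ultimately show "is_greatest_common_prefix (emit M i q) {state_map M q (iappend [i] x) | x. x \<in> C}"
      using dc[OF p(1)] p(2) by (simp add: M)
  qed
  moreover have "\<forall>x\<in>C. state_map M (c g) x = f x"
    using sm(1)[OF gS] by (simp add: g_def)
  ultimately show ?thesis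
    by blast
qed


subsection \<open>Minimal transducers over the dotted Cantor space\<close>

lemma letters_disjoint: "c \<in> dots r \<Longrightarrow> c \<notin> alphabet n"
  by (auto simp: dots_def alphabet_def)

lemma dotted_snoc: "w @ [i] \<in> dotted_words n r \<longleftrightarrow>
    w = [] \<and> i \<in> dots r \<or> w \<in> dotted_words n r \<and> i \<in> alphabet n"
  by (cases w) (auto simp: dotted_words_def)

lemma dotted_append: "v \<in> dotted_words n r \<Longrightarrow> w \<in> W \<Longrightarrow> v @ w \<in> dotted_words n r"
  by (auto simp: dotted_words_def)

lemma is_rtransducerD:
  assumes "is_rtransducer n r A"
  shows "rstates A \<subseteq> states A" "finite (rstates A)" "init A \<in> rstates A"
    "q \<in> states A \<Longrightarrow> i \<in> letters_from n r A q \<Longrightarrow> step A i q \<in> states A - {init A}"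
    "q \<in> states A - rstates A \<Longrightarrow> x \<in> C \<Longrightarrow> infinite_output A q x"
    "q \<in> rstates A \<Longrightarrow> w \<noteq> [] \<Longrightarrow> readable n r A q w \<Longrightarrow> run A w q \<noteq> q"
  using assms unfolding is_rtransducer_def by simp_all

lemma is_minimal_forD:
  assumes "is_minimal_for n r A h"
  shows "is_rtransducer n r A" "x \<in> cantor_nr n r \<Longrightarrow> state_map A (init A) x = h x"
    "q \<in> states A \<Longrightarrow> \<exists>w. readable n r A (init A) w \<and> run A w (init A) = q"
    "p \<in> states A \<Longrightarrow> q \<in> states A \<Longrightarrow> inputs_from n r A p = inputs_from n r A q \<Longrightarrow>
       (\<And>x. x \<in> inputs_from n r A p \<Longrightarrow> state_map A p x = state_map A q x) \<Longrightarrow> p = q"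
    "q \<in> states A \<Longrightarrow> i \<in> letters_from n r A q \<Longrightarrow>
       is_greatest_common_prefix (emit A i q) {state_map A q (iappend [i] x) | x. x \<in> C}"
proof -
  note m = assms[unfolded is_minimal_for_def]
  note a = m[THEN conjunct1, unfolded minimal_rtransducer_def]
  note a2 = a[THEN conjunct2] note a3 = a2[THEN conjunct2]
  show "is_rtransducer n r A"
    by (rule a[THEN conjunct1])
  show "state_map A (init A) x = h x" if "x \<in> cantor_nr n r"
    by (rule bspec[OF m[THEN conjunct2] that])
  show "\<exists>w. readable n r A (init A) w \<and> run A w (init A) = q" if "q \<in> states A"
    by (rule bspec[OF a2[THEN conjunct1] that])
  show "p = q" if "p \<in> states A" "q \<in> states A" "inputs_from n r A p = inputs_from n r A q"
    "\<And>x. x \<in> inputs_from n r A p \<Longrightarrow> state_map A p x = state_map A q x"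
    by (rule bspec[OF bspec[OF a3[THEN conjunct1] that(1)] that(2), THEN mp]) (use that(3,4) in blast)
  show "is_greatest_common_prefix (emit A i q) {state_map A q (iappend [i] x) | x. x \<in> C}"
    if "q \<in> states A" "i \<in> letters_from n r A q"
    by (rule bspec[OF bspec[OF a3[THEN conjunct2] that(1)] that(2)])
qed

lemma rrun_noninit:
  assumes A: "is_rtransducer n r A" and "q \<in> states A - {init A}" "w \<in> W"
  shows "run A w q \<in> states A - {init A}"
  using assms(2,3)
proof (induction w arbitrary: q)
  case (Cons i w)
  then have "i \<in> letters_from n r A q"
    by (simp add: letters_from_def)
  then have "step A i q \<in> states A - {init A}"
    using is_rtransducerD(4)[OF A] Cons.prems(1) by blast
  then show ?case
    using Cons by simp
qed simp

lemma rrun_init: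
  assumes A: "is_rtransducer n r A" and v: "v \<in> dotted_words n r"
  shows "run A v (init A) \<in> states A - {init A}"
proof -
  obtain d w where dw: "v = d # w" "d \<in> dots r" "w \<in> W"
    using v by (auto simp: dotted_words_def)
  have "init A \<in> states A"
    using is_rtransducerD(1,3)[OF A] by blast
  moreover have "d \<in> letters_from n r A (init A)"
    using dw by (simp add: letters_from_def)
  ultimately have "step A d (init A) \<in> states A - {init A}"
    by (rule is_rtransducerD(4)[OF A])
  then show ?thesis
    using rrun_noninit[OF A _ dw(3)] dw(1) by simp
qed

text \<open>Along an infinite run that never leaves the finite set \<open>rstates A\<close> some
  state would repeat, contradicting the absence of cycles there; after leaving it the output is
  infinite by definition.\<close>

lemma rtransducer_infinite_output:
  assumes A: "is_rtransducer n r A" and r: "1 \<le> r" and x: "x \<in> cantor_nr n r"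
  shows "infinite_output A (init A) x"
proof -
  have v: "iprefix (Suc k) x \<in> dotted_words n r" for k
    using tail_spaceD(1)[OF tail_space_cantor_nr[OF r] x, of "Suc k"] pre_cantor_nr[OF r] by simp
  define p where "p k = run A (iprefix (Suc k) x) (init A)" for k
  have p: "p k \<in> states A - {init A}" for k
    unfolding p_def by (rule rrun_init[OF A v])
  have "\<exists>k. p k \<notin> rstates A"
  proof (rule ccontr)
    assume "\<not> (\<exists>k. p k \<notin> rstates A)"
    then have "range p \<subseteq> rstates A"
      by auto
    then have "finite (range p)"
      using is_rtransducerD(2)[OF A] by (rule finite_subset)
    then have "\<not> inj p"
      using finite_imageD infinite_UNIV_nat by blast
    then obtain a b where ab: "a < b" "p a = p b"
      unfolding inj_on_def by (metis linorder_neqE_nat)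
    define t where "t = drop (Suc a) (iprefix (Suc b) x)"
    have t: "iprefix (Suc b) x = iprefix (Suc a) x @ t" "t \<noteq> []"
      unfolding t_def using append_take_drop_id[of "Suc a" "iprefix (Suc b) x"]
        take_iprefix[of "Suc a" "Suc b" x] ab(1) by simp_all
    have "iprefix (Suc a) x @ t \<in> pre (cantor_nr n r)"
      using v[of b] pre_cantor_nr[OF r] t(1) by simp
    then have tW: "t \<in> W"
      by (rule pre_appendD(2)[OF tail_space_cantor_nr[OF r]]) (simp flip: length_0_conv)
    have "run A t (p a) = p a"
      using ab(2) by (simp add: p_def t(1) run_append)
    moreover have "readable n r A (p a) t"
      using p[of a] tW t(2) by (cases t) (auto simp: readable_def letters_from_def)
    moreover have "p a \<in> rstates A"
      using \<open>range p \<subseteq> rstates A\<close> by auto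
    ultimately show False
      using is_rtransducerD(6)[OF A _ t(2)] by blast
  qed
  then obtain k where "p k \<in> states A - rstates A"
    using p by blast
  moreover have "idrop (Suc k) x \<in> C"
    using tail_spaceD(2)[OF tail_space_cantor_nr[OF r] x] by simp
  ultimately have "infinite_output A (p k) (idrop (Suc k) x)"
    by (rule is_rtransducerD(5)[OF A])
  then show ?thesis
    using infinite_output_iappend[of A "init A" "iprefix (Suc k) x" "idrop (Suc k) x"]
    by (simp add: p_def)
qed

lemma rtransducer_local_action:
  assumes A: "is_minimal_for n r A h" and r: "1 \<le> r" and v: "v \<in> dotted_words n r"
  shows "lout n h v = outword A v (init A)" "loc n h v = restrict (state_map A (run A v (init A))) C"
proof -
  have tr: "is_rtransducer n r A"
    by (rule is_minimal_forD(1)[OF A])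
  obtain w i where wi: "v = w @ [i]"
    using v by (cases v rule: rev_cases) (auto simp: dotted_words_def)
  have D: "iappend (w @ [i]) x \<in> cantor_nr n r" if "x \<in> C" for x
    using v that unfolding wi pre_cantor_nr[OF r, symmetric] by (rule preD(1))
  have inf: "infinite_output A (init A) (iappend (w @ [i]) x)" if "x \<in> C" for x
    by (rule rtransducer_infinite_output[OF tr r D[OF that]])
  have "run A w (init A) \<in> states A \<and> i \<in> letters_from n r A (run A w (init A))"
  proof (cases "w = []")
    case True
    then show ?thesis
      using v wi dotted_snoc[of w i r] is_rtransducerD(1,3)[OF tr]
      by (auto simp: letters_from_def dotted_words_def)
  next
    case False
    then show ?thesis
      using v wi dotted_snoc[of w i r] rrun_init[OF tr, of w] by (simp add: letters_from_def)
  qed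
  then have gcp: "is_greatest_common_prefix (emit A i (run A w (init A)))
      {state_map A (run A w (init A)) (iappend [i] x) | x. x \<in> C}"
    using is_minimal_forD(5)[OF A] by blast
  have "h (iappend (w @ [i]) x) = state_map A (init A) (iappend (w @ [i]) x)" if "x \<in> C" for x
    using is_minimal_forD(2)[OF A D[OF that]] by simp
  from run_local_action[OF inf gcp this]
  show "lout n h v = outword A v (init A)" "loc n h v = restrict (state_map A (run A v (init A))) C"
    unfolding wi by auto
qed

lemma rstate_eqI:
  assumes A: "is_minimal_for n r A h" and p: "p \<in> states A - {init A}" and q: "q \<in> states A - {init A}"
    and "restrict (state_map A p) C = restrict (state_map A q) C"
  shows "p = q"
proof -
  have "state_map A p x = state_map A q x" if "x \<in> C" for x
    using fun_cong[OF assms(4), of x] that by simp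
  moreover have "inputs_from n r A p = C" "inputs_from n r A q = C"
    using p q by (auto simp: inputs_from_def)
  ultimately show ?thesis
    using is_minimal_forD(4)[OF A, of p q] p q by simp
qed

lemma rreach:
  assumes A: "is_minimal_for n r A h" and q: "q \<in> states A - {init A}"
  shows "\<exists>v\<in>dotted_words n r. q = run A v (init A)"
proof -
  obtain w where w: "readable n r A (init A) w" "run A w (init A) = q"
    using is_minimal_forD(3)[OF A, of q] q by blast
  then have "w \<noteq> []"
    using q by auto
  then have "w \<in> dotted_words n r"
    using w(1) by (cases w) (auto simp: readable_def letters_from_def dotted_words_def)
  then show ?thesis
    using w(2) by blast
qed

lemma readable_W: "q \<noteq> init A \<Longrightarrow> w \<in> W \<Longrightarrow> readable n r A q w"
  by (cases w) (auto simp: readable_def letters_from_def)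

lemma rsync_atD:
  assumes "rsync_at n r A k" "length w = k" "w \<in> W" "p \<in> states A - {init A}" "q \<in> states A - {init A}"
  shows "run A w p = run A w q"
proof -
  have "readable n r A p w" "readable n r A q w"
    using readable_W[of _ A w r] assms(3-5) by auto
  then show ?thesis
    using assms(1)[unfolded rsync_at_def, rule_format, OF assms(2), of p q] assms(4,5) by blast
qed

lemma rsync_imp_sim_at:
  assumes A: "is_minimal_for n r A h" and r: "1 \<le> r" and h: "inj_on h (cantor_nr n r)"
    and k: "rsync_at n r A k"
  shows "sim_at (cantor_nr n r) h (cantor_nr n r) h k"
proof (rule sim_atI[OF h h])
  fix w v v' assume w: "w \<in> words n k" and v: "v \<in> pre (cantor_nr n r)" "v' \<in> pre (cantor_nr n r)"
  have tr: "is_rtransducer n r A"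
    by (rule is_minimal_forD(1)[OF A])
  have W: "w \<in> W" "length w = k"
    using w by (auto simp: words_def)
  have d: "v \<in> dotted_words n r" "v' \<in> dotted_words n r" "v @ w \<in> dotted_words n r" "v' @ w \<in> dotted_words n r"
    using v dotted_append[OF _ W(1)] unfolding pre_cantor_nr[OF r] by blast+
  note p = rrun_init[OF tr d(1)] rrun_init[OF tr d(2)]
  have "run A w (run A v (init A)) = run A w (run A v' (init A))"
    by (rule rsync_atD[OF k W(2,1) p])
  then show "loc n h (v @ w) = loc n h (v' @ w)"
    using rtransducer_local_action(2)[OF A r d(3)] rtransducer_local_action(2)[OF A r d(4)]
    by (simp add: run_append)
qed

text \<open>A word starting with a dotted letter is readable from the initial state only. The level
  is \<open>Suc k\<close> because the empty word is readable everywhere and does not identify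
  different states.\<close>

lemma sim_at_imp_rsync:
  assumes A: "is_minimal_for n r A h" and r: "1 \<le> r"
    and k: "sim_at (cantor_nr n r) h (cantor_nr n r) h k"
  shows "rsync_at n r A (Suc k)"
  unfolding rsync_at_def
proof (intro allI impI ballI, elim conjE)
  fix w p q assume len: "length w = Suc k" and p: "p \<in> states A" and q: "q \<in> states A"
    and rd: "readable n r A p w" "readable n r A q w"
  have tr: "is_rtransducer n r A"
    by (rule is_minimal_forD(1)[OF A])
  obtain c w' where cw: "w = c # w'"
    using len by (cases w) auto
  have c: "c \<in> letters_from n r A p" "c \<in> letters_from n r A q" "w' \<in> W"
    using rd unfolding cw readable_def by auto
  show "run A w p = run A w q"
  proof (cases "c \<in> dots r")
    case True
    then have "p = init A" "q = init A"
      using c letters_disjoint[OF True] by (auto simp: letters_from_def split: if_splits)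
    then show ?thesis by simp
  next
    case False
    then have pq: "p \<in> states A - {init A}" "q \<in> states A - {init A}" "c \<in> alphabet n"
      using c p q by (auto simp: letters_from_def split: if_splits)
    then have w: "w \<in> W"
      using c cw by simp
    obtain u v where u: "u \<in> dotted_words n r" "p = run A u (init A)"
      and v: "v \<in> dotted_words n r" "q = run A v (init A)"
      using rreach[OF A pq(1)] rreach[OF A pq(2)] by blast
    have d: "u @ w \<in> dotted_words n r" "v @ w \<in> dotted_words n r"
      using u(1) v(1) dotted_append[OF _ w] by blast+
    have "loc n h (u @ w) = loc n h (v @ w)"
      by (rule sim_atD[OF k w]) (use len u v pre_cantor_nr[OF r] in auto)
    then have "restrict (state_map A (run A (u @ w) (init A))) C =
        restrict (state_map A (run A (v @ w) (init A))) C"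
      unfolding rtransducer_local_action(2)[OF A r d(1)] rtransducer_local_action(2)[OF A r d(2)] .
    from rstate_eqI[OF A rrun_init[OF tr d(1)] rrun_init[OF tr d(2)] this]
    show ?thesis
      by (simp add: u v run_append)
  qed
qed

lemma rcore_isomorphic:
  assumes A: "is_minimal_for n r A h" and r: "1 \<le> r" and h: "inj_on h (cantor_nr n r)"
    and s: "\<exists>k. rsync_at n r A k"
  shows "isomorphic n (rcore n r A) (core_transducer (core_maps (cantor_nr n r) h))"
    "\<And>q i. q \<in> states (rcore n r A) \<Longrightarrow> i \<in> alphabet n \<Longrightarrow> step (rcore n r A) i q \<in> states (rcore n r A)"
proof -
  let ?D = "cantor_nr n r"
  have tr: "is_rtransducer n r A"
    by (rule is_minimal_forD(1)[OF A])
  define l where "l = (LEAST k. rsync_at n r A k)"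
  have sy: "rsync_at n r A l"
    unfolding l_def using s by (rule LeastI_ex)
  have at: "sim_at ?D h ?D h l"
    by (rule rsync_imp_sim_at[OF A r h sy])
  obtain u where u: "u \<in> pre ?D"
    using pre_exists[OF tail_space_cantor_nr[OF r]] by blast
  have dot: "u @ w \<in> dotted_words n r" if "w \<in> W" for w
    using pre_append[OF u that] pre_cantor_nr[OF r] by simp
  define \<Phi> where "\<Phi> p = restrict (state_map A p) C" for p
  have uu: "run A u (init A) \<in> states A - {init A}"
    using rrun_init[OF tr, of u] dot[of "[]"] by simp
  have core: "states (rcore n r A) = (\<lambda>w. run A (u @ w) (init A)) ` words n l"
  proof -
    have eq: "run A w q = run A (u @ w) (init A)" if w: "w \<in> words n l" and q: "q \<in> states A - {init A}" for w q
    proof -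
      have "w \<in> W" "length w = l"
        using w by (auto simp: words_def)
      then have "run A w q = run A w (run A u (init A))"
        by (intro rsync_atD[OF sy _ _ q uu])
      then show ?thesis
        by (simp add: run_append)
    qed
    have "{run A w q | w q. w \<in> words n l \<and> q \<in> states A - {init A}} =
        (\<lambda>w. run A (u @ w) (init A)) ` words n l"
    proof (intro equalityI subsetI)
      fix p assume "p \<in> (\<lambda>w. run A (u @ w) (init A)) ` words n l"
      then show "p \<in> {run A w q | w q. w \<in> words n l \<and> q \<in> states A - {init A}}"
        using eq[OF _ uu, symmetric] uu by blast
    qed (use eq in auto)
    then show ?thesis
      by (simp add: rcore_def l_def)
  qed
  have sub: "p \<in> states A - {init A}" "\<exists>w\<in>W. p = run A (u @ w) (init A)" if p: "p \<in> states (rcore n r A)" for p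
  proof -
    obtain w where w: "w \<in> words n l" "p = run A (u @ w) (init A)"
      using p unfolding core by blast
    then have "w \<in> W"
      by (simp add: words_def)
    then show "\<exists>w\<in>W. p = run A (u @ w) (init A)" "p \<in> states A - {init A}"
      unfolding w(2) by (blast, rule rrun_init[OF tr dot])
  qed
  have \<Phi>u: "\<Phi> (run A (u @ w) (init A)) = loc n h (u @ w)" if "w \<in> W" for w
    unfolding \<Phi>_def by (rule rtransducer_local_action(2)[OF A r dot[OF that], symmetric])
  have inj: "inj_on \<Phi> (states A - {init A})"
    unfolding \<Phi>_def by (rule inj_onI, rule rstate_eqI[OF A])
  have im: "\<Phi> ` states (rcore n r A) = core_maps ?D h"
    unfolding core core_maps_level[OF at u] image_image
    by (intro image_cong refl \<Phi>u) (simp add: words_def)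
  have bij: "bij_betw \<Phi> (states (rcore n r A)) (core_maps ?D h)"
    unfolding bij_betw_def by (rule conjI[OF inj_on_subset[OF inj subsetI] im], rule sub(1))
  have st: "\<Phi> (step A i p) = loc n (\<Phi> p) [i] \<and> emit A i p = lout n (\<Phi> p) [i]"
    if p: "p \<in> states (rcore n r A)" and i: "i \<in> alphabet n" for p i
  proof -
    obtain w where w: "w \<in> W" "p = run A (u @ w) (init A)"
      using sub(2)[OF p] by blast
    have wi: "w @ [i] \<in> W"
      using w i by simp
    have ic: "inj_cone n h (u @ w)"
      using inj_cone_pre[OF h pre_append[OF u w(1)]] .
    have "lout n h (u @ w) @ emit A i p = lout n h (u @ w) @ lout n (loc n h (u @ w)) [i]"
      using rtransducer_local_action(1)[OF A r dot[OF w(1)]] rtransducer_local_action(1)[OF A r dot[OF wi]]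
        lout_append[OF ic, of "[i]"] i outword_append[of A "u @ w" "[i]" "init A"] by (simp add: w)
    moreover have "\<Phi> (step A i p) = loc n (loc n h (u @ w)) [i]"
      using \<Phi>u[OF wi] loc_loc[OF ic, of "[i]"] i by (simp add: w run_append)
    ultimately show ?thesis
      using \<Phi>u[OF w(1)] w(2) by simp
  qed
  have steps: "step (rcore n r A) = step A" "emit (rcore n r A) = emit A"
    by (simp_all add: rcore_def)
  show "isomorphic n (rcore n r A) (core_transducer (core_maps ?D h))"
    unfolding isomorphic_def steps using bij st by (intro exI[of _ \<Phi>]) simp
  show "step (rcore n r A) i p \<in> states (rcore n r A)"
    if p: "p \<in> states (rcore n r A)" and i: "i \<in> alphabet n" for p i
  proof -
    obtain w where w: "w \<in> W" "p = run A (u @ w) (init A)"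
      using sub(2)[OF p] by blast
    have wi: "w @ [i] \<in> W"
      using w i by simp
    have eq: "step A i p = run A (u @ w @ [i]) (init A)"
      by (simp add: w run_append)
    \<comment> \<open>The word leading to \<open>p\<close> is replaced by one whose length stays
      above the level after appending \<open>i\<close>; the label of \<open>step A i p\<close> is
      then a core map, and injectivity of \<open>\<Phi>\<close> finds the state.\<close>
    have "loc n h (u @ w) \<in> core_maps ?D h"
      unfolding im[symmetric] \<Phi>u[OF w(1), symmetric] w(2)[symmetric] using p by (rule imageI)
    then obtain v t where vt: "v \<in> pre ?D" "t \<in> W" "l \<le> length t" "loc n h (u @ w) = loc n h (v @ t)"
      by (rule core_mapsE)
    have "\<Phi> (step A i p) = loc n (loc n h (v @ t)) [i]"
      using st[OF p i] \<Phi>u[OF w(1)] w(2) vt(4) by simp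
    also have "\<dots> = loc n h (v @ (t @ [i]))"
      using loc_loc[OF inj_cone_pre[OF h pre_append[OF vt(1,2)]], of "[i]"] i by simp
    also have "\<dots> \<in> core_maps ?D h"
      by (rule loc_in_core_maps[OF at vt(1)]) (use vt i in auto)
    finally obtain p' where p': "p' \<in> states (rcore n r A)" "\<Phi> (step A i p) = \<Phi> p'"
      unfolding im[symmetric] by blast
    have "step A i p = p'"
      using inj_onD[OF inj p'(2)] sub(1)[OF p'(1)] rrun_init[OF tr dot[OF wi]] eq by simp
    then show ?thesis
      using p'(1) by (simp add: steps)
  qed
qed

text \<open>Every minimal transducer of \<open>h\<close> yields the same isomorphism class, so the
  union in the definition of \<open>Core\<close> is that class.\<close>

lemma
  assumes h: "inj_on h (cantor_nr n r)" and b: "bisync n r h" and r: "1 \<le> r"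
  shows bisync_imp_sim: "sim (cantor_nr n r) h (cantor_nr n r) h"
    and Core_eq_core_class: "Core n r h = core_class (cantor_nr n r) h"
    and Core_nonempty: "Core n r h \<noteq> {}"
proof -
  obtain A :: "nat rtransducer" and k where A: "is_minimal_for n r A h" "rsync_at n r A k"
    using b unfolding bisync_def by blast
  have at: "sim_at (cantor_nr n r) h (cantor_nr n r) h k"
    by (rule rsync_imp_sim_at[OF A(1) r h A(2)])
  then show "sim (cantor_nr n r) h (cantor_nr n r) h"
    by (auto simp: sim_def)
  have iso: "iso_class n (rcore n r A') = core_class (cantor_nr n r) h"
    if A': "is_minimal_for n r A' h" for A' :: "nat rtransducer"
  proof -
    have "\<exists>k. rsync_at n r A' k"
      using sim_at_imp_rsync[OF A' r at] by blast
    from rcore_isomorphic[OF A' r h this] show ?thesis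
      unfolding core_class_def by (rule iso_class_eq)
  qed
  show "Core n r h = core_class (cantor_nr n r) h"
    unfolding Core_def using A(1) iso by auto
  have "isomorphic n (rcore n r A) (rcore n r A)"
    unfolding isomorphic_def by (intro exI[of _ id]) simp
  then show "Core n r h \<noteq> {}"
    unfolding Core_def iso_class_def using A(1) by blast
qed

text \<open>The minimal transducer is built from the local actions of \<open>h\<close> at nonempty
  words, plus a separate initial state, which alone reads dotted letters.\<close>

lemma bisyncI:
  assumes h: "emb (cantor_nr n r) (cantor_nr n r) h" and r: "1 \<le> r"
    and s: "sim (cantor_nr n r) h (cantor_nr n r) h"
  shows "bisync n r h"
proof -
  let ?D = "cantor_nr n r"
  have D: "tail_space ?D" "pre ?D = dotted_words n r"
    using tail_space_cantor_nr[OF r] pre_cantor_nr[OF r] by auto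
  have hin: "inj_cone n h v" if "v \<in> pre ?D" for v
    by (rule emb_inj_cone[OF h that])
  define S where "S = loc n h ` pre ?D"
  have fin: "finite S"
    unfolding S_def using finite_local_actions[OF s D(1)] embD[OF h] by blast
  \<comment> \<open>The shift by one keeps \<open>0\<close> free for the initial state.\<close>
  define c d where "c p = Suc (to_nat_on S p)" and "d q = from_nat_into S (q - 1)" for p q
  have dc: "d (c p) = p" if "p \<in> S" for p
    unfolding c_def d_def using from_nat_into_to_nat_on[OF countable_finite[OF fin] that] by simp
  have c0 [simp]: "c p \<noteq> 0" for p
    by (simp add: c_def)
  have dotS: "[i] \<in> pre ?D" if "i \<in> dots r" for i
    unfolding D using that by (simp add: dotted_words_def)
  have CD: "x \<notin> C" if "x \<in> ?D" for x
    using that letters_disjoint[of "x 0" r] by (auto simp: cantor_nr_def cantor_n_def)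
  have Sloc: "loc n p w \<in> S" if pS: "p \<in> S" and w: "w \<in> W" for p w
  proof -
    obtain v where v: "v \<in> pre ?D" "p = loc n h v"
      using pS by (auto simp: S_def)
    show ?thesis
      unfolding S_def v(2) loc_loc[OF hin[OF v(1)] w] by (rule imageI, rule pre_append[OF v(1) w])
  qed
  have Semb: "inj_on p C" "uc C p" "p \<in> extensional C" "lout n p [] = []" if "p \<in> S" for p
    using that inj_loc[OF hin] uc_loc[OF embD(4)[OF h]] lout_loc_Nil[OF hin] by (auto simp: S_def)
  \<comment> \<open>Local actions whose values still carry their dotted letter, that is, those
    reached before any output. Together with the initial state they form the part R.\<close>
  define Rm where "Rm = {p \<in> S. \<forall>x\<in>C. p x \<in> ?D}"
  have nil: "loc n h v \<in> Rm \<longleftrightarrow> lout n h v = []" if v: "v \<in> pre ?D" for v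
  proof
    assume a: "lout n h v = []"
    have "loc n h v x \<in> ?D" if "x \<in> C" for x
      using lout_loc[OF hin[OF v] that] a emb_in[OF h preD(1)[OF v that]] by simp
    then show "loc n h v \<in> Rm"
      using v by (simp add: Rm_def S_def)
  next
    assume "loc n h v \<in> Rm"
    then have "loc n h v (\<lambda>_. Sym 0) \<notin> C"
      using CD C_two(1) by (auto simp: Rm_def)
    then show "lout n h v = []"
      using lout_in_pre(2)[of ?D h ?D v "\<lambda>_. Sym 0"] embD[OF h] v C_two(1) by blast
  qed
  have lne: "lout n h v \<in> dotted_words n r" if "v \<in> pre ?D" "lout n h v \<noteq> []" for v
    using lout_in_pre(1)[of ?D h ?D v] embD[OF h] that D by auto
  define A :: "nat rtransducer" where
    "A = \<lparr>states = insert 0 (c ` S),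
          step = (\<lambda>i q. if q = 0 then c (loc n h [i]) else c (loc n (d q) [i])),
          emit = (\<lambda>i q. if q = 0 then lout n h [i] else lout n (d q) [i]),
          init = 0, rstates = insert 0 (c ` Rm)\<rparr>"
  have A: "states A = insert 0 (c ` S)" "init A = 0" "rstates A = insert 0 (c ` Rm)"
    "step A i 0 = c (loc n h [i])" "emit A i 0 = lout n h [i]"
    "step A i (c p) = c (loc n (d (c p)) [i])" "emit A i (c p) = lout n (d (c p)) [i]" for i p
    by (simp_all add: A_def)
  have co: "coherent A d (c ` S)"
    unfolding coherent_def
  proof (intro ballI)
    fix q assume "q \<in> c ` S"
    then obtain p where p: "p \<in> S" "q = c p"
      by auto
    have "c (loc n p [i]) \<in> c ` S" "d (c (loc n p [i])) = loc n p [i]" if "i \<in> alphabet n" for i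
      using Sloc[OF p(1), of "[i]"] dc that by auto
    then show "inj_on (d q) C \<and> uc C (d q) \<and> (\<forall>i\<in>alphabet n. step A i q \<in> c ` S \<and>
        d (step A i q) = loc n (d q) [i] \<and> emit A i q = lout n (d q) [i])"
      unfolding p(2) A(6,7) dc[OF p(1)] using Semb(1,2)[OF p(1)] by simp
  qed
  have cinj: "p = p'" if "p \<in> S" "p' \<in> S" "c p = c p'" for p p'
  proof -
    have "d (c p) = d (c p')"
      unfolding that(3) ..
    then show ?thesis
      unfolding dc[OF that(1)] dc[OF that(2)] .
  qed
  have runS: "run A w (c p) = c (loc n p w)" if p: "p \<in> S" and w: "w \<in> W" "w \<noteq> []" for p w
  proof -
    have "run A w (c p) \<in> c ` S" "d (run A w (c p)) = loc n p w"
      using coherent_run[OF co imageI[OF p] w(1)] w(2) dc[OF p] by simp_all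
    then obtain p' where p': "p' \<in> S" "run A w (c p) = c p'" "d (c p') = loc n p w"
      by force
    then show ?thesis
      unfolding p'(2) using dc[OF p'(1)] by simp
  qed
  have run0: "run A v 0 = c (loc n h v)" if v: "v \<in> dotted_words n r" for v
  proof -
    obtain i w where iw: "v = i # w" "i \<in> dots r" "w \<in> W"
      using v by (auto simp: dotted_words_def)
    show ?thesis
    proof (cases "w = []")
      case True
      then show ?thesis
        using iw A(4) by simp
    next
      case False
      have "run A w (c (loc n h [i])) = c (loc n (loc n h [i]) w)"
        by (rule runS) (use dotS[OF iw(2)] iw(3) False in \<open>auto simp: S_def\<close>)
      then show ?thesis
        using loc_loc[OF hin[OF dotS[OF iw(2)]] iw(3)] iw(1) A(4) by simp
    qed
  qed
  have sm: "infinite_output A (c p) x" "state_map A (c p) x = p x" if "p \<in> S" "x \<in> C" for p x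
    using coherent_state_map[OF co imageI[OF that(1)] that(2)] dc[OF that(1)] by simp_all
  have sm0: "state_map A 0 x = h x" if x: "x \<in> ?D" for x
  proof -
    let ?i = "iprefix 1 x" and ?y = "idrop 1 x"
    have iy: "?i \<in> pre ?D" "?y \<in> C" "?i = [x 0]"
      using tail_spaceD[OF D(1) x, of 1] by (simp_all add: iprefix_def)
    have S: "loc n h ?i \<in> S"
      using iy(1) by (simp add: S_def)
    have "run A ?i 0 = c (loc n h ?i)" "outword A ?i 0 = lout n h ?i"
      using iy(3) A(4,5) by simp_all
    then have "state_map A 0 (iappend ?i ?y) = iappend (lout n h ?i) (loc n h ?i ?y)"
      using state_map_iappend[of A ?i 0 ?y] sm[OF S iy(2)] by simp
    also have "\<dots> = h (iappend ?i ?y)"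
      using lout_loc[OF hin[OF iy(1)] iy(2)] by simp
    finally show ?thesis
      by simp
  qed
  have letters: "letters_from n r A 0 = dots r" "letters_from n r A (c p) = alphabet n" for p
    by (simp_all add: letters_from_def A(2))
  have RmS: "Rm \<subseteq> S"
    by (auto simp: Rm_def)
  have crs: "c p \<in> rstates A \<longleftrightarrow> p \<in> Rm" if "p \<in> S" for p
  proof -
    have "p \<in> Rm" if "c p = c p'" "p' \<in> Rm" for p'
      using cinj[OF \<open>p \<in> S\<close> _ that(1)] that(2) RmS by blast
    then show ?thesis
      unfolding A(3) by auto
  qed
  have is_r: "is_rtransducer n r A"
    unfolding is_rtransducer_def
  proof (intro conjI)
    show "rstates A \<subseteq> states A"
      using A RmS by auto
    show "finite (rstates A)"
      using A(3) finite_subset[OF RmS fin] by simp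
    show "init A \<in> rstates A"
      using A by simp
    show "\<forall>q\<in>states A. \<forall>i\<in>letters_from n r A q. step A i q \<in> states A - {init A}"
    proof (intro ballI)
      fix q i assume q: "q \<in> states A" and i: "i \<in> letters_from n r A q"
      show "step A i q \<in> states A - {init A}"
      proof (cases "q = 0")
        case True
        then show ?thesis
          using i letters A c0 dotS by (auto simp: S_def)
      next
        case False
        then obtain p where "p \<in> S" "q = c p"
          using q A(1) by auto
        then show ?thesis
          using i letters A c0 Sloc dc by auto
      qed
    qed
    show "\<forall>q\<in>rstates A. \<forall>i\<in>letters_from n r A q.
        (step A i q \<in> rstates A \<longrightarrow> emit A i q = []) \<and>
        (step A i q \<notin> rstates A \<longrightarrow> emit A i q \<in> dotted_words n r)"
    proof (intro ballI)
      fix q i assume q: "q \<in> rstates A" and i: "i \<in> letters_from n r A q"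
      have "\<exists>v\<in>pre ?D. step A i q = c (loc n h v) \<and> emit A i q = lout n h v"
      proof (cases "q = 0")
        case True
        then show ?thesis
          using i letters A(4,5) dotS by auto
      next
        case False
        then obtain p where p: "p \<in> Rm" "q = c p"
          using q A(3) by auto
        then obtain v where v: "v \<in> pre ?D" "p = loc n h v"
          by (auto simp: Rm_def S_def)
        have iW: "[i] \<in> W"
          using i letters p(2) by simp
        have "lout n h v = []"
          using nil[OF v(1)] v(2) p(1) by simp
        then show ?thesis
          using loc_loc[OF hin[OF v(1)] iW] lout_append[OF hin[OF v(1)] iW] pre_append[OF v(1) iW]
            A(6,7) p v dc RmS by (intro bexI[of _ "v @ [i]"]) auto
      qed
      then obtain v where "v \<in> pre ?D" "step A i q = c (loc n h v)" "emit A i q = lout n h v"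
        by blast
      then show "(step A i q \<in> rstates A \<longrightarrow> emit A i q = []) \<and>
        (step A i q \<notin> rstates A \<longrightarrow> emit A i q \<in> dotted_words n r)"
        using crs[of "loc n h v"] nil lne by (auto simp: S_def)
    qed
    show "\<forall>q\<in>states A - rstates A. \<forall>i\<in>alphabet n.
        step A i q \<in> states A - rstates A \<and> emit A i q \<in> W"
    proof (intro ballI)
      fix q i assume q: "q \<in> states A - rstates A" and i: "i \<in> alphabet n"
      then obtain p where p: "p \<in> S" "p \<notin> Rm" "q = c p"
        using A(1,3) by auto
      then obtain v where v: "v \<in> pre ?D" "p = loc n h v"
        by (auto simp: S_def)
      have iW: "[i] \<in> W"
        using i by simp
      have vi: "v @ [i] \<in> pre ?D"
        by (rule pre_append[OF v(1) iW])
      have ne: "lout n h v \<noteq> []"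
        using nil[OF v(1)] v(2) p(2) by simp
      have l: "lout n h (v @ [i]) = lout n h v @ lout n p [i]"
        using lout_append[OF hin[OF v(1)] iW] v(2) by simp
      then have "loc n h (v @ [i]) \<notin> Rm"
        using nil[OF vi] ne by simp
      moreover have "loc n p [i] = loc n h (v @ [i])"
        using loc_loc[OF hin[OF v(1)] iW] v(2) by simp
      moreover have "lout n p [i] \<in> W"
      proof -
        have "lout n h v @ lout n p [i] \<in> pre ?D"
          using lne[OF vi] l ne D(2) by simp
        then show ?thesis
          by (rule pre_appendD(2)[OF D(1) _ ne])
      qed
      ultimately show "step A i q \<in> states A - rstates A \<and> emit A i q \<in> W"
        using A(1,6,7) p crs dc[OF p(1)] Sloc[OF p(1) iW] by auto
    qed
    show "\<forall>q\<in>states A - rstates A. \<forall>x\<in>C. infinite_output A q x"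
      using A(1,3) sm(1) by auto
    show "\<forall>q\<in>rstates A. \<forall>w. w \<noteq> [] \<and> readable n r A q w \<longrightarrow> run A w q \<noteq> q"
    proof (intro ballI allI impI, elim conjE, rule notI)
      fix q w assume q: "q \<in> rstates A" and w: "w \<noteq> []" "readable n r A q w" and e: "run A w q = q"
      show False
      proof (cases "q = 0")
        case True
        then have "w \<in> dotted_words n r"
          using w letters by (cases w) (auto simp: readable_def dotted_words_def)
        then show ?thesis
          using run0[of w] e True c0[of "loc n h w"] by simp
      next
        case False
        then obtain p where p: "p \<in> Rm" "q = c p"
          using q A(3) by auto
        then obtain v where v: "v \<in> pre ?D" "p = loc n h v"
          by (auto simp: Rm_def S_def)
        have pS: "p \<in> S"
          using p RmS by auto
        have wW: "w \<in> W"
          using w letters p(2) by (cases w) (auto simp: readable_def)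
        have lw: "loc n p w = p"
          using runS[OF pS wW w(1)] e p(2) cinj[OF Sloc[OF pS wW] pS] by simp
        \<comment> \<open>Going round a cycle at \<open>p\<close> repeatedly would give arbitrarily
          long words with local action \<open>p\<close> and hence with empty common prefix, against
          \<open>lout_long\<close>.\<close>
        have "\<exists>u\<in>pre ?D. j \<le> length u \<and> loc n h u = p" for j
        proof (induction j)
          case 0
          then show ?case
            using v by auto
        next
          case (Suc j)
          then obtain u where u: "u \<in> pre ?D" "j \<le> length u" "loc n h u = p"
            by blast
          have "loc n h (u @ w) = p"
            using loc_loc[OF hin[OF u(1)] wW] u(3) lw by simp
          moreover have "Suc j \<le> length (u @ w)"
            using u(2) w(1) by (cases w) auto
          ultimately show ?case
            using pre_append[OF u(1) wW] by blast
        qed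
        moreover obtain L where "\<forall>v\<in>pre ?D. L \<le> length v \<longrightarrow> 1 \<le> length (lout n h v)"
          using lout_long[OF D(1), of h 1] embD[OF h] by blast
        ultimately obtain u where "u \<in> pre ?D" "1 \<le> length (lout n h u)" "loc n h u = p"
          by blast
        then show False
          using nil p(1) by auto
      qed
    qed
  qed
  have min: "minimal_rtransducer n r A"
    unfolding minimal_rtransducer_def
  proof (intro conjI)
    show "is_rtransducer n r A"
      by (rule is_r)
    show "\<forall>q\<in>states A. \<exists>w. readable n r A (init A) w \<and> run A w (init A) = q"
    proof
      fix q assume "q \<in> states A"
      then consider "q = 0" | v where "v \<in> dotted_words n r" "q = c (loc n h v)"
        using A(1) D(2) by (auto simp: S_def)
      then show "\<exists>w. readable n r A (init A) w \<and> run A w (init A) = q"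
      proof cases
        case 1
        then show ?thesis
          using A(2) by (intro exI[of _ "[]"]) (simp add: readable_def)
      next
        case 2
        then have "readable n r A (init A) v"
          unfolding readable_def A(2) letters by (auto simp: dotted_words_def)
        then show ?thesis
          using run0[OF 2(1)] 2(2) A(2) by auto
      qed
    qed
    show "\<forall>q\<in>states A. \<forall>p\<in>states A. inputs_from n r A q = inputs_from n r A p \<and>
        (\<forall>x\<in>inputs_from n r A q. state_map A q x = state_map A p x) \<longrightarrow> q = p"
    proof (intro ballI impI, elim conjE)
      fix q p assume q: "q \<in> states A" and p: "p \<in> states A"
        and i: "inputs_from n r A q = inputs_from n r A p"
        and e: "\<forall>x\<in>inputs_from n r A q. state_map A q x = state_map A p x"
      have ne: "?D \<noteq> C"
        using CD C_nonempty by blast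
      show "q = p"
      proof (cases "q = 0 \<or> p = 0")
        case True
        then show ?thesis
          using i ne A(2) by (auto simp: inputs_from_def split: if_splits)
      next
        case False
        then obtain a b where ab: "a \<in> S" "q = c a" "b \<in> S" "p = c b"
          using q p A(1) by auto
        have "a x = b x" if "x \<in> C" for x
          using e that sm(2)[OF ab(1) that] sm(2)[OF ab(3) that] ab False A(2)
          by (simp add: inputs_from_def)
        then have "a = b"
          using Semb(3)[OF ab(1)] Semb(3)[OF ab(3)] by (intro extensionalityI[of a C b]) auto
        then show ?thesis
          using ab by simp
      qed
    qed
    show "\<forall>q\<in>states A. \<forall>i\<in>letters_from n r A q. is_greatest_common_prefix (emit A i q)
        {state_map A q (iappend [i] x) | x. x \<in> C}"
    proof (intro ballI)
      fix q i assume q: "q \<in> states A" and i: "i \<in> letters_from n r A q"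
      show "is_greatest_common_prefix (emit A i q) {state_map A q (iappend [i] x) | x. x \<in> C}"
      proof (cases "q = 0")
        case True
        then have i': "[i] \<in> pre ?D"
          using i letters dotS by simp
        have "{state_map A q (iappend [i] x) | x. x \<in> C} = {h (iappend [i] x) | x. x \<in> C}"
          unfolding Setcompr_eq_image True by (intro image_cong) (use sm0 preD(1)[OF i'] in auto)
        then show ?thesis
          using lout_gcp[OF hin[OF i']] True A(5) by simp
      next
        case False
        then obtain p where p: "p \<in> S" "q = c p"
          using q A(1) by auto
        then have i': "[i] \<in> W"
          using i letters by simp
        have "{state_map A q (iappend [i] x) | x. x \<in> C} = {p (iappend [i] x) | x. x \<in> C}"
          unfolding Setcompr_eq_image p(2) by (intro image_cong) (use sm(2)[OF p(1)] i' in auto)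
        then show ?thesis
          using lout_gcp[OF inj_cone_W[OF Semb(1)[OF p(1)] i']] p dc A(7) by simp
      qed
    qed
  qed
  then have for_h: "is_minimal_for n r A h"
    unfolding is_minimal_for_def using sm0 A(2) by simp
  obtain k where "sim_at ?D h ?D h k"
    using s by (auto simp: sim_def)
  then have "rsync_at n r A (Suc k)"
    by (rule sim_at_imp_rsync[OF for_h r])
  moreover have "finite (states A)"
    using A(1) fin by simp
  ultimately show ?thesis
    unfolding bisync_def using for_h by blast
qed

end



section \<open>Homeomorphisms\<close>

abbreviation (input) "topo n r \<equiv> cantor_nr_topology n r"

section \<open>Cylinder sets, compactness and uniform continuity\<close>

lemma openin_prefix_set: "openin (topo n r) {y \<in> cantor_nr n r. iprefix L y = iprefix L x}"
proof (induction L)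
  case 0
  then show ?case
    using openin_topspace[of "topo n r"] by (simp add: topspace_cantor_nr_topology)
next
  case (Suc L)
  let ?A = "if L = 0 then dots r else alphabet n"
  have "openin (topo n r) {y \<in> topspace (topo n r). y L \<in> {x L} \<inter> ?A}"
    unfolding cantor_nr_topology_def
    by (rule openin_continuous_map_preimage[OF continuous_map_product_projection]) auto
  moreover have "{y \<in> topspace (topo n r). y L \<in> {x L} \<inter> ?A} = {y \<in> cantor_nr n r. y L = x L}"
    unfolding topspace_cantor_nr_topology by (auto simp: cantor_nr_def)
  ultimately have "openin (topo n r) {y \<in> cantor_nr n r. y L = x L}"
    by simp
  then have "openin (topo n r) ({y \<in> cantor_nr n r. iprefix L y = iprefix L x} \<inter>
      {y \<in> cantor_nr n r. y L = x L})"
    using Suc by (rule openin_Int[rotated])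
  moreover have "{y \<in> cantor_nr n r. iprefix L y = iprefix L x} \<inter> {y \<in> cantor_nr n r. y L = x L} =
      {y \<in> cantor_nr n r. iprefix (Suc L) y = iprefix (Suc L) x}"
    by (auto simp: iprefix_Suc)
  ultimately show ?case
    by simp
qed

lemma open_contains_prefix_set:
  assumes "openin (topo n r) S" "x \<in> S"
  shows "\<exists>L. \<forall>y\<in>cantor_nr n r. iprefix L y = iprefix L x \<longrightarrow> y \<in> S"
proof -
  let ?T = "\<lambda>k. discrete_topology (if k = (0::nat) then dots r else alphabet n)"
  obtain X where X: "x \<in> (\<Pi>\<^sub>E i\<in>UNIV. X i)" "finite {i. X i \<noteq> topspace (?T i)}"
    "(\<Pi>\<^sub>E i\<in>UNIV. X i) \<subseteq> S"
    using product_topology_open_contains_basis[OF assms[unfolded cantor_nr_topology_def]] by blast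
  obtain L where L: "\<forall>i\<in>{i. X i \<noteq> topspace (?T i)}. i < L"
    using X(2) finite_nat_set_iff_bounded by blast
  have "y \<in> S" if y: "y \<in> cantor_nr n r" "iprefix L y = iprefix L x" for y
  proof -
    have "y i \<in> X i" for i
    proof (cases "i < L")
      case True
      then have "y i = x i"
        using y(2) by (simp add: iprefix_eq_iff)
      then show ?thesis
        using X(1) by (auto simp: PiE_iff)
    next
      case False
      then have "X i = topspace (?T i)"
        using L by blast
      then show ?thesis
        using y(1) by (auto simp: cantor_nr_def)
    qed
    then show ?thesis
      using X(3) by (auto simp: PiE_iff)
  qed
  then show ?thesis
    by blast
qed

lemma compact_space_cantor_nr: "compact_space (topo n r)"
  unfolding cantor_nr_topology_def
  by (auto simp: compact_space_product_topology compact_space_discrete_topology dots_def alphabet_def)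

lemma Hausdorff_space_cantor_nr: "Hausdorff_space (topo n r)"
  unfolding cantor_nr_topology_def by (simp add: Hausdorff_space_product_topology)

text \<open>The usual compactness argument: every point has a cylinder on which \<open>m\<close>
  output letters are constant, finitely many of these cover the space, and the largest of their
  lengths works uniformly.\<close>

lemma continuous_map_imp_uc:
  assumes "continuous_map (topo n r) (topo n r) h"
  shows "uc (cantor_nr n r) h"
  unfolding uc_def
proof
  fix m
  let ?D = "cantor_nr n r"
  have "\<forall>x\<in>?D. \<exists>L. \<forall>y\<in>?D. iprefix L y = iprefix L x \<longrightarrow> iprefix m (h y) = iprefix m (h x)"
  proof
    fix x assume x: "x \<in> ?D"
    have "openin (topo n r) {y \<in> topspace (topo n r).
        h y \<in> {z \<in> ?D. iprefix m z = iprefix m (h x)}}"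
      by (rule openin_continuous_map_preimage[OF assms openin_prefix_set])
    moreover have "h x \<in> ?D"
      using assms x by (auto simp: continuous_map_def topspace_cantor_nr_topology)
    ultimately obtain L where "\<forall>y\<in>?D. iprefix L y = iprefix L x \<longrightarrow>
        y \<in> {y \<in> topspace (topo n r). h y \<in> {z \<in> ?D. iprefix m z = iprefix m (h x)}}"
      using open_contains_prefix_set[of n r "{y \<in> topspace (topo n r).
        h y \<in> {z \<in> ?D. iprefix m z = iprefix m (h x)}}" x] x
      unfolding topspace_cantor_nr_topology by blast
    then show "\<exists>L. \<forall>y\<in>?D. iprefix L y = iprefix L x \<longrightarrow> iprefix m (h y) = iprefix m (h x)"
      by blast
  qed
  from bchoice[OF this] obtain l where "\<forall>x\<in>?D. \<forall>y\<in>?D. iprefix (l x) y = iprefix (l x) x \<longrightarrow>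
      iprefix m (h y) = iprefix m (h x)" ..
  then have l: "\<And>x y. x \<in> ?D \<Longrightarrow> y \<in> ?D \<Longrightarrow> iprefix (l x) y = iprefix (l x) x \<Longrightarrow>
      iprefix m (h y) = iprefix m (h x)"
    by blast
  define U where "U x = {y \<in> ?D. iprefix (l x) y = iprefix (l x) x}" for x
  have "\<forall>V\<in>U ` ?D. openin (topo n r) V"
    unfolding U_def using openin_prefix_set by blast
  moreover have "\<Union> (U ` ?D) = topspace (topo n r)"
    unfolding topspace_cantor_nr_topology by (auto simp: U_def)
  ultimately have "\<exists>F. finite F \<and> F \<subseteq> U ` ?D \<and> \<Union>F = topspace (topo n r)"
    by (intro compact_space_cantor_nr[of n r, unfolded compact_space, THEN spec, THEN mp] conjI)
  then obtain F where F: "finite F" "F \<subseteq> U ` ?D" "\<Union>F = ?D"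
    unfolding topspace_cantor_nr_topology by (elim exE conjE)
  then obtain E where E: "finite E" "E \<subseteq> ?D" "F = U ` E"
    using finite_subset_image[OF F(1,2)] by (elim exE conjE)
  obtain L where L: "\<forall>x\<in>E. l x \<le> L"
    using finite_imageI[OF E(1), of l] unfolding finite_nat_set_iff_bounded_le by blast
  have "iprefix m (h y) = iprefix m (h z)" if yz: "y \<in> ?D" "z \<in> ?D" "iprefix L y = iprefix L z" for y z
  proof -
    obtain x where x: "x \<in> E" "y \<in> U x"
      using F(3) E(3) yz(1) by blast
    have "iprefix (l x) y = iprefix (l x) z"
      using iprefix_mono[OF yz(3)] L x(1) by blast
    then have "z \<in> U x"
      using x(2) yz(2) by (simp add: U_def)
    then show ?thesis
      using l[of x y] l[of x z] x E(2) yz by (auto simp: U_def)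
  qed
  then show "\<exists>L. \<forall>x\<in>?D. \<forall>y\<in>?D. iprefix L x = iprefix L y \<longrightarrow> iprefix m (h x) = iprefix m (h y)"
    by blast
qed

lemma uc_imp_continuous_map:
  assumes "h ` cantor_nr n r \<subseteq> cantor_nr n r" "uc (cantor_nr n r) h"
  shows "continuous_map (topo n r) (topo n r) h"
proof -
  let ?D = "cantor_nr n r"
  let ?A = "\<lambda>k. if k = (0::nat) then dots r else alphabet n"
  have "continuous_map (topo n r) (discrete_topology (?A k)) (\<lambda>x. h x k)" for k
    unfolding continuous_map_def
  proof (intro conjI allI impI)
    show "(\<lambda>x. h x k) \<in> topspace (topo n r) \<rightarrow> topspace (discrete_topology (?A k))"
      using assms(1) unfolding topspace_cantor_nr_topology by (auto simp: cantor_nr_def)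
    fix U
    obtain L where L: "\<forall>x\<in>?D. \<forall>y\<in>?D. iprefix L x = iprefix L y \<longrightarrow>
        iprefix (Suc k) (h x) = iprefix (Suc k) (h y)"
      using assms(2) unfolding uc_def by blast
    show "openin (topo n r) {x \<in> topspace (topo n r). h x k \<in> U}"
    proof (subst openin_subopen, intro ballI)
      fix x assume "x \<in> {x \<in> topspace (topo n r). h x k \<in> U}"
      then have xD: "x \<in> ?D" "h x k \<in> U"
        by (simp_all add: topspace_cantor_nr_topology)
      have e: "h y k = h x k" if "y \<in> ?D" "iprefix L y = iprefix L x" for y
      proof -
        have "iprefix (Suc k) (h y) = iprefix (Suc k) (h x)"
          using L that xD(1) by blast
        then show ?thesis
          by (simp add: iprefix_Suc)
      qed
      show "\<exists>T. openin (topo n r) T \<and> x \<in> T \<and> T \<subseteq> {x \<in> topspace (topo n r). h x k \<in> U}"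
      proof (intro exI conjI)
        show "openin (topo n r) {y \<in> ?D. iprefix L y = iprefix L x}"
          by (rule openin_prefix_set)
        show "{y \<in> ?D. iprefix L y = iprefix L x} \<subseteq> {x \<in> topspace (topo n r). h x k \<in> U}"
          unfolding topspace_cantor_nr_topology using e xD(2) by auto
      qed (use xD(1) in simp)
    qed
  qed
  then show ?thesis
    unfolding cantor_nr_topology_def[of n r] continuous_map_componentwise_UNIV
    unfolding cantor_nr_topology_def[symmetric] by blast
qed

text \<open>A continuous bijection from a compact space to a Hausdorff space is a homeomorphism, so
  the inverse needs no separate condition.\<close>

lemma homeomorphic_map_iff_uc:
  "homeomorphic_map (topo n r) (topo n r) h \<longleftrightarrow>
     bij_betw h (cantor_nr n r) (cantor_nr n r) \<and> uc (cantor_nr n r) h"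
proof
  assume "homeomorphic_map (topo n r) (topo n r) h"
  then show "bij_betw h (cantor_nr n r) (cantor_nr n r) \<and> uc (cantor_nr n r) h"
    using continuous_map_imp_uc
    by (auto simp: homeomorphic_eq_everything_map bij_betw_def topspace_cantor_nr_topology)
next
  assume a: "bij_betw h (cantor_nr n r) (cantor_nr n r) \<and> uc (cantor_nr n r) h"
  then have "continuous_map (topo n r) (topo n r) h"
    by (intro uc_imp_continuous_map) (auto simp: bij_betw_def)
  then show "homeomorphic_map (topo n r) (topo n r) h"
    by (rule continuous_imp_homeomorphic_map[OF _ compact_space_cantor_nr Hausdorff_space_cantor_nr])
      (use a in \<open>auto simp: bij_betw_def topspace_cantor_nr_topology\<close>)
qed

lemma uc_inv_into:
  assumes "bij_betw h (cantor_nr n r) (cantor_nr n r)" "uc (cantor_nr n r) h"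
  shows "uc (cantor_nr n r) (inv_into (cantor_nr n r) h)"
proof -
  have "homeomorphic_map (topo n r) (topo n r) h"
    using assms by (simp add: homeomorphic_map_iff_uc)
  then obtain g where "homeomorphic_maps (topo n r) (topo n r) h g"
    unfolding homeomorphic_map_maps by blast
  then have g: "continuous_map (topo n r) (topo n r) g" "\<And>x. x \<in> cantor_nr n r \<Longrightarrow> g (h x) = x"
    by (auto simp: homeomorphic_maps_def topspace_cantor_nr_topology)
  have "inv_into (cantor_nr n r) h y = g y" if y: "y \<in> cantor_nr n r" for y
  proof -
    obtain x where "x \<in> cantor_nr n r" "y = h x"
      using y assms(1) by (auto simp: bij_betw_def)
    then show ?thesis
      using g(2) bij_betw_inv_into_left[OF assms(1)] by simp
  qed
  then show ?thesis
    using uc_cong[OF continuous_map_imp_uc[OF g(1)]] by blast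
qed

context alph
begin

lemma bij_emb:
  assumes "1 \<le> r" "bij_betw h (cantor_nr n r) (cantor_nr n r)" "uc (cantor_nr n r) h"
  shows "emb (cantor_nr n r) (cantor_nr n r) h"
  using assms tail_space_cantor_nr[OF assms(1)] by (auto simp: emb_def bij_betw_def)

lemma bij_emb_inv:
  assumes "1 \<le> r" "bij_betw h (cantor_nr n r) (cantor_nr n r)" "uc (cantor_nr n r) h"
  shows "emb (cantor_nr n r) (cantor_nr n r) (inv_into (cantor_nr n r) h)"
  by (rule bij_emb[OF assms(1) bij_betw_inv_into[OF assms(2)] uc_inv_into[OF assms(2,3)]])

text \<open>This removes transducers from the description of \<open>B_nr\<close>: afterwards
  membership is a property of the local actions of \<open>h\<close> and its inverse.\<close>

lemma B_nr_iff:
  assumes r: "1 \<le> r"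
  shows "h \<in> B_nr n r \<longleftrightarrow> bij_betw h (cantor_nr n r) (cantor_nr n r) \<and> uc (cantor_nr n r) h \<and>
     sim (cantor_nr n r) h (cantor_nr n r) h \<and>
     sim (cantor_nr n r) (inv_into (cantor_nr n r) h) (cantor_nr n r) (inv_into (cantor_nr n r) h)"
    (is "_ \<longleftrightarrow> ?b \<and> ?u \<and> ?s \<and> ?si")
proof -
  have "bisync n r h \<longleftrightarrow> ?s" "bisync n r (inv_into (cantor_nr n r) h) \<longleftrightarrow> ?si" if b: ?b and u: ?u
    using bisyncI[OF bij_emb[OF r b u] r] bisyncI[OF bij_emb_inv[OF r b u] r]
      bisync_imp_sim[OF embD(3)[OF bij_emb[OF r b u]] _ r]
      bisync_imp_sim[OF embD(3)[OF bij_emb_inv[OF r b u]] _ r] by blast+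
  then show ?thesis
    unfolding B_nr_def mem_Collect_eq homeomorphic_map_iff_uc by blast
qed

lemma B_nrD:
  assumes "h \<in> B_nr n r" "1 \<le> r"
  shows "bij_betw h (cantor_nr n r) (cantor_nr n r)" "emb (cantor_nr n r) (cantor_nr n r) h"
    "sim (cantor_nr n r) h (cantor_nr n r) h"
    "emb (cantor_nr n r) (cantor_nr n r) (inv_into (cantor_nr n r) h)"
    "sim (cantor_nr n r) (inv_into (cantor_nr n r) h) (cantor_nr n r) (inv_into (cantor_nr n r) h)"
proof -
  note a = assms(1)[unfolded B_nr_iff[OF assms(2)]]
  show b: "bij_betw h (cantor_nr n r) (cantor_nr n r)"
    by (rule a[THEN conjunct1])
  have u: "uc (cantor_nr n r) h"
    by (rule a[THEN conjunct2, THEN conjunct1])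
  show "emb (cantor_nr n r) (cantor_nr n r) h"
    "emb (cantor_nr n r) (cantor_nr n r) (inv_into (cantor_nr n r) h)"
    by (rule bij_emb[OF assms(2) b u], rule bij_emb_inv[OF assms(2) b u])
  show "sim (cantor_nr n r) h (cantor_nr n r) h"
    "sim (cantor_nr n r) (inv_into (cantor_nr n r) h) (cantor_nr n r) (inv_into (cantor_nr n r) h)"
    by (rule a[THEN conjunct2, THEN conjunct2, THEN conjunct1],
        rule a[THEN conjunct2, THEN conjunct2, THEN conjunct2])
qed

lemma Core_core_class:
  assumes "h \<in> B_nr n r" "1 \<le> r"
  shows "Core n r h = core_class (cantor_nr n r) h" "Core n r h \<noteq> {}"
proof -
  have "bisync n r h"
    using assms(1) by (simp add: B_nr_def)
  from Core_eq_core_class[OF embD(3)[OF B_nrD(2)[OF assms]] this assms(2)]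
    Core_nonempty[OF embD(3)[OF B_nrD(2)[OF assms]] this assms(2)]
  show "Core n r h = core_class (cantor_nr n r) h" "Core n r h \<noteq> {}" by auto
qed

lemma core_class_eq:
  "sim D f E g \<Longrightarrow> tail_space D \<Longrightarrow> tail_space E \<Longrightarrow> core_class D f = core_class E g"
  by (simp add: core_class_def core_maps_eq)

lemma B_nr_comp:
  assumes h1: "h1 \<in> B_nr n r" and h2: "h2 \<in> B_nr n r" and r: "1 \<le> r"
  shows "(\<lambda>x. h2 (h1 x)) \<in> B_nr n r"
  unfolding B_nr_iff[OF r]
proof (intro conjI)
  let ?D = "cantor_nr n r"
  let ?h = "\<lambda>x. h2 (h1 x)" and ?g = "\<lambda>x. inv_into ?D h1 (inv_into ?D h2 x)"
  note d1 = B_nrD[OF h1 r] and d2 = B_nrD[OF h2 r]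
  show b: "bij_betw ?h ?D ?D"
    using bij_betw_trans[OF d1(1) d2(1)] by (simp add: comp_def)
  show "uc ?D ?h"
    by (rule embD(4)[OF emb_comp[OF d1(2) d2(2)]])
  show "sim ?D ?h ?D ?h"
    by (rule sim_comp[OF d1(2) d1(2) d2(2) d2(2) d1(3) d2(3)])
  have s: "sim ?D ?g ?D ?g"
    by (rule sim_comp[OF d2(4) d2(4) d1(4) d1(4) d2(5) d1(5)])
  have inv: "inv_into ?D ?h y = ?g y" if y: "y \<in> ?D" for y
  proof -
    have "?g y \<in> ?D"
      using emb_in[OF d1(4)] emb_in[OF d2(4)] y by blast
    moreover have "?h (?g y) = y"
      using bij_betw_inv_into_right[OF d1(1)] bij_betw_inv_into_right[OF d2(1)]
        emb_in[OF d2(4)] y by simp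
    ultimately show ?thesis
      using bij_betw_inv_into_left[OF b] by metis
  qed
  show "sim ?D (inv_into ?D ?h) ?D (inv_into ?D ?h)"
    by (rule sim_cong[OF s inv inv])
qed

lemma B_nr_inv:
  assumes h: "h \<in> B_nr n r" and r: "1 \<le> r"
  shows "inv_into (cantor_nr n r) h \<in> B_nr n r"
  unfolding B_nr_iff[OF r]
proof (intro conjI)
  let ?D = "cantor_nr n r"
  let ?g = "inv_into ?D h"
  note d = B_nrD[OF h r]
  show b: "bij_betw ?g ?D ?D"
    by (rule bij_betw_inv_into[OF d(1)])
  show "uc ?D ?g"
    by (rule embD(4)[OF d(4)])
  show "sim ?D ?g ?D ?g"
    by (rule d(5))
  have inv: "inv_into ?D ?g x = h x" if x: "x \<in> ?D" for x
    using bij_betw_inv_into_left[OF b, of "h x"] bij_betw_inv_into_left[OF d(1) x]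
      emb_in[OF d(2) x] by simp
  show "sim ?D (inv_into ?D ?g) ?D (inv_into ?D ?g)"
    by (rule sim_cong[OF d(3) inv inv])
qed

section \<open>Products of cores\<close>

text \<open>Reading \<open>w\<close> and then \<open>i\<close> is reading the first letter and then
  a word of the same length as \<open>w\<close>, which forces a core state again.\<close>

lemma core_step_closed:
  assumes M: "is_transducer n M" and p: "p \<in> states (core n M)" and i: "i \<in> alphabet n"
  shows "step (core n M) i p \<in> states (core n M)"
proof -
  obtain w q where w: "w \<in> words n (min_sync_level n M)" "q \<in> states M" "p = run M w q"
    using p by (auto simp: core_def)
  obtain c w' where cw: "w @ [i] = c # w'"
    by (metis append_Cons append_Nil neq_Nil_conv)
  have "c # w' \<in> W"
    unfolding cw[symmetric] using w(1) i by (simp add: words_def)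
  moreover have "length (c # w') = Suc (length w)"
    unfolding cw[symmetric] by simp
  ultimately have "c \<in> alphabet n" "w' \<in> words n (min_sync_level n M)"
    using w(1) by (simp_all add: words_def)
  moreover have "step M i p = run M w' (step M c q)"
    using arg_cong[OF cw, of "\<lambda>w. run M w q"] w(3) by (simp add: run_append)
  moreover have "step (core n M) = step M"
    by (simp add: core_def)
  ultimately show ?thesis
    using is_transducerD(1)[OF M w(2)] by (auto simp: core_def)
qed

lemma core_product_core_class:
  assumes h1: "emb D D h1" "sim D h1 D h1" "core_class D h1 \<noteq> {}"
    and h2: "emb D D h2" "sim D h2 D h2" "core_class D h2 \<noteq> {}"
  shows "core_product n (core_class D h1) (core_class D h2) = core_class D (\<lambda>x. h2 (h1 x))"
proof -
  let ?h = "\<lambda>x. h2 (h1 x)"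
  let ?P = "\<lambda>M :: nat transducer. \<exists>T\<in>core_class D h1. \<exists>T'\<in>core_class D h2. \<exists>q\<in>states T. \<exists>q'\<in>states T'.
    \<exists>q0. minimal_transducer n M q0 \<and> (\<forall>x\<in>C. state_map M q0 x = state_map T' q' (state_map T q x))"
  note D = embD(1)[OF h1(1)]
  \<comment> \<open>Core states are related by \<open>sim\<close> to the maps they come from, and
    \<open>sim\<close> is compatible with composition.\<close>
  have mid: "emb C C (\<lambda>x. p' (p x))" "sim C (\<lambda>x. p' (p x)) D ?h" "sim C (\<lambda>x. p' (p x)) C (\<lambda>x. p' (p x))"
    if p: "p \<in> core_maps D h1" "p' \<in> core_maps D h2" for p p'
  proof -
    note e = core_maps_emb(1)[OF h1(1) p(1)] core_maps_emb(1)[OF h2(1) p(2)]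
    show "emb C C (\<lambda>x. p' (p x))"
      by (rule emb_comp[OF e])
    show s: "sim C (\<lambda>x. p' (p x)) D ?h"
      by (rule sim_comp[OF e(1) h1(1) e(2) h2(1) core_maps_sim[OF h1(1,2) p(1)]
            core_maps_sim[OF h2(1,2) p(2)]])
    show "sim C (\<lambda>x. p' (p x)) C (\<lambda>x. p' (p x))"
      by (rule sim_trans[OF s sim_sym[OF s] D])
  qed
  have maps: "\<exists>p\<in>core_maps D f. \<forall>x\<in>C. state_map T q x = p x"
    if f: "emb D D f" and T: "T \<in> core_class D f" and q: "q \<in> states T" for f q and T :: "nat transducer"
  proof -
    obtain F where F: "coherent T F (states T)" "bij_betw F (states T) (core_maps D f)"
      using core_class_coherent[OF f T] by blast
    have "F q \<in> core_maps D f"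
      using F(2) q by (auto simp: bij_betw_def)
    then show ?thesis
      using coherent_state_map(2)[OF F(1) q] by blast
  qed
  have states: "\<exists>q. q \<in> states T" if f: "emb D D f" "sim D f D f" and T: "T \<in> core_class D f"
    for f and T :: "nat transducer"
  proof -
    obtain F where F: "bij_betw F (states T) (core_maps D f)"
      using core_class_coherent[OF f(1) T] by blast
    then show ?thesis
      using core_maps_nonempty[OF f(2) D] by (auto simp: bij_betw_def)
  qed
  have sm: "\<exists>p\<in>core_maps D h1. \<exists>p'\<in>core_maps D h2. \<forall>x\<in>C. state_map T' q' (state_map T q x) = p' (p x)"
    if T: "T \<in> core_class D h1" "T' \<in> core_class D h2" and q: "q \<in> states T" "q' \<in> states T'" for T T' q q'
  proof -
    obtain p where p: "p \<in> core_maps D h1" "\<forall>x\<in>C. state_map T q x = p x"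
      using maps[OF h1(1) T(1) q(1)] by blast
    obtain p' where p': "p' \<in> core_maps D h2" "\<forall>x\<in>C. state_map T' q' x = p' x"
      using maps[OF h2(1) T(2) q(2)] by blast
    have "state_map T' q' (state_map T q x) = p' (p x)" if "x \<in> C" for x
      using p(2) p'(2) that emb_in[OF core_maps_emb(1)[OF h1(1) p(1)] that] by simp
    then show ?thesis
      using p(1) p'(1) by blast
  qed
  have eq: "iso_class n (core n M) = core_class D ?h" if P: "?P M" for M
  proof -
    obtain T T' q q' q0 where T: "T \<in> core_class D h1" "T' \<in> core_class D h2" "q \<in> states T" "q' \<in> states T'"
      and M: "minimal_transducer n M q0" "\<forall>x\<in>C. state_map M q0 x = state_map T' q' (state_map T q x)"
      using P by blast
    obtain p p' where p: "p \<in> core_maps D h1" "p' \<in> core_maps D h2"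
      "\<forall>x\<in>C. state_map T' q' (state_map T q x) = p' (p x)"
      using sm[OF T] by blast
    have M': "\<forall>x\<in>C. state_map M q0 x = p' (p x)"
      using M(2) p(3) by simp
    have "isomorphic n (core n M) (core_transducer (core_maps C (\<lambda>x. p' (p x))))"
      by (rule minimal_transducer_core[OF M(1) M' mid(1,3)[OF p(1,2)]])
    then have "iso_class n (core n M) = core_class C (\<lambda>x. p' (p x))"
      unfolding core_class_def
      by (rule iso_class_eq) (rule core_step_closed[OF minimal_transducerD(1)[OF M(1)]])
    then show ?thesis
      using core_class_eq[OF mid(2)[OF p(1,2)] tail_space_C D] by simp
  qed
  have "\<exists>M. ?P M"
  proof -
    obtain T T' q q' where T: "T \<in> core_class D h1" "T' \<in> core_class D h2" "q \<in> states T" "q' \<in> states T'"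
      using h1(3) h2(3) states[OF h1(1,2)] states[OF h2(1,2)] by blast
    obtain p p' where p: "p \<in> core_maps D h1" "p' \<in> core_maps D h2"
      "\<forall>x\<in>C. state_map T' q' (state_map T q x) = p' (p x)"
      using sm[OF T] by blast
    obtain M :: "nat transducer" and q0 where "minimal_transducer n M q0" "\<forall>x\<in>C. state_map M q0 x = p' (p x)"
      using minimal_transducer_exists[OF mid(1,3)[OF p(1,2)]] by blast
    then show ?thesis
      using T p(3) by (metis (no_types, lifting))
  qed
  then have "{iso_class n (core n M) | M. ?P M} = {core_class D ?h}"
    using eq by blast
  then show ?thesis
    unfolding core_product_def by simp
qed

lemma Core_mult:
  assumes h1: "h1 \<in> B_nr n r" and h2: "h2 \<in> B_nr n r" and r: "1 \<le> r"
  shows "core_product n (Core n r h1) (Core n r h2) = Core n r (\<lambda>x. h2 (h1 x))"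
  using core_product_core_class[OF B_nrD(2,3)[OF h1 r] _ B_nrD(2,3)[OF h2 r]]
    Core_core_class[OF h1 r] Core_core_class[OF h2 r] Core_core_class(1)[OF B_nr_comp[OF h1 h2 r] r]
  by simp

lemma Core_cong:
  assumes "h \<in> B_nr n r" "g \<in> B_nr n r" "1 \<le> r" "\<And>x. x \<in> cantor_nr n r \<Longrightarrow> g x = h x"
  shows "Core n r g = Core n r h"
  using core_class_eq[OF sim_cong[OF B_nrD(3)[OF assms(1,3)] assms(4)], of h]
    Core_core_class(1)[OF assms(1,3)] Core_core_class(1)[OF assms(2,3)] tail_space_cantor_nr[OF assms(3)]
  by simp

lemma
  assumes r: "1 \<le> r"
  shows B_nr_id: "(\<lambda>x. x) \<in> B_nr n r"
    and Core_id: "Core n r (\<lambda>x. x) = iso_class n identity_transducer"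
proof -
  let ?D = "cantor_nr n r" and ?i = "\<lambda>x :: iword. x"
  have b: "bij_betw ?i ?D ?D"
    by (simp add: bij_betw_def inj_on_def)
  have u: "uc ?D ?i"
    unfolding uc_def by blast
  have inj: "inj_cone n ?i []"
    by (simp add: inj_cone_def inj_on_def)
  have "is_greatest_common_prefix [] {?i (iappend [] x) | x. x \<in> C}"
    unfolding is_greatest_common_prefix_def
  proof (intro conjI allI impI)
    fix v assume v: "\<forall>x\<in>{?i (iappend [] x) | x. x \<in> C}. iprefix (length v) x = v"
    \<comment> \<open>The constant sequences of \<open>0\<close> and of \<open>1\<close> already
      differ in their first letter.\<close>
    have "iprefix (length v) (\<lambda>_. Sym 0) = iprefix (length v) (\<lambda>_. Sym (Suc 0))"
      using v C_two(1,2) by simp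
    from spec[OF this[unfolded iprefix_eq_iff], of 0] have "length v = 0"
      by simp
    then show "length v \<le> length []"
      by simp
  qed simp
  then have l0: "lout n ?i [] = []"
    by (rule lout_eqI)
  have k0: "loc n ?i [] = restrict ?i C"
    unfolding loc_def l0 by (intro restrict_ext) (simp add: idrop_def)
  have lv: "lout n ?i v = v" "loc n ?i v = restrict ?i C" for v
    using lout_shift[of ?i v v ?i "[]"] loc_shift[of ?i v v ?i "[]"] inj l0 k0 by simp_all
  have s: "sim ?D ?i ?D ?i"
    unfolding sim_def sim_at_def lv by simp
  have inv: "inv_into ?D ?i x = x" if "x \<in> ?D" for x
    using inv_into_f_f[of ?i ?D x] that by (simp add: inj_on_def)
  show B: "?i \<in> B_nr n r"
    unfolding B_nr_iff[OF r] using b u s sim_cong[OF s inv inv] by blast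
  have K: "core_maps ?D ?i = {restrict ?i C}"
  proof -
    have "\<exists>v\<in>pre ?D. \<exists>w\<in>W. N \<le> length w" for N
      using pre_exists[OF tail_space_cantor_nr[OF r], of 0] words_exist[of N] by auto
    then show ?thesis
      unfolding core_maps_def lv by auto
  qed
  have e: "loc n (restrict ?i C) [i] = restrict ?i C" "lout n (restrict ?i C) [i] = [i]" if "i \<in> alphabet n" for i
    using loc_cong[of "restrict ?i C" "[i]" ?i] lv[of "[i]"] that by simp_all
  have "isomorphic n identity_transducer (core_transducer {restrict ?i C})"
    unfolding isomorphic_def
    by (intro exI[of _ "\<lambda>_. restrict ?i C"]) (simp add: identity_transducer_def bij_betw_def e)
  then have "iso_class n identity_transducer = iso_class n (core_transducer {restrict ?i C})"
    by (rule iso_class_eq) (simp add: identity_transducer_def)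
  then show "Core n r ?i = iso_class n identity_transducer"
    using Core_core_class(1)[OF B r] by (simp add: core_class_def K)
qed

end



section \<open>Counting cones modulo \<open>n - 1\<close>\<close>

context alph
begin

text \<open>A finite disjoint union of cones given by prefixes of length \<open>L\<close>, dotted or
  not.\<close>

definition clopen_at :: "nat \<Rightarrow> iword set \<Rightarrow> bool" where
  "clopen_at L A \<longleftrightarrow> finite (iprefix L ` A) \<and>
     (\<forall>x\<in>A. idrop L x \<in> C \<and> (\<forall>y\<in>C. iappend (iprefix L x) y \<in> A))"

text \<open>The residue is demanded at all large levels, so that counts of different sets can be
  compared or added at a common level.\<close>

definition cone_count :: "iword set \<Rightarrow> nat \<Rightarrow> bool" where
  "cone_count A s \<longleftrightarrow>
     (\<exists>L0. \<forall>L\<ge>L0. clopen_at L A \<and> [card (iprefix L ` A) = s] (mod (n - 1)))"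

lemma n_mult_cong: "[n * a = a] (mod (n - 1))"
proof -
  have "n * a = a + (n - 1) * a"
    using n2 by (cases n) auto
  then show ?thesis
    by (simp add: cong_def)
qed

lemma n_power_mult_cong: "[n ^ k * a = a] (mod (n - 1))"
proof (induction k)
  case (Suc k)
  have "[n * (n ^ k * a) = n ^ k * a] (mod (n - 1))"
    by (rule n_mult_cong)
  then show ?case
    using Suc cong_trans by (simp add: mult.assoc) blast
qed simp

text \<open>Each cone splits into its \<open>n\<close> children, and \<open>n\<close> is 1 modulo
  \<open>n - 1\<close>; this is the invariance behind the signature.\<close>

lemma clopen_at_Suc:
  assumes "clopen_at L A"
  shows "clopen_at (Suc L) A" "card (iprefix (Suc L) ` A) = n * card (iprefix L ` A)"
proof -
  have xL: "x L \<in> alphabet n" if "x \<in> A" for x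
  proof -
    have "idrop L x 0 \<in> alphabet n"
      using assms that unfolding clopen_at_def by (auto simp: cantor_n_def)
    then show ?thesis
      by (simp add: idrop_def)
  qed
  have eq: "iprefix (Suc L) ` A = (\<lambda>(v, c). v @ [c]) ` (iprefix L ` A \<times> alphabet n)"
  proof (intro equalityI subsetI)
    fix v assume "v \<in> iprefix (Suc L) ` A"
    then obtain x where "x \<in> A" "v = iprefix L x @ [x L]"
      by (auto simp: iprefix_Suc)
    then show "v \<in> (\<lambda>(v, c). v @ [c]) ` (iprefix L ` A \<times> alphabet n)"
      using xL by (intro image_eqI[of _ _ "(iprefix L x, x L)"]) auto
  next
    fix v assume "v \<in> (\<lambda>(v, c). v @ [c]) ` (iprefix L ` A \<times> alphabet n)"
    then obtain x i where x: "x \<in> A" "i < n" "v = iprefix L x @ [Sym i]"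
      by (auto simp: alphabet_def)
    let ?y = "iappend (iprefix L x) (\<lambda>_. Sym i)"
    have "?y \<in> A"
      using assms x const_in_C[of i] unfolding clopen_at_def by blast
    moreover have "iprefix (Suc L) ?y = v"
      unfolding x(3) iprefix_Suc using iprefix_length_iappend[of "iprefix L x" "\<lambda>_. Sym i"]
      by (simp add: iappend_def)
    ultimately show "v \<in> iprefix (Suc L) ` A"
      by blast
  qed
  have ca: "finite (alphabet n)" "card (alphabet n) = n"
    by (simp_all add: alphabet_def card_image inj_on_def)
  have "inj_on (\<lambda>(v, c). v @ [c]) (iprefix L ` A \<times> alphabet n)"
    by (auto simp: inj_on_def)
  then show "card (iprefix (Suc L) ` A) = n * card (iprefix L ` A)"
    unfolding eq using ca by (simp add: card_image card_cartesian_product)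
  have "idrop (Suc L) x \<in> C \<and> (\<forall>y\<in>C. iappend (iprefix (Suc L) x) y \<in> A)" if x: "x \<in> A" for x
  proof (intro conjI ballI)
    have "idrop (Suc L) x = idrop 1 (idrop L x)"
      by (auto simp: idrop_def)
    then show "idrop (Suc L) x \<in> C"
      using assms x idrop_in_cantor_n unfolding clopen_at_def by metis
    fix y assume "y \<in> C"
    then have "iappend [x L] y \<in> C"
      using xL[OF x] by simp
    then have "iappend (iprefix L x) (iappend [x L] y) \<in> A"
      using assms x unfolding clopen_at_def by blast
    then show "iappend (iprefix (Suc L) x) y \<in> A"
      by (simp add: iprefix_Suc)
  qed
  moreover have "finite (iprefix (Suc L) ` A)"
    unfolding eq using assms ca by (simp add: clopen_at_def)
  ultimately show "clopen_at (Suc L) A"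
    by (simp add: clopen_at_def)
qed

lemma clopen_at_mono:
  assumes "clopen_at L A" "L \<le> L'"
  shows "clopen_at L' A \<and> [card (iprefix L' ` A) = card (iprefix L ` A)] (mod (n - 1))"
  using assms(2)
proof (induction L' rule: dec_induct)
  case base
  then show ?case
    using assms(1) by simp
next
  case (step k)
  then show ?case
    using clopen_at_Suc[of k A] n_mult_cong[of "card (iprefix k ` A)"] cong_trans by metis
qed

lemma cone_count_clopen: "clopen_at L A \<Longrightarrow> cone_count A (card (iprefix L ` A))"
  unfolding cone_count_def using clopen_at_mono by blast

lemma cone_count_unique:
  assumes "cone_count A s" "cone_count A t"
  shows "[s = t] (mod (n - 1))"
proof -
  obtain K where K: "\<forall>L\<ge>K. clopen_at L A \<and> [card (iprefix L ` A) = s] (mod (n - 1))"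
    using assms(1) unfolding cone_count_def by blast
  obtain J where J: "\<forall>L\<ge>J. clopen_at L A \<and> [card (iprefix L ` A) = t] (mod (n - 1))"
    using assms(2) unfolding cone_count_def by blast
  have "[card (iprefix (max K J) ` A) = s] (mod (n - 1))"
    "[card (iprefix (max K J) ` A) = t] (mod (n - 1))"
    using K J by auto
  then show ?thesis
    using cong_sym cong_trans by blast
qed

lemma cone_count_cong:
  assumes "cone_count A s" "[s = t] (mod (n - 1))"
  shows "cone_count A t"
  using assms cong_trans unfolding cone_count_def by blast

lemma cone_count_iappend:
  assumes "cone_count A s"
  shows "cone_count (iappend l ` A) s"
proof -
  obtain K where K: "\<forall>L\<ge>K. clopen_at L A \<and> [card (iprefix L ` A) = s] (mod (n - 1))"
    using assms(1) unfolding cone_count_def by blast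
  have "clopen_at L (iappend l ` A) \<and> [card (iprefix L ` iappend l ` A) = s] (mod (n - 1))"
    if L: "K + length l \<le> L" for L
  proof -
    define j where "j = L - length l"
    have j: "L = length l + j" "K \<le> j"
      using L by (simp_all add: j_def)
    have cl: "clopen_at j A" and ca: "[card (iprefix j ` A) = s] (mod (n - 1))"
      using K j(2) by auto
    have eq: "iprefix L ` iappend l ` A = (@) l ` iprefix j ` A"
      unfolding j(1) image_image by simp
    have "idrop L (iappend l x) \<in> C \<and> (\<forall>y\<in>C. iappend (iprefix L (iappend l x)) y \<in> iappend l ` A)"
      if x: "x \<in> A" for x
    proof (intro conjI ballI)
      have "idrop L (iappend l x) = idrop j x"
        by (rule ext) (simp add: idrop_def iappend_def j)
      then show "idrop L (iappend l x) \<in> C"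
        using cl x by (simp add: clopen_at_def)
      fix y assume "y \<in> C"
      then have "iappend l (iappend (iprefix j x) y) \<in> iappend l ` A"
        using cl x unfolding clopen_at_def by blast
      then show "iappend (iprefix L (iappend l x)) y \<in> iappend l ` A"
        by (simp add: j(1))
    qed
    then have "clopen_at L (iappend l ` A)"
      using cl unfolding clopen_at_def eq by blast
    moreover have "card (iprefix L ` iappend l ` A) = card (iprefix j ` A)"
      unfolding eq by (rule card_image) (simp add: inj_on_def)
    ultimately show ?thesis
      using ca by simp
  qed
  then show ?thesis
    unfolding cone_count_def by blast
qed

lemma clopen_at_iappendD:
  assumes "clopen_at (length l + L) (iappend l ` A)"
  shows "clopen_at L A"
proof -
  have "(\<lambda>w. drop (length l) w) ` iprefix (length l + L) ` iappend l ` A = iprefix L ` A"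
    unfolding image_image by simp
  then have "finite (iprefix L ` A)"
    using assms unfolding clopen_at_def by (metis finite_imageI)
  moreover have "idrop L x \<in> C \<and> (\<forall>y\<in>C. iappend (iprefix L x) y \<in> A)" if x: "x \<in> A" for x
  proof -
    have a: "idrop (length l + L) (iappend l x) \<in> C"
      "\<forall>y\<in>C. iappend (iprefix (length l + L) (iappend l x)) y \<in> iappend l ` A"
      using assms x unfolding clopen_at_def by blast+
    have "idrop (length l + L) (iappend l x) = idrop L x"
      by (rule ext) (simp add: idrop_def iappend_def)
    moreover have "iappend (iprefix (length l + L) (iappend l x)) y = iappend l (iappend (iprefix L x) y)" for y
      by simp
    ultimately show ?thesis
      using a by (auto simp del: iappend_iappend)
  qed
  ultimately show ?thesis
    by (simp add: clopen_at_def)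
qed

lemma cone_count_Un:
  assumes "cone_count A s" "cone_count B t" "A \<inter> B = {}"
  shows "cone_count (A \<union> B) (s + t)"
proof -
  obtain K where K: "\<forall>L\<ge>K. clopen_at L A \<and> [card (iprefix L ` A) = s] (mod (n - 1))"
    using assms(1) unfolding cone_count_def by blast
  obtain J where J: "\<forall>L\<ge>J. clopen_at L B \<and> [card (iprefix L ` B) = t] (mod (n - 1))"
    using assms(2) unfolding cone_count_def by blast
  have "clopen_at L (A \<union> B) \<and> [card (iprefix L ` (A \<union> B)) = s + t] (mod (n - 1))"
    if L: "max K J \<le> L" for L
  proof -
    have a: "clopen_at L A" "[card (iprefix L ` A) = s] (mod (n - 1))"
      and b: "clopen_at L B" "[card (iprefix L ` B) = t] (mod (n - 1))"
      using K J L by auto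
    have "iprefix L x \<noteq> iprefix L y" if "x \<in> A" "y \<in> B" for x y
    proof
      assume "iprefix L x = iprefix L y"
      then have "iappend (iprefix L x) (idrop L y) = y"
        by simp
      then have "y \<in> A"
        using a(1) b(1) that unfolding clopen_at_def by metis
      then show False
        using assms(3) that by blast
    qed
    then have "iprefix L ` A \<inter> iprefix L ` B = {}"
      by blast
    then have "card (iprefix L ` (A \<union> B)) = card (iprefix L ` A) + card (iprefix L ` B)"
      unfolding image_Un using a(1) b(1) by (intro card_Un_disjoint) (auto simp: clopen_at_def)
    moreover have "clopen_at L (A \<union> B)"
      using a(1) b(1) unfolding clopen_at_def image_Un by auto
    ultimately show ?thesis
      using cong_add[OF a(2) b(2)] by simp
  qed
  then show ?thesis
    unfolding cone_count_def by blast
qed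

lemma cone_count_UN:
  assumes "finite I" "\<And>i. i \<in> I \<Longrightarrow> cone_count (A i) (s i)"
    "\<And>i j. i \<in> I \<Longrightarrow> j \<in> I \<Longrightarrow> i \<noteq> j \<Longrightarrow> A i \<inter> A j = {}"
  shows "cone_count (\<Union>i\<in>I. A i) (\<Sum>i\<in>I. s i)"
  using assms
proof (induction I)
  case empty
  then show ?case
    by (auto simp: cone_count_def clopen_at_def)
next
  case (insert i I)
  have "A i \<inter> (\<Union>i\<in>I. A i) = {}"
    using insert.prems(2)[of i] insert.hyps by blast
  then have "cone_count (A i \<union> (\<Union>i\<in>I. A i)) (s i + (\<Sum>i\<in>I. s i))"
    using insert by (intro cone_count_Un) auto
  then show ?case
    using insert.hyps by simp
qed

lemma cone_count_cone: "cone_count (iappend v ` C) 1"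
proof (rule cone_count_iappend)
  have "clopen_at 0 C"
    using C_nonempty by (simp add: clopen_at_def idrop_in_cantor_n image_constant_conv)
  from cone_count_clopen[OF this] show "cone_count C 1"
    using C_nonempty by (simp add: image_constant_conv)
qed

text \<open>The image of a cone is the image of the local action with a word prepended, which does
  not affect the count; injectivity keeps the pieces disjoint.\<close>

lemma cone_count_image:
  assumes g: "inj_on g A" and V: "finite V" "\<And>v. v \<in> V \<Longrightarrow> length v = l"
    and A: "A = (\<Union>v\<in>V. iappend v ` C)"
    and s: "\<And>v. v \<in> V \<Longrightarrow> cone_count (loc n g v ` C) (s v)"
  shows "cone_count (g ` A) (\<Sum>v\<in>V. s v)"
proof -
  have "cone_count (g ` iappend v ` C) (s v)" if v: "v \<in> V" for v
  proof -
    have "inj_cone n g v"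
      by (rule inj_on_cone[OF g]) (use v A in blast)
    then have "g ` iappend v ` C = iappend (lout n g v) ` loc n g v ` C"
      unfolding image_image using lout_loc by (intro image_cong) auto
    then show ?thesis
      using cone_count_iappend[OF s[OF v]] by simp
  qed
  moreover have "g ` iappend v ` C \<inter> g ` iappend w ` C = {}" if "v \<in> V" "w \<in> V" "v \<noteq> w" for v w
  proof -
    have "iappend v ` C \<inter> iappend w ` C = {}"
      using that V(2) iappend_eq_iff[of v w] by auto
    then show ?thesis
      using inj_on_image_Int[OF g, of "iappend v ` C" "iappend w ` C"] that A by blast
  qed
  ultimately have "cone_count (\<Union>v\<in>V. g ` iappend v ` C) (\<Sum>v\<in>V. s v)"
    by (rule cone_count_UN[OF V(1)])
  then show ?thesis
    by (simp add: A image_UN)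
qed

lemma C_eq_UN_words: "C = (\<Union>v\<in>words n l. iappend v ` C)"
proof (intro equalityI subsetI)
  fix x assume x: "x \<in> C"
  then have "iprefix l x \<in> words n l" "x \<in> iappend (iprefix l x) ` C"
    using iprefix_in_lists[OF x, of l] image_eqI[of x "iappend (iprefix l x)" "idrop l x" C]
      idrop_in_cantor_n[OF x] by (auto simp: words_def)
  then show "x \<in> (\<Union>v\<in>words n l. iappend v ` C)"
    by blast
qed (auto simp: words_def)

lemma clopen_at_eq_UN:
  assumes "clopen_at L A"
  shows "A = (\<Union>v\<in>iprefix L ` A. iappend v ` C)"
proof (intro equalityI subsetI)
  fix x assume "x \<in> A"
  then have "iprefix L x \<in> iprefix L ` A" "x \<in> iappend (iprefix L x) ` C"
    using assms image_eqI[of x "iappend (iprefix L x)" "idrop L x" C] by (auto simp: clopen_at_def)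
  then show "x \<in> (\<Union>v\<in>iprefix L ` A. iappend v ` C)"
    by blast
next
  fix x assume "x \<in> (\<Union>v\<in>iprefix L ` A. iappend v ` C)"
  then obtain y z where "y \<in> A" "z \<in> C" "x = iappend (iprefix L y) z"
    by blast
  then show "x \<in> A"
    using assms unfolding clopen_at_def by blast
qed

text \<open>The image of a cone under \<open>h\<close> is its preimage under the inverse, which
  decides \<open>length v\<close> letters after finitely many input letters.\<close>

lemma clopen_at_image_cone:
  assumes D: "tail_space D" and h: "bij_betw h D D" and hi: "uc D (inv_into D h)" and v: "v \<in> pre D"
  shows "\<exists>L\<ge>m. clopen_at L (h ` iappend v ` C)"
proof -
  obtain L' where L': "\<forall>x\<in>D. \<forall>y\<in>D. iprefix L' x = iprefix L' y \<longrightarrow>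
      iprefix (length v) (inv_into D h x) = iprefix (length v) (inv_into D h y)"
    using hi unfolding uc_def by blast
  \<comment> \<open>The summand \<open>m\<close> meets the required lower bound, and
    \<open>1\<close> makes prefixes of length \<open>L\<close> nonempty, as \<open>pre D\<close>
    requires.\<close>
  define L where "L = L' + m + 1"
  have L: "iprefix (length v) (inv_into D h x) = iprefix (length v) (inv_into D h y)"
    if "x \<in> D" "y \<in> D" "iprefix L x = iprefix L y" for x y
  proof -
    have "iprefix L' x = iprefix L' y"
      by (rule iprefix_mono[OF that(3)]) (simp add: L_def)
    then show ?thesis
      using L' that(1,2) by blast
  qed
  let ?A = "h ` iappend v ` C"
  have AD: "?A \<subseteq> D"
    using preD(1)[OF v] h by (auto simp: bij_betw_def)
  have px: "iprefix L x \<in> pre D" "idrop L x \<in> C" if "x \<in> D" for x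
    using tail_spaceD[OF D that, of L] by (simp_all add: L_def)
  have "iappend (iprefix L x) y \<in> ?A" if x: "x \<in> ?A" and y: "y \<in> C" for x y
  proof -
    let ?x = "iappend (iprefix L x) y"
    obtain z where z: "z \<in> C" "x = h (iappend v z)"
      using x by blast
    have xD: "x \<in> D" "?x \<in> D"
      using x AD preD(1)[OF px(1) y] by auto
    have "iprefix L ?x = iprefix L x"
      using iprefix_length_iappend[of "iprefix L x" y] by simp
    from L[OF xD(2,1) this] have "iprefix (length v) (inv_into D h ?x) = v"
      using bij_betw_inv_into_left[OF h preD(1)[OF v z(1)]] z(2) by simp
    then obtain t where t: "inv_into D h ?x = iappend v t"
      unfolding iprefix_word_iff by blast
    have "inv_into D h ?x \<in> D"
      using bij_betw_inv_into[OF h] xD(2) by (auto simp: bij_betw_def)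
    then have "t \<in> C"
      using tail_space_iappendD(2)[OF D _ preD(2)[OF v]] t by simp
    moreover have "?x = h (iappend v t)"
      using bij_betw_inv_into_right[OF h xD(2)] t by simp
    ultimately show ?thesis
      by blast
  qed
  moreover have "iprefix L ` ?A \<subseteq> {w \<in> pre D. length w = L}"
    using AD px(1) by auto
  then have "finite (iprefix L ` ?A)"
    using finite_pre[OF D] finite_subset by blast
  ultimately have "clopen_at L ?A"
    using AD px(2) unfolding clopen_at_def by blast
  then show ?thesis
    by (intro exI[of _ L]) (simp add: L_def)
qed

text \<open>The residue \<open>s\<close> in \<open>core_count D h s\<close> is the reduced signature of the core of \<open>h\<close>.\<close>

definition core_count :: "iword set \<Rightarrow> (iword \<Rightarrow> iword) \<Rightarrow> nat \<Rightarrow> bool" where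
  "core_count D h s \<longleftrightarrow> (\<forall>g\<in>core_maps D h. cone_count (g ` C) s)"

lemma core_image_clopen:
  assumes D: "tail_space D" and h: "bij_betw h D D" "uc D (inv_into D h)" and g: "g \<in> core_maps D h"
  shows "\<exists>L. clopen_at L (g ` C)"
proof -
  obtain v w where vw: "v \<in> pre D" "w \<in> W" "0 \<le> length w" "g = loc n h (v @ w)"
    using g by (rule core_mapsE)
  have p: "v @ w \<in> pre D"
    by (rule pre_append[OF vw(1,2)])
  let ?l = "lout n h (v @ w)"
  have inj: "inj_cone n h (v @ w)"
    using inj_cone_pre[OF _ p] h(1) by (auto simp: bij_betw_def)
  \<comment> \<open>The level must be at least \<open>length ?l\<close>, so that the common prefix
    can be removed from the cones.\<close>
  obtain L where L: "length ?l \<le> L" "clopen_at L (h ` iappend (v @ w) ` C)"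
    using clopen_at_image_cone[OF D h p] by blast
  have "h ` iappend (v @ w) ` C = iappend ?l ` g ` C"
    unfolding image_image vw(4) using lout_loc[OF inj] by (intro image_cong) auto
  then have "clopen_at (length ?l + (L - length ?l)) (iappend ?l ` g ` C)"
    using L by simp
  then show ?thesis
    using clopen_at_iappendD by blast
qed

text \<open>Reading a word \<open>w\<close> of synchronizing length from any core state leads to the
  same core state. Hence the image of each core state is a disjoint union of pieces with the same
  counts \<open>t w\<close>, and the total does not depend on the state.\<close>

lemma core_count_exists:
  assumes h: "h \<in> B_nr n r" and r: "1 \<le> r"
  shows "\<exists>s. core_count (cantor_nr n r) h s"
proof -
  let ?D = "cantor_nr n r"
  note d = B_nrD[OF h r]
  note D = embD(1)[OF d(2)]
  obtain k where k: "sim_at ?D h ?D h k"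
    using d(3) by (auto simp: sim_def)
  obtain u where u: "u \<in> pre ?D"
    using pre_exists[OF D] by blast
  have "\<exists>t. cone_count (loc n h (u @ w) ` C) t" if w: "w \<in> words n k" for w
  proof -
    have "loc n h (u @ w) \<in> core_maps ?D h"
      by (rule loc_in_core_maps[OF k u]) (use w in \<open>auto simp: words_def\<close>)
    from core_image_clopen[OF D d(1) embD(4)[OF d(4)] this] show ?thesis
      using cone_count_clopen by blast
  qed
  then obtain t where t: "\<And>w. w \<in> words n k \<Longrightarrow> cone_count (loc n h (u @ w) ` C) (t w)"
    by metis
  have "cone_count (g ` C) (\<Sum>w\<in>words n k. t w)" if g: "g \<in> core_maps ?D h" for g
  proof (rule cone_count_image[OF embD(3)[OF core_maps_emb(1)[OF d(2) g]] finite_words _ C_eq_UN_words])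
    fix w assume w: "w \<in> words n k"
    then show "length w = k"
      by (simp add: words_def)
    obtain v w0 where vw: "v \<in> pre ?D" "w0 \<in> W" "0 \<le> length w0" "g = loc n h (v @ w0)"
      using g by (rule core_mapsE)
    have W: "w \<in> W" "k \<le> length w"
      using w by (auto simp: words_def)
    have p: "v @ w0 \<in> pre ?D"
      by (rule pre_append[OF vw(1,2)])
    have "loc n g w = loc n h ((v @ w0) @ w)"
      unfolding vw(4) by (rule loc_loc[OF emb_inj_cone[OF d(2) p] W(1)])
    also have "\<dots> = loc n h (u @ w)"
      by (rule sim_atD[OF k W p u])
    finally show "cone_count (loc n g w ` C) (t w)"
      using t[OF w] by simp
  qed
  then show ?thesis
    unfolding core_count_def by blast
qed

text \<open>The image of a composite of core states is counted twice: as the image under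
  \<open>p\<close> of about \<open>s1\<close> cones contributing \<open>s2\<close> each, and as the
  images of a power of \<open>n\<close> many cones contributing \<open>s\<close> each.\<close>

lemma core_count_comp:
  assumes h1: "h1 \<in> B_nr n r" and h2: "h2 \<in> B_nr n r" and r: "1 \<le> r"
    and s1: "core_count (cantor_nr n r) h1 s1" and s2: "core_count (cantor_nr n r) h2 s2"
    and s: "core_count (cantor_nr n r) (\<lambda>x. h2 (h1 x)) s"
  shows "[s = s1 * s2] (mod (n - 1))"
proof -
  let ?D = "cantor_nr n r" and ?h = "\<lambda>x. h2 (h1 x)"
  note d1 = B_nrD[OF h1 r] and d2 = B_nrD[OF h2 r]
  note D = embD(1)[OF d1(2)]
  obtain q where q: "q \<in> core_maps ?D h1"
    using core_maps_nonempty[OF d1(3) D] by blast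
  obtain p where p: "p \<in> core_maps ?D h2"
    using core_maps_nonempty[OF d2(3) D] by blast
  note eq = core_maps_emb(1)[OF d1(2) q] and ep = core_maps_emb(1)[OF d2(2) p]
  let ?f = "\<lambda>x. p (q x)"
  have ef: "emb C C ?f"
    by (rule emb_comp[OF eq ep])
  have sf: "sim C ?f ?D ?h"
    by (rule sim_comp[OF eq d1(2) ep d2(2) core_maps_sim[OF d1(2,3) q] core_maps_sim[OF d2(2,3) p]])
  obtain L where L: "clopen_at L (q ` C)" "[card (iprefix L ` q ` C) = s1] (mod (n - 1))"
    using s1 q unfolding core_count_def cone_count_def by blast
  have qC: "q ` C \<subseteq> C"
    by (rule embD(5)[OF eq])
  have "cone_count (p ` (q ` C)) (\<Sum>v\<in>iprefix L ` q ` C. s2)"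
  proof (rule cone_count_image[OF _ _ _ clopen_at_eq_UN[OF L(1)]])
    show "inj_on p (q ` C)"
      using inj_on_subset[OF embD(3)[OF ep] qC] .
    show "finite (iprefix L ` q ` C)"
      using L(1) by (simp add: clopen_at_def)
    show "length v = L" if "v \<in> iprefix L ` q ` C" for v
      using that by auto
    show "cone_count (loc n p v ` C) s2" if v: "v \<in> iprefix L ` q ` C" for v
    proof -
      have "v \<in> W"
        using v qC iprefix_in_lists by blast
      from core_maps_emb(4)[OF d2(2) p this] show ?thesis
        using s2 by (simp add: core_count_def)
    qed
  qed
  then have c1: "cone_count (?f ` C) (card (iprefix L ` q ` C) * s2)"
    by (simp add: image_image)
  obtain k where k: "sim_at C ?f C ?f k"
    using sim_trans[OF sf sim_sym[OF sf] D] by (auto simp: sim_def)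
  \<comment> \<open>The local actions at long words are core maps of the composite, although the map
    itself need not be one. The extra letter again gives a nonempty first word.\<close>
  have "cone_count (?f ` C) (\<Sum>w\<in>words n (Suc k). s)"
  proof (rule cone_count_image[OF embD(3)[OF ef] finite_words _ C_eq_UN_words])
    fix w assume w: "w \<in> words n (Suc k)"
    then show "length w = Suc k"
      by (simp add: words_def)
    obtain c w' where cw: "w = [c] @ w'" "c \<in> alphabet n" "w' \<in> W" "k \<le> length w'"
      using w by (cases w) (auto simp: words_def)
    have "loc n ?f w \<in> core_maps C ?f"
      unfolding cw(1) by (rule loc_in_core_maps[OF k _ cw(3,4)]) (use cw(2) pre_C in auto)
    then have "loc n ?f w \<in> core_maps ?D ?h"
      using core_maps_eq[OF sf tail_space_C D] by simp
    then show "cone_count (loc n ?f w ` C) s"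
      using s by (simp add: core_count_def)
  qed
  then have "cone_count (?f ` C) (n ^ Suc k * s)"
    by (simp add: card_words)
  then have "cone_count (?f ` C) s"
    using n_power_mult_cong cone_count_cong by blast
  from cone_count_unique[OF this c1] show ?thesis
    using cong_scalar_right[OF L(2)] cong_trans by blast
qed

section \<open>The count of the dotted space and its relation to the signature\<close>

lemma pre_level_eq:
  assumes "tail_space D" "1 \<le> l"
  shows "{v \<in> pre D. length v = l} = iprefix l ` D" "clopen_at l D"
proof -
  show eq: "{v \<in> pre D. length v = l} = iprefix l ` D"
  proof (intro equalityI subsetI)
    fix v assume v: "v \<in> {v \<in> pre D. length v = l}"
    then have "iappend v (\<lambda>_. Sym 0) \<in> D"
      using preD(1) C_two(1) by blast
    then show "v \<in> iprefix l ` D"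
      using v by (intro image_eqI[of _ _ "iappend v (\<lambda>_. Sym 0)"]) auto
  qed (use tail_spaceD(1)[OF assms(1) _ assms(2)] in auto)
  have "finite (iprefix l ` D)"
    unfolding eq[symmetric] by (rule finite_pre[OF assms(1)])
  then show "clopen_at l D"
    unfolding clopen_at_def using tail_spaceD[OF assms(1) _ assms(2)] preD(1) by blast
qed

lemma cone_count_cantor_nr:
  assumes r: "1 \<le> r"
  shows "cone_count (cantor_nr n r) r"
proof -
  have "{v \<in> pre (cantor_nr n r). length v = 1} = (\<lambda>a. [Dot a]) ` {..<r}"
    unfolding pre_cantor_nr[OF r] by (auto simp: dotted_words_def dots_def)
  moreover have "card ((\<lambda>a. [Dot a]) ` {..<r}) = r"
    by (subst card_image) (auto simp: inj_on_def)
  ultimately show ?thesis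
    using cone_count_clopen[OF pre_level_eq(2)[OF tail_space_cantor_nr[OF r], of 1]]
      pre_level_eq(1)[OF tail_space_cantor_nr[OF r], of 1] by simp
qed

text \<open>The space consists of \<open>r\<close> cones modulo \<open>n - 1\<close>, each of which
  is spread by a core state over \<open>s\<close> cones, and the images fill the space
  again.\<close>

lemma core_count_index:
  assumes h: "h \<in> B_nr n r" and r: "1 \<le> r" and s: "core_count (cantor_nr n r) h s"
  shows "[r * s = r] (mod (n - 1))"
proof -
  let ?D = "cantor_nr n r"
  note d = B_nrD[OF h r]
  note D = embD(1)[OF d(2)]
  obtain k where k: "sim_at ?D h ?D h k"
    using d(3) by (auto simp: sim_def)
  let ?V = "iprefix (Suc k) ` ?D"
  have V: "?V = {v \<in> pre ?D. length v = Suc k}" "clopen_at (Suc k) ?D"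
    using pre_level_eq[OF D, of "Suc k"] by simp_all
  have "cone_count (h ` ?D) (\<Sum>v\<in>?V. s)"
  proof (rule cone_count_image[OF embD(3)[OF d(2)] _ _ clopen_at_eq_UN[OF V(2)]])
    show "finite ?V"
      using V(2) by (simp add: clopen_at_def)
    fix v assume v: "v \<in> ?V"
    then show "length v = Suc k"
      by auto
    then obtain c w where cw: "v = [c] @ w" "length w = k"
      by (auto simp: length_Suc_conv)
    have "[c] \<in> pre ?D" "w \<in> W"
      using pre_appendD[OF D, of "[c]" w] v V(1) cw(1) by auto
    then have "loc n h v \<in> core_maps ?D h"
      unfolding cw(1) by (intro loc_in_core_maps[OF k]) (use cw(2) in auto)
    then show "cone_count (loc n h v ` C) s"
      using s by (simp add: core_count_def)
  qed
  moreover have "h ` ?D = ?D"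
    using d(1) by (simp add: bij_betw_def)
  ultimately have "cone_count ?D (card ?V * s)"
    by simp
  then have "[card ?V * s = r] (mod (n - 1))"
    using cone_count_unique cone_count_cantor_nr[OF r] by blast
  moreover have "[card ?V = r] (mod (n - 1))"
    using cone_count_unique[OF cone_count_clopen[OF V(2)] cone_count_cantor_nr[OF r]] .
  ultimately show ?thesis
    using cong_scalar_right[of "card ?V" r "n - 1" s] cong_sym cong_trans by blast
qed

lemma cone_eq: "v \<in> W \<Longrightarrow> cone n v = iappend v ` C"
proof -
  assume v: "v \<in> W"
  have "x \<in> cone n v \<longleftrightarrow> x \<in> iappend v ` C" for x
    unfolding cone_def using iprefix_word_iff[of v x] v by auto
  then show ?thesis
    by blast
qed

text \<open>A cover by the least number of cones is automatically disjoint, so its size is a count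
  in the sense of \<open>cone_count\<close>.\<close>

lemma Least_cones_cong:
  assumes A: "A \<subseteq> C" and s: "cone_count A s"
  shows "[(LEAST m. \<exists>V. V \<subseteq> W \<and> finite V \<and> card V = m \<and> (\<Union>v\<in>V. cone n v) = A) = s] (mod (n - 1))"
proof -
  let ?P = "\<lambda>m. \<exists>V. V \<subseteq> W \<and> finite V \<and> card V = m \<and> (\<Union>v\<in>V. cone n v) = A"
  obtain L where L: "clopen_at L A"
    using s unfolding cone_count_def by blast
  have sub: "iprefix L ` A \<subseteq> W"
    using A iprefix_in_lists by blast
  have "(\<Union>v\<in>iprefix L ` A. cone n v) = (\<Union>v\<in>iprefix L ` A. iappend v ` C)"
    by (intro SUP_cong refl cone_eq) (use sub in blast)
  then have "(\<Union>v\<in>iprefix L ` A. cone n v) = A"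
    using clopen_at_eq_UN[OF L] by simp
  then have "?P (card (iprefix L ` A))"
    using sub L unfolding clopen_at_def by blast
  then have "?P (LEAST m. ?P m)"
    by (rule LeastI)
  then obtain V where V: "V \<subseteq> W" "finite V" "card V = (LEAST m. ?P m)" "(\<Union>v\<in>V. cone n v) = A"
    by blast
  have disj: "cone n v \<inter> cone n w = {}" if vw: "v \<in> V" "w \<in> V" "v \<noteq> w" for v w
  proof (rule ccontr)
    assume "cone n v \<inter> cone n w \<noteq> {}"
    then obtain x where x: "x \<in> cone n v" "x \<in> cone n w"
      by blast
    \<comment> \<open>If two cones meet, the one of the longer word lies inside the other and could
      be dropped from the cover.\<close>
    have *: False if ab: "a \<in> V" "b \<in> V" "a \<noteq> b" "x \<in> cone n a" "x \<in> cone n b" "length a \<le> length b" for a b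
    proof -
      have "iprefix (length a) x = a" "iprefix (length b) x = b"
        using ab by (auto simp: cone_def)
      then obtain t where t: "b = a @ t"
        using iprefix_append_word[of b x a] ab(6) by blast
      have abW: "a @ t \<in> W" "a \<in> W"
        using ab V(1) t by auto
      have sub: "cone n b \<subseteq> cone n a"
        unfolding t cone_eq[OF abW(1)] cone_eq[OF abW(2)] using abW(1)
        by (auto simp flip: iappend_iappend)
      have "(\<Union>v\<in>V. cone n v) = cone n b \<union> (\<Union>v\<in>V - {b}. cone n v)"
        using ab(2) by blast
      moreover have "cone n b \<subseteq> (\<Union>v\<in>V - {b}. cone n v)"
        using sub ab(1,3) by blast
      ultimately have "(\<Union>v\<in>V - {b}. cone n v) = A"
        using V(4) by (simp add: Un_absorb1)
      then have "?P (card (V - {b}))"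
        using V(1,2) by (intro exI[of _ "V - {b}"]) auto
      then have "card V \<le> card (V - {b})"
        unfolding V(3) by (rule Least_le)
      then show False
        using V(2) ab(2) card_Diff1_less[of V b] by simp
    qed
    show False
      using *[of v w] *[of w v] vw x by (cases "length v \<le> length w") auto
  qed
  have "cone_count (cone n v) 1" if "v \<in> V" for v
    unfolding cone_eq[OF subsetD[OF V(1) that]] by (rule cone_count_cone)
  then have "cone_count (\<Union>v\<in>V. cone n v) (\<Sum>v\<in>V. 1)"
    by (rule cone_count_UN[OF V(2) _ disj])
  then have "cone_count A (card V)"
    using V(4) by simp
  from cone_count_unique[OF this s] show ?thesis
    unfolding V(3) .
qed

text \<open>The signature is a sum over a power of \<open>n\<close> many words with all terms
  congruent to \<open>s\<close>, so any synchronizing level would give the same residue.\<close>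

lemma reduced_sig_Core:
  assumes h: "h \<in> B_nr n r" and r: "1 \<le> r" and s: "core_count (cantor_nr n r) h s"
  shows "reduced_sig n (Core n r h) = s mod (n - 1)"
proof -
  let ?D = "cantor_nr n r"
  note d = B_nrD[OF h r]
  note D = embD(1)[OF d(2)]
  define T where "T = (SOME T. T \<in> Core n r h)"
  have "T \<in> Core n r h"
    unfolding T_def using Core_core_class(2)[OF h r] by (simp add: some_in_eq)
  then have "T \<in> core_class ?D h"
    using Core_core_class(1)[OF h r] by simp
  from core_class_coherent[OF d(2) this] obtain F where F: "coherent T F (states T)"
    "bij_betw F (states T) (core_maps ?D h)"
    by blast
  have FK: "F q \<in> core_maps ?D h" if "q \<in> states T" for q
    using F(2) that by (auto simp: bij_betw_def)
  have cn: "[cone_number n T q = s] (mod (n - 1))" if q: "q \<in> states T" for q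
  proof -
    have "state_image n T q = F q ` C"
      unfolding state_image_def by (intro image_cong refl coherent_state_map(2)[OF F(1) q])
    moreover have "F q ` C \<subseteq> C"
      by (rule embD(5)[OF core_maps_emb(1)[OF d(2) FK[OF q]]])
    moreover have "cone_count (F q ` C) s"
      using s FK[OF q] by (simp add: core_count_def)
    ultimately show ?thesis
      unfolding cone_number_def using Least_cones_cong by simp
  qed
  obtain k where k: "sim_at ?D h ?D h k"
    using d(3) by (auto simp: sim_def)
  have run: "run T w q \<in> states T" if "w \<in> W" "q \<in> states T" for w q
    using coherent_run[OF F(1) that(2,1)] by blast
  \<comment> \<open>The level \<open>Suc k\<close> ensures that \<open>w\<close> is nonempty, as
    needed for reading off labels by \<open>coherent_run\<close>.\<close>
  have "sync_at n T (Suc k)"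
    unfolding sync_at_def
  proof (intro ballI)
    fix w p q assume w: "w \<in> words n (Suc k)" and p: "p \<in> states T" and q: "q \<in> states T"
    have W: "w \<in> W" "w \<noteq> []" "k \<le> length w"
      using w by (auto simp: words_def)
    have e: "\<exists>v\<in>pre ?D. F q' = loc n h v" if q': "q' \<in> states T" for q'
    proof -
      obtain v t where "v \<in> pre ?D" "t \<in> W" "0 \<le> length t" "F q' = loc n h (v @ t)"
        using FK[OF q'] by (rule core_mapsE)
      then show ?thesis
        using pre_append by blast
    qed
    obtain u v where u: "u \<in> pre ?D" "F p = loc n h u" and v: "v \<in> pre ?D" "F q = loc n h v"
      using e[OF p] e[OF q] by blast
    have "F (run T w p) = loc n h (u @ w)"
      using coherent_run[OF F(1) p W(1)] W(2) u loc_loc[OF emb_inj_cone[OF d(2) u(1)] W(1)] by simp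
    moreover have "F (run T w q) = loc n h (v @ w)"
      using coherent_run[OF F(1) q W(1)] W(2) v loc_loc[OF emb_inj_cone[OF d(2) v(1)] W(1)] by simp
    ultimately have "F (run T w p) = F (run T w q)"
      using sim_atD[OF k W(1,3) u(1) v(1)] by simp
    then show "run T w p = run T w q"
      using inj_onD[OF bij_betw_imp_inj_on[OF F(2)]] run[OF W(1)] p q by blast
  qed
  then have sync: "sync_at n T (min_sync_level n T)"
    unfolding min_sync_level_def by (rule LeastI)
  have "states T \<noteq> {}"
    using F(2) core_maps_nonempty[OF d(3) D] by (auto simp: bij_betw_def)
  then obtain q0 where q0: "q0 \<in> states T"
    by blast
  have sy: "run T w p = run T w q0" if "w \<in> words n (min_sync_level n T)" "p \<in> states T" for w p
    by (rule bspec[OF bspec[OF bspec[OF sync[unfolded sync_at_def] that(1)] that(2)] q0])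
  have forced: "forced_state T w \<in> states T" if w: "w \<in> words n (min_sync_level n T)" for w
  proof -
    have "forced_state T w = run T w q0"
      unfolding forced_state_def
    proof (rule the_equality)
      show "\<forall>p\<in>states T. run T w p = run T w q0"
        by (intro ballI sy[OF w])
    qed (use q0 in auto)
    then show ?thesis
      using run[of w q0] w q0 by (simp add: words_def)
  qed
  have "[transducer_sig n T = (\<Sum>w\<in>words n (min_sync_level n T). s)] (mod (n - 1))"
    unfolding transducer_sig_def by (rule cong_sum, rule cn, rule forced)
  then have "[transducer_sig n T = n ^ min_sync_level n T * s] (mod (n - 1))"
    by (simp add: card_words)
  then have "[transducer_sig n T = s] (mod (n - 1))"
    using n_power_mult_cong cong_trans by blast
  then show ?thesis
    unfolding reduced_sig_def sig_def T_def cong_def .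
qed

end



section \<open>The lexicographic order and the relation \<open>glue\<close>\<close>

primrec dig :: "letter \<Rightarrow> nat" where
  "dig (Sym i) = i"
| "dig (Dot a) = a"

text \<open>The number with base \<open>m\<close> digits \<open>w\<close>. For words of equal length
  it encodes the lexicographic order, and adjacency of points becomes a difference of at most one at
  every level.\<close>

definition nval :: "nat \<Rightarrow> word \<Rightarrow> nat" where
  "nval m w = foldl (\<lambda>a c. a * m + dig c) 0 w"

lemma nval_Nil [simp]: "nval m [] = 0"
  by (simp add: nval_def)

lemma nval_snoc: "nval m (w @ [c]) = nval m w * m + dig c"
  by (simp add: nval_def)

lemma nval_append: "nval m (u @ v) = nval m u * m ^ length v + nval m v"
proof (induction v rule: rev_induct)
  case (snoc c v)
  have "nval m (u @ v @ [c]) = nval m (u @ v) * m + dig c"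
    using nval_snoc[of m "u @ v" c] by simp
  then show ?case
    using snoc by (simp add: nval_snoc algebra_simps)
qed simp

context alph
begin

abbreviation val :: "nat \<Rightarrow> iword \<Rightarrow> nat" where
  "val L x \<equiv> nval n (iprefix L x)"

definition lt :: "iword \<Rightarrow> iword \<Rightarrow> bool" where
  "lt x y \<longleftrightarrow> (\<exists>L. val L x < val L y)"

text \<open>The first letter is exempt: as the leading digit it may have any size, so dotted letters
  beyond \<open>n\<close> do no harm.\<close>

definition tailed :: "iword \<Rightarrow> bool" where
  "tailed x \<longleftrightarrow> (\<forall>k\<ge>1. x k \<in> alphabet n)"

text \<open>Since \<open>dig\<close> forgets whether a letter is dotted, totality of
  \<open>lt\<close> has to exclude confusing the two kinds.\<close>

definition same_kind :: "iword \<Rightarrow> iword \<Rightarrow> bool" where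
  "same_kind x y \<longleftrightarrow> (\<forall>k. dig (x k) = dig (y k) \<longrightarrow> x k = y k)"

lemma tailed_C: "x \<in> C \<Longrightarrow> tailed x"
  by (simp add: cantor_n_def tailed_def)

lemma tailed_cantor_nr: "x \<in> cantor_nr n r \<Longrightarrow> tailed x"
  by (simp add: cantor_nr_def tailed_def)

lemma same_kind_C: "x \<in> C \<Longrightarrow> y \<in> C \<Longrightarrow> same_kind x y"
  unfolding same_kind_def
proof (intro allI impI)
  fix k assume x: "x \<in> C" and y: "y \<in> C" and d: "dig (x k) = dig (y k)"
  then have "x k \<in> alphabet n" "y k \<in> alphabet n"
    by (auto simp: cantor_n_def)
  then show "x k = y k"
    using d by (auto simp: alphabet_def)
qed

lemma same_kind_cantor_nr: "x \<in> cantor_nr n r \<Longrightarrow> y \<in> cantor_nr n r \<Longrightarrow> same_kind x y"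
  unfolding same_kind_def
proof (intro allI impI)
  fix k assume x: "x \<in> cantor_nr n r" and y: "y \<in> cantor_nr n r" and d: "dig (x k) = dig (y k)"
  show "x k = y k"
  proof (cases "k = 0")
    case True
    then have "x k \<in> dots r" "y k \<in> dots r"
      using x y by (auto simp: cantor_nr_def)
    then show ?thesis
      using d by (auto simp: dots_def)
  next
    case False
    then have "x k \<in> alphabet n" "y k \<in> alphabet n"
      using x y by (auto simp: cantor_nr_def)
    then show ?thesis
      using d by (auto simp: alphabet_def)
  qed
qed

lemma dig_less: "c \<in> alphabet n \<Longrightarrow> dig c < n"
  by (auto simp: alphabet_def)

lemma val_Suc: "val (Suc L) x = val L x * n + dig (x L)"
  by (simp add: iprefix_Suc nval_snoc)

lemma nval_less: "w \<in> W \<Longrightarrow> nval n w < n ^ length w"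
proof (induction w rule: rev_induct)
  case (snoc c w)
  then have "nval n w + 1 \<le> n ^ length w" "dig c < n"
    by (auto intro: dig_less simp: Suc_le_eq)
  then have "nval n w * n + dig c < (nval n w + 1) * n" "(nval n w + 1) * n \<le> n ^ length w * n"
    by (simp_all only: mult_le_mono1) simp
  then show ?case
    by (simp add: nval_snoc mult.commute)
qed simp

lemma val_iappend: "val (length v + k) (iappend v x) = nval n v * n ^ k + val k x"
  by (simp add: nval_append)

lemma val_mono_step:
  assumes "a < b" "d < n"
  shows "a * n + d < b * n + e"
proof -
  have "a * n + d < (a + 1) * n"
    using assms(2) by simp
  also have "\<dots> \<le> b * n"
    using assms(1) by (intro mult_le_mono1) simp
  finally show ?thesis
    by simp
qed

lemma val_less_mono:
  assumes x: "tailed x" and l: "val L x < val L y" "L \<le> L'"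
  shows "val L' x < val L' y"
  using l(2)
proof (induction L' rule: dec_induct)
  case base
  show ?case by (rule l(1))
next
  case (step k)
  \<comment> \<open>A strict difference cannot occur at level 0, so all later digits are beyond the
    first one and below \<open>n\<close>.\<close>
  have "L \<noteq> 0"
    using l(1) by (intro notI) simp
  then have "dig (x k) < n"
    using x step.hyps(1) by (intro dig_less) (simp add: tailed_def)
  then show ?case
    unfolding val_Suc by (rule val_mono_step[OF step.IH])
qed

lemma lt_asym: "tailed x \<Longrightarrow> tailed y \<Longrightarrow> lt x y \<Longrightarrow> lt y x \<Longrightarrow> False"
proof -
  assume t: "tailed x" "tailed y" and a: "lt x y" "lt y x"
  obtain K where K: "val K x < val K y"
    using a(1) by (auto simp: lt_def)
  obtain L where L: "val L y < val L x"
    using a(2) by (auto simp: lt_def)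
  show False
    using val_less_mono[OF t(1) K, of "max K L"] val_less_mono[OF t(2) L, of "max K L"] by simp
qed

lemma lt_trans:
  assumes t: "tailed x" "tailed y" and a: "lt x y" "lt y z"
  shows "lt x z"
proof -
  obtain K where K: "val K x < val K y"
    using a(1) by (auto simp: lt_def)
  obtain L where L: "val L y < val L z"
    using a(2) by (auto simp: lt_def)
  have "val (max K L) x < val (max K L) z"
    using val_less_mono[OF t(1) K, of "max K L"] val_less_mono[OF t(2) L, of "max K L"] by simp
  then show ?thesis
    by (auto simp: lt_def)
qed

lemma val_le: "\<not> lt y x \<Longrightarrow> val L x \<le> val L y"
  by (auto simp: lt_def not_less)

lemma first_difference:
  assumes "x \<noteq> (y :: iword)"
  shows "\<exists>k. x k \<noteq> y k \<and> iprefix k x = iprefix k y"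
proof -
  obtain j where j: "x j \<noteq> y j"
    using assms by (auto simp: fun_eq_iff)
  define k where "k = (LEAST k. x k \<noteq> y k)"
  have "x k \<noteq> y k"
    unfolding k_def using j by (rule LeastI[where P = "\<lambda>k. x k \<noteq> y k"])
  moreover have "x i = y i" if "i < k" for i
    using not_less_Least[OF that[unfolded k_def]] by blast
  then have "iprefix k x = iprefix k y"
    unfolding iprefix_eq_iff by blast
  ultimately show ?thesis
    by blast
qed

lemma lt_total:
  assumes "same_kind x y" "x \<noteq> y"
  shows "lt x y \<or> lt y x"
proof -
  obtain k where k: "x k \<noteq> y k" "iprefix k x = iprefix k y"
    using first_difference[OF assms(2)] by blast
  then have "dig (x k) \<noteq> dig (y k)"
    using assms(1) by (auto simp: same_kind_def)
  then have "val (Suc k) x \<noteq> val (Suc k) y"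
    using k(2) by (simp add: val_Suc)
  then show ?thesis
    unfolding lt_def nat_neq_iff by blast
qed

lemma lt_irrefl: "\<not> lt x x"
  by (simp add: lt_def)

lemma lt_iappend: "lt (iappend v x) (iappend v y) \<longleftrightarrow> lt x y"
proof
  assume "lt (iappend v x) (iappend v y)"
  then obtain L where L: "val L (iappend v x) < val L (iappend v y)"
    by (auto simp: lt_def)
  have "length v \<le> L"
    using L by (intro leI notI) (simp add: iprefix_iappend_le)
  then obtain k where "L = length v + k"
    using le_Suc_ex by blast
  then have "val k x < val k y"
    using L unfolding val_iappend by (simp add: val_iappend del: iprefix_iappend_add)
  then show "lt x y"
    by (auto simp: lt_def)
next
  assume "lt x y"
  then obtain k where "val k x < val k y"
    by (auto simp: lt_def)
  then have "val (length v + k) (iappend v x) < val (length v + k) (iappend v y)"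
    unfolding val_iappend by simp
  then show "lt (iappend v x) (iappend v y)"
    unfolding lt_def by blast
qed

lemma lt_words: "length v = length w \<Longrightarrow> nval n v < nval n w \<Longrightarrow> lt (iappend v x) (iappend w y)"
  unfolding lt_def by (intro exI[of _ "length v"]) (metis iprefix_length_iappend)

section \<open>Constant tails and the two expansions of one number\<close>

lemma val_zero: "val k (\<lambda>_. Sym 0) = 0"
  by (induction k) (simp_all add: val_Suc)

lemma val_top: "val k (\<lambda>_. Sym (n - 1)) + 1 = n ^ k"
proof (induction k)
  case (Suc k)
  have "val (Suc k) (\<lambda>_. Sym (n - 1)) + 1 = (val k (\<lambda>_. Sym (n - 1)) + 1) * n"
    using n2 by (simp add: val_Suc algebra_simps)
  also have "\<dots> = n ^ Suc k"
    unfolding Suc by simp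
  finally show ?case .
qed simp

lemma zero_C: "(\<lambda>_. Sym 0) \<in> C" and top_C: "(\<lambda>_. Sym (n - 1)) \<in> C"
  using n2 by (auto intro: const_in_C)

lemma not_lt_zero: "\<not> lt x (\<lambda>_. Sym 0)"
  by (simp add: lt_def val_zero)

lemma not_top_lt: "x \<in> C \<Longrightarrow> \<not> lt (\<lambda>_. Sym (n - 1)) x"
proof
  assume x: "x \<in> C" and "lt (\<lambda>_. Sym (n - 1)) x"
  then obtain k where "val k (\<lambda>_. Sym (n - 1)) < val k x"
    by (auto simp: lt_def)
  moreover have "val k x < n ^ k"
    using nval_less[OF iprefix_in_lists[OF x, of k]] by simp
  ultimately show False
    using val_top[of k] by simp
qed

text \<open>These are two expansions of the same number in base \<open>n\<close>: truncations agree
  up to \<open>length w\<close> digits and differ by exactly one afterwards.\<close>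

lemma successor_val:
  assumes "dig c = dig c' + 1"
  shows "val L (iappend (w @ [c]) (\<lambda>_. Sym 0)) = val L (iappend (w @ [c']) (\<lambda>_. Sym (n - 1))) \<or>
         val L (iappend (w @ [c]) (\<lambda>_. Sym 0)) = val L (iappend (w @ [c']) (\<lambda>_. Sym (n - 1))) + 1"
proof (cases "L \<le> length w")
  case True
  then show ?thesis
    by (simp add: iprefix_iappend_le)
next
  case False
  then obtain k where k: "L = Suc (length w) + k"
    using le_Suc_ex by (metis Suc_leI not_le)
  have "val L (iappend (w @ [c]) (\<lambda>_. Sym 0)) = (nval n w * n + dig c) * n ^ k"
    using val_iappend[of "w @ [c]" k "\<lambda>_. Sym 0"] by (simp add: k val_zero nval_snoc)
  moreover have "val L (iappend (w @ [c']) (\<lambda>_. Sym (n - 1))) + 1 =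
      (nval n w * n + dig c') * n ^ k + n ^ k"
    using val_iappend[of "w @ [c']" k "\<lambda>_. Sym (n - 1)"] val_top[of k] by (simp add: k nval_snoc)
  ultimately show ?thesis
    using assms by (simp add: algebra_simps)
qed

text \<open>A point strictly between would push the values at least two apart at a deep enough
  level.\<close>

lemma not_between:
  assumes x: "tailed x" and z: "tailed z" and near: "\<And>L. val L y \<le> val L x + 1"
    and l: "lt x z" "lt z y"
  shows False
proof -
  obtain K where K: "val K x < val K z"
    using l(1) by (auto simp: lt_def)
  obtain L where L: "val L z < val L y"
    using l(2) by (auto simp: lt_def)
  show False
    using val_less_mono[OF x K, of "max K L"] val_less_mono[OF z L, of "max K L"] near[of "max K L"] by simp
qed

text \<open>Glued points are the jumps of the order together with the pair of its end points. The
  relation is a parameter in order to treat the reversed order as well.\<close>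

definition neighbours :: "iword set \<Rightarrow> (iword \<Rightarrow> iword \<Rightarrow> bool) \<Rightarrow> iword \<Rightarrow> iword \<Rightarrow> bool" where
  "neighbours D R x y \<longleftrightarrow> R x y \<and> \<not> (\<exists>z\<in>D. R x z \<and> R z y)"

definition extremes :: "iword set \<Rightarrow> (iword \<Rightarrow> iword \<Rightarrow> bool) \<Rightarrow> iword \<Rightarrow> iword \<Rightarrow> bool" where
  "extremes D R x y \<longleftrightarrow> (\<forall>z\<in>D. \<not> R z x) \<and> (\<forall>z\<in>D. \<not> R y z)"

lemma glued_pair_cases:
  assumes "glued_pair n r y x"
  shows "(lt x y \<and> (\<forall>L. val L y \<le> val L x + 1 \<and> val L x \<le> val L y)) \<or>
     (y = iappend [Dot 0] (\<lambda>_. Sym 0) \<and> x = iappend [Dot (r - 1)] (\<lambda>_. Sym (n - 1)))"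
proof -
  have *: "lt x y \<and> (\<forall>L. val L y \<le> val L x + 1 \<and> val L x \<le> val L y)"
    if "dig c = dig c' + 1" "y = iappend (w @ [c]) (\<lambda>_. Sym 0)" "x = iappend (w @ [c']) (\<lambda>_. Sym (n - 1))"
    for w c c'
  proof -
    have "nval n (w @ [c']) < nval n (w @ [c])"
      using that(1) by (simp add: nval_snoc)
    then have "lt x y"
      unfolding that(2,3) by (intro lt_words) simp_all
    moreover have "val L y \<le> val L x + 1 \<and> val L x \<le> val L y" for L
      unfolding that(2,3) using successor_val[OF that(1), of L w] by linarith
    ultimately show ?thesis
      by blast
  qed
  show ?thesis
    using assms
  proof cases
    case (1 w i)
    then show ?thesis
      using *[of "Sym i" "Sym (i - 1)" w] by simp
  next
    case (2 a)
    then show ?thesis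
      using *[of "Dot a" "Dot (a - 1)" "[]"] by simp
  qed simp
qed

lemma extremes_cantor_nr:
  assumes r: "1 \<le> r"
  shows "extremes (cantor_nr n r) lt (iappend [Dot 0] (\<lambda>_. Sym 0)) (iappend [Dot (r - 1)] (\<lambda>_. Sym (n - 1)))"
  unfolding extremes_def
proof (intro conjI ballI notI)
  fix z assume "lt z (iappend [Dot 0] (\<lambda>_. Sym 0))"
  moreover have "iappend [Dot 0] (\<lambda>_. Sym 0) k = (if k = 0 then Dot 0 else Sym 0)" for k
    by (simp add: iappend_def)
  then have "val k (iappend [Dot 0] (\<lambda>_. Sym 0)) = 0" for k
    by (induction k) (simp_all add: val_Suc)
  ultimately show False
    by (simp add: lt_def)
next
  fix z assume z: "z \<in> cantor_nr n r" and "lt (iappend [Dot (r - 1)] (\<lambda>_. Sym (n - 1))) z"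
  then obtain L where L: "val L (iappend [Dot (r - 1)] (\<lambda>_. Sym (n - 1))) < val L z"
    by (auto simp: lt_def)
  then have "L \<noteq> 0"
    by (intro notI) simp
  then obtain k where k: "L = length [Dot (r - 1)] + k"
    by (metis One_nat_def Suc_pred length_Cons list.size(3) neq0_conv plus_1_eq_Suc)
  let ?y = "idrop 1 z"
  have y: "?y \<in> C" "z = iappend [z 0] ?y"
    using tail_spaceD(2)[OF tail_space_cantor_nr[OF r] z, of 1] iappend_iprefix_idrop[of 1 z]
    by (simp_all add: iprefix_def)
  obtain a where a: "z 0 = Dot a" "a < r"
    using z by (auto simp: cantor_nr_def dots_def)
  have "val L z = a * n ^ k + val k ?y"
    using val_iappend[of "[z 0]" k ?y] y(2) a(1) k by (simp add: nval_def)
  moreover have "val k ?y + 1 \<le> n ^ k"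
    using nval_less[OF iprefix_in_lists[OF y(1), of k]] by simp
  moreover have "val L (iappend [Dot (r - 1)] (\<lambda>_. Sym (n - 1))) + 1 = (r - 1) * n ^ k + n ^ k"
    using val_iappend[of "[Dot (r - 1)]" k "\<lambda>_. Sym (n - 1)"] val_top[of k] k by (simp add: nval_def)
  moreover have "a * n ^ k \<le> (r - 1) * n ^ k"
    using a(2) by (intro mult_le_mono1) simp
  ultimately show False
    using L by linarith
qed

text \<open>At the first difference the digits must be consecutive, and the tails must be greatest
  and least; in every other case an explicit point lies between.\<close>

lemma neighbours_glued_pair:
  assumes r: "1 \<le> r" and x: "x \<in> cantor_nr n r" and y: "y \<in> cantor_nr n r"
    and nb: "neighbours (cantor_nr n r) lt x y"
  shows "glued_pair n r y x"
proof -
  let ?D = "cantor_nr n r"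
  have xy: "lt x y" and no: "\<And>z. z \<in> ?D \<Longrightarrow> lt x z \<Longrightarrow> lt z y \<Longrightarrow> False"
    using nb by (auto simp: neighbours_def)
  note D = tail_space_cantor_nr[OF r]
  have "x \<noteq> y"
    using xy lt_irrefl by blast
  then obtain k where k: "x k \<noteq> y k" "iprefix k x = iprefix k y"
    using first_difference by blast
  define w where "w = iprefix k x"
  have px: "iprefix (Suc k) x = w @ [x k]" and py: "iprefix (Suc k) y = w @ [y k]"
    using k(2) by (simp_all add: iprefix_Suc w_def)
  have pre: "w @ [x k] \<in> pre ?D" "w @ [y k] \<in> pre ?D"
    using tail_spaceD(1)[OF D x, of "Suc k"] tail_spaceD(1)[OF D y, of "Suc k"] px py by simp_all
  have "dig (x k) < dig (y k)"
  proof (rule ccontr)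
    assume "\<not> dig (x k) < dig (y k)"
    moreover have "dig (x k) \<noteq> dig (y k)"
      using same_kind_cantor_nr[OF x y] k(1) by (auto simp: same_kind_def)
    ultimately have "val (Suc k) y < val (Suc k) x"
      using k(2) by (simp add: val_Suc)
    then show False
      using lt_asym[OF tailed_cantor_nr[OF x] tailed_cantor_nr[OF y] xy] by (auto simp: lt_def)
  qed
  note d = this
  \<comment> \<open>Otherwise replacing the tail of \<open>x\<close> by the greatest one gives a
    point strictly between \<open>x\<close> and \<open>y\<close>.\<close>
  have tx: "idrop (Suc k) x = (\<lambda>_. Sym (n - 1))"
  proof (rule ccontr)
    assume ne: "idrop (Suc k) x \<noteq> (\<lambda>_. Sym (n - 1))"
    have C: "idrop (Suc k) x \<in> C"
      using tail_spaceD(2)[OF D x] by simp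
    have "lt (idrop (Suc k) x) (\<lambda>_. Sym (n - 1))"
      using lt_total[OF same_kind_C[OF C top_C] ne] not_top_lt[OF C] by blast
    then have "lt (iappend (w @ [x k]) (idrop (Suc k) x)) (iappend (w @ [x k]) (\<lambda>_. Sym (n - 1)))"
      unfolding lt_iappend .
    then have "lt x (iappend (w @ [x k]) (\<lambda>_. Sym (n - 1)))"
      unfolding px[symmetric] iappend_iprefix_idrop .
    moreover have "lt (iappend (w @ [x k]) (\<lambda>_. Sym (n - 1))) (iappend (w @ [y k]) (idrop (Suc k) y))"
      by (rule lt_words) (use d in \<open>simp_all add: nval_snoc\<close>)
    then have "lt (iappend (w @ [x k]) (\<lambda>_. Sym (n - 1))) y"
      unfolding py[symmetric] iappend_iprefix_idrop .
    ultimately show False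
      using no preD(1)[OF pre(1) top_C] by blast
  qed
  have ty: "idrop (Suc k) y = (\<lambda>_. Sym 0)"
  proof (rule ccontr)
    assume ne: "idrop (Suc k) y \<noteq> (\<lambda>_. Sym 0)"
    have C: "idrop (Suc k) y \<in> C"
      using tail_spaceD(2)[OF D y] by simp
    have "lt (\<lambda>_. Sym 0) (idrop (Suc k) y)"
      using lt_total[OF same_kind_C[OF C zero_C] ne] not_lt_zero by blast
    then have "lt (iappend (w @ [y k]) (\<lambda>_. Sym 0)) (iappend (w @ [y k]) (idrop (Suc k) y))"
      unfolding lt_iappend .
    then have "lt (iappend (w @ [y k]) (\<lambda>_. Sym 0)) y"
      unfolding py[symmetric] iappend_iprefix_idrop .
    moreover have "lt (iappend (w @ [x k]) (idrop (Suc k) x)) (iappend (w @ [y k]) (\<lambda>_. Sym 0))"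
      by (rule lt_words) (use d in \<open>simp_all add: nval_snoc\<close>)
    then have "lt x (iappend (w @ [y k]) (\<lambda>_. Sym 0))"
      unfolding px[symmetric] iappend_iprefix_idrop .
    ultimately show False
      using no preD(1)[OF pre(2) zero_C] by blast
  qed
  have xe: "x = iappend (w @ [x k]) (\<lambda>_. Sym (n - 1))" and ye: "y = iappend (w @ [y k]) (\<lambda>_. Sym 0)"
    using iappend_iprefix_idrop[of "Suc k" x] iappend_iprefix_idrop[of "Suc k" y] px py tx ty by simp_all
  have mid: False if c: "w @ [c] \<in> pre ?D" "dig (x k) < dig c" "dig c < dig (y k)" for c
  proof -
    have "lt x (iappend (w @ [c]) (\<lambda>_. Sym 0))"
      by (subst xe, rule lt_words) (use c in \<open>simp_all add: nval_snoc\<close>)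
    moreover have "lt (iappend (w @ [c]) (\<lambda>_. Sym 0)) y"
      by (subst ye, rule lt_words) (use c in \<open>simp_all add: nval_snoc\<close>)
    ultimately show False
      using no preD(1)[OF c(1) zero_C] by blast
  qed
  show ?thesis
  proof (cases "k = 0")
    case True
    then obtain a b where ab: "x k = Dot a" "y k = Dot b" "a < r" "b < r"
      using x y by (auto simp: cantor_nr_def dots_def)
    have w: "w = []"
      using True by (simp add: w_def)
    have "b = a + 1"
    proof (rule ccontr)
      assume "b \<noteq> a + 1"
      then have "a + 1 < b"
        using d ab by simp
      moreover have "w @ [Dot (a + 1)] \<in> pre ?D"
        unfolding pre_cantor_nr[OF r] w using calculation ab(4) by (simp add: dotted_words_def dots_def)
      ultimately show False
        using mid[of "Dot (a + 1)"] ab by simp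
    qed
    then have "glued_pair n r (iappend [Dot b] (\<lambda>_. Sym 0)) (iappend [Dot (b - 1)] (\<lambda>_. Sym (n - 1)))"
      using ab by (intro glued_pair.intros(2)) simp_all
    then show ?thesis
      using xe ye ab w \<open>b = a + 1\<close> by simp
  next
    case False
    have kx: "x k \<in> alphabet n" "y k \<in> alphabet n"
      using False x y by (auto simp: cantor_nr_def)
    then obtain a b where ab: "x k = Sym a" "y k = Sym b" "a < n" "b < n"
      by (auto simp: alphabet_def)
    have w: "w \<in> dotted_words n r" "w \<in> pre ?D"
      using tail_spaceD(1)[OF D x, of k] False unfolding pre_cantor_nr[OF r] by (simp_all add: w_def)
    have "b = a + 1"
    proof (rule ccontr)
      assume "b \<noteq> a + 1"
      then have "a + 1 < b"
        using d ab by simp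
      moreover have "w @ [Sym (a + 1)] \<in> pre ?D"
        by (rule pre_append[OF w(2)]) (use calculation ab(4) Sym_in in simp)
      ultimately show False
        using mid[of "Sym (a + 1)"] ab by simp
    qed
    then have "glued_pair n r (iappend (w @ [Sym b]) (\<lambda>_. Sym 0))
        (iappend (w @ [Sym (b - 1)]) (\<lambda>_. Sym (n - 1)))"
      using ab w(1) by (intro glued_pair.intros(1)) simp_all
    then show ?thesis
      using xe ye ab \<open>b = a + 1\<close> by simp
  qed
qed

lemma glued_pair_iff:
  assumes r: "1 \<le> r" and x: "x \<in> cantor_nr n r" and y: "y \<in> cantor_nr n r"
  shows "glued_pair n r y x \<longleftrightarrow> neighbours (cantor_nr n r) lt x y \<or> extremes (cantor_nr n r) lt y x"
proof
  let ?D = "cantor_nr n r"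
  let ?a = "iappend [Dot 0] (\<lambda>_. Sym 0)" and ?b = "iappend [Dot (r - 1)] (\<lambda>_. Sym (n - 1))"
  show "neighbours ?D lt x y \<or> extremes ?D lt y x" if "glued_pair n r y x"
    using glued_pair_cases[OF that]
  proof
    assume a: "lt x y \<and> (\<forall>L. val L y \<le> val L x + 1 \<and> val L x \<le> val L y)"
    have "\<not> (lt x z \<and> lt z y)" if "z \<in> ?D" for z
      using not_between[OF tailed_cantor_nr[OF x] tailed_cantor_nr[OF that]] a by blast
    then show ?thesis
      using a by (simp add: neighbours_def)
  next
    assume "y = ?a \<and> x = ?b"
    then show ?thesis
      using extremes_cantor_nr[OF r] by simp
  qed
  assume "neighbours ?D lt x y \<or> extremes ?D lt y x"
  then show "glued_pair n r y x"
  proof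
    assume "neighbours ?D lt x y"
    then show ?thesis
      by (rule neighbours_glued_pair[OF r x y])
  next
    assume e: "extremes ?D lt y x"
    have ab: "?a \<in> ?D" "?b \<in> ?D"
      using preD(1)[of "[Dot 0]" ?D, OF _ zero_C] preD(1)[of "[Dot (r - 1)]" ?D, OF _ top_C] r
      unfolding pre_cantor_nr[OF r] by (simp_all add: dotted_words_def dots_def)
    have "y = ?a"
    proof (rule ccontr)
      assume "y \<noteq> ?a"
      from lt_total[OF same_kind_cantor_nr[OF y ab(1)] this] show False
        using e extremes_cantor_nr[OF r] y ab(1) unfolding extremes_def by blast
    qed
    moreover have "x = ?b"
    proof (rule ccontr)
      assume "x \<noteq> ?b"
      from lt_total[OF same_kind_cantor_nr[OF x ab(2)] this] show False
        using e extremes_cantor_nr[OF r] x ab(2) unfolding extremes_def by blast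
    qed
    ultimately show ?thesis
      using glued_pair.intros(3) by simp
  qed
qed

text \<open>Symmetric in \<open>x\<close> and \<open>y\<close> and unchanged when the order is
  reversed, so order-reversing bijections preserve it too.\<close>

definition close :: "iword set \<Rightarrow> (iword \<Rightarrow> iword \<Rightarrow> bool) \<Rightarrow> iword \<Rightarrow> iword \<Rightarrow> bool" where
  "close D R x y \<longleftrightarrow> x = y \<or> neighbours D R x y \<or> neighbours D R y x \<or> extremes D R x y \<or> extremes D R y x"

lemma glue_iff:
  "1 \<le> r \<Longrightarrow> x \<in> cantor_nr n r \<Longrightarrow> y \<in> cantor_nr n r \<Longrightarrow> glue n r x y \<longleftrightarrow> close (cantor_nr n r) lt x y"
  unfolding glue_def close_def using glued_pair_iff[of r x y] glued_pair_iff[of r y x] by blast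

lemma close_converse: "close D (\<lambda>x y. R y x) x y \<longleftrightarrow> close D R x y"
  unfolding close_def neighbours_def extremes_def by blast

lemma close_bij:
  assumes h: "bij_betw h D D" and R: "\<And>x y. x \<in> D \<Longrightarrow> y \<in> D \<Longrightarrow> R x y \<longleftrightarrow> S (h x) (h y)"
    and x: "x \<in> D" and y: "y \<in> D"
  shows "close D R x y \<longleftrightarrow> close D S (h x) (h y)"
proof -
  have "h ` D = D"
    using h by (simp add: bij_betw_def)
  then have ball: "(\<forall>z\<in>D. P z) \<longleftrightarrow> (\<forall>z\<in>D. P (h z))" for P
    using ball_simps(9)[of h D P] by simp
  have hx: "h z \<in> D" if "z \<in> D" for z
    using h that by (auto simp: bij_betw_def)
  have nb: "neighbours D R u v \<longleftrightarrow> neighbours D S (h u) (h v)" if uv: "u \<in> D" "v \<in> D" for u v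
  proof -
    have "(\<forall>z\<in>D. \<not> (S (h u) z \<and> S z (h v))) \<longleftrightarrow> (\<forall>z\<in>D. \<not> (S (h u) (h z) \<and> S (h z) (h v)))"
      by (rule ball)
    also have "\<dots> \<longleftrightarrow> (\<forall>z\<in>D. \<not> (R u z \<and> R z v))"
      using R[OF uv(1)] R[OF _ uv(2)] by (intro ball_cong) simp_all
    finally show ?thesis
      unfolding neighbours_def using R[OF uv] by blast
  qed
  have ex: "extremes D R u v \<longleftrightarrow> extremes D S (h u) (h v)" if uv: "u \<in> D" "v \<in> D" for u v
  proof -
    have "(\<forall>z\<in>D. \<not> S z (h u)) \<longleftrightarrow> (\<forall>z\<in>D. \<not> R z u)"
      unfolding ball[of "\<lambda>z. \<not> S z (h u)"] using R[OF _ uv(1)] by (intro ball_cong) simp_all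
    moreover have "(\<forall>z\<in>D. \<not> S (h v) z) \<longleftrightarrow> (\<forall>z\<in>D. \<not> R v z)"
      unfolding ball[of "\<lambda>z. \<not> S (h v) z"] using R[OF uv(2)] by (intro ball_cong) simp_all
    ultimately show ?thesis
      unfolding extremes_def by blast
  qed
  have "x = y \<longleftrightarrow> h x = h y"
    using h x y by (auto simp: bij_betw_def dest: inj_onD)
  then show ?thesis
    unfolding close_def using nb[OF x y] nb[OF y x] ex[OF x y] ex[OF y x] by blast
qed

lemma monotone_preserves_glue:
  assumes r: "1 \<le> r" and h: "bij_betw h (cantor_nr n r) (cantor_nr n r)"
    and mono: "(\<forall>x\<in>cantor_nr n r. \<forall>y\<in>cantor_nr n r. lt x y \<longrightarrow> lt (h x) (h y)) \<or>
        (\<forall>x\<in>cantor_nr n r. \<forall>y\<in>cantor_nr n r. lt x y \<longrightarrow> lt (h y) (h x))"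
    and x: "x \<in> cantor_nr n r" and y: "y \<in> cantor_nr n r"
  shows "glue n r x y \<longleftrightarrow> glue n r (h x) (h y)"
proof -
  let ?D = "cantor_nr n r"
  have hD: "h z \<in> ?D" if "z \<in> ?D" for z
    using h that by (auto simp: bij_betw_def)
  have tot: "u = v \<or> lt u v \<or> lt v u" if "u \<in> ?D" "v \<in> ?D" for u v
    using lt_total[OF same_kind_cantor_nr[OF that]] by blast
  have asym: "\<not> (lt u v \<and> lt v u)" if "u \<in> ?D" "v \<in> ?D" for u v
    using lt_asym[OF tailed_cantor_nr[OF that(1)] tailed_cantor_nr[OF that(2)]] by blast
  have "close ?D lt x y \<longleftrightarrow> close ?D lt (h x) (h y)"
    using mono
  proof
    assume m: "\<forall>x\<in>?D. \<forall>y\<in>?D. lt x y \<longrightarrow> lt (h x) (h y)"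
    have e: "lt u v \<longleftrightarrow> lt (h u) (h v)" if "u \<in> ?D" "v \<in> ?D" for u v
      using bspec[OF bspec[OF m that(1)] that(2)] bspec[OF bspec[OF m that(2)] that(1)]
        tot[OF that] asym[OF hD[OF that(1)] hD[OF that(2)]] lt_irrefl[of "h u"] by metis
    show ?thesis
      by (rule close_bij[where R = lt and S = lt, OF h e x y])
  next
    assume m: "\<forall>x\<in>?D. \<forall>y\<in>?D. lt x y \<longrightarrow> lt (h y) (h x)"
    have e: "lt u v \<longleftrightarrow> lt (h v) (h u)" if "u \<in> ?D" "v \<in> ?D" for u v
      using bspec[OF bspec[OF m that(1)] that(2)] bspec[OF bspec[OF m that(2)] that(1)]
        tot[OF that] asym[OF hD[OF that(1)] hD[OF that(2)]] lt_irrefl[of "h u"] by metis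
    have "close ?D lt x y \<longleftrightarrow> close ?D (\<lambda>x y. lt y x) (h x) (h y)"
      by (rule close_bij[where R = lt and S = "\<lambda>x y. lt y x", OF h e x y])
    then show ?thesis
      by (simp only: close_converse[of ?D lt])
  qed
  then show ?thesis
    using glue_iff[OF r x y] glue_iff[OF r hD[OF x] hD[OF y]] by simp
qed

end



section \<open>Core states of glue-preserving homeomorphisms are monotone\<close>

context alph
begin

text \<open>The base \<open>n\<close> expansion with exactly \<open>L\<close> digits; it inverts
  \<open>nval\<close> on words of length \<open>L\<close>.\<close>

fun word_of :: "nat \<Rightarrow> nat \<Rightarrow> word" where
  "word_of 0 j = []"
| "word_of (Suc L) j = word_of L (j div n) @ [Sym (j mod n)]"

lemma word_of: "word_of L j \<in> W" "length (word_of L j) = L"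
  using n2 by (induction L arbitrary: j) (auto intro: Sym_in)

lemma nval_word_of: "j < n ^ L \<Longrightarrow> nval n (word_of L j) = j"
proof (induction L arbitrary: j)
  case (Suc L)
  have "j div n < n ^ L"
    using Suc.prems by (simp add: less_mult_imp_div_less mult.commute)
  then show ?case
    using Suc.IH by (simp add: nval_snoc)
qed simp

lemma nval_eq_imp_eq:
  assumes "length v = length w" "nval n v = nval n w"
    and t: "tailed (iappend v x)" "tailed (iappend w x)" "same_kind (iappend v x) (iappend w x)"
  shows "v = w"
proof (rule ccontr)
  assume "v \<noteq> w"
  then have ne: "iappend v x \<noteq> iappend w x"
    using assms(1) by (simp add: iappend_eq_iff)
  have "val (length v + k) (iappend v x) = val (length v + k) (iappend w x)" for k
    using val_iappend[of v k x] val_iappend[of w k x] assms(1,2) by simp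
  then have "\<not> lt (iappend v x) (iappend w x)" "\<not> lt (iappend w x) (iappend v x)"
    using val_less_mono[OF t(1)] val_less_mono[OF t(2)]
    unfolding lt_def by (metis le_add2 less_irrefl)+
  then show False
    using lt_total[OF t(3) ne] by blast
qed

lemma nval_inj:
  assumes "v \<in> W" "w \<in> W" "length v = length w" "nval n v = nval n w"
  shows "v = w"
  by (rule nval_eq_imp_eq[OF assms(3,4), of "\<lambda>_. Sym 0"])
    (use assms(1,2) zero_C in \<open>auto intro!: tailed_C same_kind_C\<close>)

text \<open>Maxima and minima of consecutive cones of level \<open>L\<close> are neighbours, so along these cones the
  level \<open>m\<close> values of \<open>q\<close> change by at most one and the integer intermediate value theorem applies.\<close>

lemma discrete_ivt:
  assumes q: "uc C q"
    and near: "\<And>x y m. x \<in> C \<Longrightarrow> y \<in> C \<Longrightarrow> lt x y \<Longrightarrow> (\<And>L. val L y \<le> val L x + 1) \<Longrightarrow>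
      val m (q x) \<le> val m (q y) + 1 \<and> val m (q y) \<le> val m (q x) + 1"
    and x: "x \<in> C" and y: "y \<in> C" and xy: "lt x y"
    and t: "val m (q x) \<le> t \<and> t \<le> val m (q y) \<or> val m (q y) \<le> t \<and> t \<le> val m (q x)"
  shows "\<exists>u\<in>C. \<not> lt u x \<and> \<not> lt y u \<and> val m (q u) = t"
proof -
  obtain L where L: "\<forall>x\<in>C. \<forall>y\<in>C. iprefix L x = iprefix L y \<longrightarrow> iprefix m (q x) = iprefix m (q y)"
    using q unfolding uc_def by blast
  \<comment> \<open>The points \<open>e j\<close> and \<open>e' j\<close> are the least and the
    greatest point of the cone of level \<open>L\<close> with number \<open>j\<close>.\<close>
  define e where "e j = iappend (word_of L j) (\<lambda>_. Sym 0)" for j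
  define e' where "e' j = iappend (word_of L j) (\<lambda>_. Sym (n - 1))" for j
  have eC: "e j \<in> C" "e' j \<in> C" for j
    using word_of[of L j] zero_C top_C by (simp_all add: e_def e'_def)
  have pe: "iprefix L (e j) = word_of L j" "iprefix L (e' j) = word_of L j" for j
    unfolding e_def e'_def using iprefix_length_iappend[of "word_of L j"] word_of(2)[of L j] by metis+
  define f where "f j = int (val m (q (e j)))" for j
  have vL: "val L z < n ^ L" if "z \<in> C" for z
    using nval_less[OF iprefix_in_lists[OF that, of L]] by simp
  have fv: "f (val L z) = int (val m (q z))" if z: "z \<in> C" for z
  proof -
    have "iprefix L (e (val L z)) = iprefix L z"
      unfolding pe by (rule nval_inj)
        (use word_of iprefix_in_lists[OF z] nval_word_of[OF vL[OF z]] in auto)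
    then have "iprefix m (q (e (val L z))) = iprefix m (q z)"
      using L eC z by blast
    then show ?thesis
      by (simp add: f_def)
  qed
  have step: "\<bar>f (Suc j) - f j\<bar> \<le> 1" if j: "Suc j < n ^ L" for j
  proof -
    have nv: "nval n (word_of L j) = j" "nval n (word_of L (Suc j)) = Suc j"
      using nval_word_of j by simp_all
    have "lt (e' j) (e (Suc j))"
      unfolding e_def e'_def by (rule lt_words) (use nv word_of in simp_all)
    \<comment> \<open>Below level \<open>L\<close> consecutive numbers are truncated, which keeps
      them within one; from level \<open>L\<close> on the tails \<open>n - 1\<close> and
      \<open>0\<close> leave a gap of one.\<close>
    moreover have "val K (e (Suc j)) \<le> val K (e' j) + 1" for K
    proof (cases "K < L")
      case True
      then obtain d where d: "L = K + d"
        using less_imp_add_positive by blast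
      have s: "word_of L i = iprefix K (e i) @ drop K (word_of L i)" for i
        using append_take_drop_id[of K "word_of L i"] word_of(2)[of L i] d
        by (simp add: e_def iprefix_iappend_le)
      have k: "iprefix K (e' i) = iprefix K (e i)" for i
        using word_of(2)[of L i] d by (simp add: e_def e'_def iprefix_iappend_le)
      have l: "length (drop K (word_of L i)) = d" for i
        using word_of(2)[of L i] d by simp
      have a: "i = val K (e i) * n ^ d + nval n (drop K (word_of L i))" if "i < n ^ L" for i
        using nval_word_of[OF that] s[of i] nval_append[of n "iprefix K (e i)" "drop K (word_of L i)"] l
        by metis
      have b: "nval n (drop K (word_of L i)) < n ^ d" for i
      proof -
        have "drop K (word_of L i) \<in> W"
          using word_of(1)[of L i] set_drop_subset[of K "word_of L i"] by auto
        from nval_less[OF this] show ?thesis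
          using l by simp
      qed
      show ?thesis
      proof (rule ccontr)
        assume "\<not> ?thesis"
        then have "val K (e j) + 2 \<le> val K (e (Suc j))"
          by (simp add: k)
        then have "(val K (e j) + 2) * n ^ d \<le> val K (e (Suc j)) * n ^ d"
          by (rule mult_le_mono1)
        then have "val K (e j) * n ^ d + 2 * n ^ d \<le> val K (e (Suc j)) * n ^ d"
          by (simp add: algebra_simps)
        moreover have "n ^ d \<ge> 1"
          using n2 by simp
        moreover have "j < n ^ L"
          using j by simp
        ultimately show False
          using a[OF j] a[of j] b[of j] by linarith
      qed
    next
      case False
      then obtain k where k: "K = L + k"
        using le_Suc_ex not_less by blast
      have "val K (e (Suc j)) = Suc j * n ^ k"
        using val_iappend[of "word_of L (Suc j)" k "\<lambda>_. Sym 0"] word_of(2)[of L "Suc j"]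
        by (simp add: k e_def val_zero nv)
      moreover have "val K (e' j) + 1 = j * n ^ k + n ^ k"
        using val_iappend[of "word_of L j" k "\<lambda>_. Sym (n - 1)"] word_of(2)[of L j] val_top[of k]
        by (simp add: k e'_def nv)
      ultimately show ?thesis
        by simp
    qed
    ultimately have "val m (q (e' j)) \<le> val m (q (e (Suc j))) + 1 \<and>
        val m (q (e (Suc j))) \<le> val m (q (e' j)) + 1"
      by (rule near[OF eC(2) eC(1)])
    moreover have "iprefix m (q (e' j)) = iprefix m (q (e j))"
      using L eC pe by metis
    ultimately have "val m (q (e j)) \<le> val m (q (e (Suc j))) + 1 \<and>
        val m (q (e (Suc j))) \<le> val m (q (e j)) + 1"
      by simp
    then show ?thesis
      unfolding f_def by linarith
  qed
  let ?a = "val L x" and ?b = "val L y"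
  have ab: "?a \<le> ?b"
    using val_le[of y x L] lt_asym[OF tailed_C[OF x] tailed_C[OF y] xy] by blast
  have steps: "\<forall>i. ?a \<le> i \<and> i < ?b \<longrightarrow> \<bar>f (Suc i) - f i\<bar> \<le> 1"
    using step vL[OF y] by auto
  \<comment> \<open>The negated sequence serves the case in which the values run downwards.\<close>
  then have steps': "\<forall>i. ?a \<le> i \<and> i < ?b \<longrightarrow> \<bar>- f (Suc i) - (- f i)\<bar> \<le> 1"
    by (simp add: abs_minus_commute)
  have "\<exists>j. ?a \<le> j \<and> j \<le> ?b \<and> f j = int t"
    using t
  proof
    assume "val m (q x) \<le> t \<and> t \<le> val m (q y)"
    then show ?thesis
      using nat_intermed_int_val[OF steps ab, of "int t"] fv[OF x] fv[OF y] by simp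
  next
    assume "val m (q y) \<le> t \<and> t \<le> val m (q x)"
    then show ?thesis
      using nat_intermed_int_val[OF steps' ab, of "- int t"] fv[OF x] fv[OF y] by simp
  qed
  then obtain j where j: "?a \<le> j" "j \<le> ?b" "f j = int t"
    by blast
  \<comment> \<open>In the two end cones \<open>e j\<close> may lie outside the interval from
    \<open>x\<close> to \<open>y\<close>, so \<open>x\<close> and \<open>y\<close> themselves are
    used there.\<close>
  consider "j = ?a" | "j = ?b" | "?a < j" "j < ?b"
    using j by linarith
  then show ?thesis
  proof cases
    case 1
    then have "val m (q x) = t"
      using j(3) fv[OF x] by simp
    then show ?thesis
      using x lt_irrefl lt_asym[OF tailed_C[OF x] tailed_C[OF y] xy] by blast
  next
    case 2
    then have "val m (q y) = t"
      using j(3) fv[OF y] by simp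
    then show ?thesis
      using y lt_irrefl lt_asym[OF tailed_C[OF x] tailed_C[OF y] xy] by blast
  next
    case 3
    have "val L (e j) = j"
      using pe(1)[of j] nval_word_of[of j L] vL[OF y] j(2) by simp
    then have "lt x (e j)" "lt (e j) y"
      using 3 unfolding lt_def by metis+
    then have "\<not> lt (e j) x" "\<not> lt y (e j)"
      using lt_asym[OF tailed_C[OF x] tailed_C[OF eC(1)]] lt_asym[OF tailed_C[OF eC(1)] tailed_C[OF y]]
      by blast+
    moreover have "val m (q (e j)) = t"
      using j(3) by (simp add: f_def)
    ultimately show ?thesis
      using eC(1) by blast
  qed
qed

definition increasing :: "(iword \<Rightarrow> iword) \<Rightarrow> bool" where
  "increasing q \<longleftrightarrow> (\<forall>x\<in>C. \<forall>y\<in>C. lt x y \<longrightarrow> lt (q x) (q y))"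

definition decreasing :: "(iword \<Rightarrow> iword) \<Rightarrow> bool" where
  "decreasing q \<longleftrightarrow> (\<forall>x\<in>C. \<forall>y\<in>C. lt x y \<longrightarrow> lt (q y) (q x))"

text \<open>As on an interval of the real line, an injective map with the intermediate value
  property is monotone. Injectivity is used in the uniform form \<open>inv\<close>, because
  \<open>discrete_ivt\<close> hits a value only up to level \<open>m\<close>.\<close>

lemma monotone_map:
  assumes q: "emb C C q"
    and inv: "\<And>l. \<exists>m. \<forall>x\<in>C. \<forall>y\<in>C. iprefix m (q x) = iprefix m (q y) \<longrightarrow> iprefix l x = iprefix l y"
    and near: "\<And>x y m. x \<in> C \<Longrightarrow> y \<in> C \<Longrightarrow> lt x y \<Longrightarrow> (\<And>L. val L y \<le> val L x + 1) \<Longrightarrow>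
      val m (q x) \<le> val m (q y) + 1 \<and> val m (q y) \<le> val m (q x) + 1"
  shows "increasing q \<or> decreasing q"
proof -
  have qC: "q x \<in> C" if "x \<in> C" for x
    by (rule emb_in[OF q that])
  have asym: False if "lt u v" "lt v u" "u \<in> C" "v \<in> C" for u v
    using lt_asym[OF tailed_C[OF that(3)] tailed_C[OF that(4)] that(1,2)] .
  have tot: "lt u v \<or> lt v u" if "u \<in> C" "v \<in> C" "u \<noteq> v" for u v
    by (rule lt_total[OF same_kind_C[OF that(1,2)] that(3)])
  have qtot: "lt (q u) (q v) \<or> lt (q v) (q u)" if "u \<in> C" "v \<in> C" "u \<noteq> v" for u v
    by (rule tot[OF qC[OF that(1)] qC[OF that(2)]]) (use emb_inj[OF q that(1,2)] that(3) in blast)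
  \<comment> \<open>A point \<open>w\<close> outside the interval whose value lies between the end
    values would share \<open>m\<close> letters of its value with some \<open>u\<close> inside; by
    \<open>inv\<close> then \<open>u\<close> and \<open>w\<close> share \<open>l\<close> letters,
    while \<open>l\<close> was chosen to tell \<open>w\<close> from the interval.\<close>
  have outside: False
    if x: "x \<in> C" and y: "y \<in> C" and w: "w \<in> C" and xy: "lt x y" and out: "lt w x \<or> lt y w"
      and btw: "lt (q x) (q w) \<and> lt (q w) (q y) \<or> lt (q y) (q w) \<and> lt (q w) (q x)" for x y w
  proof -
    obtain l where l: "val l w < val l x \<or> val l y < val l w"
      using out unfolding lt_def by blast
    obtain m where m: "\<forall>x\<in>C. \<forall>y\<in>C. iprefix m (q x) = iprefix m (q y) \<longrightarrow> iprefix l x = iprefix l y"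
      using inv by blast
    have "val m (q x) \<le> val m (q w) \<and> val m (q w) \<le> val m (q y) \<or>
        val m (q y) \<le> val m (q w) \<and> val m (q w) \<le> val m (q x)"
      using btw val_le asym qC x y w by metis
    then obtain u where u: "u \<in> C" "\<not> lt u x" "\<not> lt y u" "val m (q u) = val m (q w)"
      using discrete_ivt[OF embD(4)[OF q] near x y xy] by blast
    have "iprefix m (q u) = iprefix m (q w)"
      by (rule nval_inj) (use iprefix_in_lists[OF qC[OF u(1)]] iprefix_in_lists[OF qC[OF w]] u(4) in auto)
    then have "iprefix l u = iprefix l w"
      using m u(1) w by blast
    then show False
      using l val_le[OF u(2), of l] val_le[OF u(3), of l] by simp
  qed
  \<comment> \<open>If the value of the middle point were not in the middle, then \<open>z\<close>
    would be outside the interval from \<open>x\<close> to \<open>y\<close> with a value between, or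
    \<open>x\<close> outside the one from \<open>y\<close> to \<open>z\<close>.\<close>
  have btw: "lt (q x) (q y) \<and> lt (q y) (q z) \<or> lt (q z) (q y) \<and> lt (q y) (q x)"
    if x: "x \<in> C" and y: "y \<in> C" and z: "z \<in> C" and l: "lt x y" "lt y z" for x y z
  proof -
    have ne: "x \<noteq> y" "y \<noteq> z"
      using l lt_irrefl by auto
    have "x \<noteq> z"
      using asym[OF l(1) _ x y] l(2) by auto
    from qtot[OF x z this] qtot[OF x y ne(1)] qtot[OF y z ne(2)] show ?thesis
      using outside[OF x y z l(1)] outside[OF y z x l(2)] l by blast
  qed
  have qtr: "lt (q u) (q w)" if "lt (q u) (q v)" "lt (q v) (q w)" "u \<in> C" "v \<in> C" for u v w
    using lt_trans[OF tailed_C[OF qC[OF that(3)]] tailed_C[OF qC[OF that(4)]] that(1,2)] .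
  have qas: False if "lt (q u) (q v)" "lt (q v) (q u)" "u \<in> C" "v \<in> C" for u v
    by (rule asym[OF that(1,2) qC[OF that(3)] qC[OF that(4)]])
  \<comment> \<open>Betweenness is preserved, so the direction is decided by the images of the least
    and the greatest point.\<close>
  let ?a = "\<lambda>_ :: nat. Sym 0" and ?b = "\<lambda>_ :: nat. Sym (n - 1)"
  have a: "lt ?a x" if "x \<in> C" "x \<noteq> ?a" for x
    using tot[OF zero_C that(1)] that(2) not_lt_zero by metis
  have b: "lt x ?b" if "x \<in> C" "x \<noteq> ?b" for x
    using tot[OF top_C that(1)] that(2) not_top_lt[OF that(1)] by metis
  have ab: "?a \<noteq> ?b"
    using n2 by (auto simp: fun_eq_iff)
  from qtot[OF zero_C top_C ab] show ?thesis
  proof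
    assume P: "lt (q ?a) (q ?b)"
    have Pa: "lt (q ?a) (q x)" if x: "x \<in> C" "x \<noteq> ?a" for x
    proof (cases "x = ?b")
      case False
      show ?thesis
        using btw[OF zero_C x(1) top_C a[OF x] b[OF x(1) False]] qtr[OF _ _ top_C x(1), of ?a]
          qas[OF P _ zero_C top_C] by blast
    qed (use P in simp)
    have "lt (q x) (q y)" if x: "x \<in> C" and y: "y \<in> C" and l: "lt x y" for x y
    proof (cases "x = ?a")
      case True
      then show ?thesis
        using Pa[OF y] l lt_irrefl by auto
    next
      case False
      then show ?thesis
        using btw[OF zero_C x y a[OF x False] l] qas[OF Pa[OF x False] _ zero_C x] by blast
    qed
    then show ?thesis
      by (simp add: increasing_def)
  next
    assume P: "lt (q ?b) (q ?a)"
    have Pa: "lt (q x) (q ?a)" if x: "x \<in> C" "x \<noteq> ?a" for x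
    proof (cases "x = ?b")
      case False
      show ?thesis
        using btw[OF zero_C x(1) top_C a[OF x] b[OF x(1) False]] qtr[OF _ _ zero_C x(1), of ?b]
          qas[OF P _ top_C zero_C] by blast
    qed (use P in simp)
    have "lt (q y) (q x)" if x: "x \<in> C" and y: "y \<in> C" and l: "lt x y" for x y
    proof (cases "x = ?a")
      case True
      then show ?thesis
        using Pa[OF y] l lt_irrefl by auto
    next
      case False
      then show ?thesis
        using btw[OF zero_C x y a[OF x False] l] qas[OF Pa[OF x False] _ x zero_C] by blast
    qed
    then show ?thesis
      by (simp add: decreasing_def)
  qed
qed

lemma monotone_loc:
  assumes q: "emb C C q" and w: "w \<in> W"
  shows "increasing q \<Longrightarrow> increasing (loc n q w)" "decreasing q \<Longrightarrow> decreasing (loc n q w)"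
proof -
  have e: "lt (loc n q w x) (loc n q w y) \<longleftrightarrow> lt (q (iappend w x)) (q (iappend w y))"
    if "x \<in> C" "y \<in> C" for x y
    unfolding lout_loc[OF emb_inj_cone_C[OF q w] that(1)] lout_loc[OF emb_inj_cone_C[OF q w] that(2)]
      lt_iappend ..
  have l: "lt (iappend w x) (iappend w y)" "iappend w x \<in> C" "iappend w y \<in> C"
    if "x \<in> C" "y \<in> C" "lt x y" for x y
    using that w by (simp_all add: lt_iappend)
  show "increasing q \<Longrightarrow> increasing (loc n q w)"
    unfolding increasing_def using e l by (intro ballI impI) metis
  show "decreasing q \<Longrightarrow> decreasing (loc n q w)"
    unfolding decreasing_def using e l by (intro ballI impI) metis
qed

text \<open>It suffices that a single local action \<open>q\<close> of \<open>h\<close> is monotone: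
  all core states are local actions of \<open>q\<close> and inherit its direction.\<close>

lemma TB_monotone:
  assumes h: "h \<in> TB_nr n s" and s: "1 \<le> s"
  shows "(\<forall>g\<in>core_maps (cantor_nr n s) h. increasing g) \<or> (\<forall>g\<in>core_maps (cantor_nr n s) h. decreasing g)"
proof -
  let ?D = "cantor_nr n s"
  have B: "h \<in> B_nr n s"
    using h by (simp add: TB_nr_def)
  have glue: "glue n s (h x) (h y)" if "x \<in> ?D" "y \<in> ?D" "glue n s x y" for x y
    using h that by (simp add: TB_nr_def)
  note d = B_nrD[OF B s]
  note D = embD(1)[OF d(2)]
  obtain k where k: "sim_at ?D h ?D h k"
    using d(3) by (auto simp: sim_def)
  \<comment> \<open>Two common output letters rule out the glued pair of end points: its second
    letters \<open>0\<close> and \<open>n - 1\<close> differ, whereas all values on the cone of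
    \<open>v\<close> share theirs.\<close>
  obtain L where L: "\<forall>v\<in>pre ?D. L \<le> length v \<longrightarrow> 2 \<le> length (lout n h v)"
    using lout_long[OF D embD(3,4)[OF d(2)]] by blast
  obtain v where v: "v \<in> pre ?D" "length v = Suc L"
    using pre_exists[OF D] by blast
  define l q where "l = lout n h v" and "q = loc n h v"
  have l2: "2 \<le> length l"
    using L v by (simp add: l_def)
  have q: "emb C C q"
    unfolding q_def by (rule emb_loc[OF d(2) v(1)]) (use l2 l_def in auto)
  have hv: "h (iappend v x) = iappend l (q x)" if "x \<in> C" for x
    unfolding l_def q_def by (rule lout_loc[OF emb_inj_cone[OF d(2) v(1)] that])
  have "increasing q \<or> decreasing q"
  proof (rule monotone_map[OF q])
    fix j
    obtain m where m: "\<forall>x\<in>?D. \<forall>y\<in>?D. iprefix m x = iprefix m y \<longrightarrow>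
        iprefix (length v + j) (inv_into ?D h x) = iprefix (length v + j) (inv_into ?D h y)"
      using embD(4)[OF d(4)] unfolding uc_def by blast
    have "iprefix j x = iprefix j y" if x: "x \<in> C" and y: "y \<in> C" and e: "iprefix m (q x) = iprefix m (q y)" for x y
    proof -
      have "iprefix (length l + m) (iappend l (q x)) = iprefix (length l + m) (iappend l (q y))"
        using e by simp
      then have "iprefix m (h (iappend v x)) = iprefix m (h (iappend v y))"
        unfolding hv[OF x] hv[OF y] by (rule iprefix_mono) simp
      moreover have xD: "iappend v x \<in> ?D" "iappend v y \<in> ?D"
        using preD(1)[OF v(1)] x y by blast+
      ultimately have "iprefix (length v + j) (inv_into ?D h (h (iappend v x))) =
          iprefix (length v + j) (inv_into ?D h (h (iappend v y)))"
        using m emb_in[OF d(2)] by blast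
      then show ?thesis
        unfolding bij_betw_inv_into_left[OF d(1) xD(1)] bij_betw_inv_into_left[OF d(1) xD(2)] by simp
    qed
    then show "\<exists>m. \<forall>x\<in>C. \<forall>y\<in>C. iprefix m (q x) = iprefix m (q y) \<longrightarrow> iprefix j x = iprefix j y"
      by blast
  next
    fix x y m assume x: "x \<in> C" and y: "y \<in> C" and xy: "lt x y" and nr: "\<And>L. val L y \<le> val L x + 1"
    have xD: "iappend v x \<in> ?D" "iappend v y \<in> ?D"
      using preD(1)[OF v(1)] x y by blast+
    have nrv: "val L (iappend v y) \<le> val L (iappend v x) + 1" for L
    proof (cases "L \<le> length v")
      case True
      then show ?thesis
        by (simp add: iprefix_iappend_le)
    next
      case False
      then obtain j where "L = length v + j"
        using le_Suc_ex nat_le_linear by blast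
      then show ?thesis
        using nr[of j] by (simp only: val_iappend)
    qed
    have "lt (iappend v x) (iappend v y)"
      using xy by (simp add: lt_iappend)
    then have "neighbours ?D lt (iappend v x) (iappend v y)"
      unfolding neighbours_def
      using not_between[OF tailed_cantor_nr[OF xD(1)] tailed_cantor_nr nrv] by blast
    then have "glue n s (iappend v x) (iappend v y)"
      using glued_pair_iff[OF s xD] by (simp add: glue_def)
    then have g: "glue n s (iappend l (q x)) (iappend l (q y))"
      using glue[OF xD] hv x y by simp
    have ends: "\<not> (iappend l a = iappend [Dot 0] (\<lambda>_. Sym 0) \<and> iappend l b = iappend [Dot (s - 1)] (\<lambda>_. Sym (n - 1)))" for a b
    proof
      assume "iappend l a = iappend [Dot 0] (\<lambda>_. Sym 0) \<and> iappend l b = iappend [Dot (s - 1)] (\<lambda>_. Sym (n - 1))"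
      then have "iappend l a 1 = Sym 0" "iappend l b 1 = Sym (n - 1)"
        by (simp_all add: iappend_def[of "[_]"])
      moreover have "iappend l a 1 = iappend l b 1"
        using l2 by (simp add: iappend_def)
      ultimately show False
        using n2 by simp
    qed
    have gp: "\<forall>L. val L (iappend l b) \<le> val L (iappend l a) + 1 \<and> val L (iappend l a) \<le> val L (iappend l b) + 1"
      if "glued_pair n s (iappend l b) (iappend l a)" for a b
      using glued_pair_cases[OF that] ends[of b a] by (auto intro: le_SucI)
    have "\<forall>L. val L (iappend l (q x)) \<le> val L (iappend l (q y)) + 1 \<and>
        val L (iappend l (q y)) \<le> val L (iappend l (q x)) + 1"
      using g gp[of "q x" "q y"] gp[of "q y" "q x"] unfolding glue_def by auto
    then have "val (length l + m) (iappend l (q x)) \<le> val (length l + m) (iappend l (q y)) + 1 \<and>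
        val (length l + m) (iappend l (q y)) \<le> val (length l + m) (iappend l (q x)) + 1"
      by blast
    then show "val m (q x) \<le> val m (q y) + 1 \<and> val m (q y) \<le> val m (q x) + 1"
      unfolding val_iappend by simp
  qed
  moreover have "\<exists>w\<in>W. g = loc n q w" if g: "g \<in> core_maps ?D h" for g
  proof -
    obtain u w where uw: "u \<in> pre ?D" "w \<in> W" "k \<le> length w" "g = loc n h (u @ w)"
      using g by (rule core_mapsE)
    have "g = loc n h (v @ w)"
      using sim_atD[OF k uw(2,3,1) v(1)] uw(4) by simp
    then show ?thesis
      using loc_loc[OF emb_inj_cone[OF d(2) v(1)] uw(2)] uw(2) unfolding q_def
      by (intro bexI[of _ w]) simp_all
  qed
  ultimately show ?thesis
    using monotone_loc[OF q] by blast
qed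

end



section \<open>Realizing a core over another number of dotted letters\<close>

lemma finite_uniform:
  assumes "finite I" "\<And>i. i \<in> I \<Longrightarrow> \<exists>K. \<forall>L\<ge>(K::nat). P i L"
  shows "\<exists>K. \<forall>i\<in>I. \<forall>L\<ge>K. P i L"
  using assms
proof (induction I)
  case (insert i I)
  obtain K where K: "\<forall>i\<in>I. \<forall>L\<ge>K. P i L"
    using insert by blast
  obtain J where J: "\<forall>L\<ge>J. P i L"
    using insert.prems by blast
  have "\<forall>j\<in>insert i I. \<forall>L\<ge>max K J. P j L"
    using K J by simp
  then show ?case
    by blast
qed simp

lemma rank_bij:
  assumes S: "finite S" and key: "inj_on key S"
  defines "rk \<equiv> \<lambda>c. card {c' \<in> S. key c' < (key c :: nat)}"
  shows "bij_betw rk S {..<card S}" "\<And>c c'. c \<in> S \<Longrightarrow> c' \<in> S \<Longrightarrow> key c < key c' \<Longrightarrow> rk c < rk c'"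
proof -
  show mono: "rk c < rk c'" if "c \<in> S" "c' \<in> S" "key c < key c'" for c c'
    unfolding rk_def using S that by (intro psubset_card_mono) auto
  have "inj_on rk S"
  proof (rule inj_onI)
    fix c c' assume c: "c \<in> S" "c' \<in> S" "rk c = rk c'"
    then have "key c = key c'"
      using mono[of c c'] mono[of c' c] by (metis less_irrefl linorder_neqE_nat)
    then show "c = c'"
      using inj_onD[OF key] c by blast
  qed
  moreover have "rk c < card S" if "c \<in> S" for c
    unfolding rk_def using S that by (intro psubset_card_mono) auto
  ultimately show "bij_betw rk S {..<card S}"
    unfolding bij_betw_def by (intro conjI card_subset_eq) (auto simp: card_image)
qed

lemma iprefix_iappend_cong: "iprefix m x = iprefix m y \<Longrightarrow> iprefix m (iappend w x) = iprefix m (iappend w y)"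
  by (auto simp: iprefix_eq_iff iappend_def)

lemma mult_add_less_mono:
  assumes "(a :: nat) < b" "d < N"
  shows "a * N + d < b * N + e"
proof -
  have "a * N + d < (a + 1) * N"
    using assms(2) by simp
  also have "\<dots> \<le> b * N"
    using assms(1) by (intro mult_le_mono1) simp
  finally show ?thesis
    by simp
qed

context alph
begin

text \<open>Starting from the dotted letters, the first cone is replaced by its \<open>n\<close>
  children \<open>t\<close> times; each step adds \<open>n - 1\<close> parts and keeps the list
  ordered.\<close>

lemma cone_partition_exists:
  assumes r: "1 \<le> r"
  shows "\<exists>P. length P = r + t * (n - 1) \<and> set P \<subseteq> pre (cantor_nr n r) \<and>
     (\<forall>x\<in>cantor_nr n r. \<exists>p\<in>set P. \<exists>y\<in>C. x = iappend p y) \<and>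
     sorted_wrt (\<lambda>p p'. \<forall>x\<in>C. \<forall>y\<in>C. lt (iappend p x) (iappend p' y)) P"
proof (induction t)
  case 0
  let ?P = "map (\<lambda>a. [Dot a]) [0..<r]"
  have "\<exists>p\<in>set ?P. \<exists>y\<in>C. x = iappend p y" if x: "x \<in> cantor_nr n r" for x
  proof -
    obtain a where a: "x 0 = Dot a" "a < r"
      using x by (auto simp: cantor_nr_def dots_def)
    have "x = iappend [Dot a] (idrop 1 x)" "idrop 1 x \<in> C"
      using iappend_iprefix_idrop[of 1 x] tail_spaceD(2)[OF tail_space_cantor_nr[OF r] x, of 1] a(1)
      by (simp_all add: iprefix_def)
    then show ?thesis
      using a(2) by auto
  qed
  moreover have "set ?P \<subseteq> pre (cantor_nr n r)"
    unfolding pre_cantor_nr[OF r] by (auto simp: dotted_words_def dots_def)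
  moreover have "sorted_wrt (\<lambda>p p'. \<forall>x\<in>C. \<forall>y\<in>C. lt (iappend p x) (iappend p' y)) ?P"
    unfolding sorted_wrt_map
    by (rule sorted_wrt_mono_rel[OF _ sorted_wrt_upt]) (auto intro!: lt_words simp: nval_def)
  ultimately show ?case
    by (intro exI[of _ ?P]) simp
next
  case (Suc t)
  let ?R = "\<lambda>p p'. \<forall>x\<in>C. \<forall>y\<in>C. lt (iappend p x) (iappend p' y)"
  obtain P where P: "length P = r + t * (n - 1)" "set P \<subseteq> pre (cantor_nr n r)"
    "\<forall>x\<in>cantor_nr n r. \<exists>p\<in>set P. \<exists>y\<in>C. x = iappend p y" "sorted_wrt ?R P"
    using Suc.IH by blast
  obtain p ps where ps: "P = p # ps"
    using P(1) r by (cases P) auto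
  let ?ch = "map (\<lambda>i. p @ [Sym i]) [0..<n]"
  let ?P = "?ch @ ps"
  have "length ?P = r + Suc t * (n - 1)"
    using P(1) ps n2 by simp
  moreover have "set ?P \<subseteq> pre (cantor_nr n r)"
    using P(2) ps by (auto intro!: pre_append Sym_in)
  moreover have "\<exists>p\<in>set ?P. \<exists>y\<in>C. x = iappend p y" if x: "x \<in> cantor_nr n r" for x
  proof -
    obtain p' y where py: "p' \<in> set P" "y \<in> C" "x = iappend p' y"
      using P(3) x by blast
    show ?thesis
    proof (cases "p' = p")
      case True
      obtain i where i: "y 0 = Sym i" "i < n"
        using py(2) by (auto simp: cantor_n_def alphabet_def)
      have "y = iappend [Sym i] (idrop 1 y)"
        using iappend_iprefix_idrop[of 1 y] i(1) by (simp add: iprefix_def)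
      then have "x = iappend (p @ [Sym i]) (idrop 1 y)"
        using py(3) True iappend_iappend[of p "[Sym i]" "idrop 1 y"] by simp
      then show ?thesis
        using i(2) idrop_in_cantor_n[OF py(2)] by (intro bexI[of _ "p @ [Sym i]"]) auto
    next
      case False
      then show ?thesis
        using py ps by auto
    qed
  qed
  moreover have "sorted_wrt ?R ?P"
    unfolding sorted_wrt_append
  proof (intro conjI ballI)
    show "sorted_wrt ?R ?ch"
      unfolding sorted_wrt_map
      by (rule sorted_wrt_mono_rel[OF _ sorted_wrt_upt]) (auto intro!: lt_words simp: nval_snoc)
    show "sorted_wrt ?R ps"
      using P(4) ps by simp
    fix a b x y assume a: "a \<in> set ?ch" and b: "b \<in> set ps" and x: "x \<in> C" and y: "y \<in> C"
    obtain i where i: "a = p @ [Sym i]" "i < n"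
      using a by auto
    have "\<forall>x\<in>C. \<forall>y\<in>C. lt (iappend p x) (iappend b y)"
      using P(4) ps b by simp
    moreover have "iappend [Sym i] x \<in> C"
      using x Sym_in[OF i(2)] by simp
    ultimately have "lt (iappend p (iappend [Sym i] x)) (iappend b y)"
      using y by blast
    then show "lt (iappend a x) (iappend b y)"
      by (simp add: i(1))
  qed
  ultimately show ?case
    by (intro exI[of _ ?P]) blast
qed

text \<open>A homeomorphism \<open>h\<close> is assembled as follows. A word \<open>b\<close> of length \<open>k + 1\<close> determines a core
  state of \<open>h0\<close>, whose image splits into cones of level \<open>L\<close>. The congruence on the number of dotted
  letters makes the total number of these cones the size of some partition \<open>P\<close> of the target into
  cones; \<open>h\<close> applies the core state and then moves the cones onto the parts of \<open>P\<close>, in an order that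
  respects, or reverses, the order of the words \<open>b\<close>.\<close>

lemma realize_core:
  assumes h0: "h0 \<in> B_nr n s" and s: "1 \<le> s" and r: "1 \<le> r"
    and sg: "core_count (cantor_nr n s) h0 \<sigma>" and cong: "[r * \<sigma> = r] (mod (n - 1))"
  shows "\<exists>h\<in>B_nr n r. sim (cantor_nr n r) h (cantor_nr n s) h0 \<and>
     (\<not> dec \<and> (\<forall>g\<in>core_maps (cantor_nr n s) h0. increasing g) \<longrightarrow>
        (\<forall>x\<in>cantor_nr n r. \<forall>y\<in>cantor_nr n r. lt x y \<longrightarrow> lt (h x) (h y))) \<and>
     (dec \<and> (\<forall>g\<in>core_maps (cantor_nr n s) h0. decreasing g) \<longrightarrow>
        (\<forall>x\<in>cantor_nr n r. \<forall>y\<in>cantor_nr n r. lt x y \<longrightarrow> lt (h y) (h x)))"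
proof -
  let ?D = "cantor_nr n r" and ?E = "cantor_nr n s"
  note D = tail_space_cantor_nr[OF r] and E = tail_space_cantor_nr[OF s]
  note d = B_nrD[OF h0 s]
  obtain k where k: "sim_at ?E h0 ?E h0 k"
    using d(3) by (auto simp: sim_def)
  obtain u0 where u0: "u0 \<in> pre ?E"
    using pre_exists[OF E] by blast
  \<comment> \<open>One dotted letter followed by \<open>k\<close> letters, which are enough to
    force a core state of \<open>h0\<close>.\<close>
  define B where "B = {v \<in> pre ?D. length v = Suc k}"
  have B_eq: "B = iprefix (Suc k) ` ?D" and B_clopen: "clopen_at (Suc k) ?D"
    using pre_level_eq[OF D, of "Suc k"] by (simp_all add: B_def)
  have B_fin: "finite B"
    unfolding B_def by (rule finite_pre[OF D])
  have tlW: "tl b \<in> W" if "b \<in> pre ?D" for b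
    using that unfolding pre_cantor_nr[OF r] by (auto simp: dotted_words_def)
  \<comment> \<open>The dotted letter of \<open>b\<close> has no meaning over \<open>s\<close>
    dotted letters and is replaced by the fixed word \<open>u0\<close>; by synchronization the
    choice is immaterial.\<close>
  define \<Phi> where "\<Phi> b = loc n h0 (u0 @ tl b)" for b
  have \<Phi>: "\<Phi> b \<in> core_maps ?E h0" if b: "b \<in> B" for b
    unfolding \<Phi>_def by (rule loc_in_core_maps[OF k u0 tlW]) (use b in \<open>simp_all add: B_def\<close>)
  have \<Phi>e: "emb C C (\<Phi> b)" if "b \<in> B" for b
    by (rule core_maps_emb(1)[OF d(2) \<Phi>[OF that]])
  obtain L where L: "\<forall>b\<in>B. clopen_at L (\<Phi> b ` C) \<and> [card (iprefix L ` \<Phi> b ` C) = \<sigma>] (mod (n - 1))"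
  proof -
    have "\<exists>K. \<forall>b\<in>B. \<forall>L\<ge>K. clopen_at L (\<Phi> b ` C) \<and> [card (iprefix L ` \<Phi> b ` C) = \<sigma>] (mod (n - 1))"
    proof (rule finite_uniform[OF B_fin])
      show "\<exists>K. \<forall>L\<ge>K. clopen_at L (\<Phi> b ` C) \<and> [card (iprefix L ` \<Phi> b ` C) = \<sigma>] (mod (n - 1))"
        if "b \<in> B" for b
        using sg \<Phi>[OF that] unfolding core_count_def cone_count_def by blast
    qed
    then show thesis
      using that by blast
  qed
  define cells where "cells = Sigma B (\<lambda>b. iprefix L ` \<Phi> b ` C)"
  have cells_fin: "finite cells"
    unfolding cells_def using B_fin L by (intro finite_SigmaI) (auto simp: clopen_at_def)
  have card_cells: "card cells = (\<Sum>b\<in>B. card (iprefix L ` \<Phi> b ` C))"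
    unfolding cells_def using B_fin L by (intro card_SigmaI) (auto simp: clopen_at_def)
  have vW: "v \<in> W" "length v = L" if "(b, v) \<in> cells" for b v
    using that iprefix_in_lists[OF emb_in[OF \<Phi>e]] by (auto simp: cells_def)
  have "[card cells = (\<Sum>b\<in>B. \<sigma>)] (mod (n - 1))"
    unfolding card_cells using L by (intro cong_sum) blast
  then have "[card cells = card B * \<sigma>] (mod (n - 1))"
    by simp
  moreover have "[card B = r] (mod (n - 1))"
    using cone_count_unique[OF cone_count_clopen[OF B_clopen] cone_count_cantor_nr[OF r]]
    by (simp add: B_eq)
  ultimately have "[card cells = r] (mod (n - 1))"
    using cong_scalar_right[of "card B" r "n - 1" \<sigma>] cong cong_trans by blast
  \<comment> \<open>The congruence alone could hold with too few cells. Each of the \<open>r\<close>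
    dotted letters contributes at least one, so the partition arises from \<open>t\<close>
    splittings with \<open>t\<close> a natural number.\<close>
  moreover have "r \<le> card cells"
  proof -
    obtain w where w: "w \<in> W" "length w = k"
      using words_exist by blast
    have "{..<r} \<subseteq> (\<lambda>(b, v). dig (hd b)) ` cells"
    proof
      fix a assume a: "a \<in> {..<r}"
      then have b: "Dot a # w \<in> B"
        using w unfolding B_def pre_cantor_nr[OF r] by (simp add: dotted_words_def dots_def)
      have "(Dot a # w, iprefix L (\<Phi> (Dot a # w) (\<lambda>_. Sym 0))) \<in> cells"
        unfolding cells_def using b zero_C by blast
      from imageI[OF this, of "\<lambda>(b, v). dig (hd b)"] show "a \<in> (\<lambda>(b, v). dig (hd b)) ` cells"
        by simp
    qed
    from card_mono[OF finite_imageI[OF cells_fin] this] card_image_le[OF cells_fin, of "\<lambda>(b, v). dig (hd b)"]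
    show ?thesis by simp
  qed
  ultimately obtain t where t: "card cells = r + t * (n - 1)"
    using cong_le_nat[of r "card cells" "n - 1"] by (auto simp: add.commute)
  obtain P where P: "length P = card cells" "set P \<subseteq> pre ?D"
    "\<forall>x\<in>?D. \<exists>p\<in>set P. \<exists>y\<in>C. x = iappend p y"
    "sorted_wrt (\<lambda>p p'. \<forall>x\<in>C. \<forall>y\<in>C. lt (iappend p x) (iappend p' y)) P"
    using cone_partition_exists[OF r, of t] unfolding t[symmetric] by (elim exE conjE)
  have Plt: "lt (iappend (P ! i) x) (iappend (P ! j) y)" if "i < j" "j < card cells" "x \<in> C" "y \<in> C" for i j x y
    using sorted_wrt_nth_less[OF P(4) that(1)] that P(1) by simp
  have Ppre: "P ! j \<in> pre ?D" if "j < card cells" for j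
    by (rule subsetD[OF P(2) nth_mem]) (simp add: P(1) that)
  have Pinj: "i = j \<and> x = y"
    if "i < card cells" "j < card cells" "x \<in> C" "y \<in> C" "iappend (P ! i) x = iappend (P ! j) y" for i j x y
  proof -
    have "\<not> i < j" "\<not> j < i"
      using Plt[of i j x y] Plt[of j i y x] that(1-4) lt_irrefl[of "iappend (P ! j) y"]
      unfolding that(5) by blast+
    then have "i = j"
      by simp
    then show ?thesis
      using that(5) by simp
  qed
  \<comment> \<open>For \<open>dec\<close> the order of the words \<open>b\<close> is reflected in
    their greatest value, so that the natural subtraction never truncates.\<close>
  define mx where "mx = Max (nval n ` B)"
  define pos where "pos b = (if dec then mx - nval n b else nval n b)" for b
  have mx: "nval n b \<le> mx" if "b \<in> B" for b
    unfolding mx_def using B_fin that by (intro Max_ge) auto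
  have B_inj: "b = b'" if b: "b \<in> B" "b' \<in> B" "nval n b = nval n b'" for b b'
  proof (rule nval_eq_imp_eq[OF _ b(3), of "\<lambda>_. Sym 0"])
    have "iappend b (\<lambda>_. Sym 0) \<in> ?D" "iappend b' (\<lambda>_. Sym 0) \<in> ?D"
      using preD(1)[OF _ zero_C] b by (auto simp: B_def)
    then show "tailed (iappend b (\<lambda>_. Sym 0))" "tailed (iappend b' (\<lambda>_. Sym 0))"
      "same_kind (iappend b (\<lambda>_. Sym 0)) (iappend b' (\<lambda>_. Sym 0))"
      using tailed_cantor_nr same_kind_cantor_nr by blast+
  qed (use b in \<open>simp add: B_def\<close>)
  have pos_inj: "b = b'" if "b \<in> B" "b' \<in> B" "pos b = pos b'" for b b'
    using that mx[OF that(1)] mx[OF that(2)] by (intro B_inj) (auto simp: pos_def split: if_splits)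
  \<comment> \<open>Cells are ordered by \<open>b\<close> first and by \<open>v\<close> inside. The
    order of \<open>v\<close> is never reflected: a decreasing core state reverses the order within
    \<open>b\<close> by itself.\<close>
  define key where "key = (\<lambda>(b, v). pos b * n ^ L + nval n v)"
  have keyless: "key (b, v) < key (b', v')" if "pos b < pos b' \<or> (b = b' \<and> nval n v < nval n v')"
    "(b, v) \<in> cells" "(b', v') \<in> cells" for b v b' v'
    using that(1)
  proof
    assume "pos b < pos b'"
    moreover have "nval n v < n ^ L"
      using nval_less[OF vW(1)[OF that(2)]] vW(2)[OF that(2)] by simp
    ultimately show ?thesis
      unfolding key_def using mult_add_less_mono by simp
  qed (simp add: key_def)
  have "inj_on key cells"
  proof (rule inj_onI)
    fix c c' assume c: "c \<in> cells" "c' \<in> cells" and e: "key c = key c'"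
    obtain b v b' v' where bv: "c = (b, v)" "c' = (b', v')"
      by (cases c, cases c')
    have B: "b \<in> B" "b' \<in> B"
      using c bv by (auto simp: cells_def)
    have "pos b = pos b'"
      using keyless[of b b' v v'] keyless[of b' b v' v] c bv e
      by (metis less_irrefl linorder_neqE_nat)
    then have bb: "b = b'"
      by (rule pos_inj[OF B])
    then have "nval n v = nval n v'"
      using e bv by (simp add: key_def)
    then have "v = v'"
      using nval_inj vW c bv by metis
    then show "c = c'"
      using bb bv by simp
  qed
  note rank = rank_bij[OF cells_fin this]
  define rk where "rk = (\<lambda>c. card {c' \<in> cells. key c' < key c})"
  have rk: "bij_betw rk cells {..<card cells}" "\<And>c c'. c \<in> cells \<Longrightarrow> c' \<in> cells \<Longrightarrow> key c < key c' \<Longrightarrow> rk c < rk c'"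
    using rank unfolding rk_def by blast+
  have rk_less: "rk c < card cells" if "c \<in> cells" for c
    using rk(1) that by (auto simp: bij_betw_def)
  define z where "z x = \<Phi> (iprefix (Suc k) x) (idrop (Suc k) x)" for x
  define cell where "cell x = (iprefix (Suc k) x, iprefix L (z x))" for x
  define h where "h x = iappend (P ! rk (cell x)) (idrop L (z x))" for x
  have xB: "iprefix (Suc k) x \<in> B" "idrop (Suc k) x \<in> C" if "x \<in> ?D" for x
    using tail_spaceD[OF D that, of "Suc k"] by (simp_all add: B_def)
  have zC: "z x \<in> \<Phi> (iprefix (Suc k) x) ` C" "z x \<in> C" if "x \<in> ?D" for x
    unfolding z_def using xB[OF that] emb_in[OF \<Phi>e] by auto
  have cell: "cell x \<in> cells" if "x \<in> ?D" for x
    unfolding cell_def cells_def using xB(1)[OF that] zC(1)[OF that] by blast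
  have tC: "idrop L (z x) \<in> C" if "x \<in> ?D" for x
    by (rule idrop_in_cantor_n[OF zC(2)[OF that]])
  have hD: "h x \<in> ?D" if "x \<in> ?D" for x
    unfolding h_def by (rule preD(1)[OF Ppre[OF rk_less[OF cell[OF that]]] tC[OF that]])
  have h_inj: "inj_on h ?D"
  proof (rule inj_onI)
    fix x y assume x: "x \<in> ?D" and y: "y \<in> ?D" and e: "h x = h y"
    have rt: "rk (cell x) = rk (cell y) \<and> idrop L (z x) = idrop L (z y)"
      using Pinj[OF rk_less[OF cell[OF x]] rk_less[OF cell[OF y]] tC[OF x] tC[OF y]] e
      unfolding h_def by blast
    then have c: "cell x = cell y"
      using inj_onD[OF bij_betw_imp_inj_on[OF rk(1)]] cell[OF x] cell[OF y] by blast
    then have b: "iprefix (Suc k) x = iprefix (Suc k) y" "iprefix L (z x) = iprefix L (z y)"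
      by (simp_all add: cell_def)
    have "z x = z y"
      using iappend_iprefix_idrop[of L "z x"] iappend_iprefix_idrop[of L "z y"] b(2) rt by metis
    then have "idrop (Suc k) x = idrop (Suc k) y"
      unfolding z_def b(1) by (rule emb_inj[OF \<Phi>e[OF xB(1)[OF y]] xB(2)[OF x] xB(2)[OF y]])
    then show "x = y"
      using iappend_iprefix_idrop[of "Suc k" x] iappend_iprefix_idrop[of "Suc k" y] b(1) by metis
  qed
  have "?D \<subseteq> h ` ?D"
  proof
    fix y assume "y \<in> ?D"
    then obtain p t where pt: "p \<in> set P" "t \<in> C" "y = iappend p t"
      using P(3) by blast
    obtain j where j: "j < card cells" "p = P ! j"
      using pt(1) P(1) by (metis in_set_conv_nth)
    then obtain c where c: "c \<in> cells" "rk c = j"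
      using rk(1) by (metis bij_betw_def imageE lessThan_iff)
    obtain b v where bv: "c = (b, v)"
      by (cases c)
    have b: "b \<in> B" "v \<in> iprefix L ` \<Phi> b ` C"
      using c(1) bv by (auto simp: cells_def)
    then have "iappend v t \<in> \<Phi> b ` C"
      using L pt(2) unfolding clopen_at_def by blast
    then obtain y1 where y1: "y1 \<in> C" "iappend v t = \<Phi> b y1"
      by blast
    have bl: "length b = Suc k" "b \<in> pre ?D"
      using b(1) by (simp_all add: B_def)
    have vl: "length v = L"
      using vW(2) c(1) bv by blast
    let ?x = "iappend b y1"
    have p: "iprefix (Suc k) ?x = b" "idrop (Suc k) ?x = y1"
      using iprefix_length_iappend[of b y1] idrop_length_iappend[of b y1] bl(1) by simp_all
    have zx: "z ?x = iappend v t"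
      unfolding z_def p using y1(2) by simp
    have "iprefix L (z ?x) = v" "idrop L (z ?x) = t"
      unfolding zx using iprefix_length_iappend[of v t] idrop_length_iappend[of v t] vl by simp_all
    then have "h ?x = y"
      unfolding h_def cell_def p using c(2) bv j(2) pt(3) by simp
    then show "y \<in> h ` ?D"
      using preD(1)[OF bl(2) y1(1)] by blast
  qed
  then have bij: "bij_betw h ?D ?D"
    unfolding bij_betw_def using h_inj hD by blast
  have uch: "uc ?D h"
    unfolding uc_def
  proof
    fix m
    have "\<exists>K. \<forall>b\<in>B. \<forall>K'\<ge>K. \<forall>x\<in>C. \<forall>y\<in>C.
        iprefix K' x = iprefix K' y \<longrightarrow> iprefix (L + m) (\<Phi> b x) = iprefix (L + m) (\<Phi> b y)"
    proof (rule finite_uniform[OF B_fin])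
      fix b assume b: "b \<in> B"
      obtain K where K: "\<forall>x\<in>C. \<forall>y\<in>C. iprefix K x = iprefix K y \<longrightarrow> iprefix (L + m) (\<Phi> b x) = iprefix (L + m) (\<Phi> b y)"
        using embD(4)[OF \<Phi>e[OF b]] unfolding uc_def by blast
      have "iprefix (L + m) (\<Phi> b x) = iprefix (L + m) (\<Phi> b y)"
        if "K \<le> K'" "x \<in> C" "y \<in> C" "iprefix K' x = iprefix K' y" for K' x y
        using K that(2,3) iprefix_mono[OF that(4,1)] by blast
      then show "\<exists>K. \<forall>K'\<ge>K. \<forall>x\<in>C. \<forall>y\<in>C.
          iprefix K' x = iprefix K' y \<longrightarrow> iprefix (L + m) (\<Phi> b x) = iprefix (L + m) (\<Phi> b y)"
        by blast
    qed
    then obtain K where K: "\<forall>b\<in>B. \<forall>K'\<ge>K. \<forall>x\<in>C. \<forall>y\<in>C.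
        iprefix K' x = iprefix K' y \<longrightarrow> iprefix (L + m) (\<Phi> b x) = iprefix (L + m) (\<Phi> b y)"
      by blast
    have "iprefix m (h x) = iprefix m (h y)"
      if x: "x \<in> ?D" and y: "y \<in> ?D" and e: "iprefix (Suc k + K) x = iprefix (Suc k + K) y" for x y
    proof -
      have b: "iprefix (Suc k) x = iprefix (Suc k) y"
        by (rule iprefix_mono[OF e]) simp
      have "iprefix K (idrop (Suc k) x) = iprefix K (idrop (Suc k) y)"
        using e by (auto simp: iprefix_eq_iff idrop_def)
      then have zz: "iprefix (L + m) (z x) = iprefix (L + m) (z y)"
        unfolding z_def b using K xB(1)[OF y] xB(2)[OF x] xB(2)[OF y] by blast
      have "iprefix L (z x) = iprefix L (z y)"
        by (rule iprefix_mono[OF zz]) simp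
      then have "cell x = cell y"
        using b by (simp add: cell_def)
      moreover have "iprefix m (idrop L (z x)) = iprefix m (idrop L (z y))"
        using zz by (auto simp: iprefix_eq_iff idrop_def)
      ultimately show ?thesis
        unfolding h_def using iprefix_iappend_cong by metis
    qed
    then show "\<exists>L. \<forall>x\<in>?D. \<forall>y\<in>?D. iprefix L x = iprefix L y \<longrightarrow> iprefix m (h x) = iprefix m (h y)"
      by blast
  qed
  note he = bij_emb[OF r bij uch]
  have hsim: "sim ?D h ?E h0"
  proof -
    \<comment> \<open>After \<open>K\<close> further letters the core state has written
      \<open>L\<close> letters, so the cell, and with it the part of \<open>P\<close>, is
      decided.\<close>
    have "\<exists>K. \<forall>b\<in>B. \<forall>K'\<ge>K. \<forall>u\<in>pre C. K' \<le> length u \<longrightarrow> L \<le> length (lout n (\<Phi> b) u)"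
    proof (rule finite_uniform[OF B_fin])
      fix b assume b: "b \<in> B"
      obtain K where K: "\<forall>u\<in>pre C. K \<le> length u \<longrightarrow> L \<le> length (lout n (\<Phi> b) u)"
        using lout_long[OF tail_space_C embD(3,4)[OF \<Phi>e[OF b]]] by blast
      have "L \<le> length (lout n (\<Phi> b) u)" if "K \<le> K'" "u \<in> pre C" "K' \<le> length u" for K' u
        using K that(2) le_trans[OF that(1,3)] by blast
      then show "\<exists>K. \<forall>K'\<ge>K. \<forall>u\<in>pre C. K' \<le> length u \<longrightarrow> L \<le> length (lout n (\<Phi> b) u)"
        by blast
    qed
    then obtain K where K: "\<forall>b\<in>B. \<forall>K'\<ge>K. \<forall>u\<in>pre C. K' \<le> length u \<longrightarrow>
        L \<le> length (lout n (\<Phi> b) u)"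
      by blast
    have "sim_at ?D h ?E h0 (Suc k + K)"
      unfolding sim_at_def
    proof (intro ballI impI)
      fix w v v' assume w: "w \<in> W" "Suc k + K \<le> length w" and v: "v \<in> pre ?D" "v' \<in> pre ?E"
      let ?b = "take (Suc k) (v @ w)" and ?u = "drop (Suc k) (v @ w)"
      have vw: "v @ w \<in> pre ?D"
        by (rule pre_append[OF v(1) w(1)])
      have vl: "length v \<ge> 1"
        using preD(2)[OF v(1)] by (cases v) auto
      have "?b @ ?u \<in> pre ?D" "?b \<noteq> []"
        using vw preD(2)[OF vw] by (simp only: append_take_drop_id, simp)
      from pre_appendD[OF D this] have bu: "?b \<in> pre ?D" "?u \<in> W"
        by auto
      have b: "?b \<in> B"
        using bu(1) w(2) by (simp add: B_def)
      have ul: "K \<le> length ?u" "?u \<noteq> []"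
        using w(2) vl by auto
      then have u: "?u \<in> pre C"
        using bu(2) unfolding pre_C by blast
      let ?l = "lout n (\<Phi> ?b) ?u" and ?g = "loc n (\<Phi> ?b) ?u"
      have ll: "L \<le> length ?l"
        using K b u ul(1) by blast
      have ic: "inj_cone n (\<Phi> ?b) ?u"
        by (rule emb_inj_cone[OF \<Phi>e[OF b] u])
      \<comment> \<open>Moving cells only exchanges the first \<open>L\<close> output letters for a
        word of \<open>P\<close>; the local action is that of \<open>\<Phi> ?b\<close> at
        \<open>?u\<close>.\<close>
      have hx: "h (iappend (v @ w) x) = iappend (P ! rk (?b, take L ?l) @ drop L ?l) (?g (iappend [] x))"
        if x: "x \<in> C" for x
      proof -
        have e: "iappend (v @ w) x = iappend ?b (iappend ?u x)"
          by (simp only: iappend_iappend append_take_drop_id)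
        have bl: "length ?b = Suc k"
          using b by (simp add: B_def)
        have p: "iprefix (Suc k) (iappend (v @ w) x) = ?b" "idrop (Suc k) (iappend (v @ w) x) = iappend ?u x"
          unfolding e using iprefix_length_iappend[of ?b "iappend ?u x"]
            idrop_length_iappend[of ?b "iappend ?u x"] unfolding bl by blast+
        have zz: "z (iappend (v @ w) x) = iappend ?l (?g x)"
          unfolding z_def p by (rule lout_loc[OF ic x])
        show ?thesis
          unfolding h_def cell_def p zz
          using ll by (simp add: iprefix_iappend_le idrop_iappend_le)
      qed
      have "loc n h (v @ w) = loc n ?g []"
        by (rule loc_shift[OF hx inj_cone_loc[OF ic]]) simp_all
      also have "\<dots> = loc n (\<Phi> ?b) ?u"
        by (rule loc_loc_Nil[OF ic])
      also have "\<dots> = loc n h0 ((u0 @ tl ?b) @ ?u)"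
        unfolding \<Phi>_def by (rule loc_loc[OF emb_inj_cone[OF d(2) pre_append[OF u0 tlW[OF bu(1)]]] bu(2)])
      \<comment> \<open>Regardless of where the cut falls, exactly the first letter of
        \<open>v @ w\<close> is lost, and \<open>w\<close> remains as a suffix that synchronizes
        \<open>h0\<close>.\<close>
      also have "(u0 @ tl ?b) @ ?u = (u0 @ tl v) @ w"
      proof -
        have "tl ?b @ ?u = tl (?b @ ?u)"
          using \<open>?b \<noteq> []\<close> by (rule tl_append2[symmetric])
        also have "\<dots> = tl v @ w"
          unfolding append_take_drop_id using preD(2)[OF v(1)] by simp
        finally show ?thesis
          by simp
      qed
      also have "loc n h0 ((u0 @ tl v) @ w) = loc n h0 (v' @ w)"
        by (rule sim_atD[OF k w(1) _ pre_append[OF u0 tlW[OF v(1)]] v(2)]) (use w(2) in simp)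
      finally show "loc n h (v @ w) = loc n h0 (v' @ w)" .
    qed
    then show ?thesis
      by (auto simp: sim_def)
  qed
  have "sim ?D h ?D h"
    by (rule sim_trans[OF hsim sim_sym[OF hsim] E])
  \<comment> \<open>Here the synchronization of the inverse of \<open>h0\<close> is transferred to
    the inverse of \<open>h\<close>.\<close>
  moreover have "sim ?D (inv_into ?D h) ?D (inv_into ?D h)"
    by (rule sim_inverse[OF he d(2) hsim bij_emb_inv[OF r bij uch] _ d(4) _ d(5)])
      (use bij_betw_inv_into_right[OF bij] bij_betw_inv_into_left[OF d(1)] in blast)+
  ultimately have hB: "h \<in> B_nr n r"
    unfolding B_nr_iff[OF r] using bij uch by blast
  have less1: "lt (h x) (h y)" if x: "x \<in> ?D" and y: "y \<in> ?D" and l: "key (cell x) < key (cell y)" for x y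
    unfolding h_def using Plt[OF rk(2)[OF cell[OF x] cell[OF y] l] rk_less[OF cell[OF y]] tC[OF x] tC[OF y]] .
  have less2: "lt (h x) (h y)" if x: "x \<in> ?D" and y: "y \<in> ?D"
    and l: "iprefix (Suc k) x = iprefix (Suc k) y" "lt (z x) (z y)" for x y
  proof (cases "val L (z x) < val L (z y)")
    case True
    then have "key (cell x) < key (cell y)"
      unfolding cell_def using cell[OF x] cell[OF y] l(1) by (intro keyless) (auto simp: cell_def)
    then show ?thesis
      by (rule less1[OF x y])
  next
    case False
    moreover have "val L (z x) \<le> val L (z y)"
      using val_le lt_asym[OF tailed_C[OF zC(2)[OF x]] tailed_C[OF zC(2)[OF y]] l(2)] by blast
    ultimately have "iprefix L (z x) = iprefix L (z y)"
      by (intro nval_inj iprefix_in_lists zC(2) x y) simp_all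
    note e = this
    have "lt (idrop L (z x)) (idrop L (z y))"
      using l(2) lt_iappend[of "iprefix L (z x)" "idrop L (z x)" "idrop L (z y)"]
        iappend_iprefix_idrop[of L "z x"] iappend_iprefix_idrop[of L "z y"] e by simp
    moreover have "cell x = cell y"
      using e l(1) by (simp add: cell_def)
    ultimately show ?thesis
      unfolding h_def by (simp add: lt_iappend)
  qed
  \<comment> \<open>Either the words of \<open>B\<close> already decide the comparison, or they
    coincide and a single core state compares the rest.\<close>
  have split: "nval n (iprefix (Suc k) x) < nval n (iprefix (Suc k) y) \<or>
      iprefix (Suc k) x = iprefix (Suc k) y \<and> lt (idrop (Suc k) x) (idrop (Suc k) y)"
    if x: "x \<in> ?D" and y: "y \<in> ?D" and l: "lt x y" for x y
  proof (cases "nval n (iprefix (Suc k) x) < nval n (iprefix (Suc k) y)")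
    case False
    moreover have "val (Suc k) x \<le> val (Suc k) y"
      using val_le lt_asym[OF tailed_cantor_nr[OF x] tailed_cantor_nr[OF y] l] by blast
    ultimately have e: "iprefix (Suc k) x = iprefix (Suc k) y"
      by (intro B_inj xB(1) x y) simp
    have "lt (idrop (Suc k) x) (idrop (Suc k) y)"
      using l lt_iappend[of "iprefix (Suc k) x" "idrop (Suc k) x" "idrop (Suc k) y"]
        iappend_iprefix_idrop[of "Suc k" x] iappend_iprefix_idrop[of "Suc k" y] e by simp
    then show ?thesis
      using e by blast
  qed blast
  have inc: "lt (h x) (h y)" if nd: "\<not> dec" and g: "\<forall>g\<in>core_maps ?E h0. increasing g"
    and x: "x \<in> ?D" and y: "y \<in> ?D" and l: "lt x y" for x y
    using split[OF x y l]
  proof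
    assume "nval n (iprefix (Suc k) x) < nval n (iprefix (Suc k) y)"
    then have "key (cell x) < key (cell y)"
      unfolding cell_def using cell[OF x] cell[OF y] nd by (intro keyless) (auto simp: cell_def pos_def)
    then show ?thesis
      by (rule less1[OF x y])
  next
    assume e: "iprefix (Suc k) x = iprefix (Suc k) y \<and> lt (idrop (Suc k) x) (idrop (Suc k) y)"
    have "increasing (\<Phi> (iprefix (Suc k) y))"
      using g \<Phi>[OF xB(1)[OF y]] by blast
    then have "lt (z x) (z y)"
      using e xB(2)[OF x] xB(2)[OF y] unfolding z_def increasing_def by simp
    then show ?thesis
      using less2[OF x y] e by blast
  qed
  have dcr: "lt (h y) (h x)" if nd: "dec" and g: "\<forall>g\<in>core_maps ?E h0. decreasing g"
    and x: "x \<in> ?D" and y: "y \<in> ?D" and l: "lt x y" for x y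
    using split[OF x y l]
  proof
    assume "nval n (iprefix (Suc k) x) < nval n (iprefix (Suc k) y)"
    then have "pos (iprefix (Suc k) y) < pos (iprefix (Suc k) x)"
      using mx[OF xB(1)[OF y]] nd by (simp add: pos_def)
    then have "key (cell y) < key (cell x)"
      unfolding cell_def using cell[OF x] cell[OF y] by (intro keyless) (auto simp: cell_def)
    then show ?thesis
      by (rule less1[OF y x])
  next
    assume e: "iprefix (Suc k) x = iprefix (Suc k) y \<and> lt (idrop (Suc k) x) (idrop (Suc k) y)"
    have "decreasing (\<Phi> (iprefix (Suc k) y))"
      using g \<Phi>[OF xB(1)[OF y]] by blast
    then have "lt (z y) (z x)"
      using e xB(2)[OF x] xB(2)[OF y] unfolding z_def decreasing_def by simp
    then show ?thesis
      using less2[OF y x] e by simp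
  qed
  show ?thesis
  proof (intro bexI[of _ h] conjI impI ballI)
    show "sim ?D h ?E h0" "h \<in> B_nr n r"
      by (rule hsim, rule hB)
    show "lt (h x) (h y)"
      if "\<not> dec \<and> (\<forall>g\<in>core_maps ?E h0. increasing g)" "x \<in> ?D" "y \<in> ?D" "lt x y" for x y
      by (rule inc[OF conjunct1[OF that(1)] conjunct2[OF that(1)] that(2-4)])
    show "lt (h y) (h x)"
      if "dec \<and> (\<forall>g\<in>core_maps ?E h0. decreasing g)" "x \<in> ?D" "y \<in> ?D" "lt x y" for x y
      by (rule dcr[OF conjunct1[OF that(1)] conjunct2[OF that(1)] that(2-4)])
  qed
qed

lemma realize_O_nr:
  assumes h0: "h0 \<in> B_nr n s" and s: "1 \<le> s" and r: "1 \<le> r"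
    and sg: "core_count (cantor_nr n s) h0 \<sigma>" and cong: "[r * \<sigma> = r] (mod (n - 1))"
  shows "Core n s h0 \<in> O_nr n r"
proof -
  obtain h where h: "h \<in> B_nr n r" "sim (cantor_nr n r) h (cantor_nr n s) h0"
    using realize_core[OF assms] by blast
  have "Core n r h = Core n s h0"
    using Core_core_class(1)[OF h(1) r] Core_core_class(1)[OF h0 s]
      core_class_eq[OF h(2) tail_space_cantor_nr[OF r] tail_space_cantor_nr[OF s]] by simp
  then show ?thesis
    unfolding O_nr_def using h(1) by (metis imageI)
qed

text \<open>All core states having the same direction is what allows one choice of
  \<open>dec\<close> to make the assembled homeomorphism monotone globally.\<close>

lemma realize_TO_nr:
  assumes h0: "h0 \<in> TB_nr n s" and s: "1 \<le> s" and r: "1 \<le> r"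
    and sg: "core_count (cantor_nr n s) h0 \<sigma>" and cong: "[r * \<sigma> = r] (mod (n - 1))"
  shows "Core n s h0 \<in> TO_nr n r"
proof -
  let ?D = "cantor_nr n r"
  have B: "h0 \<in> B_nr n s"
    using h0 by (simp add: TB_nr_def)
  have "\<exists>h\<in>B_nr n r. sim ?D h (cantor_nr n s) h0 \<and> ((\<forall>x\<in>?D. \<forall>y\<in>?D. lt x y \<longrightarrow> lt (h x) (h y)) \<or>
      (\<forall>x\<in>?D. \<forall>y\<in>?D. lt x y \<longrightarrow> lt (h y) (h x)))"
    using TB_monotone[OF h0 s]
  proof
    assume "\<forall>g\<in>core_maps (cantor_nr n s) h0. increasing g"
    then show ?thesis
      using realize_core[OF B s r sg cong, of False] by blast
  next
    assume "\<forall>g\<in>core_maps (cantor_nr n s) h0. decreasing g"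
    then show ?thesis
      using realize_core[OF B s r sg cong, of True] by blast
  qed
  then obtain h where h: "h \<in> B_nr n r" "sim ?D h (cantor_nr n s) h0"
    and mono: "(\<forall>x\<in>?D. \<forall>y\<in>?D. lt x y \<longrightarrow> lt (h x) (h y)) \<or> (\<forall>x\<in>?D. \<forall>y\<in>?D. lt x y \<longrightarrow> lt (h y) (h x))"
    by blast
  have "h \<in> TB_nr n r"
    unfolding TB_nr_def using h(1) monotone_preserves_glue[OF r B_nrD(1)[OF h(1) r] mono] by blast
  moreover have "Core n r h = Core n s h0"
    using Core_core_class(1)[OF h(1) r] Core_core_class(1)[OF B s]
      core_class_eq[OF h(2) tail_space_cantor_nr[OF r] tail_space_cantor_nr[OF s]] by simp
  ultimately show ?thesis
    unfolding TO_nr_def by (metis imageI)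
qed

end



section \<open>Subgroups cut out by a homomorphism to the units modulo \<open>m\<close>\<close>

text \<open>With \<open>t\<close> the product of the primes that divide \<open>m\<close> but not
  \<open>a\<close>, every prime divisor of \<open>m\<close> divides exactly one of \<open>a\<close>
  and \<open>t * l\<close>.\<close>

lemma coprime_lift:
  assumes "coprime a (l :: nat)" "0 < m"
  shows "\<exists>t. coprime (a + t * l) m"
proof -
  define t where "t = \<Prod>{p. prime p \<and> p dvd m \<and> \<not> p dvd a}"
  have fin: "finite {p. prime p \<and> p dvd m \<and> \<not> p dvd a}"
    using assms(2) by (intro finite_subset[OF _ finite_divisors_nat[of m]]) auto
  have "\<not> p dvd a + t * l" if p: "prime p" "p dvd m" for p
  proof (cases "p dvd a")
    case True
    have "\<not> p dvd l"
      using coprime_common_divisor[OF assms(1) True] p(1) not_prime_unit by blast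
    moreover have "\<not> p dvd t"
    proof
      assume "p dvd t"
      then obtain q where "q \<in> {p. prime p \<and> p dvd m \<and> \<not> p dvd a}" "p dvd q"
        unfolding t_def using prime_dvd_prod_iff[OF fin p(1), of "\<lambda>x. x"] by auto
      then show False
        using True p(1) primes_dvd_imp_eq by blast
    qed
    ultimately have "\<not> p dvd t * l"
      using p(1) by (simp add: prime_dvd_mult_iff)
    then show ?thesis
      using True by (simp add: dvd_add_right_iff)
  next
    case False
    then have "p dvd t"
      unfolding t_def using prime_dvd_prod_iff[OF fin p(1), of "\<lambda>x. x"] p by auto
    then show ?thesis
      using False by (simp add: dvd_add_left_iff)
  qed
  then have "gcd (a + t * l) m = 1"
    using prime_factor_nat[of "gcd (a + t * l) m"] by (meson dvd_trans gcd_dvd1 gcd_dvd2)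
  then have "coprime (a + t * l) m"
    by (simp add: coprime_iff_gcd_eq_1)
  then show ?thesis
    by blast
qed

lemma unit_residues_coprime: "u \<in> unit_residues m \<Longrightarrow> coprime u m"
  unfolding unit_residues_def by (auto dest: coprime_iff_invertible_nat[THEN iffD2, rotated] simp: coprime_iff_invertible_nat)

lemma coprime_mod_unit_residue:
  assumes "coprime u m" "0 < m"
  shows "u mod m \<in> unit_residues m"
proof -
  obtain v where "[u * v = 1] (mod m)"
    using cong_solve_coprime_nat[OF assms(1)] by auto
  then have "[u mod m * v = 1] (mod m)"
    by (simp add: cong_def mod_mult_left_eq)
  then show ?thesis
    using assms(2) by (auto simp: unit_residues_def)
qed

lemma index_cong_iff:
  fixes i :: nat
  assumes "m = i * d" "0 < i"
  shows "[i * u = i] (mod m) \<longleftrightarrow> [u = 1] (mod d)"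
proof -
  have "(i * u) mod (i * d) = i * (u mod d)" "(i * 1) mod (i * d) = i * (1 mod d)"
    by (simp_all only: mult_mod_right)
  then show ?thesis
    using assms by (simp add: cong_def)
qed

text \<open>Writing the least common multiple as \<open>i * p\<close> and \<open>j * q\<close> makes
  \<open>p\<close> and \<open>q\<close> coprime, and multiplying the gcd of the quotients by it
  gives the gcd of \<open>m * p\<close> and \<open>m * q\<close>.\<close>

lemma gcd_quotients_lcm:
  fixes i j m :: nat
  assumes "i dvd m" "j dvd m" "0 < m"
  shows "m = lcm i j * gcd (m div i) (m div j)"
proof -
  obtain a where a: "m = i * a"
    using assms(1) by (elim dvdE)
  obtain b where b: "m = j * b"
    using assms(2) by (elim dvdE)
  note ab = a b
  have ij: "0 < i" "0 < j"
    using assms by (auto intro: dvd_pos_nat)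
  obtain p q where pq: "lcm i j = i * p" "lcm i j = j * q"
    by (metis dvd_def dvd_lcm1 dvd_lcm2)
  have "coprime p q"
  proof (rule coprimeI)
    fix c assume c: "c dvd p" "c dvd q"
    obtain p' q' where pq': "p = c * p'" "q = c * q'"
      using c by (auto elim!: dvdE)
    have c0: "0 < c"
      using pq' pq ij by (metis lcm_pos_nat mult_is_0 neq0_conv)
    have e: "c * (i * p') = lcm i j" "c * (j * q') = lcm i j"
    proof -
      show "c * (i * p') = lcm i j"
        unfolding pq(1) pq'(1) by (rule mult.left_commute)
      show "c * (j * q') = lcm i j"
        unfolding pq(2) pq'(2) by (rule mult.left_commute)
    qed
    have "c * (i * p') = c * (j * q')"
      unfolding e ..
    then have e3: "i * p' = j * q'"
      using c0 by simp
    have "j dvd i * p'"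
      unfolding e3 by (rule dvd_triv_left)
    then have "lcm i j dvd i * p'"
      by (intro lcm_least dvd_triv_left)
    moreover have "lcm i j = i * (c * p')"
      unfolding pq(1) pq'(1) ..
    ultimately have "i * (c * p') dvd i * p'"
      by (simp only:)
    then have "c * p' dvd p'"
      using ij by simp
    moreover have p0: "0 < p'"
      using pq pq' ij by (metis lcm_pos_nat mult_is_0 neq0_conv)
    ultimately have "c * p' \<le> 1 * p'"
      by (simp add: dvd_imp_le)
    then have "c \<le> 1"
      using p0 by simp
    then show "is_unit c"
      using c0 by simp
  qed
  have "lcm i j * gcd a b = gcd (lcm i j * a) (lcm i j * b)"
    by (simp add: gcd_mult_distrib_nat)
  also have "\<dots> = gcd (m * p) (m * q)"
    using pq ab by (metis mult.assoc mult.commute)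
  also have "\<dots> = m"
    using \<open>coprime p q\<close> by (simp add: gcd_mult_distrib_nat[symmetric])
  finally have "m = lcm i j * gcd a b" ..
  moreover have "m div i = a"
    using ij unfolding a by simp
  moreover have "m div j = b"
    using ij unfolding b by simp
  ultimately show ?thesis
    by simp
qed

text \<open>With \<open>d = m div i\<close> and \<open>e = m div j\<close> the conditions say: 1
  modulo \<open>d\<close>, 1 modulo \<open>e\<close>, and for \<open>u\<close> 1 modulo
  \<open>gcd d e\<close>. A unit \<open>v\<close> that is 1 modulo \<open>d\<close> and
  \<open>u\<close> modulo \<open>e\<close> leaves a cofactor that is 1 modulo \<open>e\<close>. The
  cofactor is quantified because it will be the signature of a group element.\<close>

lemma unit_factorization:
  fixes i j m u :: nat
  assumes ij: "i dvd m" "j dvd m" and m: "0 < m" and u: "coprime u m"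
    and l: "[lcm i j * u = lcm i j] (mod m)"
  shows "\<exists>v. coprime v m \<and> [i * v = i] (mod m) \<and>
     (\<forall>w. [v * w = u] (mod m) \<longrightarrow> [j * w = j] (mod m))"
proof -
  define d e g where "d = m div i" and "e = m div j" and "g = gcd d e"
  have md: "m = i * d" and me: "m = j * e"
    using ij by (simp_all add: d_def e_def)
  have pos: "0 < i" "0 < j" "0 < d" "0 < e"
    using m md me by (auto intro: Nat.gr0I)
  have "m = lcm i j * g"
    unfolding g_def d_def e_def by (rule gcd_quotients_lcm[OF ij m])
  from index_cong_iff[OF this, of u] l have "[u = 1] (mod g)"
    using pos by (simp add: lcm_pos_nat)
  then have "int g dvd int u - 1"
    using cong_iff_dvd_diff[of "int u" 1 "int g"] cong_int_iff[of u 1 g] by simp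
  then obtain t where t: "int u - 1 = int g * t"
    by (auto elim: dvdE)
  obtain p q where pq: "p * int d + q * int e = int g"
    using bezout_int[of "int d" "int e"] by (auto simp: g_def)
  \<comment> \<open>From \<open>u = 1 + g t\<close> and the Bezout identity for \<open>g\<close>,
    the number \<open>1 + p d t\<close> is 1 modulo \<open>d\<close> and \<open>u\<close> modulo
    \<open>e\<close>; reducing it makes it a natural number.\<close>
  define x where "x = nat ((1 + p * int d * t) mod int (d * e))"
  have x: "int x = (1 + p * int d * t) mod int (d * e)"
    unfolding x_def using pos by (intro nat_0_le pos_mod_sign) simp
  have xc: "[int x = 1 + p * int d * t] (mod int (d * e))"
    unfolding x by simp
  have xde: "[int x = 1 + p * int d * t] (mod int d)" "[int x = 1 + p * int d * t] (mod int e)"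
    using cong_dvd_modulus[OF xc, of "int d"] cong_dvd_modulus[OF xc, of "int e"] by simp_all
  have od: "[1 + p * int d * t = 1] (mod int d)"
    by (simp add: cong_iff_dvd_diff)
  have "1 + p * int d * t - int u = - (q * t * int e)"
  proof -
    have "int u = 1 + (p * int d + q * int e) * t"
      using t pq by simp
    then show ?thesis
      by (simp add: algebra_simps)
  qed
  then have oe: "[1 + p * int d * t = int u] (mod int e)"
    by (simp add: cong_iff_dvd_diff)
  have "[int x = int 1] (mod int d)" "[int x = int u] (mod int e)"
    using cong_trans[OF xde(1) od] cong_trans[OF xde(2) oe] by simp_all
  then have xd: "[x = 1] (mod d)" and xe: "[x = u] (mod e)"
    unfolding cong_int_iff by auto
  have "coprime x d"
    using cong_imp_coprime[OF cong_sym[OF xd]] by simp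
  moreover have "coprime u e"
    using u me by (simp add: coprime_mult_right_iff)
  then have "coprime x e"
    using cong_imp_coprime[OF cong_sym[OF xe]] by simp
  ultimately have "coprime x (d * e)"
    by simp
  \<comment> \<open>So far \<open>x\<close> is a unit modulo \<open>d * e\<close> only; a multiple
    of \<open>d * e\<close> is added to make it a unit modulo \<open>m\<close>.\<close>
  from coprime_lift[OF this m] obtain s where s: "coprime (x + s * (d * e)) m"
    by blast
  define v where "v = x + s * (d * e)"
  have "[x + s * (d * e) = x] (mod d)" "[x + s * (d * e) = x] (mod e)"
    by (simp_all add: cong_add_lcancel_0_nat cong_0_iff)
  then have v: "[v = 1] (mod d)" "[v = u] (mod e)"
    using cong_trans xd xe unfolding v_def by blast+
  have "[j * w = j] (mod m)" if w: "[v * w = u] (mod m)" for w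
  proof -
    have "[v * w = u] (mod e)"
      by (rule cong_dvd_modulus_nat[OF w]) (simp add: me)
    then have "[v * w = v * 1] (mod e)"
      using cong_trans[OF _ cong_sym[OF v(2)]] by simp
    moreover have "coprime v e"
      using s me by (simp add: v_def coprime_mult_right_iff)
    ultimately have "[w = 1] (mod e)"
      using cong_mult_lcancel_nat by blast
    then show ?thesis
      using index_cong_iff[OF me pos(2)] by blast
  qed
  moreover have "[i * v = i] (mod m)"
    using index_cong_iff[OF md pos(1)] v(1) by blast
  ultimately show ?thesis
    using s unfolding v_def[symmetric] by blast
qed

text \<open>The condition says that \<open>m\<close> divides \<open>r * (u - 1)\<close>, and
  \<open>t\<close> is \<open>m\<close> divided by its gcd with \<open>u - 1\<close>.\<close>

lemma index_cong_dvd: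
  fixes m u :: nat
  assumes "0 < m"
  shows "\<exists>t. 1 \<le> t \<and> t \<le> m \<and> t dvd m \<and> (\<forall>r. [r * u = r] (mod m) \<longleftrightarrow> t dvd r)"
proof -
  \<comment> \<open>For \<open>u = 0\<close> the integer \<open>u - 1\<close> is \<open>-1\<close>,
    replaced by \<open>1\<close>, which has the same multiples.\<close>
  define a where "a = (if u = 0 then 1 else u - 1)"
  have a: "[r * u = r] (mod m) \<longleftrightarrow> m dvd r * a" for r
  proof (cases "u = 0")
    case False
    then have "r * u = r + r * a"
      by (cases u) (simp_all add: a_def)
    moreover have "[r + r * a = r] (mod m) \<longleftrightarrow> [r * a = 0] (mod m)"
      using cong_add_lcancel_0_nat by blast
    ultimately show ?thesis
      by (simp add: cong_0_iff)
  qed (simp add: a_def cong_sym_eq[of 0] cong_0_iff)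
  define g where "g = gcd m a"
  have g: "0 < g" "g dvd m" "g dvd a"
    using assms by (simp_all add: g_def)
  obtain t b where tb: "m = g * t" "a = g * b"
    using g(2,3) by (auto elim!: dvdE)
  have "coprime t b"
  proof -
    have "g * gcd t b = gcd (g * t) (g * b)"
      by (rule gcd_mult_distrib_nat)
    also have "gcd (g * t) (g * b) = gcd m a"
      by (simp only: tb)
    also have "\<dots> = g * 1"
      by (simp only: g_def mult_1_right)
    finally show ?thesis
      using g(1) unfolding mult_cancel1 coprime_iff_gcd_eq_1 by simp
  qed
  have "m dvd r * a \<longleftrightarrow> t dvd r" for r
  proof -
    have "m dvd r * a \<longleftrightarrow> g * t dvd g * (r * b)"
      using tb by (simp add: ac_simps)
    also have "\<dots> \<longleftrightarrow> t dvd r * b"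
      using g(1) by simp
    also have "\<dots> \<longleftrightarrow> t dvd r"
      using \<open>coprime t b\<close> by (simp add: coprime_dvd_mult_left_iff)
    finally show ?thesis .
  qed
  moreover have "1 \<le> t" "t \<le> m" "t dvd m"
    using assms tb g(1) by (auto simp: Suc_le_eq intro: Nat.gr0I)
  ultimately show ?thesis
    using a by blast
qed

text \<open>The arithmetic skeleton of the theorem: \<open>M\<close> will be the group with
  \<open>n - 1\<close> dotted letters and \<open>\<sigma>\<close> the reduced signature, treated
  alike for both families.\<close>

locale residue_filtration = group G for G :: "'g monoid" (structure) +
  fixes n :: nat and M :: "'g set" and \<sigma> :: "'g \<Rightarrow> nat" and X :: "nat \<Rightarrow> 'g set"
  assumes n2: "2 \<le> n" and M: "subgroup M G"
    and hom: "x \<in> M \<Longrightarrow> y \<in> M \<Longrightarrow> [\<sigma> (x \<otimes> y) = \<sigma> x * \<sigma> y] (mod (n - 1))"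
    and onto: "\<sigma> ` M = unit_residues (n - 1)"
    and X: "1 \<le> r \<Longrightarrow> X r = {x \<in> M. [r * \<sigma> x = r] (mod (n - 1))}"
begin

lemma m_pos: "0 < n - 1"
  using n2 by simp

lemma \<sigma>_coprime: "x \<in> M \<Longrightarrow> coprime (\<sigma> x) (n - 1)"
  using onto unit_residues_coprime by blast

text \<open>Multiplicativity makes this value idempotent, and being a unit it can be
  cancelled.\<close>

lemma \<sigma>_one: "[\<sigma> \<one> = 1] (mod (n - 1))"
proof -
  have one: "\<one> \<in> M"
    by (rule subgroup.one_closed[OF M])
  have "[\<sigma> \<one> * 1 = \<sigma> \<one> * \<sigma> \<one>] (mod (n - 1))"
    using hom[OF one one] by simp
  from this[unfolded cong_mult_lcancel_nat[OF \<sigma>_coprime[OF one]]] show ?thesis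
    by (rule cong_sym)
qed

lemma \<sigma>_inv: "x \<in> M \<Longrightarrow> [\<sigma> x * \<sigma> (inv x) = 1] (mod (n - 1))"
  using hom[of x "inv x"] subgroup.m_inv_closed[OF M] subgroup.mem_carrier[OF M] \<sigma>_one cong_sym cong_trans
  by (metis r_inv)

lemma X_subgroup:
  assumes r: "1 \<le> r"
  shows "subgroup (X r) G"
proof (rule subgroupI)
  show "X r \<subseteq> carrier G"
    using X[OF r] subgroup.subset[OF M] by auto
  have "\<one> \<in> X r"
    using X[OF r] subgroup.one_closed[OF M] cong_scalar_left[OF \<sigma>_one, of r] by simp
  then show "X r \<noteq> {}"
    by blast
  fix x assume x: "x \<in> X r"
  then have xM: "x \<in> M" "[r * \<sigma> x = r] (mod (n - 1))"
    using X[OF r] by auto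
  have "[r * \<sigma> x * \<sigma> (inv x) = r * \<sigma> (inv x)] (mod (n - 1))"
    by (rule cong_scalar_right[OF xM(2)])
  moreover have "[r * (\<sigma> x * \<sigma> (inv x)) = r * 1] (mod (n - 1))"
    by (rule cong_scalar_left[OF \<sigma>_inv[OF xM(1)]])
  ultimately have "[r * \<sigma> (inv x) = r] (mod (n - 1))"
    by (metis cong_sym cong_trans mult.assoc mult.right_neutral)
  then show "inv x \<in> X r"
    using X[OF r] subgroup.m_inv_closed[OF M xM(1)] by simp
  fix y assume y: "y \<in> X r"
  then have yM: "y \<in> M" "[r * \<sigma> y = r] (mod (n - 1))"
    using X[OF r] by auto
  have "[r * \<sigma> (x \<otimes> y) = r * (\<sigma> x * \<sigma> y)] (mod (n - 1))"
    by (rule cong_scalar_left[OF hom[OF xM(1) yM(1)]])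
  moreover have "[r * \<sigma> x * \<sigma> y = r * \<sigma> y] (mod (n - 1))"
    by (rule cong_scalar_right[OF xM(2)])
  ultimately have "[r * \<sigma> (x \<otimes> y) = r] (mod (n - 1))"
    using yM(2) by (metis cong_trans mult.assoc)
  then show "x \<otimes> y \<in> X r"
    using X[OF r] subgroup.m_closed[OF M xM(1) yM(1)] by simp
qed

text \<open>For \<open>x\<close> in \<open>M\<close> this is the least index whose group contains
  \<open>x\<close>; the least elements of the atoms are numbers of this form.\<close>

definition \<rho> :: "'g \<Rightarrow> nat" where
  "\<rho> x = (SOME t. 1 \<le> t \<and> t \<le> n - 1 \<and> t dvd n - 1 \<and> (\<forall>r. [r * \<sigma> x = r] (mod (n - 1)) \<longleftrightarrow> t dvd r))"

lemma \<rho>: "1 \<le> \<rho> x" "\<rho> x \<le> n - 1" "\<rho> x dvd n - 1" "[r * \<sigma> x = r] (mod (n - 1)) \<longleftrightarrow> \<rho> x dvd r"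
  using someI_ex[OF index_cong_dvd[OF m_pos, of "\<sigma> x"]] unfolding \<rho>_def by blast+

lemma X_iff: "1 \<le> r \<Longrightarrow> x \<in> X r \<longleftrightarrow> x \<in> M \<and> \<rho> x dvd r"
  using X \<rho>(4) by simp

lemma X_mono: "1 \<le> r \<Longrightarrow> 1 \<le> s \<Longrightarrow> r dvd s \<Longrightarrow> X r \<subseteq> X s"
  using X_iff dvd_trans by blast

lemma X_gcd: "1 \<le> r \<Longrightarrow> 1 \<le> s \<Longrightarrow> X (gcd r s) = X r \<inter> X s"
  using X_iff[of "gcd r s"] X_iff[of r] X_iff[of s] gcd_pos_nat[of r s] by (auto simp: Suc_le_eq)

text \<open>Replacing an index by its gcd with \<open>n - 1\<close> does not change the group, so
  the least index of a class must be a divisor of \<open>n - 1\<close>.\<close>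

lemma index_classesD:
  assumes c: "c \<in> index_classes n X"
  shows "Min c \<in> {1..n - 1}" "c = {j \<in> {1..n - 1}. X j = X (Min c)}" "Min c dvd n - 1"
proof -
  obtain i where i: "i \<in> {1..n - 1}" "c = {j \<in> {1..n - 1}. X j = X i}"
    using c by (auto simp: index_classes_def index_class_def)
  have "finite c" "c \<noteq> {}"
    using i by auto
  then have mc: "Min c \<in> c" "\<And>j. j \<in> c \<Longrightarrow> Min c \<le> j"
    by auto
  then show r: "Min c \<in> {1..n - 1}" "c = {j \<in> {1..n - 1}. X j = X (Min c)}"
    using i(2) by auto
  let ?g = "gcd (Min c) (n - 1)"
  have "X (n - 1) = M"
    using X_iff[of "n - 1"] \<rho>(3) m_pos by auto
  moreover have "X (Min c) \<subseteq> M"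
    using X r(1) by auto
  ultimately have "X ?g = X (Min c)"
    using X_gcd[of "Min c" "n - 1"] r(1) by auto
  moreover have g: "1 \<le> ?g" "?g \<le> Min c" "?g \<le> n - 1"
    using r(1) gcd_le1_nat[of "Min c" "n - 1"] gcd_le2_nat[of "n - 1" "Min c"] m_pos
    by (auto simp: Suc_le_eq)
  ultimately have "?g \<in> c"
    by (subst r(2)) simp
  then have "?g = Min c"
    using mc(2) g(2) by (simp add: le_antisym)
  then show "Min c dvd n - 1"
    by (metis gcd_dvd2)
qed

lemma index_class_in:
  assumes "i \<in> {1..n - 1}"
  shows "index_class n X i \<in> index_classes n X" "i \<in> index_class n X i" "Min (index_class n X i) \<le> i"
    "X (Min (index_class n X i)) = X i"
proof -
  show c: "index_class n X i \<in> index_classes n X" and i: "i \<in> index_class n X i"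
    using assms by (auto simp: index_classes_def index_class_def)
  have f: "finite (index_class n X i)"
    by (simp add: index_class_def)
  then show "Min (index_class n X i) \<le> i"
    using i by simp
  have "Min (index_class n X i) \<in> index_class n X i"
    using Min_in[OF f] i by blast
  then show "X (Min (index_class n X i)) = X i"
    by (simp add: index_class_def)
qed

lemma class_eqI:
  assumes "c \<in> index_classes n X" "d \<in> index_classes n X" "Min c = Min d"
  shows "c = d"
  using index_classesD(2)[OF assms(1)] index_classesD(2)[OF assms(2)] assms(3) by simp

text \<open>An element \<open>x\<close> of the group of \<open>c\<close> lies in no group of index
  below \<open>\<rho> x\<close>, so the class of \<open>\<rho> x\<close> is an atom of
  \<open>c\<close>. Conversely, an element witnessing an atom has \<open>\<rho>\<close> equal to the
  least element of that atom.\<close>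

lemma class_dvd_iff:
  assumes c: "c \<in> index_classes n X" and d: "d \<in> index_classes n X"
  shows "class_dvd n X c d \<longleftrightarrow> X (Min c) \<subseteq> X (Min d)"
proof
  have cd: "1 \<le> Min c" "1 \<le> Min d"
    using index_classesD(1)[OF c] index_classesD(1)[OF d] by auto
  show "X (Min c) \<subseteq> X (Min d)" if dv: "class_dvd n X c d"
  proof
    fix x assume x: "x \<in> X (Min c)"
    let ?t = "\<rho> x"
    let ?a = "index_class n X ?t"
    have xM: "x \<in> M" "?t dvd Min c"
      using x X_iff[OF cd(1)] by auto
    have t: "?t \<in> {1..n - 1}"
      using \<rho> by simp
    note a = index_class_in[OF t]
    have xt: "x \<in> X ?t"
      using X_iff[of ?t] \<rho>(1) xM(1) by simp
    have small: "x \<notin> X s" if "1 \<le> s" "s < ?t" for s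
      using X_iff[OF that(1)] that by (auto dest: dvd_imp_le)
    have "\<not> Min ?a < ?t"
      using small[of "Min ?a"] xt a(4) index_classesD(1)[OF a(1)] by auto
    then have mt: "Min ?a = ?t"
      using a(3) by simp
    have "is_atom n X ?a"
      unfolding is_atom_def class_group_def class_less_def mt
      using a(1) xt small index_classesD(1) by (intro conjI bexI[of _ x]) auto
    moreover have "X ?t \<subseteq> X (Min c)"
      by (rule X_mono[OF \<rho>(1) cd(1) xM(2)])
    ultimately have "is_atom_of n X ?a c"
      by (simp add: is_atom_of_def class_group_def mt)
    then have "?t dvd Min d"
      using dv mt unfolding class_dvd_def by metis
    then show "x \<in> X (Min d)"
      using X_iff[OF cd(2)] xM(1) by simp
  qed
  show "class_dvd n X c d" if sub: "X (Min c) \<subseteq> X (Min d)"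
    unfolding class_dvd_def
  proof (intro allI impI)
    fix a assume a: "is_atom_of n X a c"
    then have ac: "a \<in> index_classes n X" "X (Min a) \<subseteq> X (Min c)"
      by (simp_all add: is_atom_of_def is_atom_def class_group_def)
    obtain x where x: "x \<in> X (Min a)" "\<And>s. s \<in> index_classes n X \<Longrightarrow> Min s < Min a \<Longrightarrow> x \<notin> X (Min s)"
      using a by (auto simp: is_atom_of_def is_atom_def class_group_def class_less_def)
    have a1: "1 \<le> Min a"
      using index_classesD(1)[OF ac(1)] by simp
    have xa: "x \<in> M" "\<rho> x dvd Min a"
      using x(1) X_iff[OF a1] by auto
    have t: "\<rho> x \<in> {1..n - 1}"
      using \<rho> by simp
    note b = index_class_in[OF t]
    have "x \<in> X (Min (index_class n X (\<rho> x)))"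
      using b(4) X_iff[of "\<rho> x"] \<rho>(1) xa(1) by simp
    then have "\<not> Min (index_class n X (\<rho> x)) < Min a"
      using x(2)[OF b(1)] by blast
    then have "Min a = \<rho> x"
      using b(3) dvd_imp_le[OF xa(2)] a1 by simp
    moreover have "\<rho> x dvd Min d"
      using x(1) ac(2) sub X_iff[OF cd(2)] by blast
    ultimately show "Min a dvd Min d"
      by simp
  qed
qed

text \<open>The signature of \<open>x\<close> is factored in the units; surjectivity lifts the first
  factor to \<open>y\<close>, and the quotient of \<open>x\<close> by \<open>y\<close> then has the
  required signature.\<close>

lemma X_lcm_products:
  assumes i: "1 \<le> i" "i dvd n - 1" and j: "1 \<le> j" "j dvd n - 1" and x: "x \<in> X (lcm i j)"
  shows "\<exists>y\<in>X i. \<exists>z\<in>X j. x = y \<otimes> z"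
proof -
  have l: "1 \<le> lcm i j"
    using i j by (simp add: Suc_le_eq lcm_pos_nat)
  have xM: "x \<in> M" "[lcm i j * \<sigma> x = lcm i j] (mod (n - 1))"
    using x X[OF l] by auto
  obtain v where v: "coprime v (n - 1)" "[i * v = i] (mod (n - 1))"
    "\<And>w. [v * w = \<sigma> x] (mod (n - 1)) \<Longrightarrow> [j * w = j] (mod (n - 1))"
    using unit_factorization[OF i(2) j(2) m_pos \<sigma>_coprime[OF xM(1)] xM(2)] by blast
  obtain y where y: "y \<in> M" "\<sigma> y = v mod (n - 1)"
    using coprime_mod_unit_residue[OF v(1) m_pos] onto by (metis imageE)
  have yv: "[\<sigma> y = v] (mod (n - 1))"
    by (simp add: y(2))
  have "[i * \<sigma> y = i] (mod (n - 1))"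
    using cong_scalar_left[OF yv, of i] v(2) cong_trans by blast
  then have yi: "y \<in> X i"
    using X[OF i(1)] y(1) by simp
  have yc: "y \<in> carrier G" and xc: "x \<in> carrier G"
    using y(1) xM(1) subgroup.mem_carrier[OF M] by auto
  define z where "z = inv y \<otimes> x"
  have zM: "z \<in> M"
    unfolding z_def using subgroup.m_closed[OF M subgroup.m_inv_closed[OF M y(1)] xM(1)] .
  have xyz: "x = y \<otimes> z"
    unfolding z_def using yc xc by (simp add: m_assoc[symmetric])
  have "[\<sigma> y * \<sigma> z = \<sigma> x] (mod (n - 1))"
    using hom[OF y(1) zM] xyz cong_sym by simp
  then have "[v * \<sigma> z = \<sigma> x] (mod (n - 1))"
    using cong_scalar_right[OF yv, of "\<sigma> z"] cong_sym cong_trans by blast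
  then have "z \<in> X j"
    using v(3) X[OF j(1)] zM by simp
  then show ?thesis
    using yi xyz by blast
qed

theorem generate_classes:
  assumes c: "c \<in> index_classes n X" and d: "d \<in> index_classes n X"
  shows "generate G (class_group X c \<union> class_group X d) = class_group X (class_lcm n X c d)"
proof -
  let ?i = "Min c" and ?j = "Min d"
  let ?l = "lcm ?i ?j"
  have i: "1 \<le> ?i" "?i dvd n - 1" and j: "1 \<le> ?j" "?j dvd n - 1"
    using index_classesD[OF c] index_classesD[OF d] by auto
  have l1: "1 \<le> ?l"
    using i j by (simp add: Suc_le_eq lcm_pos_nat)
  have "?l dvd n - 1"
    using i j by (simp add: lcm_least)
  then have l: "?l \<in> {1..n - 1}"
    using l1 dvd_imp_le m_pos by simp
  \<comment> \<open>The candidate for the lowest common multiple of classes is the class of the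
    numerical one.\<close>
  define b where "b = index_class n X ?l"
  have b: "b \<in> index_classes n X" "X (Min b) = X ?l"
    unfolding b_def by (rule index_class_in(1)[OF l], rule index_class_in(4)[OF l])
  have sub: "X ?i \<subseteq> X ?l" "X ?j \<subseteq> X ?l"
    by (rule X_mono[OF i(1) l1], simp, rule X_mono[OF j(1) l1], simp)
  have gen: "generate G (X ?i \<union> X ?j) = X ?l"
  proof
    show "generate G (X ?i \<union> X ?j) \<subseteq> X ?l"
      by (rule generate_subgroup_incl[OF _ X_subgroup[OF l1]]) (use sub in blast)
    show "X ?l \<subseteq> generate G (X ?i \<union> X ?j)"
    proof
      fix x assume "x \<in> X ?l"
      from X_lcm_products[OF i j this] show "x \<in> generate G (X ?i \<union> X ?j)"
        by (auto intro: generate.eng generate.incl)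
    qed
  qed
  \<comment> \<open>A competitor's group contains that of \<open>b\<close>, so
    \<open>gcd (Min b) (Min l')\<close> has the same group as \<open>b\<close>; by minimality of
    \<open>Min b\<close> it cannot be smaller.\<close>
  have least: "b = l' \<or> class_less b l'"
    if l': "l' \<in> index_classes n X" "class_dvd n X c l'" "class_dvd n X d l'" for l'
  proof -
    have m: "1 \<le> Min l'" "1 \<le> Min b"
      using index_classesD(1)[OF l'(1)] index_classesD(1)[OF b(1)] by auto
    have "X ?i \<union> X ?j \<subseteq> X (Min l')"
      using l' class_dvd_iff[OF c l'(1)] class_dvd_iff[OF d l'(1)] by blast
    then have "X ?l \<subseteq> X (Min l')"
      using generate_subgroup_incl[OF _ X_subgroup[OF m(1)]] gen by blast
    then have "X (gcd (Min b) (Min l')) = X (Min b)"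
      using X_gcd[OF m(2,1)] b(2) by auto
    moreover have "gcd (Min b) (Min l') \<in> {1..n - 1}"
    proof -
      have "gcd (Min b) (Min l') \<le> Min b"
        using m by (intro gcd_le1_nat) simp
      also have "Min b \<le> n - 1"
        using index_classesD(1)[OF b(1)] by simp
      finally show ?thesis
        using m by (simp add: Suc_le_eq)
    qed
    ultimately have "gcd (Min b) (Min l') \<in> b"
      by (subst index_classesD(2)[OF b(1)]) simp
    then have "Min b \<le> gcd (Min b) (Min l')"
      by (intro Min_le) (auto simp: b_def index_class_def)
    also have "\<dots> \<le> Min l'"
      using m by (intro gcd_le2_nat) simp
    finally show ?thesis
      using class_eqI[OF b(1) l'(1)] unfolding class_less_def by fastforce
  qed
  have "is_class_lcm n X c d b"
    unfolding is_class_lcm_def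
    using b least class_dvd_iff[OF c b(1)] class_dvd_iff[OF d b(1)] sub by simp
  moreover have "l' = b" if "is_class_lcm n X c d l'" for l'
  proof -
    have "b = l' \<or> class_less b l'"
      using that least unfolding is_class_lcm_def by blast
    moreover have "l' = b \<or> class_less l' b"
      using that \<open>is_class_lcm n X c d b\<close> unfolding is_class_lcm_def by blast
    ultimately show ?thesis
      unfolding class_less_def by fastforce
  qed
  ultimately have "class_lcm n X c d = b"
    unfolding class_lcm_def by (rule the_equality)
  then show ?thesis
    using gen b(2) by (simp add: class_group_def)
qed

end

section \<open>The group of cores\<close>

context alph
begin

lemma m_ge1: "1 \<le> n - 1"
  using n2 by simp

section \<open>The families of cores as sets defined by the signature\<close>

lemma Core_sig:
  assumes h: "h \<in> B_nr n r" and r: "1 \<le> r"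
  shows "\<exists>s. core_count (cantor_nr n r) h s \<and> reduced_sig n (Core n r h) = s mod (n - 1) \<and>
    [r * s = r] (mod (n - 1))"
  using core_count_exists[OF h r] reduced_sig_Core[OF h r] core_count_index[OF h r] by blast

lemma cong_mod_iff: "[r * (s mod m) = r] (mod m) \<longleftrightarrow> [r * s = r] (mod (m :: nat))"
  by (simp add: cong_def mod_mult_right_eq)

text \<open>Realization is used in both directions: into \<open>n - 1\<close> dotted letters the
  congruence always holds, and back into \<open>r\<close> it is the stated condition.\<close>

lemma O_nr_eq:
  assumes r: "1 \<le> r"
  shows "O_nr n r = {T \<in> O_nr n (n - 1). [r * reduced_sig n T = r] (mod (n - 1))}"
proof (intro equalityI subsetI)
  fix T assume "T \<in> O_nr n r"
  then obtain h where h: "h \<in> B_nr n r" "T = Core n r h"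
    by (auto simp: O_nr_def)
  obtain s where s: "core_count (cantor_nr n r) h s" "reduced_sig n (Core n r h) = s mod (n - 1)"
    "[r * s = r] (mod (n - 1))"
    using Core_sig[OF h(1) r] by blast
  have "T \<in> O_nr n (n - 1)"
    unfolding h(2) by (rule realize_O_nr[OF h(1) r m_ge1 s(1)]) (simp add: cong_def)
  then show "T \<in> {T \<in> O_nr n (n - 1). [r * reduced_sig n T = r] (mod (n - 1))}"
    using s(2,3) h(2) cong_mod_iff by simp
next
  fix T assume T: "T \<in> {T \<in> O_nr n (n - 1). [r * reduced_sig n T = r] (mod (n - 1))}"
  then obtain h where h: "h \<in> B_nr n (n - 1)" "T = Core n (n - 1) h"
    by (auto simp: O_nr_def)
  obtain s where s: "core_count (cantor_nr n (n - 1)) h s" "reduced_sig n (Core n (n - 1) h) = s mod (n - 1)"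
    using Core_sig[OF h(1) m_ge1] by blast
  show "T \<in> O_nr n r"
    unfolding h(2) by (rule realize_O_nr[OF h(1) m_ge1 r s(1)]) (use T s(2) h(2) cong_mod_iff in simp)
qed

lemma TO_nr_eq:
  assumes r: "1 \<le> r"
  shows "TO_nr n r = {T \<in> TO_nr n (n - 1). [r * reduced_sig n T = r] (mod (n - 1))}"
proof (intro equalityI subsetI)
  fix T assume "T \<in> TO_nr n r"
  then obtain h where h: "h \<in> TB_nr n r" "T = Core n r h"
    by (auto simp: TO_nr_def)
  then have hB: "h \<in> B_nr n r"
    by (simp add: TB_nr_def)
  obtain s where s: "core_count (cantor_nr n r) h s" "reduced_sig n (Core n r h) = s mod (n - 1)"
    "[r * s = r] (mod (n - 1))"
    using Core_sig[OF hB r] by blast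
  have "T \<in> TO_nr n (n - 1)"
    unfolding h(2) by (rule realize_TO_nr[OF h(1) r m_ge1 s(1)]) (simp add: cong_def)
  then show "T \<in> {T \<in> TO_nr n (n - 1). [r * reduced_sig n T = r] (mod (n - 1))}"
    using s(2,3) h(2) cong_mod_iff by simp
next
  fix T assume T: "T \<in> {T \<in> TO_nr n (n - 1). [r * reduced_sig n T = r] (mod (n - 1))}"
  then obtain h where h: "h \<in> TB_nr n (n - 1)" "T = Core n (n - 1) h"
    by (auto simp: TO_nr_def)
  then have hB: "h \<in> B_nr n (n - 1)"
    by (simp add: TB_nr_def)
  obtain s where s: "core_count (cantor_nr n (n - 1)) h s" "reduced_sig n (Core n (n - 1) h) = s mod (n - 1)"
    using Core_sig[OF hB m_ge1] by blast
  show "T \<in> TO_nr n r"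
    unfolding h(2) by (rule realize_TO_nr[OF h(1) m_ge1 r s(1)]) (use T s(2) h(2) cong_mod_iff in simp)
qed

lemma UN_top:
  assumes "\<And>r. 1 \<le> r \<Longrightarrow> X r \<subseteq> X (n - 1)"
  shows "(\<Union>r\<in>{1..n - 1}. X r) = X (n - 1)"
proof
  show "(\<Union>r\<in>{1..n - 1}. X r) \<subseteq> X (n - 1)"
    by (rule UN_least) (use assms in simp)
  show "X (n - 1) \<subseteq> (\<Union>r\<in>{1..n - 1}. X r)"
    using m_ge1 by (intro UN_upper) simp
qed

lemma carrier_O_group: "carrier (O_group n) = O_nr n (n - 1)"
proof -
  have "O_nr n r \<subseteq> O_nr n (n - 1)" if "1 \<le> r" for r
    using O_nr_eq[OF that] by blast
  from UN_top[of "O_nr n", OF this] show ?thesis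
    by (simp add: O_group_def)
qed

section \<open>Closure properties of \<open>TB_nr\<close> and the group of cores\<close>

lemma TB_nr_subset: "TB_nr n r \<subseteq> B_nr n r"
  by (auto simp: TB_nr_def)

lemma TB_nrD:
  "h \<in> TB_nr n r \<Longrightarrow> x \<in> cantor_nr n r \<Longrightarrow> y \<in> cantor_nr n r \<Longrightarrow> glue n r x y \<longleftrightarrow> glue n r (h x) (h y)"
  unfolding TB_nr_def by blast

lemma TB_nr_comp:
  assumes "h1 \<in> TB_nr n r" "h2 \<in> TB_nr n r" "1 \<le> r"
  shows "(\<lambda>x. h2 (h1 x)) \<in> TB_nr n r"
proof -
  have B: "h1 \<in> B_nr n r" "h2 \<in> B_nr n r"
    using assms(1,2) TB_nr_subset by auto
  have D: "h1 x \<in> cantor_nr n r" if "x \<in> cantor_nr n r" for x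
    by (rule emb_in[OF B_nrD(2)[OF B(1) assms(3)] that])
  have "glue n r x y \<longleftrightarrow> glue n r (h2 (h1 x)) (h2 (h1 y))"
    if "x \<in> cantor_nr n r" "y \<in> cantor_nr n r" for x y
    by (rule trans[OF TB_nrD[OF assms(1) that] TB_nrD[OF assms(2) D[OF that(1)] D[OF that(2)]]])
  then show ?thesis
    unfolding TB_nr_def mem_Collect_eq using B_nr_comp[OF B assms(3)] by blast
qed

lemma TB_nr_inv:
  assumes "h \<in> TB_nr n r" "1 \<le> r"
  shows "inv_into (cantor_nr n r) h \<in> TB_nr n r"
proof -
  let ?D = "cantor_nr n r"
  have B: "h \<in> B_nr n r"
    using assms(1) TB_nr_subset by auto
  note d = B_nrD[OF B assms(2)]
  have "glue n r x y \<longleftrightarrow> glue n r (inv_into ?D h x) (inv_into ?D h y)" if x: "x \<in> ?D" and y: "y \<in> ?D" for x y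
  proof -
    have "glue n r (inv_into ?D h x) (inv_into ?D h y) \<longleftrightarrow>
        glue n r (h (inv_into ?D h x)) (h (inv_into ?D h y))"
      by (rule TB_nrD[OF assms(1) emb_in[OF d(4) x] emb_in[OF d(4) y]])
    then show ?thesis
      unfolding bij_betw_inv_into_right[OF d(1) x] bij_betw_inv_into_right[OF d(1) y] by blast
  qed
  then show ?thesis
    unfolding TB_nr_def mem_Collect_eq using B_nr_inv[OF B assms(2)] by blast
qed

lemma O_group_mult [simp]: "x \<otimes>\<^bsub>O_group n\<^esub> y = core_product n x y"
  and O_group_one [simp]: "\<one>\<^bsub>O_group n\<^esub> = iso_class n identity_transducer"
  by (simp_all add: O_group_def)

lemma Core_inv:
  assumes h: "h \<in> B_nr n r" and r: "1 \<le> r"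
  shows "core_product n (Core n r (inv_into (cantor_nr n r) h)) (Core n r h) = iso_class n identity_transducer"
proof -
  let ?g = "inv_into (cantor_nr n r) h"
  note g = B_nr_inv[OF h r]
  have "core_product n (Core n r ?g) (Core n r h) = Core n r (\<lambda>x. h (?g x))"
    by (rule Core_mult[OF g h r])
  also have "\<dots> = Core n r (\<lambda>x. x)"
    by (rule Core_cong[OF B_nr_id[OF r] B_nr_comp[OF g h r] r])
      (rule bij_betw_inv_into_right[OF B_nrD(1)[OF h r]])
  finally show ?thesis
    by (simp add: Core_id[OF r])
qed

text \<open>Every element is the core of a homeomorphism over the same \<open>n - 1\<close> dotted
  letters, so the axioms descend from composition of maps.\<close>

lemma group_O_group: "group (O_group n)"
proof (rule groupI)
  let ?m = "n - 1"
  have C: "\<exists>h\<in>B_nr n ?m. x = Core n ?m h" if "x \<in> carrier (O_group n)" for x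
    using that by (auto simp: carrier_O_group O_nr_def)
  have in_C: "Core n ?m h \<in> carrier (O_group n)" if "h \<in> B_nr n ?m" for h
    using that by (auto simp: carrier_O_group O_nr_def)
  show "\<one>\<^bsub>O_group n\<^esub> \<in> carrier (O_group n)"
    using in_C[OF B_nr_id[OF m_ge1]] Core_id[OF m_ge1] by simp
  show "x \<otimes>\<^bsub>O_group n\<^esub> y \<in> carrier (O_group n)"
    if xy: "x \<in> carrier (O_group n)" "y \<in> carrier (O_group n)" for x y
  proof -
    obtain f where f: "f \<in> B_nr n ?m" "x = Core n ?m f"
      using C[OF xy(1)] by blast
    obtain g where g: "g \<in> B_nr n ?m" "y = Core n ?m g"
      using C[OF xy(2)] by blast
    show ?thesis
      unfolding O_group_mult f(2) g(2) Core_mult[OF f(1) g(1) m_ge1]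
      by (rule in_C[OF B_nr_comp[OF f(1) g(1) m_ge1]])
  qed
  show "x \<otimes>\<^bsub>O_group n\<^esub> y \<otimes>\<^bsub>O_group n\<^esub> z = x \<otimes>\<^bsub>O_group n\<^esub> (y \<otimes>\<^bsub>O_group n\<^esub> z)"
    if xyz: "x \<in> carrier (O_group n)" "y \<in> carrier (O_group n)" "z \<in> carrier (O_group n)" for x y z
  proof -
    obtain f where f: "f \<in> B_nr n ?m" "x = Core n ?m f"
      using C[OF xyz(1)] by blast
    obtain g where g: "g \<in> B_nr n ?m" "y = Core n ?m g"
      using C[OF xyz(2)] by blast
    obtain h where h: "h \<in> B_nr n ?m" "z = Core n ?m h"
      using C[OF xyz(3)] by blast
    show ?thesis
      unfolding O_group_mult f(2) g(2) h(2) Core_mult[OF f(1) g(1) m_ge1] Core_mult[OF g(1) h(1) m_ge1]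
        Core_mult[OF B_nr_comp[OF f(1) g(1) m_ge1] h(1) m_ge1]
        Core_mult[OF f(1) B_nr_comp[OF g(1) h(1) m_ge1] m_ge1] ..
  qed
  show "\<one>\<^bsub>O_group n\<^esub> \<otimes>\<^bsub>O_group n\<^esub> x = x" if x: "x \<in> carrier (O_group n)" for x
  proof -
    obtain h where h: "h \<in> B_nr n ?m" "x = Core n ?m h"
      using C[OF x] by blast
    show ?thesis
      unfolding O_group_mult O_group_one h(2) Core_id[OF m_ge1, symmetric]
        Core_mult[OF B_nr_id[OF m_ge1] h(1) m_ge1] ..
  qed
  show "\<exists>y\<in>carrier (O_group n). y \<otimes>\<^bsub>O_group n\<^esub> x = \<one>\<^bsub>O_group n\<^esub>" if x: "x \<in> carrier (O_group n)" for x
  proof -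
    obtain h where h: "h \<in> B_nr n ?m" "x = Core n ?m h"
      using C[OF x] by blast
    show ?thesis
      using in_C[OF B_nr_inv[OF h(1) m_ge1]] Core_inv[OF h(1) m_ge1] h(2)
      by (intro bexI[of _ "Core n ?m (inv_into (cantor_nr n ?m) h)"]) simp_all
  qed
qed

lemma Core_image_subgroup:
  assumes S: "S \<subseteq> B_nr n (n - 1)" "S \<noteq> {}"
    and comp: "\<And>f g. f \<in> S \<Longrightarrow> g \<in> S \<Longrightarrow> (\<lambda>x. g (f x)) \<in> S"
    and inv: "\<And>f. f \<in> S \<Longrightarrow> inv_into (cantor_nr n (n - 1)) f \<in> S"
  shows "subgroup (Core n (n - 1) ` S) (O_group n)"
proof -
  let ?m = "n - 1"
  interpret group "O_group n"
    by (rule group_O_group)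
  have sub: "Core n ?m ` S \<subseteq> carrier (O_group n)"
    using S(1) by (auto simp: carrier_O_group O_nr_def)
  show ?thesis
  proof (rule subgroupI)
    show "Core n ?m ` S \<subseteq> carrier (O_group n)" "Core n ?m ` S \<noteq> {}"
      using sub S(2) by auto
    fix x assume "x \<in> Core n ?m ` S"
    then obtain f where f: "f \<in> S" "x = Core n ?m f"
      by blast
    have fB: "f \<in> B_nr n ?m"
      using f(1) S(1) by blast
    have "inv\<^bsub>O_group n\<^esub> x = Core n ?m (inv_into (cantor_nr n ?m) f)"
      by (rule inv_equality) (use Core_inv[OF fB m_ge1] f inv[OF f(1)] sub in auto)
    then show "inv\<^bsub>O_group n\<^esub> x \<in> Core n ?m ` S"
      using inv[OF f(1)] by blast
    fix y assume "y \<in> Core n ?m ` S"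
    then obtain g where g: "g \<in> S" "y = Core n ?m g"
      by blast
    have gB: "g \<in> B_nr n ?m"
      using g(1) S(1) by blast
    show "x \<otimes>\<^bsub>O_group n\<^esub> y \<in> Core n ?m ` S"
      unfolding O_group_mult f(2) g(2) Core_mult[OF fB gB m_ge1] using comp[OF f(1) g(1)] by blast
  qed
qed

lemma reduced_sig_mult:
  assumes "x \<in> O_nr n (n - 1)" "y \<in> O_nr n (n - 1)"
  shows "[reduced_sig n (core_product n x y) = reduced_sig n x * reduced_sig n y] (mod (n - 1))"
proof -
  let ?m = "n - 1"
  obtain f g where f: "f \<in> B_nr n ?m" "x = Core n ?m f" and g: "g \<in> B_nr n ?m" "y = Core n ?m g"
    using assms by (auto simp: O_nr_def)
  note fg = B_nr_comp[OF f(1) g(1) m_ge1]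
  obtain s1 where s1: "core_count (cantor_nr n ?m) f s1"
    using core_count_exists[OF f(1) m_ge1] by blast
  obtain s2 where s2: "core_count (cantor_nr n ?m) g s2"
    using core_count_exists[OF g(1) m_ge1] by blast
  obtain s where s: "core_count (cantor_nr n ?m) (\<lambda>x. g (f x)) s"
    using core_count_exists[OF fg m_ge1] by blast
  have "[s = s1 * s2] (mod ?m)"
    by (rule core_count_comp[OF f(1) g(1) m_ge1 s1 s2 s])
  then show ?thesis
    unfolding f(2) g(2) Core_mult[OF f(1) g(1) m_ge1] reduced_sig_Core[OF f(1) m_ge1 s1]
      reduced_sig_Core[OF g(1) m_ge1 s2] reduced_sig_Core[OF fg m_ge1 s]
    by (simp add: cong_def mod_mult_eq)
qed

lemma TO_nr_subset: "TO_nr n r \<subseteq> O_nr n r"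
  unfolding TO_nr_def O_nr_def using TB_nr_subset by blast

lemma TB_nr_nonempty: "1 \<le> r \<Longrightarrow> TB_nr n r \<noteq> {}"
  using B_nr_id[of r] by (auto simp: TB_nr_def)

lemma residue_filtration_cores:
  assumes X: "X = TO_nr \<or> X = O_nr"
    and onto: "reduced_sig n ` (\<Union>r\<in>{1..n - 1}. X n r) = unit_residues (n - 1)"
  shows "residue_filtration (O_group n) n (X n (n - 1)) (reduced_sig n) (X n)"
proof -
  have eq: "X n r = {x \<in> X n (n - 1). [r * reduced_sig n x = r] (mod (n - 1))}" if "1 \<le> r" for r
    using X O_nr_eq[OF that] TO_nr_eq[OF that] by blast
  have sub: "X n (n - 1) \<subseteq> O_nr n (n - 1)"
    using X TO_nr_subset by blast
  show ?thesis
  proof (rule residue_filtration.intro[OF group_O_group residue_filtration_axioms.intro])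
    show "2 \<le> n"
      by (rule n2)
    have "subgroup (Core n (n - 1) ` B_nr n (n - 1)) (O_group n)"
      using B_nr_comp[OF _ _ m_ge1] B_nr_inv[OF _ m_ge1] B_nr_id[OF m_ge1]
      by (intro Core_image_subgroup) auto
    moreover have "subgroup (Core n (n - 1) ` TB_nr n (n - 1)) (O_group n)"
      using TB_nr_comp[OF _ _ m_ge1] TB_nr_inv[OF _ m_ge1] TB_nr_nonempty[OF m_ge1] TB_nr_subset
      by (intro Core_image_subgroup) auto
    ultimately show "subgroup (X n (n - 1)) (O_group n)"
      using X by (auto simp: O_nr_def TO_nr_def)
    show "[reduced_sig n (x \<otimes>\<^bsub>O_group n\<^esub> y) = reduced_sig n x * reduced_sig n y] (mod (n - 1))"
      if "x \<in> X n (n - 1)" "y \<in> X n (n - 1)" for x y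
      using reduced_sig_mult that sub by auto
    have "X n r \<subseteq> X n (n - 1)" if "1 \<le> r" for r
      using eq[OF that] by blast
    from UN_top[of "X n", OF this] show "reduced_sig n ` X n (n - 1) = unit_residues (n - 1)"
      using onto by simp
    show "X n r = {x \<in> X n (n - 1). [r * reduced_sig n x = r] (mod (n - 1))}" if "1 \<le> r" for r
      by (rule eq[OF that])
  qed
qed

end

theorem mainTheorem13:
  fixes n :: nat and X :: "nat \<Rightarrow> nat \<Rightarrow> transducer_class set"
  assumes "n \<ge> 2"
    and "X = TO_nr \<or> X = O_nr"
    and "reduced_sig n ` (\<Union>r\<in>{1..n - 1}. X n r) = unit_residues (n - 1)"
  shows "\<forall>c\<in>index_classes n (X n). \<forall>d\<in>index_classes n (X n).
           generate (O_group n) (class_group (X n) c \<union> class_group (X n) d)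
             = class_group (X n) (class_lcm n (X n) c d)"
proof -
  interpret alph n
    using assms(1) by unfold_locales
  interpret residue_filtration "O_group n" n "X n (n - 1)" "reduced_sig n" "X n"
    by (rule residue_filtration_cores[OF assms(2,3)])
  show ?thesis
    using generate_classes by blast
qed

end
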